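(* Assume: (1) $h\sim\kappa^{-(1+\gamma)}$ for some $0<\gamma\le 1$, and $h<\overline h(\kappa,p)$ (mesh threshold described in the context); (2) every subdomain $\Omega_l$ is star-shaped with respect to a disc of radius $\sim d_l$, and $\#\Lambda(l)\lesssim 1$ for all $1\le l\le N$; (3) $\epsilon=\kappa^{1+\alpha}$ and $d\sim\kappa^{-\beta}$ with $0\le\alpha\le\beta\le 1$. Define $\sigma=2-(\alpha+\beta)+\frac{\gamma}{2}$. Then there exists a constant $C_0>0$ independent of the parameters $\kappa,\epsilon,h,d,\delta$ such that, if the tolerance $\rho\in(0,1)$ is chosen to satisfy $\rho\,\kappa^{\sigma}\le C_0$, the operator $P^\rho_\epsilon=B_\epsilon^{-1}A_\epsilon$ satisfies $$\|P^\rho_\epsilon v_h\|_{1,\kappa}\lesssim\|v_h\|_{1,\kappa}\quad\forall v_h\in V_h(\Omega)$$ and $$|(v_h,P^\rho_\epsilon v_h)_{1,\kappa}|\gtrsim\|v_h\|_{1,\kappa}^2\quad\forall v_h\in V_h(\Omega).$$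
   Context: **Basic setting.** $\Omega\subset\mathbb{R}^2$ is a bounded, connected Lipschitz domain, $\kappa>0$, $\epsilon>0$. All functions are complex valued. For $v,w\in H^1(\Omega)$, $$a_\epsilon(v,w)=\int_\Omega\nabla v\cdot\nabla\bar w\,dx-(\kappa^2+\mathrm{i}\epsilon)\int_\Omega v\bar w\,dx-\mathrm{i}\kappa\int_{\partial\Omega}v\bar w\,ds,\qquad (v,w)_{1,\kappa}=\int_\Omega\nabla v\cdot\nabla\bar w\,dx+\kappa^2\int_\Omega v\bar w\,dx,$$ $\|v\|_{1,\kappa}=(v,v)_{1,\kappa}^{1/2}$; for a subdomain $G$, $(\cdot,\cdot)_{1,\kappa,G}$ and $\|\cdot\|_{1,\kappa,G}$ are the same with integrals over $G$. $\mathcal T_h$ is a quasi-uniform, shape-regular mesh of $\Omega$ with mesh diameter $h$, and $V_h(\Omega)$ is the conforming nodal finite element space of fixed order $p$ on $\mathcal T_h$. For $G$ a union of elements, $V_h(G)=\{v_h|_G:v_h\in V_h(\Omega)\}$ and $V_h(\partial G)=\{v_h|_{\partial G}:v_h\in V_h(G)\}$. **Domain decomposition.** $\overline\Omega=\bigcup_{l=1}^N\overline{\Omega_l'}$ is a non-overlapping decomposition, each $\Omega'_l$ a union of elements with diameter $d_l\sim d$; each $\Omega'_l$ is extended by several layers of elements to a larger subdomain $\Omega_l$ (Lipschitz, of characteristic length scale $d_l$), giving an overlapping decomposition with overlap $\delta$. $\Lambda(l)=\{j:\Omega_j\cap\Omega_l\ne\emptyset\}$. $\{\chi_l\}_{l=1}^N$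 is a partition of unity on $\overline\Omega$: $\operatorname{supp}\chi_l\subseteq\overline\Omega_l$, $0\le\chi_l\le1$, $\sum_l\chi_l=1$, $|\nabla\chi_l|\lesssim\delta^{-1}$. $E_l:V_h(\Omega_l)\to V_h(\Omega)$ keeps nodal values at nodes in $\overline\Omega_l$ and sets the other nodal values to $0$. $D_l:V_h(\Omega)\to V_h(\Omega)$ is $D_lv_h=\pi_h(\chi_lv_h)$ with $\pi_h$ the nodal interpolation onto $V_h(\Omega)$. The local form is $$a_{\epsilon,l}(v,w)=\int_{\Omega_l}\nabla v\cdot\nabla\bar w\,dx-(\kappa^2+\mathrm{i}\epsilon)\int_{\Omega_l}v\bar w\,dx-\mathrm{i}\kappa\int_{\partial\Omega_l}v\bar w\,ds.$$ **Coarse space.** For $\lambda_h\in V_h(\partial\Omega_l)$, $\mathcal E_{\epsilon,l}(\lambda_h)\in V_h(\Omega_l)$ is defined by $a_{\epsilon,l}(\mathcal E_{\epsilon,l}(\lambda_h),w_h)=\int_{\partial\Omega_l}\lambda_h\bar w_h\,ds$ for all $w_h\in V_h(\Omega_l)$, and $V_h^\partial(\Omega_l)=\{\mathcal E_{\epsilon,l}(\lambda_h):\lambda_h\in V_h(\partial\Omega_l)\}$, of dimension $m_l$. Let $(\lambda_l^i,\xi_l^i)_{i=1}^{m_l}$, with $0\le\lambda_l^1\le\dots\le\lambda_l^{m_l}$ and $(\xi_l^i,\xi_l^j)_{1,\kappa,\Omega_l}=\delta_{ij}$, be the eigenpairs of: find $\xi\in V_h^\partial(\Omega_l)$ with $(D_lE_l\xi,D_lE_l\theta)_{1,\kappa,\Omega_l}=\lambda(\xi,\theta)_{1,\kappa,\Omega_l}$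 for all $\theta\in V_h^\partial(\Omega_l)$. For a tolerance $\rho\in(0,1)$ let $m_l^\rho$ be such that $\lambda_l^{m_l^\rho-1}<\rho^2\le\lambda_l^{m_l^\rho}$; $V_{h,0}^\rho(\Omega_l)=\operatorname{span}\{\xi_l^i:i\ge m_l^\rho\}$ and $V_{h,0}^\rho(\Omega)=\{\sum_{l=1}^ND_lE_lv_l:v_l\in V_{h,0}^\rho(\Omega_l)\}$. **Preconditioner.** Operators $A_\epsilon$ on $V_h(\Omega)$, $A_{\epsilon,l}$ on $V_h(\Omega_l)$ and $A_0^\rho$ on $V_{h,0}^\rho(\Omega)$ represent $a_\epsilon$, $a_{\epsilon,l}$ and $a_\epsilon$ restricted to $V_{h,0}^\rho(\Omega)$, respectively, with respect to the $L^2$ inner product (e.g. $\int_\Omega(A_\epsilon v_h)\bar w_h\,dx=a_\epsilon(v_h,w_h)$). $E_0:V_{h,0}^\rho(\Omega)\to V_h(\Omega)$ is the inclusion, and ${}^*$ denotes the $L^2$ adjoint. Then $$B_\epsilon^{-1}=(I-E_0(A_0^\rho)^{-1}E_0^*A_\epsilon)\sum_{l=1}^ND_lE_lA_{\epsilon,l}^{-1}E_l^*+E_0(A_0^\rho)^{-1}E_0^*.$$ Equivalently $P_\epsilon^\rho=B_\epsilon^{-1}A_\epsilon=(I-P_0^\rho)\sum_lD_lE_lP_{\epsilon,l}+P_0^\rho$, where $P_{\epsilon,l}v_h\in V_h(\Omega_l)$ solves $a_{\epsilon,l}(P_{\epsilon,l}v_h,w)=a_\epsilon(v_h,E_lw)$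 for all $w\in V_h(\Omega_l)$, and $P_0^\rho v_h\in V_{h,0}^\rho(\Omega)$ solves $a_\epsilon(P_0^\rho v_h,w)=a_\epsilon(v_h,w)$ for all $w\in V_{h,0}^\rho(\Omega)$. **Mesh threshold.** $\overline h(\kappa,p)$ is a threshold such that $h<\overline h(\kappa,p)$ guarantees, on the star-shaped subdomains, the discrete inf-sup estimate $$\|v_h\|_{1,\kappa,\Omega_l}\lesssim\min\{1+\kappa d_l,\kappa^2/\epsilon\}\sup_{0\ne w_h\in V_h(\Omega_l)}\frac{|a_{\epsilon,l}(v_h,w_h)|}{\|w_h\|_{1,\kappa,\Omega_l}}\quad\forall v_h\in V_h(\Omega_l).$$ **Convention.** $a\lesssim b$ (equivalently $b\gtrsim a$) means $a\le Cb$ with a constant $C>0$ independent of $\kappa,\epsilon,h,d,\delta,\rho,l$ and of the functions involved; $a\sim b$ means $a\lesssim b\lesssim a$. *)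

theory Defs
  imports "HOL-Analysis.Analysis"
begin

section \<open>Domains\<close>

text \<open>Locally the epigraph of a Lipschitz function after a rigid motion.\<close>

definition lipschitz_domain :: "(real^2) set \<Rightarrow> bool" where
  "lipschitz_domain G \<longleftrightarrow> open G \<and> bounded G \<and>
     (\<forall>x\<in>frontier G. \<exists>r>0. \<exists>(T :: real^2 \<Rightarrow> real^2) L (g :: real \<Rightarrow> real).
        orthogonal_transformation T \<and> L-lipschitz_on UNIV g \<and>
        (\<forall>y\<in>ball x r. y \<in> G \<longleftrightarrow> (T (y - x)) $ 2 > g ((T (y - x)) $ 1)))"

lemma interior_closure_lipschitz_domain:
  assumes "lipschitz_domain G"
  shows "interior (closure G) = G"
proof
  have "open G" using assms by (simp add: lipschitz_domain_def)
  then show "G \<subseteq> interior (closure G)" by (simp add: interior_maximal closure_subset)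
  show "interior (closure G) \<subseteq> G"
  proof (rule ccontr)
    assume "\<not> ?thesis"
    then obtain x where x: "x \<in> interior (closure G)" "x \<notin> G" by blast
    with \<open>open G\<close> have "x \<in> frontier G"
      using interior_subset[of "closure G"] by (auto simp: frontier_def interior_open)
    then obtain r T L g where r: "r > 0" and T: "orthogonal_transformation T"
      and g: "L-lipschitz_on UNIV g"
      and eq: "\<And>y. y \<in> ball x r \<Longrightarrow> y \<in> G \<longleftrightarrow> (T (y - x)) $ 2 > (g :: real \<Rightarrow> real) ((T (y - x :: real^2) :: real^2) $ 1)"
      using assms unfolding lipschitz_domain_def by blast
    from T have lin: "linear T" and inj: "inj T" and surj: "surj T"
      by (simp_all add: orthogonal_transformation_linear orthogonal_transformation_inj
          orthogonal_transformation_surj)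
    have contg: "continuous_on UNIV g" using g by (rule lipschitz_on_continuous_on)
    have T0: "T 0 = 0" using lin by (rule linear_0)
    have g0: "0 \<le> g 0" using eq[of x] x(2) r T0 by simp
    define U where "U = interior (closure G) \<inter> ball x r"
    define W where "W = {y. (T (y - x)) $ 2 < g ((T (y - x)) $ 1)}"
    have contT: "continuous_on UNIV T" using lin by (simp add: linear_continuous_on linear_conv_bounded_linear)
    then have cT: "continuous_on UNIV (\<lambda>y. T (y - x))"
      using continuous_on_compose2[OF contT, of UNIV "\<lambda>y. y - x"]
      by (simp add: continuous_on_diff)
    have "open W" unfolding W_def
      by (intro open_Collect_less continuous_on_compose2[OF contg] continuous_on_component cT) auto
    have "open U" "x \<in> U" using x r by (auto simp: U_def)
    then obtain e where e: "e > 0" "ball x e \<subseteq> U" by (auto simp: open_contains_ball)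
    obtain u where u: "T u = - axis 2 1" using surj by (metis surjD)
    have nu: "norm u = 1" using orthogonal_transformation_norm[OF T, of u] u by simp
    define y where "y = x + (e / 2) *\<^sub>R u"
    have "y \<in> ball x e" using e nu by (simp add: y_def dist_norm)
    moreover have "T (y - x) = (e / 2) *\<^sub>R (- axis 2 1)"
      using lin u by (simp add: y_def linear_scale)
    then have "(T (y - x)) $ 2 = - (e / 2)" "(T (y - x)) $ 1 = 0"
      by (simp_all add: axis_def)
    then have "y \<in> W" using e g0 by (simp add: W_def)
    ultimately have "y \<in> U \<inter> W" using e by auto
    then have "y \<in> closure G" using interior_subset by (auto simp: U_def)
    moreover have "open (U \<inter> W)" using \<open>open U\<close> \<open>open W\<close> by blast
    ultimately have "G \<inter> (U \<inter> W) \<noteq> {}"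
      using \<open>y \<in> U \<inter> W\<close> open_Int_closure_eq_empty[of "U \<inter> W" G] by blast
    then obtain z where "z \<in> G" "z \<in> ball x r" "z \<in> W" by (auto simp: U_def)
    then show False using eq[of z] by (simp add: W_def)
  qed
qed

definition star_shaped_disc :: "(real^2) set \<Rightarrow> real \<Rightarrow> bool" where
  "star_shaped_disc G r \<longleftrightarrow>
     (\<exists>c. ball c r \<subseteq> G \<and> (\<forall>y\<in>ball c r. \<forall>x\<in>G. closed_segment y x \<subseteq> G))"

text \<open>The relation \<open>a \<sim> b\<close> with an explicit constant.\<close>

definition comparable :: "real \<Rightarrow> real \<Rightarrow> real \<Rightarrow> bool" where
  "comparable K a b \<longleftrightarrow> a \<le> K * b \<and> b \<le> K * a"


section \<open>Integrals, inner products and sesquilinear forms\<close>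

text \<open>The functions occurring below are continuous and piecewise polynomial, so their weak partial
  derivatives agree, off the null set of mesh edges, with the classical ones. The inner products
  and forms are only ever applied to such functions.\<close>

definition pderivative :: "2 \<Rightarrow> (real^2 \<Rightarrow> complex) \<Rightarrow> real^2 \<Rightarrow> complex" where
  "pderivative i v x = frechet_derivative v (at x) (axis i 1)"

definition grad_inner :: "(real^2) set \<Rightarrow> (real^2 \<Rightarrow> complex) \<Rightarrow> (real^2 \<Rightarrow> complex) \<Rightarrow> complex" where
  "grad_inner G v w =
     (LINT x:G|lebesgue. (\<Sum>i\<in>UNIV. pderivative i v x * cnj (pderivative i w x)))"

definition l2_inner :: "(real^2) set \<Rightarrow> (real^2 \<Rightarrow> complex) \<Rightarrow> (real^2 \<Rightarrow> complex) \<Rightarrow> complex" where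
  "l2_inner G v w = (LINT x:G|lebesgue. v x * cnj (w x))"

definition energy_inner ::
  "real \<Rightarrow> (real^2) set \<Rightarrow> (real^2 \<Rightarrow> complex) \<Rightarrow> (real^2 \<Rightarrow> complex) \<Rightarrow> complex" where
  "energy_inner \<kappa> G v w = grad_inner G v w + of_real (\<kappa>\<^sup>2) * l2_inner G v w"

definition energy_norm :: "real \<Rightarrow> (real^2) set \<Rightarrow> (real^2 \<Rightarrow> complex) \<Rightarrow> real" where
  "energy_norm \<kappa> G v = sqrt (Re (energy_inner \<kappa> G v v))"

text \<open>Integral with respect to arc length over a segment \<open>e\<close>. It does not depend on which of the
  two orderings of the end points is selected, see \<open>edge_integral_closed_segment\<close>.\<close>

definition edge_integral :: "(real^2) set \<Rightarrow> (real^2 \<Rightarrow> complex) \<Rightarrow> complex" where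
  "edge_integral e f =
     (let (a, b) = (SOME (a, b). e = closed_segment a b)
      in of_real (dist a b) * integral {0..1} (\<lambda>t. f (linepath a b t)))"

lemma integral_reverse_unit_interval: "integral {0..1} (\<lambda>t. f (1 - t)) = integral {0..1::real} (f :: real \<Rightarrow> complex)"
proof -
  have "(f has_integral i) {0..1} \<longleftrightarrow> ((\<lambda>t. f (1 - t)) has_integral i) {0..1}" for i
  proof -
    have *: "((\<lambda>t. g (1 - t)) has_integral i) {0..1}" if "(g has_integral i) {0..1}" for g :: "real \<Rightarrow> complex"
      using has_integral_affinity[of g i 0 1 "-1" 1] that by (simp add: cbox_interval image_affinity_atLeastAtMost)
    from *[of f] *[of "\<lambda>t. f (1 - t)"] show ?thesis by auto
  qed
  then show ?thesis by (auto simp: integral_def integrable_on_def)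
qed

lemma edge_integral_closed_segment:
  "edge_integral (closed_segment a b) f =
     of_real (dist a b) * integral {0..1} (\<lambda>t. f (linepath a b t))"
proof -
  define q where "q = (SOME (c, d). closed_segment a b = closed_segment c d)"
  have "case q of (c, d) \<Rightarrow> closed_segment a b = closed_segment c d"
    unfolding q_def by (rule someI[of _ "(a, b)"]) simp
  then obtain c d where q: "q = (c, d)" and "closed_segment a b = closed_segment c d"
    by (cases q) auto
  then consider "c = a" "d = b" | "c = b" "d = a"
    by (auto simp: doubleton_eq_iff)
  then have "of_real (dist c d) * integral {0..1} (\<lambda>t. f (linepath c d t)) =
      of_real (dist a b) * integral {0..1} (\<lambda>t. f (linepath a b t))"
  proof cases
    case 2
    have "integral {0..1} (\<lambda>t. f (linepath b a t)) = integral {0..1} (\<lambda>t. f (linepath a b (1 - t)))"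
      by (simp add: linepath_def algebra_simps)
    also have "\<dots> = integral {0..1} (\<lambda>t. f (linepath a b t))"
      by (rule integral_reverse_unit_interval)
    finally show ?thesis using 2 by (simp add: dist_commute)
  qed simp
  with q show ?thesis by (simp add: edge_integral_def q_def)
qed

text \<open>For an open set \<open>G\<close> which is the interior of the union of the elements in \<open>S\<close>, the boundary
  of \<open>G\<close> consists of the edges of elements of \<open>S\<close> contained in it.\<close>

definition boundary_edges :: "(real^2) set set \<Rightarrow> (real^2) set set" where
  "boundary_edges S = {e. e \<subseteq> frontier (interior (\<Union>S)) \<and> (\<exists>T\<in>S. e edge_of T)}"

definition boundary_inner ::
  "(real^2) set set \<Rightarrow> (real^2 \<Rightarrow> complex) \<Rightarrow> (real^2 \<Rightarrow> complex) \<Rightarrow> complex" where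
  "boundary_inner S v w = (\<Sum>e\<in>boundary_edges S. edge_integral e (\<lambda>x. v x * cnj (w x)))"

definition helmholtz_form ::
  "real \<Rightarrow> real \<Rightarrow> (real^2) set set \<Rightarrow> (real^2 \<Rightarrow> complex) \<Rightarrow> (real^2 \<Rightarrow> complex) \<Rightarrow> complex" where
  "helmholtz_form \<kappa> \<epsilon> S v w =
     grad_inner (interior (\<Union>S)) v w
       - (of_real (\<kappa>\<^sup>2) + \<i> * of_real \<epsilon>) * l2_inner (interior (\<Union>S)) v w
       - \<i> * of_real \<kappa> * boundary_inner S v w"


section \<open>Finite elements\<close>

text \<open>Functions on a set are represented by functions on the plane which vanish off that set, so
  that equality of functions on the set is equality in HOL.\<close>

definition restr :: "(real^2) set \<Rightarrow> (real^2 \<Rightarrow> complex) \<Rightarrow> real^2 \<Rightarrow> complex" where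
  "restr A v = (\<lambda>x. if x \<in> A then v x else 0)"

definition poly_on :: "nat \<Rightarrow> (real^2) set \<Rightarrow> (real^2 \<Rightarrow> complex) \<Rightarrow> bool" where
  "poly_on p T v \<longleftrightarrow> (\<exists>c. \<forall>x\<in>T.
     v x = (\<Sum>i\<le>p. \<Sum>j\<le>p - i. c i j * of_real (x $ 1) ^ i * of_real (x $ 2) ^ j))"

definition fe_space :: "nat \<Rightarrow> (real^2) set set \<Rightarrow> (real^2 \<Rightarrow> complex) set" where
  "fe_space p \<T> = {v. continuous_on (\<Union>\<T>) v \<and> (\<forall>x. x \<notin> \<Union>\<T> \<longrightarrow> v x = 0) \<and> (\<forall>T\<in>\<T>. poly_on p T v)}"

text \<open>The principal lattice of order \<open>p\<close> on a triangle: the points all of whose barycentric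
  coordinates are multiples of \<open>1/p\<close>.\<close>

definition element_nodes :: "nat \<Rightarrow> (real^2) set \<Rightarrow> (real^2) set" where
  "element_nodes p T =
     {\<Sum>v\<in>{v. v extreme_point_of T}. (real (k v) / real p) *\<^sub>R v | k.
        (\<Sum>v\<in>{v. v extreme_point_of T}. k v) = p}"

definition mesh_nodes :: "nat \<Rightarrow> (real^2) set set \<Rightarrow> (real^2) set" where
  "mesh_nodes p \<T> = (\<Union>T\<in>\<T>. element_nodes p T)"

definition nodal_interp ::
  "nat \<Rightarrow> (real^2) set set \<Rightarrow> (real^2 \<Rightarrow> complex) \<Rightarrow> real^2 \<Rightarrow> complex" where
  "nodal_interp p \<T> f = (THE u. u \<in> fe_space p \<T> \<and> (\<forall>x\<in>mesh_nodes p \<T>. u x = f x))"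

definition mesh_diameter :: "(real^2) set set \<Rightarrow> real" where
  "mesh_diameter \<T> = Max (diameter ` \<T>)"

definition conforming_mesh :: "(real^2) set \<Rightarrow> (real^2) set set \<Rightarrow> bool" where
  "conforming_mesh \<Omega> \<T> \<longleftrightarrow>
     triangulation \<T> \<and> (\<forall>T\<in>\<T>. 2 simplex T) \<and> \<Union>\<T> = closure \<Omega>"

definition shape_regular :: "real \<Rightarrow> (real^2) set set \<Rightarrow> bool" where
  "shape_regular K \<T> \<longleftrightarrow> (\<forall>T\<in>\<T>. \<exists>c r. ball c r \<subseteq> T \<and> diameter T \<le> K * r)"

definition quasi_uniform :: "real \<Rightarrow> (real^2) set set \<Rightarrow> bool" where
  "quasi_uniform K \<T> \<longleftrightarrow> (\<forall>T\<in>\<T>. mesh_diameter \<T> \<le> K * diameter T)"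

definition add_layer :: "(real^2) set set \<Rightarrow> (real^2) set set \<Rightarrow> (real^2) set set" where
  "add_layer \<T> S = {T\<in>\<T>. \<exists>T'\<in>S. T \<inter> T' \<noteq> {}}"


section \<open>Discretisation and domain decomposition\<close>

record ddm =
  wavenumber :: real                            \<comment> \<open>\<open>\<kappa>\<close>\<close>
  absorption :: real                            \<comment> \<open>\<open>\<epsilon>\<close>\<close>
  mesh :: "(real^2) set set"
  fe_order :: nat
  nsub :: nat                                   \<comment> \<open>\<open>N\<close>; subdomains are indexed by \<open>1,\<dots>,N\<close>\<close>
  part :: "nat \<Rightarrow> (real^2) set set"             \<comment> \<open>elements forming \<open>\<Omega>'\<^sub>l\<close>\<close>
  nlayers :: "nat \<Rightarrow> nat"
  pou :: "nat \<Rightarrow> real^2 \<Rightarrow> real"                \<comment> \<open>\<open>\<chi>\<^sub>l\<close>\<close>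

definition elems :: "ddm \<Rightarrow> nat \<Rightarrow> (real^2) set set" where
  "elems c l = (add_layer (mesh c) ^^ nlayers c l) (part c l)"

definition core :: "ddm \<Rightarrow> nat \<Rightarrow> (real^2) set" where
  "core c l = interior (\<Union>(part c l))"

text \<open>The domain \<open>\<Omega>\<close> itself if \<open>\<Union>(mesh c) = closure \<Omega>\<close>, by
  \<open>interior_closure_lipschitz_domain\<close>.\<close>

definition whole :: "ddm \<Rightarrow> (real^2) set" where
  "whole c = interior (\<Union>(mesh c))"

definition subdom :: "ddm \<Rightarrow> nat \<Rightarrow> (real^2) set" where
  "subdom c l = interior (\<Union>(elems c l))"

definition neighbours :: "ddm \<Rightarrow> nat \<Rightarrow> nat set" where
  "neighbours c l = {j\<in>{1..nsub c}. subdom c j \<inter> subdom c l \<noteq> {}}"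

definition decomposition :: "real \<Rightarrow> real \<Rightarrow> real \<Rightarrow> ddm \<Rightarrow> bool" where
  "decomposition K d \<delta> c \<longleftrightarrow>
     0 < \<delta> \<and>
     (\<Union>l\<in>{1..nsub c}. part c l) = mesh c \<and>
     (\<forall>l\<in>{1..nsub c}. \<forall>j\<in>{1..nsub c}. l \<noteq> j \<longrightarrow> part c l \<inter> part c j = {}) \<and>
     (\<forall>l\<in>{1..nsub c}.
        part c l \<noteq> {} \<and> 1 \<le> nlayers c l \<and>
        lipschitz_domain (subdom c l) \<and>
        comparable K (diameter (core c l)) d \<and>
        comparable K (diameter (subdom c l)) (diameter (core c l)) \<and>
        (\<forall>x\<in>core c l. \<forall>y\<in>frontier (subdom c l) - frontier (whole c). \<delta> \<le> K * dist x y) \<and>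
        (\<forall>y\<in>subdom c l. infdist y (core c l) \<le> K * \<delta>))"

text \<open>A function on a Lipschitz domain has an essentially bounded weak gradient iff it is
  Lipschitz; the weak gradient is then almost everywhere the classical one.\<close>

definition partition_of_unity :: "real \<Rightarrow> real \<Rightarrow> ddm \<Rightarrow> bool" where
  "partition_of_unity K \<delta> c \<longleftrightarrow>
     (\<forall>x\<in>closure (whole c). (\<Sum>l\<in>{1..nsub c}. pou c l x) = 1) \<and>
     (\<forall>l\<in>{1..nsub c}.
        (\<exists>L. L-lipschitz_on (closure (whole c)) (pou c l)) \<and>
        (\<forall>x\<in>closure (whole c). 0 \<le> pou c l x \<and> pou c l x \<le> 1) \<and>
        closure {x\<in>closure (whole c). pou c l x \<noteq> 0} \<subseteq> closure (subdom c l) \<and>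
        (\<forall>x\<in>whole c. \<forall>D. (pou c l has_derivative D) (at x) \<longrightarrow> onorm D \<le> K / \<delta>))"

text \<open>All standing assumptions and the assumptions on the parameters, except for the mesh
  threshold. \<open>K\<close> bounds every constant implicit in them.\<close>

definition admissible ::
  "(real^2) set \<Rightarrow> nat \<Rightarrow> real \<Rightarrow> real \<Rightarrow> real \<Rightarrow> real \<Rightarrow> real \<Rightarrow> real \<Rightarrow> ddm \<Rightarrow> bool" where
  "admissible \<Omega> p \<alpha> \<beta> \<gamma> K d \<delta> c \<longleftrightarrow>
     0 < wavenumber c \<and> 0 < absorption c \<and> fe_order c = p \<and>
     conforming_mesh \<Omega> (mesh c) \<and> shape_regular K (mesh c) \<and> quasi_uniform K (mesh c) \<and>
     decomposition K d \<delta> c \<and> partition_of_unity K \<delta> c \<and>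
     comparable K (mesh_diameter (mesh c)) (wavenumber c powr (- (1 + \<gamma>))) \<and>
     (\<forall>l\<in>{1..nsub c}.
        (\<exists>r. comparable K r (diameter (core c l)) \<and> star_shaped_disc (subdom c l) r) \<and>
        real (card (neighbours c l)) \<le> K) \<and>
     absorption c = wavenumber c powr (1 + \<alpha>) \<and>
     comparable K d (wavenumber c powr (- \<beta>))"


section \<open>Spaces and operators\<close>

definition Vh :: "ddm \<Rightarrow> (real^2 \<Rightarrow> complex) set" where
  "Vh c = fe_space (fe_order c) (mesh c)"

definition Vh_loc :: "ddm \<Rightarrow> nat \<Rightarrow> (real^2 \<Rightarrow> complex) set" where
  "Vh_loc c l = restr (closure (subdom c l)) ` Vh c"

definition Vh_trace :: "ddm \<Rightarrow> nat \<Rightarrow> (real^2 \<Rightarrow> complex) set" where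
  "Vh_trace c l = restr (frontier (subdom c l)) ` Vh_loc c l"

definition form :: "ddm \<Rightarrow> (real^2 \<Rightarrow> complex) \<Rightarrow> (real^2 \<Rightarrow> complex) \<Rightarrow> complex" where
  "form c = helmholtz_form (wavenumber c) (absorption c) (mesh c)"

definition form_loc :: "ddm \<Rightarrow> nat \<Rightarrow> (real^2 \<Rightarrow> complex) \<Rightarrow> (real^2 \<Rightarrow> complex) \<Rightarrow> complex" where
  "form_loc c l = helmholtz_form (wavenumber c) (absorption c) (elems c l)"

definition inner_\<kappa> :: "ddm \<Rightarrow> (real^2 \<Rightarrow> complex) \<Rightarrow> (real^2 \<Rightarrow> complex) \<Rightarrow> complex" where
  "inner_\<kappa> c = energy_inner (wavenumber c) (whole c)"

definition norm_\<kappa> :: "ddm \<Rightarrow> (real^2 \<Rightarrow> complex) \<Rightarrow> real" where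
  "norm_\<kappa> c = energy_norm (wavenumber c) (whole c)"

definition inner_\<kappa>_loc :: "ddm \<Rightarrow> nat \<Rightarrow> (real^2 \<Rightarrow> complex) \<Rightarrow> (real^2 \<Rightarrow> complex) \<Rightarrow> complex" where
  "inner_\<kappa>_loc c l = energy_inner (wavenumber c) (subdom c l)"

definition norm_\<kappa>_loc :: "ddm \<Rightarrow> nat \<Rightarrow> (real^2 \<Rightarrow> complex) \<Rightarrow> real" where
  "norm_\<kappa>_loc c l = energy_norm (wavenumber c) (subdom c l)"

definition extend :: "ddm \<Rightarrow> nat \<Rightarrow> (real^2 \<Rightarrow> complex) \<Rightarrow> real^2 \<Rightarrow> complex" where
  "extend c l v = nodal_interp (fe_order c) (mesh c) (restr (closure (subdom c l)) v)"

definition weight :: "ddm \<Rightarrow> nat \<Rightarrow> (real^2 \<Rightarrow> complex) \<Rightarrow> real^2 \<Rightarrow> complex" where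
  "weight c l v = nodal_interp (fe_order c) (mesh c) (\<lambda>x. of_real (pou c l x) * v x)"

definition DE :: "ddm \<Rightarrow> nat \<Rightarrow> (real^2 \<Rightarrow> complex) \<Rightarrow> real^2 \<Rightarrow> complex" where
  "DE c l v = weight c l (extend c l v)"

text \<open>The element of \<open>V\<close> representing the antilinear functional \<open>\<phi>\<close> with respect to the form \<open>b\<close>.\<close>

definition representer ::
  "(real^2 \<Rightarrow> complex) set \<Rightarrow> ((real^2 \<Rightarrow> complex) \<Rightarrow> (real^2 \<Rightarrow> complex) \<Rightarrow> complex) \<Rightarrow>
   ((real^2 \<Rightarrow> complex) \<Rightarrow> complex) \<Rightarrow> real^2 \<Rightarrow> complex" where
  "representer V b \<phi> = (THE u. u \<in> V \<and> (\<forall>w\<in>V. b u w = \<phi> w))"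

definition helmholtz_ext :: "ddm \<Rightarrow> nat \<Rightarrow> (real^2 \<Rightarrow> complex) \<Rightarrow> real^2 \<Rightarrow> complex" where
  "helmholtz_ext c l g = representer (Vh_loc c l) (form_loc c l) (boundary_inner (elems c l) g)"

definition Vh_bd :: "ddm \<Rightarrow> nat \<Rightarrow> (real^2 \<Rightarrow> complex) set" where
  "Vh_bd c l = helmholtz_ext c l ` Vh_trace c l"

definition cspan :: "(nat \<Rightarrow> real^2 \<Rightarrow> complex) \<Rightarrow> nat set \<Rightarrow> (real^2 \<Rightarrow> complex) set" where
  "cspan \<xi> I = {\<lambda>x. \<Sum>i\<in>I. a i * \<xi> i x | a. True}"

text \<open>A full system of eigenpairs. Since the eigenfunctions are orthonormal, the last clause says
  that \<open>m\<close> is the dimension of the space.\<close>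

definition eigensystem ::
  "ddm \<Rightarrow> nat \<Rightarrow> nat \<Rightarrow> (nat \<Rightarrow> real) \<Rightarrow> (nat \<Rightarrow> real^2 \<Rightarrow> complex) \<Rightarrow> bool" where
  "eigensystem c l m \<mu> \<xi> \<longleftrightarrow>
     (\<forall>i\<in>{1..m}. \<xi> i \<in> Vh_bd c l \<and> 0 \<le> \<mu> i \<and>
        (\<forall>\<theta>\<in>Vh_bd c l. inner_\<kappa>_loc c l (DE c l (\<xi> i)) (DE c l \<theta>)
            = of_real (\<mu> i) * inner_\<kappa>_loc c l (\<xi> i) \<theta>)) \<and>
     (\<forall>i\<in>{1..m}. \<forall>j\<in>{1..m}. i \<le> j \<longrightarrow> \<mu> i \<le> \<mu> j) \<and>
     (\<forall>i\<in>{1..m}. \<forall>j\<in>{1..m}. inner_\<kappa>_loc c l (\<xi> i) (\<xi> j) = (if i = j then 1 else 0)) \<and>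
     cspan \<xi> {1..m} = Vh_bd c l"

text \<open>The index \<open>m\<^sup>\<rho>\<close>, with the conventions \<open>\<mu> 0 = -\<infinity>\<close> and \<open>\<mu> (m + 1) = \<infinity>\<close>.\<close>

definition cut_index :: "nat \<Rightarrow> (nat \<Rightarrow> real) \<Rightarrow> real \<Rightarrow> nat" where
  "cut_index m \<mu> \<rho> = (LEAST i. 1 \<le> i \<and> (i \<le> m \<longrightarrow> \<rho>\<^sup>2 \<le> \<mu> i))"

definition coarse_loc ::
  "nat \<Rightarrow> (nat \<Rightarrow> real) \<Rightarrow> (nat \<Rightarrow> real^2 \<Rightarrow> complex) \<Rightarrow> real \<Rightarrow> (real^2 \<Rightarrow> complex) set" where
  "coarse_loc m \<mu> \<xi> \<rho> = cspan \<xi> {cut_index m \<mu> \<rho>..m}"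

definition coarse ::
  "ddm \<Rightarrow> (nat \<Rightarrow> nat) \<Rightarrow> (nat \<Rightarrow> nat \<Rightarrow> real) \<Rightarrow> (nat \<Rightarrow> nat \<Rightarrow> real^2 \<Rightarrow> complex) \<Rightarrow> real \<Rightarrow>
   (real^2 \<Rightarrow> complex) set" where
  "coarse c m \<mu> \<xi> \<rho> = {\<lambda>x. \<Sum>l\<in>{1..nsub c}. DE c l (v l) x | v.
     \<forall>l\<in>{1..nsub c}. v l \<in> coarse_loc (m l) (\<mu> l) (\<xi> l) \<rho>}"

definition A_op :: "ddm \<Rightarrow> (real^2 \<Rightarrow> complex) \<Rightarrow> real^2 \<Rightarrow> complex" where
  "A_op c v = representer (Vh c) (l2_inner (whole c)) (form c v)"

definition A_loc :: "ddm \<Rightarrow> nat \<Rightarrow> (real^2 \<Rightarrow> complex) \<Rightarrow> real^2 \<Rightarrow> complex" where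
  "A_loc c l v = representer (Vh_loc c l) (l2_inner (subdom c l)) (form_loc c l v)"

definition A_coarse ::
  "ddm \<Rightarrow> (real^2 \<Rightarrow> complex) set \<Rightarrow> (real^2 \<Rightarrow> complex) \<Rightarrow> real^2 \<Rightarrow> complex" where
  "A_coarse c V0 v = representer V0 (l2_inner (whole c)) (form c v)"

definition extend_adj :: "ddm \<Rightarrow> nat \<Rightarrow> (real^2 \<Rightarrow> complex) \<Rightarrow> real^2 \<Rightarrow> complex" where
  "extend_adj c l f =
     representer (Vh_loc c l) (l2_inner (subdom c l)) (\<lambda>w. l2_inner (whole c) f (extend c l w))"

text \<open>The adjoint of the inclusion of \<open>V0\<close> into the finite element space.\<close>

definition incl_adj ::
  "ddm \<Rightarrow> (real^2 \<Rightarrow> complex) set \<Rightarrow> (real^2 \<Rightarrow> complex) \<Rightarrow> real^2 \<Rightarrow> complex" where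
  "incl_adj c V0 f = representer V0 (l2_inner (whole c)) (l2_inner (whole c) f)"

definition coarse_solve ::
  "ddm \<Rightarrow> (real^2 \<Rightarrow> complex) set \<Rightarrow> (real^2 \<Rightarrow> complex) \<Rightarrow> real^2 \<Rightarrow> complex" where
  "coarse_solve c V0 f = inv_into V0 (A_coarse c V0) (incl_adj c V0 f)"

definition local_solves :: "ddm \<Rightarrow> (real^2 \<Rightarrow> complex) \<Rightarrow> real^2 \<Rightarrow> complex" where
  "local_solves c f =
     (\<lambda>x. \<Sum>l\<in>{1..nsub c}. DE c l (inv_into (Vh_loc c l) (A_loc c l) (extend_adj c l f)) x)"

definition B_inv ::
  "ddm \<Rightarrow> (real^2 \<Rightarrow> complex) set \<Rightarrow> (real^2 \<Rightarrow> complex) \<Rightarrow> real^2 \<Rightarrow> complex" where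
  "B_inv c V0 f =
     (\<lambda>x. local_solves c f x - coarse_solve c V0 (A_op c (local_solves c f)) x + coarse_solve c V0 f x)"

definition P_op ::
  "ddm \<Rightarrow> (real^2 \<Rightarrow> complex) set \<Rightarrow> (real^2 \<Rightarrow> complex) \<Rightarrow> real^2 \<Rightarrow> complex" where
  "P_op c V0 v = B_inv c V0 (A_op c v)"


section \<open>Mesh threshold\<close>

definition local_inf_sup :: "real \<Rightarrow> ddm \<Rightarrow> bool" where
  "local_inf_sup C c \<longleftrightarrow>
     (\<forall>l\<in>{1..nsub c}. \<forall>v\<in>Vh_loc c l.
        norm_\<kappa>_loc c l v \<le>
          C * min (1 + wavenumber c * diameter (core c l)) ((wavenumber c)\<^sup>2 / absorption c)
            * (SUP w\<in>Vh_loc c l - {\<lambda>x. 0}. cmod (form_loc c l v w) / norm_\<kappa>_loc c l w))"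

text \<open>Below the threshold \<open>hbar\<close> the inf-sup estimate holds with one and the same constant \<open>C\<close>.\<close>

definition mesh_threshold ::
  "(real^2) set \<Rightarrow> nat \<Rightarrow> real \<Rightarrow> real \<Rightarrow> real \<Rightarrow> real \<Rightarrow> real \<Rightarrow> (real \<Rightarrow> nat \<Rightarrow> real) \<Rightarrow> bool" where
  "mesh_threshold \<Omega> p \<alpha> \<beta> \<gamma> K C hbar \<longleftrightarrow>
     (\<forall>c d \<delta>. admissible \<Omega> p \<alpha> \<beta> \<gamma> K d \<delta> c \<and> mesh_diameter (mesh c) < hbar (wavenumber c) p
        \<longrightarrow> local_inf_sup C c)"

end

theory Submission
  imports Defs
begin

text \<open>Let \<open>z\<^sub>l = v - P\<^sub>\<epsilon>\<^sub>,\<^sub>l v\<close> on \<open>\<Omega>\<^sub>l\<close> be the error of the local solution. For test functions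
  with zero trace on the boundary of \<open>\<Omega>\<^sub>l\<close> the local and the global form coincide, so \<open>z\<^sub>l\<close> solves a
  local problem with boundary data only: it lies in the space on which the eigenproblem is posed
  (\<open>mem_Vh_bd\<close>, \<open>local_error\<close>). Expand \<open>z\<^sub>l\<close> in the eigenbasis. The part belonging to eigenvalues of at
  least \<open>\<rho>\<^sup>2\<close> is mapped into the coarse space by \<open>D\<^sub>l E\<^sub>l\<close>, and the energy of the remaining part is
  reduced by the factor \<open>\<rho>\<^sup>2\<close> (\<open>eigen_split\<close>). As the operators \<open>D\<^sub>l E\<^sub>l\<close> add up to the identity and
  the coarse projection is the identity on the coarse space, this gives \<open>P v = v - g + P\<^sub>0 g\<close>,
  where the squared energy norm of \<open>g\<close> is bounded by a multiple of \<open>\<rho>\<^sup>2\<close> times the sum of those of the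
  \<open>z\<^sub>l\<close> (\<open>P_op_deviation\<close>). Hence \<open>P\<close> is a small perturbation of the identity, with the constants \<open>3/2\<close>
  and \<open>1/2\<close> in the theorem, as soon as \<open>\<rho>\<close> beats the norms of \<open>P\<^sub>0\<close> and of \<open>v \<mapsto> (z\<^sub>l)\<close>.

  These norms are powers of \<open>\<kappa>\<close>. The imaginary part of the form is coercive in \<open>L\<^sup>2\<close> with constant
  \<open>\<epsilon>\<close>, so the norm of \<open>P\<^sub>0\<close> is of order \<open>\<kappa>\<^sup>2 / \<epsilon>\<close>, with exponent \<open>1 - \<alpha>\<close> (\<open>helmholtz_lower\<close>,
  \<open>P_coarse_bound\<close>). The norm of \<open>z\<^sub>l\<close> is at most the inf-sup constant, of order \<open>\<kappa> d\<close> with exponent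
  \<open>1 - \<beta>\<close>, times the norm of the functional \<open>w \<mapsto> a\<^sub>l(v, w) - a(v, E\<^sub>l w)\<close>. In the latter the
  extension by nodal values costs the square root of \<open>1 / (h \<kappa>)\<close>, with exponent \<open>\<gamma> / 2\<close>
  (\<open>extend_bound\<close>, \<open>local_error_bound\<close>). The three exponents add up to \<open>\<sigma>\<close>. Lower powers of \<open>\<kappa>\<close> are
  absorbed because the mesh size is at most the diameter of the domain, so that \<open>\<kappa>\<close> is bounded below
  (\<open>wavenumber_ge\<close>).

  The boundary terms of the forms and the cost of the extension rest on the same estimate: the squared
  \<open>L\<^sup>2\<close> norm over the elements at the boundary of a star-shaped domain is at most a multiple of
  \<open>h / \<kappa>\<close> times the squared energy norm (\<open>strip_estimate\<close>, \<open>rim_estimate\<close>). It follows by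
  integrating along the rays that issue from the centre, and combined with inverse estimates it takes
  the place of a trace theorem. Functions in the finite element spaces are handled element by element:
  the forms over a union of triangles are sums over its elements, and the nodal basis in barycentric
  coordinates yields inverse estimates with constants that depend on the shape regularity only.\<close>

section \<open>Barycentric coordinates\<close>

abbreviation vertices :: "(real^2) set \<Rightarrow> (real^2) set" where
  "vertices T \<equiv> {v. v extreme_point_of T}"

text \<open>The set \<open>W\<close> is arbitrary so that the same definition serves a triangle and its faces; on
  points outside the affine hull the value is unspecified.\<close>

definition bary :: "(real^2) set \<Rightarrow> real^2 \<Rightarrow> real^2 \<Rightarrow> real" where
  "bary W x = (SOME u. sum u W = 1 \<and> (\<Sum>v\<in>W. u v *\<^sub>R v) = x)"

lemma simplex_vertices:
  assumes "n simplex T"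
  shows "finite (vertices T)" "\<not> affine_dependent (vertices T)"
    "int (card (vertices T)) = n + 1" "convex hull (vertices T) = T"
proof -
  obtain C where C: "\<not> affine_dependent C" "int (card C) = n + 1" "T = convex hull C"
    using assms unfolding simplex_def by blast
  have "vertices T = C" using C extreme_point_of_convex_hull_affine_independent by blast
  then show "finite (vertices T)" "\<not> affine_dependent (vertices T)"
    "int (card (vertices T)) = n + 1" "convex hull (vertices T) = T"
    using C aff_independent_finite by auto
qed

lemma card_vertices: "2 simplex T \<Longrightarrow> card (vertices T) = 3"
  using simplex_vertices(3)[of 2 T] by simp

lemma affine_hull_vertices: 
  fixes T :: "(real^2) set"
  assumes "2 simplex T"
  shows "affine hull (vertices T) = UNIV"
proof -
  have "aff_dim T = 2" using assms by (rule aff_dim_simplex)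
  then have "affine hull T = UNIV" using aff_dim_eq_full[of T] by simp
  then show ?thesis using simplex_vertices(4)[OF assms] by (metis affine_hull_convex_hull)
qed

lemma bary:
  assumes "finite W" "x \<in> affine hull W"
  shows "sum (bary W x) W = 1" "(\<Sum>v\<in>W. bary W x v *\<^sub>R v) = x"
proof -
  have "\<exists>u. sum u W = 1 \<and> (\<Sum>v\<in>W. u v *\<^sub>R v) = x"
    using assms affine_hull_finite[of W] by auto
  from someI_ex[OF this] show "sum (bary W x) W = 1" "(\<Sum>v\<in>W. bary W x v *\<^sub>R v) = x"
    by (auto simp: bary_def)
qed

lemma bary_unique:
  assumes "\<not> affine_dependent W" "sum u W = 1" "(\<Sum>v\<in>W. u v *\<^sub>R v) = x" "v \<in> W"
  shows "bary W x v = u v"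
proof -
  have fin: "finite W" using assms(1) by (rule aff_independent_finite)
  have x: "x \<in> affine hull W" using affine_hull_finite[OF fin] assms(2,3) by blast
  define w where "w v = bary W x v - u v" for v
  have "sum w W = 0" "(\<Sum>v\<in>W. w v *\<^sub>R v) = 0"
    using bary[OF fin x] assms(2,3) by (auto simp: w_def sum_subtractf algebra_simps)
  then have "w v = 0" using assms(1,4) unfolding affine_dependent_explicit_finite[OF fin] by blast
  then show ?thesis by (simp add: w_def)
qed

text \<open>Coordinates with respect to a face are the coordinates of the triangle, the missing ones being
  zero. This makes finite element functions match across common edges.\<close>

lemma bary_subset:
  assumes "\<not> affine_dependent W'" "W \<subseteq> W'" "x \<in> affine hull W" "v \<in> W'"
  shows "bary W' x v = (if v \<in> W then bary W x v else 0)"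
proof -
  have fin: "finite W'" "finite W"
    using assms(1,2) aff_independent_finite finite_subset by blast+
  define u where "u v = (if v \<in> W then bary W x v else 0)" for v
  have "sum u W' = sum (bary W x) W"
    unfolding u_def using fin assms(2) by (simp add: sum.If_cases Int_absorb1)
  moreover have "(\<Sum>v\<in>W'. u v *\<^sub>R v) = (\<Sum>v\<in>W. bary W x v *\<^sub>R v)"
    by (rule sum.mono_neutral_cong_right[OF fin(1) assms(2)]) (auto simp: u_def)
  ultimately show ?thesis
    using bary_unique[OF assms(1) _ _ assms(4), of u x] bary[OF fin(2) assms(3)] by (simp add: u_def)
qed

lemma bary_mem_convex_hull:
  assumes "\<not> affine_dependent W" "x \<in> affine hull W"
  shows "x \<in> convex hull W \<longleftrightarrow> (\<forall>v\<in>W. 0 \<le> bary W x v)"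
proof
  have fin: "finite W" using assms(1) by (rule aff_independent_finite)
  show "x \<in> convex hull W" if "\<forall>v\<in>W. 0 \<le> bary W x v"
    using that bary[OF fin assms(2)] by (auto simp: convex_hull_finite[OF fin])
  assume "x \<in> convex hull W"
  then obtain u where "\<forall>v\<in>W. 0 \<le> u v" "sum u W = 1" "(\<Sum>v\<in>W. u v *\<^sub>R v) = x"
    by (auto simp: convex_hull_finite[OF fin])
  then show "\<forall>v\<in>W. 0 \<le> bary W x v" using bary_unique[OF assms(1)] by metis
qed

lemma bary_vertex:
  assumes "\<not> affine_dependent W" "w \<in> W" "v \<in> W"
  shows "bary W w v = (if v = w then 1 else 0)"
proof (rule bary_unique[OF assms(1) _ _ assms(3)])
  have fin: "finite W" using assms(1) by (rule aff_independent_finite)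
  show "(\<Sum>v\<in>W. if v = w then 1 else (0::real)) = 1" using fin assms(2) by simp
  have "(\<Sum>v\<in>W. (if v = w then 1 else 0) *\<^sub>R v) = (\<Sum>v\<in>W. if v = w then v else 0)"
    by (rule sum.cong) auto
  then show "(\<Sum>v\<in>W. (if v = w then 1 else 0) *\<^sub>R v) = w" using fin assms(2) by simp
qed

text \<open>The gradient: as barycentric coordinates are affine functions of the point, partial derivatives are
  differences.\<close>

definition bary_grad :: "(real^2) set \<Rightarrow> real^2 \<Rightarrow> real^2" where
  "bary_grad T v = (\<chi> i. bary (vertices T) (axis i 1) v - bary (vertices T) 0 v)"

lemma bary_affine:
  assumes "2 simplex T" "v \<in> vertices T"
  shows "bary (vertices T) x v = bary (vertices T) 0 v + bary_grad T v \<bullet> x"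
proof -
  let ?W = "vertices T"
  note W = simplex_vertices[OF assms(1)]
  note b = bary[OF W(1)]
  have aff: "y \<in> affine hull ?W" for y using affine_hull_vertices[OF assms(1)] by simp
  define u where "u v = bary ?W 0 v + (\<Sum>i\<in>UNIV. x $ i * (bary ?W (axis i 1) v - bary ?W 0 v))" for v
  have 1: "sum u ?W = 1"
    unfolding u_def by (subst sum.distrib, subst sum.swap)
      (simp add: b[OF aff] sum_subtractf sum_distrib_left[symmetric])
  have "(\<Sum>v\<in>?W. u v *\<^sub>R v) = (\<Sum>v\<in>?W. bary ?W 0 v *\<^sub>R v) +
      (\<Sum>i\<in>UNIV. x $ i *\<^sub>R ((\<Sum>v\<in>?W. bary ?W (axis i 1) v *\<^sub>R v) - (\<Sum>v\<in>?W. bary ?W 0 v *\<^sub>R v)))"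
    unfolding u_def
    by (simp add: sum.distrib scaleR_add_left scaleR_sum_left sum_subtractf[symmetric]
        scaleR_sum_right scaleR_diff_left[symmetric] sum.swap[of _ UNIV "vertices T"] del: sum_subtractf)
  also have "\<dots> = x" by (simp add: b[OF aff] basis_expansion[of x, unfolded scalar_mult_eq_scaleR])
  finally have "bary ?W x v = u v" using bary_unique[OF W(2) 1 _ assms(2)] by blast
  then show ?thesis by (simp add: u_def bary_grad_def inner_vec_def mult.commute)
qed

lemma mem_simplex_iff:
  assumes "2 simplex T"
  shows "x \<in> T \<longleftrightarrow> (\<forall>v\<in>vertices T. 0 \<le> bary (vertices T) x v)"
  using bary_mem_convex_hull[OF simplex_vertices(2)[OF assms], of x] affine_hull_vertices[OF assms]
    simplex_vertices(4)[OF assms] by simp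

lemma sum_bary: "2 simplex T \<Longrightarrow> sum (bary (vertices T) x) (vertices T) = 1"
  and sum_bary_scaleR: "2 simplex T \<Longrightarrow> (\<Sum>v\<in>vertices T. bary (vertices T) x v *\<^sub>R v) = x"
  using bary[OF simplex_vertices(1)] affine_hull_vertices by auto

lemma bary_le_1:
  assumes "2 simplex T" "x \<in> T" "v \<in> vertices T"
  shows "bary (vertices T) x v \<le> 1"
  using member_le_sum[of v "vertices T" "bary (vertices T) x"] assms mem_simplex_iff[OF assms(1), of x]
    sum_bary[OF assms(1)] simplex_vertices(1)[OF assms(1)] by auto

lemma continuous_on_bary:
  assumes "2 simplex T" "v \<in> vertices T"
  shows "continuous_on S (\<lambda>x. bary (vertices T) x v)"
  by (subst bary_affine[OF assms]) (intro continuous_intros)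

text \<open>The strict inequalities define an open set, which is contained in the triangle.\<close>

lemma bary_pos_imp_interior:
  assumes "2 simplex T" "\<And>v. v \<in> vertices T \<Longrightarrow> 0 < bary (vertices T) x v"
  shows "x \<in> interior T"
proof -
  let ?U = "\<Inter>v\<in>vertices T. {x. 0 < bary (vertices T) x v}"
  have "open ?U"
    using simplex_vertices(1)[OF assms(1)] assms(1)
    by (intro open_INT ballI open_Collect_less continuous_on_bary continuous_on_const) auto
  moreover have "x \<in> ?U" using assms(2) by blast
  moreover have "?U \<subseteq> T"
  proof
    fix y assume "y \<in> ?U"
    then have "\<forall>v\<in>vertices T. 0 \<le> bary (vertices T) y v" by (simp add: less_imp_le)
    then show "y \<in> T" by (simp only: mem_simplex_iff[OF assms(1)])
  qed
  ultimately show ?thesis by (rule interiorI)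
qed

lemma bary_grad_nonzero:
  assumes "2 simplex T" "v \<in> vertices T"
  shows "bary_grad T v \<noteq> 0"
proof
  assume 0: "bary_grad T v = 0"
  have "card (vertices T) = 3" using card_vertices assms(1) by simp
  then have "card (vertices T - {v}) = 2" using assms(2) by (simp add: card_Diff_subset)
  then obtain w where "w \<in> vertices T" "w \<noteq> v" by (metis DiffE card.empty ex_in_conv insertI1 zero_neq_numeral)
  have "bary (vertices T) v v = bary (vertices T) 0 v" "bary (vertices T) w v = bary (vertices T) 0 v"
    using bary_affine[OF assms, of v] bary_affine[OF assms, of w] unfolding 0 by auto
  moreover have "bary (vertices T) v v = 1" "bary (vertices T) w v = 0"
    using bary_vertex[OF simplex_vertices(2)[OF assms(1)], of _ v] assms(2) \<open>w \<in> vertices T\<close> \<open>w \<noteq> v\<close> by auto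
  ultimately show False by simp
qed

text \<open>A barycentric coordinate takes values in \<open>[0,1]\<close> on an inscribed disc, so it cannot vary
  faster than the reciprocal of the radius.\<close>

lemma norm_bary_grad_le:
  assumes "2 simplex T" "v \<in> vertices T" "0 < r" "ball c r \<subseteq> T"
  shows "norm (bary_grad T v) \<le> 2 / r"
proof -
  let ?g = "bary_grad T v"
  define z where "z = (r / 2 / norm ?g) *\<^sub>R ?g"
  have g: "norm ?g > 0" using bary_grad_nonzero[OF assms(1,2)] by simp
  have "norm z = r / 2" using g assms(3) by (simp add: z_def)
  then have "c + z \<in> T" "c \<in> T" using assms(3,4) by (auto simp: dist_norm)
  then have "bary (vertices T) (c + z) v \<le> 1" "0 \<le> bary (vertices T) c v"
    using bary_le_1[OF assms(1)] mem_simplex_iff[OF assms(1)] assms(2) by auto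
  then have "?g \<bullet> z \<le> 1" using bary_affine[OF assms(1,2), of "c + z"] bary_affine[OF assms(1,2), of c] by (simp add: inner_add_right)
  moreover have "?g \<bullet> z = r / 2 * norm ?g"
    using g by (simp add: z_def power2_norm_eq_inner[symmetric] power2_eq_square)
  ultimately show ?thesis using assms(3) by (simp add: field_simps)
qed

lemma bary_lipschitz:
  assumes "2 simplex T" "v \<in> vertices T" "0 < r" "ball c r \<subseteq> T"
  shows "\<bar>bary (vertices T) x v - bary (vertices T) y v\<bar> \<le> 2 / r * norm (x - y)"
proof -
  have "bary (vertices T) x v - bary (vertices T) y v = bary_grad T v \<bullet> (x - y)"
    using bary_affine[OF assms(1,2), of x] bary_affine[OF assms(1,2), of y] by (simp add: inner_diff_right)
  also have "\<bar>\<dots>\<bar> \<le> norm (bary_grad T v) * norm (x - y)" by (rule Cauchy_Schwarz_ineq2)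
  also have "\<dots> \<le> 2 / r * norm (x - y)"
    by (intro mult_right_mono norm_bary_grad_le[OF assms]) simp
  finally show ?thesis .
qed

lemma negligible_bary_zero:
  assumes "2 simplex T" "v \<in> vertices T"
  shows "negligible {x. bary (vertices T) x v = 0}"
proof -
  have "{x. bary (vertices T) x v = 0} = {x. bary_grad T v \<bullet> x = - bary (vertices T) 0 v}"
    by (subst bary_affine[OF assms]) (auto simp: algebra_simps eq_neg_iff_add_eq_0)
  then show ?thesis using negligible_hyperplane bary_grad_nonzero[OF assms] by metis
qed


section \<open>Polynomials in the plane\<close>

definition polyfun :: "nat \<Rightarrow> (real^2 \<Rightarrow> complex) \<Rightarrow> bool" where
  "polyfun p f \<longleftrightarrow> (\<exists>c. \<forall>x. f x = (\<Sum>i\<le>p. \<Sum>j\<le>p - i. c i j * of_real (x $ 1) ^ i * of_real (x $ 2) ^ j))"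

lemma poly_on_iff: "poly_on p T v \<longleftrightarrow> (\<exists>f. polyfun p f \<and> (\<forall>x\<in>T. v x = f x))"
proof
  assume "poly_on p T v"
  then obtain c where
    c: "\<forall>x\<in>T. v x = (\<Sum>i\<le>p. \<Sum>j\<le>p - i. c i j * of_real (x $ 1) ^ i * of_real (x $ 2) ^ j)"
    unfolding poly_on_def by (rule exE)
  show "\<exists>f. polyfun p f \<and> (\<forall>x\<in>T. v x = f x)"
    by (rule exI, rule conjI[OF _ c]) (auto simp: polyfun_def)
next
  assume "\<exists>f. polyfun p f \<and> (\<forall>x\<in>T. v x = f x)"
  then show "poly_on p T v" unfolding poly_on_def polyfun_def by fastforce
qed

lemma polyfun_const: "polyfun p (\<lambda>x. a)"
proof -
  have "(\<Sum>i\<le>p. \<Sum>j\<le>p - i. (if i = 0 \<and> j = 0 then a else 0) * s ^ i * t ^ j) = a" for s t :: complex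
  proof -
    have "(\<Sum>i\<le>p. \<Sum>j\<le>p - i. (if i = 0 \<and> j = 0 then a else 0) * s ^ i * t ^ j)
        = (\<Sum>i\<le>p. if i = 0 then (\<Sum>j\<le>p. if j = 0 then a else 0) else 0)"
    proof (intro sum.cong refl)
      fix i
      show "(\<Sum>j\<le>p - i. (if i = 0 \<and> j = 0 then a else 0) * s ^ i * t ^ j)
          = (if i = 0 then (\<Sum>j\<le>p. if j = 0 then a else 0) else 0)"
        by (cases "i = 0") (auto intro!: sum.cong simp del: sum.delta sum.delta')
    qed
    then show ?thesis by (simp add: sum.delta)
  qed
  then show ?thesis unfolding polyfun_def by (intro exI[of _ "\<lambda>i j. if i = 0 \<and> j = 0 then a else 0"]) simp
qed

lemma polyfun_add: "polyfun p f \<Longrightarrow> polyfun p g \<Longrightarrow> polyfun p (\<lambda>x. f x + g x)"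
  unfolding polyfun_def
proof (elim exE)
  fix c d
  assume "\<forall>x. f x = (\<Sum>i\<le>p. \<Sum>j\<le>p - i. c i j * of_real (x $ 1) ^ i * of_real (x $ 2) ^ j)"
    "\<forall>x. g x = (\<Sum>i\<le>p. \<Sum>j\<le>p - i. d i j * of_real (x $ 1) ^ i * of_real (x $ 2) ^ j)"
  then show "\<exists>c. \<forall>x. f x + g x = (\<Sum>i\<le>p. \<Sum>j\<le>p - i. c i j * of_real (x $ 1) ^ i * of_real (x $ 2) ^ j)"
    by (intro exI[of _ "\<lambda>i j. c i j + d i j"]) (simp add: sum.distrib[symmetric] ring_distribs)
qed

lemma polyfun_cmult: "polyfun p f \<Longrightarrow> polyfun p (\<lambda>x. a * f x)"
  unfolding polyfun_def
proof (elim exE)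
  fix c
  assume "\<forall>x. f x = (\<Sum>i\<le>p. \<Sum>j\<le>p - i. c i j * of_real (x $ 1) ^ i * of_real (x $ 2) ^ j)"
  then show "\<exists>c. \<forall>x. a * f x = (\<Sum>i\<le>p. \<Sum>j\<le>p - i. c i j * of_real (x $ 1) ^ i * of_real (x $ 2) ^ j)"
    by (intro exI[of _ "\<lambda>i j. a * c i j"]) (simp add: sum_distrib_left mult.assoc)
qed

lemma polyfun_sum: "(\<And>i. i \<in> I \<Longrightarrow> polyfun p (f i)) \<Longrightarrow> polyfun p (\<lambda>x. \<Sum>i\<in>I. f i x)"
  by (induction I rule: infinite_finite_induct) (auto intro: polyfun_const polyfun_add)

lemma polyfun_Suc: "polyfun p f \<Longrightarrow> polyfun (Suc p) f"
  unfolding polyfun_def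
proof (elim exE)
  fix c
  assume f: "\<forall>x. f x = (\<Sum>i\<le>p. \<Sum>j\<le>p - i. c i j * of_real (x $ 1) ^ i * of_real (x $ 2) ^ j)"
  define c' where "c' i j = (if i + j \<le> p then c i j else 0)" for i j
  have c': "(\<Sum>i\<le>Suc p. \<Sum>j\<le>Suc p - i. c' i j * s ^ i * t ^ j) = (\<Sum>i\<le>p. \<Sum>j\<le>p - i. c i j * s ^ i * t ^ j)"
    for s t :: complex
  proof -
    have "(\<Sum>j\<le>Suc p - i. c' i j * s ^ i * t ^ j) = (\<Sum>j\<le>p - i. c i j * s ^ i * t ^ j)" if "i \<le> p" for i
      using that by (intro sum.mono_neutral_cong_right) (auto simp: c'_def)
    moreover have "(\<Sum>j\<le>Suc p - Suc p. c' (Suc p) j * s ^ Suc p * t ^ j) = 0" by (simp add: c'_def)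
    ultimately show ?thesis by simp
  qed
  show "\<exists>c. \<forall>x. f x = (\<Sum>i\<le>Suc p. \<Sum>j\<le>Suc p - i. c i j * of_real (x $ 1) ^ i * of_real (x $ 2) ^ j)"
    by (intro exI[of _ c'] allI) (simp only: c' f[rule_format])
qed

lemma polyfun_mono: "p \<le> q \<Longrightarrow> polyfun p f \<Longrightarrow> polyfun q f"
  by (induction q rule: dec_induct) (auto intro: polyfun_Suc)

lemma polyfun_mult_coord1: "polyfun p f \<Longrightarrow> polyfun (Suc p) (\<lambda>x. of_real (x $ 1) * f x)"
  unfolding polyfun_def
proof (elim exE)
  fix c
  assume f: "\<forall>x. f x = (\<Sum>i\<le>p. \<Sum>j\<le>p - i. c i j * of_real (x $ 1) ^ i * of_real (x $ 2) ^ j)"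
  define c' where "c' i j = (case i of 0 \<Rightarrow> 0 | Suc i' \<Rightarrow> c i' j)" for i j
  have c': "(\<Sum>i\<le>Suc p. \<Sum>j\<le>Suc p - i. c' i j * s ^ i * t ^ j) = s * (\<Sum>i\<le>p. \<Sum>j\<le>p - i. c i j * s ^ i * t ^ j)"
    for s t :: complex
    by (subst sum.atMost_Suc_shift) (simp add: c'_def sum_distrib_left mult_ac)
  show "\<exists>c. \<forall>x. of_real (x $ 1) * f x = (\<Sum>i\<le>Suc p. \<Sum>j\<le>Suc p - i. c i j * of_real (x $ 1) ^ i * of_real (x $ 2) ^ j)"
    by (intro exI[of _ c'] allI) (simp only: c' f[rule_format])
qed

lemma polyfun_mult_coord2: "polyfun p f \<Longrightarrow> polyfun (Suc p) (\<lambda>x. of_real (x $ 2) * f x)"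
  unfolding polyfun_def
proof (elim exE)
  fix c
  assume f: "\<forall>x. f x = (\<Sum>i\<le>p. \<Sum>j\<le>p - i. c i j * of_real (x $ 1) ^ i * of_real (x $ 2) ^ j)"
  define c' where "c' i j = (case j of 0 \<Rightarrow> 0 | Suc j' \<Rightarrow> c i j')" for i j
  have c': "(\<Sum>i\<le>Suc p. \<Sum>j\<le>Suc p - i. c' i j * s ^ i * t ^ j) = t * (\<Sum>i\<le>p. \<Sum>j\<le>p - i. c i j * s ^ i * t ^ j)"
    for s t :: complex
  proof -
    have "(\<Sum>j\<le>Suc p - i. c' i j * s ^ i * t ^ j) = t * (\<Sum>j\<le>p - i. c i j * s ^ i * t ^ j)" if "i \<le> p" for i
      unfolding Suc_diff_le[OF that] by (subst sum.atMost_Suc_shift) (simp add: c'_def sum_distrib_left mult_ac)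
    moreover have "(\<Sum>j\<le>Suc p - Suc p. c' (Suc p) j * s ^ Suc p * t ^ j) = 0" by (simp add: c'_def)
    ultimately show ?thesis by (simp add: sum_distrib_left)
  qed
  show "\<exists>c. \<forall>x. of_real (x $ 2) * f x = (\<Sum>i\<le>Suc p. \<Sum>j\<le>Suc p - i. c i j * of_real (x $ 1) ^ i * of_real (x $ 2) ^ j)"
    by (intro exI[of _ c'] allI) (simp only: c' f[rule_format])
qed

lemma polyfun_mult_affine:
  assumes "polyfun p f"
  shows "polyfun (Suc p) (\<lambda>x. of_real (a + b * x $ 1 + c * x $ 2) * f x)"
proof -
  have "polyfun (Suc p) (\<lambda>x. (of_real a * f x + of_real b * (of_real (x $ 1) * f x)) + of_real c * (of_real (x $ 2) * f x))"
    using assms by (intro polyfun_add polyfun_cmult polyfun_mult_coord1 polyfun_mult_coord2)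
      (auto intro: polyfun_Suc)
  then show ?thesis by (simp add: ring_distribs mult_ac)
qed

lemma polyfun_mult_affine_power:
  assumes "polyfun p f"
  shows "polyfun (n + p) (\<lambda>x. of_real (a + b * x $ 1 + c * x $ 2) ^ n * f x)"
proof (induction n)
  case (Suc n)
  from polyfun_mult_affine[OF this, of a b c] show ?case by (simp add: mult.assoc)
qed (use assms in simp)

lemma polyfun_compose_affine:
  assumes "polyfun p f"
    and A1: "\<And>x. A x $ 1 = a1 + b1 * x $ 1 + c1 * x $ 2"
    and A2: "\<And>x. A x $ 2 = a2 + b2 * x $ 1 + c2 * x $ 2"
  shows "polyfun p (\<lambda>x. f (A x))"
proof -
  obtain c where f: "\<And>x. f x = (\<Sum>i\<le>p. \<Sum>j\<le>p - i. c i j * of_real (x $ 1) ^ i * of_real (x $ 2) ^ j)"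
    using assms(1) unfolding polyfun_def by blast
  have "polyfun p (\<lambda>x. c i j * of_real (A x $ 1) ^ i * of_real (A x $ 2) ^ j)" if "i \<le> p" "j \<le> p - i" for i j
  proof -
    have "polyfun (i + (j + 0)) (\<lambda>x. of_real (A x $ 1) ^ i * (of_real (A x $ 2) ^ j * c i j))"
      unfolding A1 A2 by (intro polyfun_mult_affine_power polyfun_const)
    then have "polyfun p (\<lambda>x. of_real (A x $ 1) ^ i * (of_real (A x $ 2) ^ j * c i j))"
      using that by (intro polyfun_mono[of "i + (j + 0)" p]) auto
    then show ?thesis by (simp add: mult_ac)
  qed
  then show ?thesis unfolding f by (intro polyfun_sum) auto
qed

lemma polyfun_0_const: "polyfun 0 f \<Longrightarrow> f x = f y"
  unfolding polyfun_def by auto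

text \<open>A polynomial of total degree \<open>n\<close> which vanishes at the integer points of the triangle with
  legs of length \<open>n\<close> vanishes on the leg with \<open>n + 1\<close> of these points, where it is a univariate
  polynomial. Splitting off the linear factor leaves a polynomial of degree \<open>n - 1\<close> and a smaller
  triangle.\<close>

lemma polyfun_eq_0_if_zero_on_lattice:
  assumes "polyfun n f" "\<And>i j. i + j \<le> n \<Longrightarrow> f (vector [real i, real j]) = 0"
  shows "f x = 0"
  using assms
proof (induction n arbitrary: f x)
  case 0
  then show ?case using 0(2)[of 0 0] polyfun_0_const[OF 0(1)] by (metis add_0 le_refl)
next
  case (Suc n)
  obtain c where f: "\<And>x. f x = (\<Sum>i\<le>Suc n. \<Sum>j\<le>Suc n - i. c i j * of_real (x $ 1) ^ i * of_real (x $ 2) ^ j)"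
    using Suc(2) unfolding polyfun_def by blast
  define g where "g x = (\<Sum>i\<le>n. \<Sum>j\<le>n - i. c (Suc i) j * of_real (x $ 1) ^ i * of_real (x $ 2) ^ j)" for x :: "real^2"
  have split: "f x = (\<Sum>j\<le>Suc n. c 0 j * of_real (x $ 2) ^ j) + of_real (x $ 1) * g x" for x
    unfolding f g_def by (subst sum.atMost_Suc_shift) (simp add: sum_distrib_left mult_ac)
  have "(\<Sum>j\<le>Suc n. c 0 j * of_nat k ^ j) = 0" if "k \<le> Suc n" for k
    using Suc(3)[of 0 k] that split[of "vector [real 0, real k]"] by simp
  then have "of_nat ` {..Suc n} \<subseteq> {z. (\<Sum>j\<le>Suc n. c 0 j * z ^ j) = 0}" by auto
  moreover have "card (of_nat ` {..Suc n} :: complex set) = Suc (Suc n)"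
    by (subst card_image) (auto simp: inj_on_def)
  ultimately have many: "finite Z \<Longrightarrow> card Z \<ge> Suc (Suc n)"
    if "Z = {z. (\<Sum>j\<le>Suc n. c 0 j * z ^ j) = 0}" for Z using that card_mono by metis
  have c0: "\<forall>j\<le>Suc n. c 0 j = 0"
  proof (rule ccontr)
    assume "\<not> ?thesis"
    then obtain k where "c 0 k \<noteq> 0" "k \<le> Suc n" by blast
    from Transcendental.polyfun_rootbound[where c = "c 0" and k = k and n = "Suc n", OF this] many[OF refl] show False by linarith
  qed
  then have fg: "f x = of_real (x $ 1) * g x" for x using split by simp
  define h where "h x = g (vector [x $ 1 + 1, x $ 2])" for x :: "real^2"
  have "polyfun n g" unfolding polyfun_def g_def by (intro exI[of _ "\<lambda>i. c (Suc i)"]) simp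
  then have "polyfun n h" unfolding h_def
    by (rule polyfun_compose_affine[of _ _ _ 1 1 0 0 0 1]) simp_all
  moreover have "h (vector [real i, real j]) = 0" if "i + j \<le> n" for i j
  proof -
    have "h (vector [real i, real j]) = g (vector [real (Suc i), real j])"
      by (simp add: h_def add.commute)
    moreover have "of_real (real (Suc i)) * g (vector [real (Suc i), real j]) = 0"
      using Suc(3)[of "Suc i" j] that fg[of "vector [real (Suc i), real j]"] by (simp del: of_nat_Suc)
    ultimately show ?thesis by (simp del: of_nat_Suc)
  qed
  ultimately have "h y = 0" for y by (rule Suc.IH)
  moreover have "h (vector [x $ 1 - 1, x $ 2]) = g x"
    unfolding h_def by (rule arg_cong[of _ _ g]) (simp add: vec_eq_iff forall_2)
  ultimately show ?case using fg by simp
qed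

section \<open>Lagrange interpolation\<close>

text \<open>Telescoping: the factors of the product are replaced one after the other.\<close>

lemma prod_bound_and_lipschitz:
  fixes f g :: "'i \<Rightarrow> real"
  assumes "finite I" "1 \<le> M" "0 \<le> \<eta>"
    and "\<And>i. i \<in> I \<Longrightarrow> \<bar>f i\<bar> \<le> M" "\<And>i. i \<in> I \<Longrightarrow> \<bar>g i\<bar> \<le> M"
    and "\<And>i. i \<in> I \<Longrightarrow> \<bar>f i - g i\<bar> \<le> M * \<eta>"
  shows "\<bar>prod f I\<bar> \<le> M ^ card I" "\<bar>prod g I\<bar> \<le> M ^ card I"
    "\<bar>prod f I - prod g I\<bar> \<le> real (card I) * M ^ card I * \<eta>"
proof -
  have "\<bar>prod f I\<bar> \<le> M ^ card I \<and> \<bar>prod g I\<bar> \<le> M ^ card I \<and>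
    \<bar>prod f I - prod g I\<bar> \<le> real (card I) * M ^ card I * \<eta>"
    using assms(1,4-6)
  proof (induction I)
    case (insert i I)
    let ?n = "card I"
    have IH: "\<bar>prod f I\<bar> \<le> M ^ ?n" "\<bar>prod g I\<bar> \<le> M ^ ?n"
      "\<bar>prod f I - prod g I\<bar> \<le> real ?n * M ^ ?n * \<eta>"
      using insert by auto
    have i: "\<bar>f i\<bar> \<le> M" "\<bar>g i\<bar> \<le> M" "\<bar>f i - g i\<bar> \<le> M * \<eta>" using insert.prems by auto
    have "f i * prod f I - g i * prod g I = f i * (prod f I - prod g I) + (f i - g i) * prod g I"
      by (simp add: algebra_simps)
    then have "\<bar>f i * prod f I - g i * prod g I\<bar>
        \<le> \<bar>f i\<bar> * \<bar>prod f I - prod g I\<bar> + \<bar>f i - g i\<bar> * \<bar>prod g I\<bar>"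
      by (metis abs_mult abs_triangle_ineq)
    also have "\<dots> \<le> M * (real ?n * M ^ ?n * \<eta>) + (M * \<eta>) * M ^ ?n"
      by (rule add_mono[OF mult_mono[OF i(1) IH(3)] mult_mono[OF i(3) IH(2)]]) (use assms(2,3) in simp_all)
    also have "\<dots> = real (Suc ?n) * M ^ Suc ?n * \<eta>" by (simp add: algebra_simps)
    finally have "\<bar>f i * prod f I - g i * prod g I\<bar> \<le> real (Suc ?n) * M ^ Suc ?n * \<eta>" .
    moreover have "\<bar>f i\<bar> * \<bar>prod f I\<bar> \<le> M * M ^ ?n" "\<bar>g i\<bar> * \<bar>prod g I\<bar> \<le> M * M ^ ?n"
      using mult_mono[OF i(1) IH(1)] mult_mono[OF i(2) IH(2)] assms(2) by simp_all
    ultimately show ?case using insert.hyps by (simp add: abs_mult)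
  qed simp
  then show "\<bar>prod f I\<bar> \<le> M ^ card I" "\<bar>prod g I\<bar> \<le> M ^ card I"
    "\<bar>prod f I - prod g I\<bar> \<le> real (card I) * M ^ card I * \<eta>" by auto
qed

text \<open>The Lagrange factor: a polynomial of degree \<open>k\<close> which vanishes at \<open>0, 1/p, \<dots>, (k-1)/p\<close> and is
  \<open>1\<close> at \<open>k/p\<close>. Products of such factors in the barycentric coordinates form the nodal basis.\<close>

definition lag :: "nat \<Rightarrow> nat \<Rightarrow> real \<Rightarrow> real" where
  "lag p k s = (\<Prod>i<k. (real p * s - real i) / (real k - real i))"

lemma lag_0 [simp]: "lag p 0 s = 1"
  by (simp add: lag_def)

lemma lag_at_0: "0 < k \<Longrightarrow> lag p k 0 = 0"
  unfolding lag_def by (rule prod_zero) (auto intro!: bexI[of _ 0])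

lemma lag_node_less: "0 < p \<Longrightarrow> j < k \<Longrightarrow> lag p k (real j / real p) = 0"
  unfolding lag_def by (rule prod_zero) (auto intro!: bexI[of _ j])

lemma lag_node_same: "0 < p \<Longrightarrow> lag p k (real k / real p) = 1"
  unfolding lag_def by (intro prod.neutral) auto

lemma lag_bounds:
  obtains M where "1 \<le> M"
    "\<And>k s. k \<le> p \<Longrightarrow> 0 \<le> s \<Longrightarrow> s \<le> 1 \<Longrightarrow> \<bar>lag p k s\<bar> \<le> M"
    "\<And>k s t. k \<le> p \<Longrightarrow> 0 \<le> s \<Longrightarrow> s \<le> 1 \<Longrightarrow> 0 \<le> t \<Longrightarrow> t \<le> 1 \<Longrightarrow>
      \<bar>lag p k s - lag p k t\<bar> \<le> M * \<bar>s - t\<bar>"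
proof -
  define P where "P = max 1 (real p)"
  have P: "1 \<le> P" "real p \<le> P" by (auto simp: P_def)
  define M where "M = (real p + 1) * P ^ p"
  have P1: "1 \<le> P ^ k" for k using P by simp
  have M1: "1 \<le> M" unfolding M_def using mult_mono[of 1 "real p + 1" 1 "P ^ p"] P1 by simp
  have fac: "\<bar>(real p * s - real i) / (real k - real i)\<bar> \<le> P"
      "\<bar>(real p * s - real i) / (real k - real i) - (real p * t - real i) / (real k - real i)\<bar> \<le> P * \<bar>s - t\<bar>"
    if "i < k" "k \<le> p" "0 \<le> s" "s \<le> 1" for i k s t
  proof -
    have d: "1 \<le> real k - real i" using that by linarith
    have "real p * s \<le> real p" using that by (simp add: mult_left_le)
    moreover have "0 \<le> real p * s" using that by simp
    moreover have "real i \<le> real p" using that by simp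
    ultimately have n: "\<bar>real p * s - real i\<bar> \<le> real p" by linarith
    have "\<bar>(real p * s - real i) / (real k - real i)\<bar> = \<bar>real p * s - real i\<bar> / (real k - real i)"
      using d by simp
    also have "\<dots> \<le> \<bar>real p * s - real i\<bar> / 1" using d by (intro divide_left_mono) auto
    finally show "\<bar>(real p * s - real i) / (real k - real i)\<bar> \<le> P" using n P by simp
    have "(real p * s - real i) / (real k - real i) - (real p * t - real i) / (real k - real i)
        = real p * (s - t) / (real k - real i)"
      by (simp add: diff_divide_distrib[symmetric] algebra_simps)
    also have "\<bar>\<dots>\<bar> = real p * \<bar>s - t\<bar> / (real k - real i)" using d by (simp add: abs_mult)
    also have "\<dots> \<le> real p * \<bar>s - t\<bar> / 1" using d by (intro divide_left_mono) auto
    also have "\<dots> \<le> P * \<bar>s - t\<bar>" using P by (simp add: mult_right_mono)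
    finally show "\<bar>(real p * s - real i) / (real k - real i) - (real p * t - real i) / (real k - real i)\<bar> \<le> P * \<bar>s - t\<bar>" .
  qed
  have Pk: "P ^ k \<le> M" "real k * P ^ k \<le> M" if "k \<le> p" for k
  proof -
    have "P ^ k \<le> P ^ p" using P that by (simp add: power_increasing)
    then have "1 * P ^ k \<le> (real p + 1) * P ^ p" "real k * P ^ k \<le> (real p + 1) * P ^ p"
      using that P by (intro mult_mono; simp)+
    then show "P ^ k \<le> M" "real k * P ^ k \<le> M" by (simp_all add: M_def)
  qed
  show thesis
  proof (rule that[OF M1])
    fix k s assume k: "k \<le> p" and s: "0 \<le> s" "s \<le> (1::real)"
    have "\<bar>lag p k s\<bar> \<le> P ^ card {..<k}"
      unfolding lag_def
      by (rule prod_bound_and_lipschitz(1)[where \<eta> = 0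
            and g = "\<lambda>i. (real p * s - real i) / (real k - real i)"])
        (use P fac(1)[of _ k s] k s in auto)
    then show "\<bar>lag p k s\<bar> \<le> M" using Pk(1)[OF k] by simp
  next
    fix k s t assume k: "k \<le> p" and st: "0 \<le> s" "s \<le> (1::real)" "0 \<le> t" "t \<le> (1::real)"
    have "\<bar>lag p k s - lag p k t\<bar> \<le> real (card {..<k}) * P ^ card {..<k} * \<bar>s - t\<bar>"
      unfolding lag_def using P fac(1)[of _ k s] fac(1)[of _ k t] fac(2)[of _ k s t] k st
      by (intro prod_bound_and_lipschitz(3)) auto
    also have "\<dots> \<le> M * \<bar>s - t\<bar>" using Pk(2)[OF k] by (intro mult_right_mono) auto
    finally show "\<bar>lag p k s - lag p k t\<bar> \<le> M * \<bar>s - t\<bar>" .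
  qed
qed

text \<open>Multi-indices of the principal lattice. They vanish off \<open>W\<close>, so that equality of functions is
  equality of multi-indices and the multi-indices of a face are among those of the triangle.\<close>

definition idx :: "(real^2) set \<Rightarrow> nat \<Rightarrow> (real^2 \<Rightarrow> nat) set" where
  "idx W p = {k. (\<forall>v. v \<notin> W \<longrightarrow> k v = 0) \<and> sum k W = p}"

definition node :: "(real^2) set \<Rightarrow> nat \<Rightarrow> (real^2 \<Rightarrow> nat) \<Rightarrow> real^2" where
  "node W p k = (\<Sum>v\<in>W. (real (k v) / real p) *\<^sub>R v)"

definition shape :: "(real^2) set \<Rightarrow> nat \<Rightarrow> (real^2 \<Rightarrow> nat) \<Rightarrow> real^2 \<Rightarrow> real" where
  "shape W p k x = (\<Prod>v\<in>W. lag p (k v) (bary W x v))"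

definition interp :: "(real^2) set \<Rightarrow> nat \<Rightarrow> (real^2 \<Rightarrow> complex) \<Rightarrow> real^2 \<Rightarrow> complex" where
  "interp W p f x = (\<Sum>k\<in>idx W p. f (node W p k) * of_real (shape W p k x))"

lemma idx_le: "finite W \<Longrightarrow> k \<in> idx W p \<Longrightarrow> k v \<le> p"
  unfolding idx_def using member_le_sum[of v W k] by (cases "v \<in> W") auto

lemma sum_idx_div:
  assumes "k \<in> idx W p" "0 < p"
  shows "(\<Sum>v\<in>W. real (k v) / real p) = 1"
proof -
  have "(\<Sum>v\<in>W. real (k v)) = real p" using assms(1) by (simp add: idx_def flip: of_nat_sum)
  then show ?thesis using assms(2) by (simp flip: sum_divide_distrib)
qed

lemma finite_idx: "finite W \<Longrightarrow> finite (idx W p)"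
proof -
  assume W: "finite W"
  have "idx W p \<subseteq> {k. \<forall>v. (v \<in> W \<longrightarrow> k v \<in> {..p}) \<and> (v \<notin> W \<longrightarrow> k v = 0)}"
    using idx_le[OF W] by (auto simp: idx_def)
  then show ?thesis using finite_set_of_finite_funs[OF W, of "{..p}" 0] finite_subset by blast
qed

lemma card_idx_le:
  assumes "finite W" "card W = 3" shows "card (idx W p) \<le> (p + 1) ^ 3"
proof -
  have "card (idx W p) \<le> card (W \<rightarrow>\<^sub>E {..p})"
  proof (rule card_inj_on_le)
    show "inj_on (\<lambda>k. restrict k W) (idx W p)"
    proof (intro inj_onI ext)
      fix k k' v
      assume k: "k \<in> idx W p" "k' \<in> idx W p" and eq: "restrict k W = restrict k' W"
      show "k v = k' v"
        using fun_cong[OF eq, of v] k by (cases "v \<in> W") (auto simp: idx_def)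
    qed
    show "(\<lambda>k. restrict k W) ` idx W p \<subseteq> W \<rightarrow>\<^sub>E {..p}" using idx_le[OF assms(1)] by auto
  qed (use assms(1) in \<open>auto intro: finite_PiE\<close>)
  then show ?thesis using assms by (simp add: card_PiE prod_constant)
qed

lemma element_nodes_eq:
  assumes "2 simplex T"
  shows "element_nodes p T = node (vertices T) p ` idx (vertices T) p"
proof -
  let ?W = "vertices T"
  have "node ?W p k \<in> node ?W p ` idx ?W p" if "sum k ?W = p" for k
  proof (rule image_eqI[of _ _ "\<lambda>v. if v \<in> ?W then k v else 0"])
    show "node ?W p k = node ?W p (\<lambda>v. if v \<in> ?W then k v else 0)"
      unfolding node_def by (rule sum.cong) auto
    have "(\<Sum>v\<in>?W. if v \<in> ?W then k v else 0) = sum k ?W" by (rule sum.cong) auto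
    then show "(\<lambda>v. if v \<in> ?W then k v else 0) \<in> idx ?W p" using that by (simp add: idx_def)
  qed
  moreover have "element_nodes p T = {node ?W p k |k. sum k ?W = p}"
    unfolding element_nodes_def node_def by (rule refl)
  ultimately show ?thesis by (auto simp: idx_def)
qed

lemma bary_node:
  assumes "\<not> affine_dependent W" "0 < p" "k \<in> idx W p" "v \<in> W"
  shows "bary W (node W p k) v = real (k v) / real p"
  by (rule bary_unique[OF assms(1) sum_idx_div[OF assms(3,2)] _ assms(4)]) (simp add: node_def)

lemma node_mem_convex_hull:
  assumes "finite W" "0 < p" "k \<in> idx W p"
  shows "node W p k \<in> convex hull W"
  using sum_idx_div[OF assms(3,2)] unfolding convex_hull_finite[OF assms(1)] node_def
  by (intro CollectI exI[of _ "\<lambda>v. real (k v) / real p"]) simp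

lemma element_nodes_subset: "2 simplex T \<Longrightarrow> 0 < p \<Longrightarrow> element_nodes p T \<subseteq> T"
  using node_mem_convex_hull[of "vertices T" p] simplex_vertices[of 2 T] by (auto simp: element_nodes_eq)

lemma finite_element_nodes: "2 simplex T \<Longrightarrow> finite (element_nodes p T)"
  using finite_idx simplex_vertices(1) by (auto simp: element_nodes_eq)

lemma card_element_nodes_le: "2 simplex T \<Longrightarrow> card (element_nodes p T) \<le> (p + 1) ^ 3"
  using card_image_le[OF finite_idx, of "vertices T" "node (vertices T) p" p]
    card_idx_le[of "vertices T" p] simplex_vertices(1) card_vertices
  by (fastforce simp: element_nodes_eq)

text \<open>If \<open>k\<close> and \<open>k'\<close> differ, then \<open>k' v < k v\<close> for some \<open>v\<close>, because both sum to \<open>p\<close>; the factor for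
  this \<open>v\<close> vanishes.\<close>

lemma shape_node:
  assumes "\<not> affine_dependent W" "0 < p" "k \<in> idx W p" "k' \<in> idx W p"
  shows "shape W p k (node W p k') = (if k = k' then 1 else 0)"
proof (cases "k = k'")
  case True
  then show ?thesis unfolding shape_def
    using bary_node[OF assms(1,2,4)] lag_node_same[OF assms(2)] by (auto intro!: prod.neutral)
next
  case False
  have fin: "finite W" using assms(1) by (rule aff_independent_finite)
  have "\<exists>v\<in>W. k' v < k v"
  proof (rule ccontr)
    assume "\<not> ?thesis"
    then have "k v = k' v" if "v \<in> W" for v
      using sum_mono_inv[of k W k' v] assms(3,4) that fin by (auto simp: idx_def not_less)
    then have "k = k'" using assms(3,4) by (fastforce simp: idx_def)
    with False show False by simp
  qed
  then obtain v where v: "v \<in> W" "k' v < k v" by blast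
  have "lag p (k v) (bary W (node W p k') v) = 0"
    using lag_node_less[OF assms(2) v(2)] bary_node[OF assms(1,2,4) v(1)] by simp
  then show ?thesis unfolding shape_def using fin v(1) False by (auto intro!: prod_zero)
qed

lemma interp_node:
  assumes "\<not> affine_dependent W" "0 < p" "k \<in> idx W p"
  shows "interp W p f (node W p k) = f (node W p k)"
proof -
  have "interp W p f (node W p k) = (\<Sum>k'\<in>idx W p. if k' = k then f (node W p k) else 0)"
    unfolding interp_def using shape_node[OF assms(1,2) _ assms(3)] by (intro sum.cong) auto
  then show ?thesis using assms(3) finite_idx[OF aff_independent_finite[OF assms(1)]] by simp
qed

text \<open>On a face the interpolant is determined by the nodes of that face. Hence interpolants on
  two triangles agree on a common face.\<close>

lemma interp_face:
  assumes "\<not> affine_dependent W'" "W \<subseteq> W'" "x \<in> affine hull W" "0 < p"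
  shows "interp W' p f x = interp W p f x"
proof -
  have fin: "finite W'" "finite W"
    using assms(1,2) aff_independent_finite finite_subset by blast+
  have sub: "idx W p \<subseteq> idx W' p"
  proof
    fix k assume k: "k \<in> idx W p"
    then have "sum k W' = sum k W"
      using fin assms(2) by (intro sum.mono_neutral_right) (auto simp: idx_def)
    then show "k \<in> idx W' p" using k assms(2) by (auto simp: idx_def)
  qed
  note b = bary_subset[OF assms(1-3)]
  have "f (node W' p k) * of_real (shape W' p k x) = 0" if k: "k \<in> idx W' p - idx W p" for k
  proof -
    have "\<exists>v\<in>W' - W. 0 < k v"
    proof (rule ccontr)
      assume *: "\<not> ?thesis"
      then have "sum k W = sum k W'"
        using fin assms(2) by (intro sum.mono_neutral_left) auto
      then have "k \<in> idx W p" using k * by (auto simp: idx_def)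
      with k show False by simp
    qed
    then obtain v where "v \<in> W'" "v \<notin> W" "0 < k v" by blast
    then have "lag p (k v) (bary W' x v) = 0" using b[of v] lag_at_0 by simp
    then show ?thesis unfolding shape_def using fin \<open>v \<in> W'\<close> by auto
  qed
  moreover have "node W' p k = node W p k" "shape W' p k x = shape W p k x" if "k \<in> idx W p" for k
  proof -
    have 0: "k v = 0" if "v \<notin> W" for v using that \<open>k \<in> idx W p\<close> by (auto simp: idx_def)
    show "node W' p k = node W p k" unfolding node_def
      using fin assms(2) 0 by (intro sum.mono_neutral_right) auto
    have "shape W' p k x = (\<Prod>v\<in>W. lag p (k v) (bary W' x v))" unfolding shape_def
      using fin assms(2) 0 by (intro prod.mono_neutral_right) auto
    also have "\<dots> = shape W p k x" unfolding shape_def using b assms(2) by (intro prod.cong) auto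
    finally show "shape W' p k x = shape W p k x" .
  qed
  ultimately show ?thesis unfolding interp_def
    using fin sub by (intro sum.mono_neutral_cong_right finite_idx) auto
qed

lemma polyfun_lag_bary:
  assumes "2 simplex T" "v \<in> vertices T" "polyfun q f"
  shows "polyfun (k + q) (\<lambda>x. of_real (lag p k (bary (vertices T) x v)) * f x)"
proof -
  have "polyfun (n + q) (\<lambda>x. of_real (\<Prod>i<n. (real p * bary (vertices T) x v - real i) / (real k - real i)) * f x)" for n
  proof (induction n)
    case (Suc n)
    let ?b = "bary (vertices T) 0 v" and ?g = "bary_grad T v"
    have fac: "(real p * bary (vertices T) x v - real n) / (real k - real n)
      = (real p * ?b - real n) / (real k - real n) + (real p * ?g $ 1 / (real k - real n)) * x $ 1
        + (real p * ?g $ 2 / (real k - real n)) * x $ 2" for x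
      by (subst bary_affine[OF assms(1,2)])
        (simp add: inner_vec_def sum_2 add_divide_distrib[symmetric] algebra_simps)
    show ?case
      using polyfun_mult_affine[OF Suc, of "(real p * ?b - real n) / (real k - real n)"
          "real p * ?g $ 1 / (real k - real n)" "real p * ?g $ 2 / (real k - real n)"]
      unfolding fac[symmetric] by (simp add: mult_ac)
  qed (use assms(3) in simp)
  from this[of k] show ?thesis by (simp add: lag_def)
qed

text \<open>The degrees of the factors add up to \<open>p\<close>, the sum of the multi-index.\<close>

lemma polyfun_shape:
  assumes "2 simplex T" "k \<in> idx (vertices T) p"
  shows "polyfun p (\<lambda>x. of_real (shape (vertices T) p k x))"
proof -
  let ?W = "vertices T"
  have "polyfun (sum k V) (\<lambda>x. of_real (\<Prod>v\<in>V. lag p (k v) (bary ?W x v)))"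
    if "finite V" "V \<subseteq> ?W" for V
    using that
  proof (induction V)
    case (insert v V)
    then show ?case using polyfun_lag_bary[OF assms(1), of v "sum k V"] by simp
  qed (simp add: polyfun_const)
  from this[of ?W] show ?thesis
    using assms simplex_vertices(1) by (auto simp: shape_def idx_def)
qed

lemma polyfun_interp: "2 simplex T \<Longrightarrow> polyfun p (interp (vertices T) p f)"
  unfolding interp_def[abs_def] by (intro polyfun_sum polyfun_cmult polyfun_shape)

text \<open>An affine map takes the nodes to the integer points of the triangle with legs of length \<open>p\<close>.\<close>

lemma polyfun_zero_if_zero_at_nodes:
  assumes "2 simplex T" "0 < p" "polyfun p f" "\<And>k. k \<in> idx (vertices T) p \<Longrightarrow> f (node (vertices T) p k) = 0"
  shows "f x = 0"
proof -
  let ?W = "vertices T"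
  note W = simplex_vertices[OF assms(1)]
  obtain a b c where abc: "?W = {a, b, c}" "a \<noteq> b" "a \<noteq> c" "b \<noteq> c"
    using card_vertices[OF assms(1)] by (auto simp: card_3_iff)
  define A where "A y = a + (y $ 1 / real p) *\<^sub>R (b - a) + (y $ 2 / real p) *\<^sub>R (c - a)" for y :: "real^2"
  have "polyfun p (\<lambda>y. f (A y))"
    by (rule polyfun_compose_affine[OF assms(3), of _ "a $ 1" "(b $ 1 - a $ 1) / p" "(c $ 1 - a $ 1) / p"
          "a $ 2" "(b $ 2 - a $ 2) / p" "(c $ 2 - a $ 2) / p"]) (simp_all add: A_def diff_divide_distrib add_divide_distrib algebra_simps)
  moreover have "f (A (vector [real i, real j])) = 0" if "i + j \<le> p" for i j
  proof -
    define k where "k v = (if v = a then p - i - j else if v = b then i else if v = c then j else 0)" for v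
    have k: "k \<in> idx ?W p" using abc that by (auto simp: idx_def k_def)
    have "A (vector [real i, real j]) = (1 - real i / p - real j / p) *\<^sub>R a + (real i / p) *\<^sub>R b + (real j / p) *\<^sub>R c"
      by (simp add: A_def algebra_simps)
    also have "1 - real i / p - real j / p = real (p - i - j) / p"
      using assms(2) that by (simp add: of_nat_diff field_simps)
    also have "(real (p - i - j) / p) *\<^sub>R a + (real i / p) *\<^sub>R b + (real j / p) *\<^sub>R c = node ?W p k"
      using abc by (simp add: node_def k_def)
    finally show ?thesis using assms(4)[OF k] by simp
  qed
  ultimately have 0: "f (A y) = 0" for y by (rule polyfun_eq_0_if_zero_on_lattice)
  have s: "bary ?W x a + bary ?W x b + bary ?W x c = 1" using sum_bary[OF assms(1), of x] abc by simp
  have "x = bary ?W x a *\<^sub>R a + bary ?W x b *\<^sub>R b + bary ?W x c *\<^sub>R c"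
    using sum_bary_scaleR[OF assms(1), of x] abc by (simp add: add.assoc)
  also have "bary ?W x a = 1 - bary ?W x b - bary ?W x c" using s by simp
  also have "(1 - bary ?W x b - bary ?W x c) *\<^sub>R a + bary ?W x b *\<^sub>R b + bary ?W x c *\<^sub>R c
      = A (vector [p * bary ?W x b, p * bary ?W x c])"
    using assms(2) by (simp add: A_def algebra_simps)
  finally show ?thesis using 0 by metis
qed

lemma poly_on_eq_interp:
  assumes "2 simplex T" "0 < p" "poly_on p T v" "x \<in> T"
  shows "v x = interp (vertices T) p v x"
proof -
  let ?W = "vertices T"
  note W = simplex_vertices[OF assms(1)]
  obtain f where f: "polyfun p f" "\<And>x. x \<in> T \<Longrightarrow> v x = f x"
    using assms(3) by (auto simp: poly_on_iff)
  have nT: "node ?W p k \<in> T" if "k \<in> idx ?W p" for k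
    using node_mem_convex_hull[OF W(1) assms(2) that] W(4) by simp
  have vf: "interp ?W p v y = interp ?W p f y" for y
    unfolding interp_def by (intro sum.cong refl) (simp add: f(2) nT)
  have "polyfun p (\<lambda>x. f x + (- 1) * interp ?W p f x)"
    by (intro polyfun_add polyfun_cmult f(1) polyfun_interp assms(1))
  from polyfun_zero_if_zero_at_nodes[OF assms(1,2) this, of x]
  have "f x = interp ?W p f x" using interp_node[OF W(2) assms(2)] by simp
  then show ?thesis using f(2)[OF assms(4)] vf by simp
qed

text \<open>Barycentric coordinates lie in \<open>[0,1]\<close> on the triangle and vary at most like the reciprocal of the
  inradius, so the constant can be chosen independently of the triangle.\<close>

lemma shape_bounds:
  obtains M where "1 \<le> M"
    "\<And>T k x. 2 simplex T \<Longrightarrow> k \<in> idx (vertices T) p \<Longrightarrow> x \<in> T \<Longrightarrow> \<bar>shape (vertices T) p k x\<bar> \<le> M"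
    "\<And>T k c r x y. 2 simplex T \<Longrightarrow> k \<in> idx (vertices T) p \<Longrightarrow> x \<in> T \<Longrightarrow> y \<in> T \<Longrightarrow> 0 < r \<Longrightarrow>
      ball c r \<subseteq> T \<Longrightarrow> \<bar>shape (vertices T) p k x - shape (vertices T) p k y\<bar> \<le> M / r * norm (x - y)"
proof -
  obtain M where M: "1 \<le> M"
    "\<And>k s. k \<le> p \<Longrightarrow> 0 \<le> s \<Longrightarrow> s \<le> 1 \<Longrightarrow> \<bar>lag p k s\<bar> \<le> M"
    "\<And>k s t. k \<le> p \<Longrightarrow> 0 \<le> s \<Longrightarrow> s \<le> 1 \<Longrightarrow> 0 \<le> t \<Longrightarrow> t \<le> 1 \<Longrightarrow>
      \<bar>lag p k s - lag p k t\<bar> \<le> M * \<bar>s - t\<bar>" by (rule lag_bounds) blast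
  have M3: "1 \<le> M ^ 3" using M(1) by simp
  show thesis
  proof (rule that[of "6 * M ^ 3"])
    show "1 \<le> 6 * M ^ 3" using M3 by simp
  next
    fix T k x assume T: "2 simplex T" and k: "k \<in> idx (vertices T) p" and x: "x \<in> T"
    have b: "\<bar>lag p (k v) (bary (vertices T) x v)\<bar> \<le> M" if "v \<in> vertices T" for v
      using that M(2) idx_le[OF simplex_vertices(1)[OF T] k] bary_le_1[OF T x] x mem_simplex_iff[OF T, of x] by auto
    have "\<bar>shape (vertices T) p k x\<bar> \<le> M ^ card (vertices T)"
      unfolding shape_def
      by (rule prod_bound_and_lipschitz(1)[where \<eta> = 0 and g = "\<lambda>v. lag p (k v) (bary (vertices T) x v)"])
        (use b M(1) simplex_vertices(1)[OF T] in auto)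
    then show "\<bar>shape (vertices T) p k x\<bar> \<le> 6 * M ^ 3" using card_vertices[OF T] M3 by simp
  next
    fix T k c r x y
    assume T: "2 simplex T" and k: "k \<in> idx (vertices T) p" and xy: "x \<in> T" "y \<in> T"
      and r: "0 < r" "ball c r \<subseteq> T"
    have in01: "0 \<le> bary (vertices T) z v" "bary (vertices T) z v \<le> 1" if "z \<in> T" "v \<in> vertices T" for z v
      using that bary_le_1[OF T that(1)] mem_simplex_iff[OF T, of z] by auto
    have kp: "k v \<le> p" for v using idx_le[OF simplex_vertices(1)[OF T] k] .
    have "\<bar>shape (vertices T) p k x - shape (vertices T) p k y\<bar>
        \<le> real (card (vertices T)) * M ^ card (vertices T) * (2 / r * norm (x - y))"
      unfolding shape_def
    proof (rule prod_bound_and_lipschitz(3))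
      fix v assume v: "v \<in> vertices T"
      note in01 = in01[OF xy(1) v] in01[OF xy(2) v]
      show "\<bar>lag p (k v) (bary (vertices T) x v)\<bar> \<le> M" "\<bar>lag p (k v) (bary (vertices T) y v)\<bar> \<le> M"
        using M(2)[OF kp] in01 by auto
      have "\<bar>lag p (k v) (bary (vertices T) x v) - lag p (k v) (bary (vertices T) y v)\<bar>
          \<le> M * \<bar>bary (vertices T) x v - bary (vertices T) y v\<bar>"
        using M(3)[OF kp] in01 by auto
      also have "\<dots> \<le> M * (2 / r * norm (x - y))"
        using bary_lipschitz[OF T v r] M(1) by (intro mult_left_mono) auto
      finally show "\<bar>lag p (k v) (bary (vertices T) x v) - lag p (k v) (bary (vertices T) y v)\<bar>
          \<le> M * (2 / r * norm (x - y))" .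
    qed (use M(1) simplex_vertices(1)[OF T] r in auto)
    also have "\<dots> = 6 * M ^ 3 / r * norm (x - y)" using card_vertices[OF T] by simp
    finally show "\<bar>shape (vertices T) p k x - shape (vertices T) p k y\<bar> \<le> 6 * M ^ 3 / r * norm (x - y)" .
  qed
qed

section \<open>Finite element spaces\<close>

text \<open>The property of the mesh and of each of its subsets on which the local constructions rely.\<close>

definition simplicial :: "(real^2) set set \<Rightarrow> bool" where
  "simplicial S \<longleftrightarrow> triangulation S \<and> (\<forall>T\<in>S. 2 simplex T)"

lemma simplicialD:
  assumes "simplicial S"
  shows "finite S" "\<And>T. T \<in> S \<Longrightarrow> 2 simplex T"
    "\<And>T T'. T \<in> S \<Longrightarrow> T' \<in> S \<Longrightarrow> (T \<inter> T') face_of T"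
  using assms by (auto simp: simplicial_def triangulation_def)

lemma simplicial_subset: "simplicial S \<Longrightarrow> S' \<subseteq> S \<Longrightarrow> simplicial S'"
  unfolding simplicial_def triangulation_def using finite_subset by blast

lemma closed_Union_simplicial: "simplicial S \<Longrightarrow> closed (\<Union>S)"
  using simplicialD closed_simplex by (metis closed_Union)

text \<open>A face of a simplex is spanned by its own extreme points, and these are vertices of both
  triangles.\<close>

lemma common_face:
  assumes "simplicial S" "T \<in> S" "T' \<in> S"
  obtains W where "W \<subseteq> vertices T" "W \<subseteq> vertices T'" "T \<inter> T' = convex hull W"
proof -
  note sT = simplicialD(2)[OF assms(1,2)] and sT' = simplicialD(2)[OF assms(1,3)]
  have "(T \<inter> T') face_of convex hull (vertices T)"
    using simplicialD(3)[OF assms] simplex_vertices(4)[OF sT] by simp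
  then obtain W where W: "W \<subseteq> vertices T" "T \<inter> T' = convex hull W"
    using face_of_convex_hull_affine_independent[OF simplex_vertices(2)[OF sT]] by blast
  have "(T \<inter> T') face_of convex hull (vertices T')"
    using simplicialD(3)[OF assms(1,3,2)] simplex_vertices(4)[OF sT'] by (simp add: Int_commute)
  then obtain W' where W': "W' \<subseteq> vertices T'" "T \<inter> T' = convex hull W'"
    using face_of_convex_hull_affine_independent[OF simplex_vertices(2)[OF sT']] by blast
  have ind: "\<not> affine_dependent W" "\<not> affine_dependent W'"
    using W W' affine_independent_subset simplex_vertices(2)[OF sT] simplex_vertices(2)[OF sT'] by blast+
  have "W = {x. x extreme_point_of (T \<inter> T')}"
    unfolding W(2) extreme_point_of_convex_hull_affine_independent[OF ind(1)] by simp
  also have "\<dots> = W'"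
    unfolding W'(2) extreme_point_of_convex_hull_affine_independent[OF ind(2)] by simp
  finally have "W = W'" .
  then show thesis using that W W' by simp
qed

lemma interp_agree:
  assumes "simplicial S" "T \<in> S" "T' \<in> S" "x \<in> T" "x \<in> T'" "0 < p"
  shows "interp (vertices T) p f x = interp (vertices T') p f x"
proof -
  obtain W where W: "W \<subseteq> vertices T" "W \<subseteq> vertices T'" "T \<inter> T' = convex hull W"
    using common_face[OF assms(1-3)] .
  then have "x \<in> affine hull W" using assms(4,5) convex_hull_subset_affine_hull by blast
  then show ?thesis
    using interp_face[OF _ W(1), of x p f] interp_face[OF _ W(2), of x p f] assms(6)
      simplex_vertices(2)[OF simplicialD(2)[OF assms(1,2)]]
      simplex_vertices(2)[OF simplicialD(2)[OF assms(1,3)]] by simp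
qed

lemma fe_eq_interp:
  assumes "simplicial S" "0 < p" "u \<in> fe_space p S" "T \<in> S" "x \<in> T"
  shows "u x = interp (vertices T) p u x"
  using poly_on_eq_interp[of T p u x] assms simplicialD(2)[OF assms(1,4)] by (simp add: fe_space_def)

lemma interp_cong_nodes:
  assumes "2 simplex T" "\<And>x. x \<in> element_nodes p T \<Longrightarrow> f x = g x"
  shows "interp (vertices T) p f x = interp (vertices T) p g x"
  unfolding interp_def using assms by (intro sum.cong) (auto simp: element_nodes_eq)

lemma fe_space_eqI:
  assumes "simplicial S" "0 < p" "u \<in> fe_space p S" "w \<in> fe_space p S"
    "\<And>x. x \<in> mesh_nodes p S \<Longrightarrow> u x = w x"
  shows "u = w"
proof
  fix x
  show "u x = w x"
  proof (cases "x \<in> \<Union>S")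
    case True
    then obtain T where T: "T \<in> S" "x \<in> T" by blast
    have "interp (vertices T) p u x = interp (vertices T) p w x"
      using simplicialD(2)[OF assms(1) T(1)]
      by (rule interp_cong_nodes) (use assms(5) T in \<open>auto simp: mesh_nodes_def\<close>)
    then show ?thesis using fe_eq_interp[OF assms(1,2) _ T] assms(3,4) by simp
  qed (use assms(3,4) in \<open>auto simp: fe_space_def\<close>)
qed

lemma continuous_on_polyfun: "polyfun p f \<Longrightarrow> continuous_on A f"
proof -
  assume "polyfun p f"
  then obtain c where f: "f = (\<lambda>x. \<Sum>i\<le>p. \<Sum>j\<le>p - i. c i j * of_real (x $ 1) ^ i * of_real (x $ 2) ^ j)"
    unfolding polyfun_def by blast
  show ?thesis unfolding f by (intro continuous_intros)
qed

text \<open>Interpolate on each triangle. The results agree on common faces by \<open>interp_agree\<close>, so they can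
  be glued to a continuous function.\<close>

lemma nodal_interp_exists:
  assumes S: "simplicial S" and p: "0 < p"
  obtains u where "u \<in> fe_space p S" "\<And>T x. T \<in> S \<Longrightarrow> x \<in> T \<Longrightarrow> u x = interp (vertices T) p f x"
proof -
  define u where "u x = (if x \<in> \<Union>S then interp (vertices (SOME T. T \<in> S \<and> x \<in> T)) p f x else 0)" for x
  have u: "u x = interp (vertices T) p f x" if "T \<in> S" "x \<in> T" for T x
  proof -
    have "(SOME T. T \<in> S \<and> x \<in> T) \<in> S \<and> x \<in> (SOME T. T \<in> S \<and> x \<in> T)"
      by (rule someI[of _ T]) (use that in simp)
    then show ?thesis using interp_agree[OF S _ that(1) _ that(2) p, of "SOME T. T \<in> S \<and> x \<in> T"] that
      by (auto simp: u_def)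
  qed
  have "poly_on p T u" if "T \<in> S" for T
    unfolding poly_on_iff using polyfun_interp[OF simplicialD(2)[OF S that]] u[OF that] by blast
  moreover have "continuous_on (\<Union>S) u"
  proof (rule continuous_on_closed_Union[of S "\<lambda>T. T", simplified])
    show "finite S" using simplicialD(1)[OF S] .
    show "closed T" if "T \<in> S" for T using closed_simplex simplicialD(2)[OF S that] by blast
    show "continuous_on T u" if "T \<in> S" for T
      using continuous_on_polyfun[OF polyfun_interp[OF simplicialD(2)[OF S that], of p f]]
      by (rule continuous_on_eq) (rule u[OF that, symmetric])
  qed
  ultimately have "u \<in> fe_space p S" by (simp add: fe_space_def) (auto simp: u_def)
  then show thesis using u that by blast
qed

lemma nodal_interp:
  assumes S: "simplicial S" and p: "0 < p"
  shows "nodal_interp p S f \<in> fe_space p S"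
    and "\<And>x. x \<in> mesh_nodes p S \<Longrightarrow> nodal_interp p S f x = f x"
proof -
  obtain u where u: "u \<in> fe_space p S" "\<And>T x. T \<in> S \<Longrightarrow> x \<in> T \<Longrightarrow> u x = interp (vertices T) p f x"
    using nodal_interp_exists[OF assms] by blast
  have un: "u x = f x" if x: "x \<in> mesh_nodes p S" for x
  proof -
    obtain T where T: "T \<in> S" "x \<in> element_nodes p T" using x by (auto simp: mesh_nodes_def)
    note sT = simplicialD(2)[OF S T(1)]
    have "x \<in> T" using element_nodes_subset[OF sT p] T(2) by blast
    then show ?thesis using u(2)[OF T(1)] interp_node[OF simplex_vertices(2)[OF sT] p] T(2)
      by (auto simp: element_nodes_eq[OF sT])
  qed
  have "nodal_interp p S f \<in> fe_space p S \<and> (\<forall>x\<in>mesh_nodes p S. nodal_interp p S f x = f x)"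
    unfolding nodal_interp_def
    by (rule theI[of _ u]) (use u(1) un fe_space_eqI[OF assms] in auto)
  then show "nodal_interp p S f \<in> fe_space p S"
    "\<And>x. x \<in> mesh_nodes p S \<Longrightarrow> nodal_interp p S f x = f x" by auto
qed

lemma nodal_interp_eqI:
  assumes "simplicial S" "0 < p" "u \<in> fe_space p S" "\<And>x. x \<in> mesh_nodes p S \<Longrightarrow> u x = f x"
  shows "nodal_interp p S f = u"
  using nodal_interp[OF assms(1,2)] assms(3,4) by (intro fe_space_eqI[OF assms(1,2)]) auto

lemma mesh_nodes_subset: "simplicial S \<Longrightarrow> 0 < p \<Longrightarrow> mesh_nodes p S \<subseteq> \<Union>S"
proof (unfold mesh_nodes_def, rule UN_least)
  fix T assume "simplicial S" "0 < p" "T \<in> S"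
  then have "element_nodes p T \<subseteq> T" by (intro element_nodes_subset simplicialD(2))
  with \<open>T \<in> S\<close> show "element_nodes p T \<subseteq> \<Union>S" by blast
qed

lemma finite_mesh_nodes: "simplicial S \<Longrightarrow> finite (mesh_nodes p S)"
  unfolding mesh_nodes_def by (intro finite_UN_I finite_element_nodes simplicialD(1) simplicialD(2))

subsection \<open>Linear structure\<close>

definition csubspace :: "(real^2 \<Rightarrow> complex) set \<Rightarrow> bool" where
  "csubspace V \<longleftrightarrow> (\<lambda>x. 0) \<in> V \<and> (\<forall>u\<in>V. \<forall>v\<in>V. \<forall>a. (\<lambda>x. u x + a * v x) \<in> V)"

text \<open>The index type is arbitrary because the coarse space is spanned by a family indexed by pairs.\<close>

definition fspan :: "('i \<Rightarrow> real^2 \<Rightarrow> complex) \<Rightarrow> 'i set \<Rightarrow> (real^2 \<Rightarrow> complex) set" where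
  "fspan f I = {\<lambda>x. \<Sum>i\<in>I. a i * f i x | a. True}"

lemma csubspace_zero: "csubspace V \<Longrightarrow> (\<lambda>x. 0) \<in> V"
  by (simp add: csubspace_def)

lemma csubspace_comb: "csubspace V \<Longrightarrow> u \<in> V \<Longrightarrow> v \<in> V \<Longrightarrow> (\<lambda>x. u x + a * v x) \<in> V"
  by (simp add: csubspace_def)

lemma csubspace_add: "csubspace V \<Longrightarrow> u \<in> V \<Longrightarrow> v \<in> V \<Longrightarrow> (\<lambda>x. u x + v x) \<in> V"
  using csubspace_comb[of V u v 1] by simp

lemma csubspace_diff: "csubspace V \<Longrightarrow> u \<in> V \<Longrightarrow> v \<in> V \<Longrightarrow> (\<lambda>x. u x - v x) \<in> V"
  using csubspace_comb[of V u v "- 1"] by simp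

lemma csubspace_scale: "csubspace V \<Longrightarrow> v \<in> V \<Longrightarrow> (\<lambda>x. a * v x) \<in> V"
  using csubspace_comb[of V "\<lambda>x. 0" v a] by (simp add: csubspace_zero)

lemma csubspace_sum:
  assumes "csubspace V" "\<And>i. i \<in> I \<Longrightarrow> u i \<in> V"
  shows "(\<lambda>x. \<Sum>i\<in>I. u i x) \<in> V"
  using assms(2)
proof (induction I rule: infinite_finite_induct)
  case (insert i I)
  then show ?case using csubspace_add[OF assms(1), of "u i" "\<lambda>x. \<Sum>i\<in>I. u i x"] by simp
qed (use assms(1) in \<open>auto simp: csubspace_def\<close>)

lemma csubspace_fspan: "csubspace (fspan f I)"
proof -
  have "(\<lambda>x. 0) \<in> fspan f I"
    unfolding fspan_def by (intro CollectI exI[of _ "\<lambda>i. 0"]) simp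
  moreover have "(\<lambda>x. u x + a * v x) \<in> fspan f I" if "u \<in> fspan f I" "v \<in> fspan f I" for u v a
  proof -
    obtain b c where "u = (\<lambda>x. \<Sum>i\<in>I. b i * f i x)" "v = (\<lambda>x. \<Sum>i\<in>I. c i * f i x)"
      using \<open>u \<in> fspan f I\<close> \<open>v \<in> fspan f I\<close> unfolding fspan_def by blast
    then show ?thesis unfolding fspan_def
      by (intro CollectI exI[of _ "\<lambda>i. b i + a * c i"])
        (simp add: sum.distrib sum_distrib_left ring_distribs mult_ac)
  qed
  ultimately show ?thesis by (auto simp: csubspace_def)
qed

lemma fspan_superset: "finite I \<Longrightarrow> i \<in> I \<Longrightarrow> f i \<in> fspan f I"
  unfolding fspan_def
  by (intro CollectI exI[of _ "\<lambda>j. if j = i then 1 else 0"]) (simp add: if_distrib[of "\<lambda>a. a * _"] cong: if_cong)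

lemma fspan_minimal: "csubspace V \<Longrightarrow> (\<And>i. i \<in> I \<Longrightarrow> f i \<in> V) \<Longrightarrow> fspan f I \<subseteq> V"
  unfolding fspan_def by (auto intro!: csubspace_sum csubspace_scale)

lemma poly_on_add_cmult: "poly_on p T u \<Longrightarrow> poly_on p T v \<Longrightarrow> poly_on p T (\<lambda>x. u x + a * v x)"
proof -
  assume "poly_on p T u" "poly_on p T v"
  then obtain f g where "polyfun p f" "polyfun p g" "\<forall>x\<in>T. u x = f x" "\<forall>x\<in>T. v x = g x"
    by (auto simp: poly_on_iff)
  then show ?thesis unfolding poly_on_iff
    by (intro exI[of _ "\<lambda>x. f x + a * g x"]) (simp add: polyfun_add polyfun_cmult)
qed

lemma csubspace_fe_space: "csubspace (fe_space p S)"
proof -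
  have "(\<lambda>x. 0) \<in> fe_space p S"
    using polyfun_const[of p 0] by (auto simp: fe_space_def poly_on_iff)
  then show ?thesis
    by (auto simp: csubspace_def fe_space_def poly_on_add_cmult intro!: continuous_intros)
qed

lemma fe_space_fspan:
  assumes "simplicial S" "0 < p"
  shows "fe_space p S = fspan (\<lambda>z. nodal_interp p S (\<lambda>x. if x = z then 1 else 0)) (mesh_nodes p S)"
    (is "_ = fspan ?\<phi> _")
proof
  show "fspan ?\<phi> (mesh_nodes p S) \<subseteq> fe_space p S"
    by (intro fspan_minimal csubspace_fe_space nodal_interp assms)
  show "fe_space p S \<subseteq> fspan ?\<phi> (mesh_nodes p S)"
  proof
    fix u assume u: "u \<in> fe_space p S"
    have "u = (\<lambda>x. \<Sum>z\<in>mesh_nodes p S. u z * ?\<phi> z x)"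
    proof (rule fe_space_eqI[OF assms u])
      show "(\<lambda>x. \<Sum>z\<in>mesh_nodes p S. u z * ?\<phi> z x) \<in> fe_space p S"
        by (intro csubspace_sum csubspace_scale csubspace_fe_space nodal_interp assms)
      fix x assume x: "x \<in> mesh_nodes p S"
      then have "(\<Sum>z\<in>mesh_nodes p S. u z * ?\<phi> z x) = (\<Sum>z\<in>mesh_nodes p S. if z = x then u x else 0)"
        by (intro sum.cong) (auto simp: nodal_interp(2)[OF assms])
      then show "u x = (\<Sum>z\<in>mesh_nodes p S. u z * ?\<phi> z x)"
        using x finite_mesh_nodes[OF assms(1)] by simp
    qed
    then show "u \<in> fspan ?\<phi> (mesh_nodes p S)" unfolding fspan_def by blast
  qed
qed

subsection \<open>Definite sesquilinear forms in finite dimension\<close>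

definition sesq :: "(real^2 \<Rightarrow> complex) set \<Rightarrow> ((real^2 \<Rightarrow> complex) \<Rightarrow> (real^2 \<Rightarrow> complex) \<Rightarrow> complex) \<Rightarrow> bool" where
  "sesq V b \<longleftrightarrow> (\<forall>u\<in>V. \<forall>v\<in>V. \<forall>w\<in>V. \<forall>a.
     b (\<lambda>x. u x + a * v x) w = b u w + a * b v w \<and> b w (\<lambda>x. u x + a * v x) = b w u + cnj a * b w v)"

definition antilin :: "(real^2 \<Rightarrow> complex) set \<Rightarrow> ((real^2 \<Rightarrow> complex) \<Rightarrow> complex) \<Rightarrow> bool" where
  "antilin V \<phi> \<longleftrightarrow> (\<forall>u\<in>V. \<forall>v\<in>V. \<forall>a. \<phi> (\<lambda>x. u x + a * v x) = \<phi> u + cnj a * \<phi> v)"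

definition definite :: "(real^2 \<Rightarrow> complex) set \<Rightarrow> ((real^2 \<Rightarrow> complex) \<Rightarrow> (real^2 \<Rightarrow> complex) \<Rightarrow> complex) \<Rightarrow> bool" where
  "definite V b \<longleftrightarrow> (\<forall>u\<in>V. b u u = 0 \<longrightarrow> u = (\<lambda>x. 0))"

lemma sesqD:
  assumes "sesq V b" "u \<in> V" "v \<in> V" "w \<in> V"
  shows "b (\<lambda>x. u x + a * v x) w = b u w + a * b v w"
    "b w (\<lambda>x. u x + a * v x) = b w u + cnj a * b w v"
  using assms by (auto simp: sesq_def)

lemma antilinD: "antilin V \<phi> \<Longrightarrow> u \<in> V \<Longrightarrow> v \<in> V \<Longrightarrow> \<phi> (\<lambda>x. u x + a * v x) = \<phi> u + cnj a * \<phi> v"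
  by (auto simp: antilin_def)

lemma sesq_mono: "sesq V b \<Longrightarrow> V' \<subseteq> V \<Longrightarrow> sesq V' b"
  unfolding sesq_def by blast

lemma definite_mono: "definite V b \<Longrightarrow> V' \<subseteq> V \<Longrightarrow> definite V' b"
  unfolding definite_def by blast

lemma antilin_mono: "antilin V b \<Longrightarrow> V' \<subseteq> V \<Longrightarrow> antilin V' b"
  unfolding antilin_def by blast

lemma sesq_antilin: "sesq V b \<Longrightarrow> u \<in> V \<Longrightarrow> antilin V (b u)"
  unfolding sesq_def antilin_def by blast

lemma sesq_diff:
  assumes "sesq V b" "u \<in> V" "v \<in> V" "w \<in> V"
  shows "b (\<lambda>x. u x - v x) w = b u w - b v w" "b w (\<lambda>x. u x - v x) = b w u - b w v"
  using sesqD[OF assms, of "- 1"] by auto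

lemma sesq_zero:
  assumes "sesq V b" "csubspace V" "u \<in> V"
  shows "b (\<lambda>x. 0) u = 0" "b u (\<lambda>x. 0) = 0"
  using sesq_diff[OF assms(1,3,3,3)] by auto

lemma sesq_scale:
  assumes "sesq V b" "csubspace V" "v \<in> V" "w \<in> V"
  shows "b (\<lambda>x. a * v x) w = a * b v w" "b w (\<lambda>x. a * v x) = cnj a * b w v"
  using sesqD[OF assms(1) _ assms(3,4), of "\<lambda>x. 0" a] sesq_zero[OF assms(1,2,4)] assms(2)
  by (auto simp: csubspace_def)

lemma sesq_sum:
  assumes "sesq V b" "csubspace V" "\<And>i. i \<in> I \<Longrightarrow> u i \<in> V" "w \<in> V"
  shows "b (\<lambda>x. \<Sum>i\<in>I. u i x) w = (\<Sum>i\<in>I. b (u i) w)" "b w (\<lambda>x. \<Sum>i\<in>I. u i x) = (\<Sum>i\<in>I. b w (u i))"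
proof -
  have "b (\<lambda>x. \<Sum>i\<in>I. u i x) w = (\<Sum>i\<in>I. b (u i) w) \<and> b w (\<lambda>x. \<Sum>i\<in>I. u i x) = (\<Sum>i\<in>I. b w (u i))"
    using assms(3)
  proof (induction I rule: infinite_finite_induct)
    case (insert i I)
    then show ?case
      using sesqD[OF assms(1) _ _ assms(4), of "u i" "\<lambda>x. \<Sum>i\<in>I. u i x" 1] csubspace_sum[OF assms(2), of I u] by simp
  qed (use sesq_zero[OF assms(1,2,4)] in auto)
  then show "b (\<lambda>x. \<Sum>i\<in>I. u i x) w = (\<Sum>i\<in>I. b (u i) w)" "b w (\<lambda>x. \<Sum>i\<in>I. u i x) = (\<Sum>i\<in>I. b w (u i))"
    by auto
qed

lemma definite_unique:
  assumes "sesq V b" "csubspace V" "definite V b" "u \<in> V" "v \<in> V" "\<And>w. w \<in> V \<Longrightarrow> b u w = b v w"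
  shows "u = v"
proof -
  have d: "(\<lambda>x. u x - v x) \<in> V" using csubspace_diff assms by blast
  then have "b (\<lambda>x. u x - v x) (\<lambda>x. u x - v x) = 0"
    using sesq_diff(1)[OF assms(1,4,5) d] assms(6) by simp
  then have "(\<lambda>x. u x - v x) = (\<lambda>x. 0)" using assms(3) d unfolding definite_def by blast
  then show ?thesis by (simp add: fun_eq_iff)
qed

text \<open>Enlarge the space by one generator at a time. A new generator is first made orthogonal, in
  the second argument, to the old space; then only one scalar equation is left, which can be solved
  because the form does not vanish on the diagonal.\<close>

lemma definite_solvable:
  assumes "finite I" "sesq (fspan f I) b" "definite (fspan f I) b" "antilin (fspan f I) \<phi>"
  shows "\<exists>u\<in>fspan f I. \<forall>w\<in>fspan f I. b u w = \<phi> w"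
  using assms
proof (induction I arbitrary: \<phi>)
  case empty
  have "antilin {\<lambda>x. 0} \<phi>" using empty by (simp add: fspan_def)
  from antilinD[OF this, of "\<lambda>x. 0" "\<lambda>x. 0" "-1"] have "\<phi> (\<lambda>x. 0) = 0" by simp
  moreover have "sesq {\<lambda>x. 0} b" using empty by (simp add: fspan_def)
  from sesqD(1)[OF this, of "\<lambda>x. 0" "\<lambda>x. 0" "\<lambda>x. 0" "-1"] have "b (\<lambda>x. 0) (\<lambda>x. 0) = 0" by simp
  ultimately show ?case by (simp add: fspan_def)
next
  case (insert i I)
  let ?V = "fspan f I" and ?V' = "fspan f (insert i I)"
  have V: "csubspace ?V" "csubspace ?V'" by (rule csubspace_fspan)+
  have sub: "?V \<subseteq> ?V'"
    by (intro fspan_minimal V fspan_superset) (use insert.hyps in auto)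
  have fi: "f i \<in> ?V'" by (intro fspan_superset) (use insert.hyps in auto)
  note IH = insert.IH[OF sesq_mono[OF insert.prems(1) sub] definite_mono[OF insert.prems(2) sub]]
  note sq = sesqD[OF insert.prems(1)]
  obtain g0 where g0: "g0 \<in> ?V" "\<forall>w\<in>?V. b g0 w = b (f i) w"
    using IH[of "b (f i)"] sesq_antilin[OF insert.prems(1) fi] antilin_mono sub by blast
  define g where "g = (\<lambda>x. f i x - g0 x)"
  have gV: "g \<in> ?V'" unfolding g_def using csubspace_diff[OF V(2) fi] g0(1) sub by blast
  have gorth: "b g w = 0" if "w \<in> ?V" for w
    unfolding g_def using sesq_diff(1)[OF insert.prems(1) fi, of g0 w] that g0 sub by auto
  obtain u0 where u0: "u0 \<in> ?V" "\<forall>w\<in>?V. b u0 w = \<phi> w"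
    using IH[of \<phi>] antilin_mono[OF insert.prems(3) sub] by blast
  have u0V: "u0 \<in> ?V'" using u0 sub by blast
  define t where "t = (if b g g = 0 then 0 else (\<phi> g - b u0 g) / b g g)"
  have \<phi>0: "\<phi> (\<lambda>x. 0) = 0" and b0: "b v (\<lambda>x. 0) = 0" if "v \<in> ?V'" for v
    using antilinD[OF insert.prems(3) fi fi, of "-1"] antilinD[OF insert.prems(3), of "\<lambda>x. 0" "\<lambda>x. 0" "-1"] 
      sesq_zero[OF insert.prems(1) V(2) that] V(2) by (auto simp: csubspace_def)
  have g_eq: "b u0 g + t * b g g = \<phi> g"
  proof (cases "b g g = 0")
    case True
    then have "g = (\<lambda>x. 0)" using insert.prems(2) gV by (simp add: definite_def)
    then show ?thesis using \<phi>0[OF gV] b0[OF gV] b0[OF u0V] by simp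
  qed (simp add: t_def)
  define u where "u = (\<lambda>x. u0 x + t * g x)"
  have "u \<in> ?V'" unfolding u_def by (rule csubspace_comb[OF V(2) u0V gV])
  moreover have "b u w = \<phi> w" if w: "w \<in> ?V'" for w
  proof -
    obtain a where a: "w = (\<lambda>x. \<Sum>j\<in>insert i I. a j * f j x)" using w unfolding fspan_def by blast
    define w0 where "w0 = (\<lambda>x. (\<Sum>j\<in>I. a j * f j x) + a i * g0 x)"
    have "(\<lambda>x. \<Sum>j\<in>I. a j * f j x) \<in> ?V" unfolding fspan_def by blast
    then have w0: "w0 \<in> ?V" unfolding w0_def by (rule csubspace_comb[OF V(1) _ g0(1)])
    have ww: "w = (\<lambda>x. w0 x + a i * g x)"
      unfolding a w0_def g_def using insert.hyps by (simp add: algebra_simps)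
    have w0V: "w0 \<in> ?V'" using w0 sub by blast
    have "b u w = b u w0 + cnj (a i) * b u g"
      unfolding ww using sq(2)[OF w0V gV \<open>u \<in> ?V'\<close>] .
    also have "b u w0 = \<phi> w0"
      unfolding u_def using sq(1)[OF u0V gV w0V] gorth[OF w0] u0(2) w0 by simp
    also have "b u g = \<phi> g"
      unfolding u_def using sq(1)[OF u0V gV gV] g_eq by simp
    finally show ?thesis unfolding ww using antilinD[OF insert.prems(3) w0V gV] by simp
  qed
  ultimately show ?case by blast
qed

lemma representer_eqI:
  assumes "sesq V b" "csubspace V" "definite V b" "u \<in> V" "\<And>w. w \<in> V \<Longrightarrow> b u w = \<phi> w"
  shows "representer V b \<phi> = u"
  unfolding representer_def
  by (rule the_equality) (use assms definite_unique[OF assms(1-3)] in auto)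

lemma representer:
  assumes "V = fspan f I" "finite I" "sesq V b" "definite V b" "antilin V \<phi>"
  shows "representer V b \<phi> \<in> V" "\<And>w. w \<in> V \<Longrightarrow> b (representer V b \<phi>) w = \<phi> w"
proof -
  obtain u where u: "u \<in> V" "\<forall>w\<in>V. b u w = \<phi> w"
    using definite_solvable[of I f b \<phi>] assms by blast
  have "representer V b \<phi> = u"
    by (rule representer_eqI) (use assms u csubspace_fspan in auto)
  with u show "representer V b \<phi> \<in> V" "\<And>w. w \<in> V \<Longrightarrow> b (representer V b \<phi>) w = \<phi> w" by auto
qed

section \<open>Integrals over triangles\<close>

text \<open>Continuously differentiable functions, with the derivative tested on fixed directions: this is
  what makes the gradient terms integrable over triangles.\<close>

definition C1fun :: "(real^2 \<Rightarrow> complex) \<Rightarrow> bool" where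
  "C1fun f \<longleftrightarrow> (\<exists>g. (\<forall>x. (f has_derivative g x) (at x)) \<and> (\<forall>h. continuous_on UNIV (\<lambda>x. g x h)))"

lemma C1fun_continuous: "C1fun f \<Longrightarrow> continuous_on A f"
  unfolding C1fun_def
  by (meson continuous_at_imp_continuous_on continuous_on_subset has_derivative_continuous subset_UNIV)

lemma C1fun_const: "C1fun (\<lambda>x. a)"
  unfolding C1fun_def by (intro exI[of _ "\<lambda>x h. 0"]) auto

lemma C1fun_coord: "C1fun (\<lambda>x. of_real (x $ i))"
  unfolding C1fun_def
  by (intro exI[of _ "\<lambda>x h. of_real (h $ i)"] conjI allI
      bounded_linear_imp_has_derivative bounded_linear_compose[OF bounded_linear_of_real bounded_linear_vec_nth]
      continuous_intros)

lemma C1fun_add: "C1fun f \<Longrightarrow> C1fun g \<Longrightarrow> C1fun (\<lambda>x. f x + g x)"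
  unfolding C1fun_def
proof (elim exE conjE)
  fix f' g'
  assume "\<forall>x. (f has_derivative f' x) (at x)" "\<forall>h. continuous_on UNIV (\<lambda>x. f' x h)"
    "\<forall>x. (g has_derivative g' x) (at x)" "\<forall>h. continuous_on UNIV (\<lambda>x. g' x h)"
  then show "\<exists>k. (\<forall>x. ((\<lambda>x. f x + g x) has_derivative k x) (at x)) \<and> (\<forall>h. continuous_on UNIV (\<lambda>x. k x h))"
    by (intro exI[of _ "\<lambda>x h. f' x h + g' x h"]) (auto intro!: has_derivative_add continuous_intros)
qed

lemma C1fun_mult: "C1fun f \<Longrightarrow> C1fun g \<Longrightarrow> C1fun (\<lambda>x. f x * g x)"
proof -
  assume fg: "C1fun f" "C1fun g"
  note c = C1fun_continuous[OF fg(1), of UNIV] C1fun_continuous[OF fg(2), of UNIV]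
  show ?thesis using fg unfolding C1fun_def
  proof (elim exE conjE)
    fix f' g'
    assume "\<forall>x. (f has_derivative f' x) (at x)" "\<forall>h. continuous_on UNIV (\<lambda>x. f' x h)"
      "\<forall>x. (g has_derivative g' x) (at x)" "\<forall>h. continuous_on UNIV (\<lambda>x. g' x h)"
    with c show "\<exists>k. (\<forall>x. ((\<lambda>x. f x * g x) has_derivative k x) (at x)) \<and> (\<forall>h. continuous_on UNIV (\<lambda>x. k x h))"
      by (intro exI[of _ "\<lambda>x h. f x * g' x h + f' x h * g x"]) (auto intro!: has_derivative_mult continuous_intros)
  qed
qed

lemma C1fun_power: "C1fun f \<Longrightarrow> C1fun (\<lambda>x. f x ^ n)"
  by (induction n) (auto intro: C1fun_const C1fun_mult)

lemma C1fun_sum: "(\<And>i. i \<in> I \<Longrightarrow> C1fun (f i)) \<Longrightarrow> C1fun (\<lambda>x. \<Sum>i\<in>I. f i x)"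
  by (induction I rule: infinite_finite_induct) (auto intro: C1fun_const C1fun_add)

lemma polyfun_C1fun: "polyfun p f \<Longrightarrow> C1fun f"
proof -
  assume "polyfun p f"
  then obtain c where f: "f = (\<lambda>x. \<Sum>i\<le>p. \<Sum>j\<le>p - i. c i j * of_real (x $ 1) ^ i * of_real (x $ 2) ^ j)"
    unfolding polyfun_def by blast
  show ?thesis unfolding f by (intro C1fun_sum C1fun_mult C1fun_power C1fun_coord C1fun_const)
qed

lemma C1fun_differentiable: "C1fun f \<Longrightarrow> f differentiable at x"
  unfolding C1fun_def differentiable_def by blast

lemma C1fun_pderivative: "C1fun f \<Longrightarrow> continuous_on A (pderivative i f)"
  unfolding C1fun_def
proof (elim exE conjE)
  fix g assume g: "\<forall>x. (f has_derivative g x) (at x)" "\<forall>h. continuous_on UNIV (\<lambda>x. g x h)"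
  have "pderivative i f = (\<lambda>x. g x (axis i 1))"
  proof
    fix x
    have "g x = frechet_derivative f (at x)" using g(1) frechet_derivative_at by blast
    then show "pderivative i f x = g x (axis i 1)" by (simp add: pderivative_def)
  qed
  moreover have "continuous_on UNIV (\<lambda>x. g x (axis i 1))" using g(2) by blast
  ultimately show "continuous_on A (pderivative i f)" by (metis continuous_on_subset subset_UNIV)
qed

text \<open>Inside the triangle the derivatives of a piecewise polynomial are those of the polynomial, which
  lives on the whole plane and has no jumps.\<close>

lemma poly_on_interior:
  assumes "poly_on p T v"
  obtains f where "polyfun p f" "\<And>x. x \<in> T \<Longrightarrow> v x = f x"
    "\<And>x i. x \<in> interior T \<Longrightarrow> pderivative i v x = pderivative i f x"
    "\<And>x. x \<in> interior T \<Longrightarrow> (v has_derivative frechet_derivative v (at x)) (at x)"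
proof -
  obtain f where f: "polyfun p f" "\<And>x. x \<in> T \<Longrightarrow> v x = f x"
    using assms by (auto simp: poly_on_iff)
  have v: "(v has_derivative frechet_derivative f (at x)) (at x)" if "x \<in> interior T" for x
  proof (rule has_derivative_transform_within_open[OF _ open_interior that])
    show "(f has_derivative frechet_derivative f (at x)) (at x)"
      using C1fun_differentiable[OF polyfun_C1fun[OF f(1)]] frechet_derivative_works by blast
    show "f y = v y" if "y \<in> interior T" for y using f(2) that interior_subset by fastforce
  qed
  have eq: "frechet_derivative v (at x) = frechet_derivative f (at x)" if "x \<in> interior T" for x
    using frechet_derivative_at[OF v[OF that]] by simp
  show thesis
    by (rule that[OF f]) (auto simp: pderivative_def eq v)
qed

lemma pderivative_comb:
  assumes "poly_on p T u" "poly_on p T v" "x \<in> interior T"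
  shows "pderivative i (\<lambda>x. u x + a * v x) x = pderivative i u x + a * pderivative i v x"
proof -
  have u: "(u has_derivative frechet_derivative u (at x)) (at x)"
    using poly_on_interior[OF assms(1)] assms(3) by metis
  have v: "(v has_derivative frechet_derivative v (at x)) (at x)"
    using poly_on_interior[OF assms(2)] assms(3) by metis
  have "((\<lambda>x. u x + a * v x) has_derivative (\<lambda>h. frechet_derivative u (at x) h + a * frechet_derivative v (at x) h)) (at x)"
    by (intro has_derivative_add u has_derivative_mult_right v)
  from frechet_derivative_at[OF this] show ?thesis by (simp add: pderivative_def fun_eq_iff)
qed

lemma AE_not_in_negligible: "negligible N \<Longrightarrow> AE x in lebesgue. x \<notin> N"
  by (rule AE_not_in) (simp only: negligible_iff_null_sets)

lemma set_integral_spike: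
  fixes F g :: "real^2 \<Rightarrow> 'b::euclidean_space"
  assumes g: "set_integrable lebesgue T g" and N: "negligible N" and eq: "\<And>x. x \<in> T \<Longrightarrow> x \<notin> N \<Longrightarrow> F x = g x"
  shows "set_integrable lebesgue T F" "(LINT x:T|lebesgue. F x) = (LINT x:T|lebesgue. g x)"
proof -
  have "AE x in lebesgue. x \<notin> N"
    using N by (rule AE_not_in_negligible)
  then have ae: "AE x in lebesgue. indicator T x *\<^sub>R g x = indicator T x *\<^sub>R F x"
    by eventually_elim (auto simp: indicator_def eq)
  have m: "(\<lambda>x. indicator T x *\<^sub>R F x) \<in> borel_measurable lebesgue"
    using g unfolding set_integrable_def by (intro borel_measurable_AE[OF _ ae]) auto
  show "set_integrable lebesgue T F"
    using g m ae unfolding set_integrable_def by (rule integrable_cong_AE_imp)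
  show "(LINT x:T|lebesgue. F x) = (LINT x:T|lebesgue. g x)"
    unfolding set_lebesgue_integral_def using g m ae unfolding set_integrable_def
    by (intro integral_cong_AE) auto
qed

lemma set_integrable_continuous_compact:
  fixes g :: "real^2 \<Rightarrow> 'b::euclidean_space"
  assumes "compact T" "continuous_on T g"
  shows "set_integrable lebesgue T g"
  using borel_integrable_compact[OF assms] unfolding set_integrable_def
  by (simp add: integrable_completion borel_measurable_integrable)

lemma negligible_simplex_boundary: 
  fixes T :: "(real^2) set"
  assumes "2 simplex T"
  shows "negligible (T - interior T)"
  using negligible_convex_frontier[OF convex_simplex[OF assms]] closed_simplex[OF assms]
  by (simp add: frontier_def)

lemma interior_simplex_nonempty:
  fixes T :: "(real^2) set"
  assumes "2 simplex T" shows "interior T \<noteq> {}"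
proof -
  let ?x = "\<Sum>v\<in>vertices T. (1/3::real) *\<^sub>R v"
  have b: "bary (vertices T) ?x v = 1 / 3" if "v \<in> vertices T" for v
    using simplex_vertices[OF assms] card_vertices[OF assms] that by (intro bary_unique) auto
  have "?x \<in> interior T"
  proof (rule bary_pos_imp_interior[OF assms])
    show "0 < bary (vertices T) ?x v" if "v \<in> vertices T" for v using b[OF that] by linarith
  qed
  then show ?thesis by blast
qed

lemma closure_interior_simplex:
  fixes T :: "(real^2) set"
  assumes "2 simplex T" shows "closure (interior T) = T"
  using convex_closure_interior[OF convex_simplex[OF assms] interior_simplex_nonempty[OF assms]]
    closed_simplex[OF assms] by simp

lemma simplicial_interior_disjoint:
  assumes "simplicial S" "T \<in> S" "T' \<in> S" "T \<noteq> T'"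
  shows "interior T \<inter> T' = {}"
proof (rule ccontr)
  assume ne: "interior T \<inter> T' \<noteq> {}"
  have f: "(T \<inter> T') face_of T" using simplicialD(3)[OF assms(1-3)] .
  have eq: "T \<inter> T' = T"
  proof (rule ccontr)
    assume "T \<inter> T' \<noteq> T"
    then have "(T \<inter> T') \<inter> interior T = {}" by (rule face_of_disjoint_interior[OF f])
    with ne show False using interior_subset by blast
  qed
  then have "T face_of T'" using simplicialD(3)[OF assms(1,3,2)] by (simp add: Int_commute)
  then have "T \<inter> interior T' = {}" using face_of_disjoint_interior assms(4) by blast
  moreover have "interior T \<subseteq> interior T'" using eq by (intro interior_mono) blast
  ultimately show False
    using interior_simplex_nonempty[OF simplicialD(2)[OF assms(1,2)]] interior_subset by blast
qed

lemma sets_simplex: 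
  fixes T :: "(real^2) set"
  shows "2 simplex T \<Longrightarrow> T \<in> sets lebesgue"
  using lmeasurable_compact[OF compact_simplex] by (auto intro: fmeasurableD)

lemma interior_Union_subset:
  fixes S :: "(real^2) set set"
  assumes "finite S" "\<And>T. T \<in> S \<Longrightarrow> 2 simplex T"
  shows "negligible (\<Union>S - interior (\<Union>S))"
proof -
  have "\<Union>S - interior (\<Union>S) \<subseteq> (\<Union>T\<in>S. T - interior T)"
    using interior_mono[OF Union_upper] by blast
  moreover have "negligible (\<Union>T\<in>S. T - interior T)"
    by (intro negligible_Union finite_imageI assms(1)) (auto intro: negligible_simplex_boundary assms(2))
  ultimately show ?thesis by (rule negligible_subset[rotated])
qed

text \<open>Boundaries of triangles are null sets and interiors are disjoint.\<close>

lemma set_integral_simplicial: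
  fixes F :: "real^2 \<Rightarrow> complex"
  assumes S: "simplicial S" and int: "\<And>T. T \<in> S \<Longrightarrow> set_integrable lebesgue T F"
  shows "(LINT x:interior (\<Union>S)|lebesgue. F x) = (\<Sum>T\<in>S. LINT x:T|lebesgue. F x)"
proof -
  note fin = simplicialD(1)[OF S] and sT = simplicialD(2)[OF S]
  have "(LINT x:(\<Union>T\<in>S. T)|lebesgue. F x) = (\<Sum>T\<in>S. LINT x:T|lebesgue. F x)"
  proof (rule set_integral_finite_UN_AE[OF fin _ sets_simplex[OF sT] int])
    fix T T' assume T: "T \<in> S" "T' \<in> S"
    show "AE x in lebesgue. x \<in> T \<and> x \<in> T' \<longrightarrow> T = T'"
    proof (cases "T = T'")
      case False
      have "AE x in lebesgue. x \<notin> T - interior T"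
        by (intro AE_not_in_negligible negligible_simplex_boundary sT T(1))
      then show ?thesis
        by eventually_elim (use simplicial_interior_disjoint[OF S T False] in auto)
    qed simp
  qed auto
  moreover have i: "set_integrable lebesgue (\<Union>S) F"
    using set_integrable_UN[of S lebesgue "\<lambda>T. T" F] fin int sets_simplex[OF sT] by simp
  have AE: "AE x in lebesgue. x \<notin> \<Union>S - interior (\<Union>S)"
    by (intro AE_not_in_negligible interior_Union_subset fin sT)
  have "set_integrable lebesgue (interior (\<Union>S)) F"
    using i by (rule set_integrable_subset) (auto simp: interior_subset)
  then have "(LINT x:interior (\<Union>S)|lebesgue. F x) = (LINT x:\<Union>S|lebesgue. F x)"
    using i unfolding set_lebesgue_integral_def set_integrable_def
  proof (intro integral_cong_AE)
    show "AE x in lebesgue. indicator (interior (\<Union>S)) x *\<^sub>R F x = indicator (\<Union>S) x *\<^sub>R F x"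
      using AE by eventually_elim (use interior_subset in \<open>auto simp: indicator_def\<close>)
  qed auto
  ultimately show ?thesis by simp
qed

lemma integrable_forms:
  assumes T: "2 simplex T" and v: "poly_on p T v" and w: "poly_on p T w"
  shows "set_integrable lebesgue T (\<lambda>x. \<Sum>i\<in>UNIV. pderivative i v x * cnj (pderivative i w x))"
    and "set_integrable lebesgue T (\<lambda>x. v x * cnj (w x))"
proof -
  obtain f where f: "polyfun p f" "\<And>x. x \<in> T \<Longrightarrow> v x = f x"
    "\<And>x i. x \<in> interior T \<Longrightarrow> pderivative i v x = pderivative i f x"
    using poly_on_interior[OF v] by metis
  obtain g where g: "polyfun p g" "\<And>x. x \<in> T \<Longrightarrow> w x = g x"
    "\<And>x i. x \<in> interior T \<Longrightarrow> pderivative i w x = pderivative i g x"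
    using poly_on_interior[OF w] by metis
  note C = polyfun_C1fun[OF f(1)] polyfun_C1fun[OF g(1)]
  note N = negligible_simplex_boundary[OF T]
  have "set_integrable lebesgue T (\<lambda>x. \<Sum>i\<in>UNIV. pderivative i f x * cnj (pderivative i g x))"
    by (intro set_integrable_continuous_compact compact_simplex[OF T] continuous_intros C1fun_pderivative C)
  then show "set_integrable lebesgue T (\<lambda>x. \<Sum>i\<in>UNIV. pderivative i v x * cnj (pderivative i w x))"
    by (rule set_integral_spike(1)[OF _ N]) (simp add: f g)
  have "set_integrable lebesgue T (\<lambda>x. f x * cnj (g x))"
    by (intro set_integrable_continuous_compact compact_simplex[OF T] continuous_intros C1fun_continuous C)
  then show "set_integrable lebesgue T (\<lambda>x. v x * cnj (w x))"
    by (rule set_integral_spike(1)[OF _ N]) (simp add: f g)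
qed

lemma sesq_grad_inner_simplex:
  assumes T: "2 simplex T" shows "sesq {v. poly_on p T v} (grad_inner T)"
  unfolding sesq_def
proof (intro ballI allI conjI; simp only: mem_Collect_eq)
  fix u v w a assume p: "poly_on p T u" "poly_on p T v" "poly_on p T w"
  note I = integrable_forms(1)[OF T, of p]
  have "grad_inner T (\<lambda>x. u x + a * v x) w =
      (LINT x:T|lebesgue. (\<Sum>i\<in>UNIV. pderivative i u x * cnj (pderivative i w x)) +
        a * (\<Sum>i\<in>UNIV. pderivative i v x * cnj (pderivative i w x)))"
    unfolding grad_inner_def
  proof (rule set_integral_spike(2)[OF _ negligible_simplex_boundary[OF T]])
    show "set_integrable lebesgue T (\<lambda>x. (\<Sum>i\<in>UNIV. pderivative i u x * cnj (pderivative i w x)) +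
        a * (\<Sum>i\<in>UNIV. pderivative i v x * cnj (pderivative i w x)))"
      by (intro set_integral_add set_integrable_mult_right I p)
  qed (simp add: pderivative_comb[OF p(1,2)] sum.distrib sum_distrib_left ring_distribs mult_ac)
  also have "\<dots> = grad_inner T u w + a * grad_inner T v w"
    unfolding grad_inner_def
    by (subst set_integral_add(2)) (auto intro!: I p set_integrable_mult_right)
  finally show "grad_inner T (\<lambda>x. u x + a * v x) w = grad_inner T u w + a * grad_inner T v w" .
  have "grad_inner T w (\<lambda>x. u x + a * v x) =
      (LINT x:T|lebesgue. (\<Sum>i\<in>UNIV. pderivative i w x * cnj (pderivative i u x)) +
        cnj a * (\<Sum>i\<in>UNIV. pderivative i w x * cnj (pderivative i v x)))"
    unfolding grad_inner_def
  proof (rule set_integral_spike(2)[OF _ negligible_simplex_boundary[OF T]])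
    show "set_integrable lebesgue T (\<lambda>x. (\<Sum>i\<in>UNIV. pderivative i w x * cnj (pderivative i u x)) +
        cnj a * (\<Sum>i\<in>UNIV. pderivative i w x * cnj (pderivative i v x)))"
      by (intro set_integral_add set_integrable_mult_right I p)
  qed (simp add: pderivative_comb[OF p(1,2)] sum.distrib sum_distrib_left ring_distribs mult_ac)
  also have "\<dots> = grad_inner T w u + cnj a * grad_inner T w v"
    unfolding grad_inner_def
    by (subst set_integral_add(2)) (auto intro!: I p set_integrable_mult_right)
  finally show "grad_inner T w (\<lambda>x. u x + a * v x) = grad_inner T w u + cnj a * grad_inner T w v" .
qed

lemma sesq_l2_inner_simplex:
  assumes T: "2 simplex T" shows "sesq {v. poly_on p T v} (l2_inner T)"
  unfolding sesq_def
proof (intro ballI allI conjI; simp only: mem_Collect_eq)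
  fix u v w a assume p: "poly_on p T u" "poly_on p T v" "poly_on p T w"
  note I = integrable_forms(2)[OF T, of p]
  have "l2_inner T (\<lambda>x. u x + a * v x) w = (LINT x:T|lebesgue. u x * cnj (w x) + a * (v x * cnj (w x)))"
    by (simp add: l2_inner_def ring_distribs mult_ac)
  also have "\<dots> = l2_inner T u w + a * l2_inner T v w"
    unfolding l2_inner_def by (subst set_integral_add(2)) (auto intro!: I p set_integrable_mult_right)
  finally show "l2_inner T (\<lambda>x. u x + a * v x) w = l2_inner T u w + a * l2_inner T v w" .
  have "l2_inner T w (\<lambda>x. u x + a * v x) = (LINT x:T|lebesgue. w x * cnj (u x) + cnj a * (w x * cnj (v x)))"
    by (simp add: l2_inner_def ring_distribs mult_ac)
  also have "\<dots> = l2_inner T w u + cnj a * l2_inner T w v"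
    unfolding l2_inner_def by (subst set_integral_add(2)) (auto intro!: I p set_integrable_mult_right)
  finally show "l2_inner T w (\<lambda>x. u x + a * v x) = l2_inner T w u + cnj a * l2_inner T w v" .
qed

lemma l2_inner_hermitian: "l2_inner T w v = cnj (l2_inner T v w)"
proof -
  have "cnj (l2_inner T v w) = integral\<^sup>L lebesgue (\<lambda>x. cnj (indicator T x *\<^sub>R (v x * cnj (w x))))"
    unfolding l2_inner_def set_lebesgue_integral_def by (rule Bochner_Integration.integral_cnj[symmetric])
  also have "\<dots> = l2_inner T w v" unfolding l2_inner_def set_lebesgue_integral_def
    by (rule Bochner_Integration.integral_cong) (auto simp: mult.commute)
  finally show ?thesis ..
qed

lemma grad_inner_hermitian: "grad_inner T w v = cnj (grad_inner T v w)"
proof -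
  have "cnj (grad_inner T v w) = integral\<^sup>L lebesgue (\<lambda>x. cnj (indicator T x *\<^sub>R (\<Sum>i\<in>UNIV. pderivative i v x * cnj (pderivative i w x))))"
    unfolding grad_inner_def set_lebesgue_integral_def by (rule Bochner_Integration.integral_cnj[symmetric])
  also have "\<dots> = grad_inner T w v" unfolding grad_inner_def set_lebesgue_integral_def
    by (rule Bochner_Integration.integral_cong) (auto simp: mult.commute)
  finally show ?thesis ..
qed

definition l2sq :: "(real^2) set \<Rightarrow> (real^2 \<Rightarrow> complex) \<Rightarrow> real" where
  "l2sq T v = (LINT x:T|lebesgue. (cmod (v x))\<^sup>2)"

definition gradsq :: "(real^2 \<Rightarrow> complex) \<Rightarrow> real^2 \<Rightarrow> real" where
  "gradsq v x = (\<Sum>i\<in>UNIV. (cmod (pderivative i v x))\<^sup>2)"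

definition h1sq :: "(real^2) set \<Rightarrow> (real^2 \<Rightarrow> complex) \<Rightarrow> real" where
  "h1sq T v = (LINT x:T|lebesgue. gradsq v x)"

lemma l2_inner_self: "l2_inner T v v = of_real (l2sq T v)"
proof -
  have "l2_inner T v v = integral\<^sup>L lebesgue (\<lambda>x. of_real (indicator T x *\<^sub>R (cmod (v x))\<^sup>2))"
    unfolding l2_inner_def set_lebesgue_integral_def
    by (rule Bochner_Integration.integral_cong) (auto simp: complex_norm_square[symmetric] indicator_def)
  also have "\<dots> = of_real (l2sq T v)" unfolding l2sq_def set_lebesgue_integral_def
    by (rule integral_complex_of_real)
  finally show ?thesis .
qed

lemma grad_inner_self: "grad_inner T v v = of_real (h1sq T v)"
proof -
  have "grad_inner T v v = integral\<^sup>L lebesgue (\<lambda>x. of_real (indicator T x *\<^sub>R gradsq v x))"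
    unfolding grad_inner_def set_lebesgue_integral_def gradsq_def
    by (rule Bochner_Integration.integral_cong) (auto simp: complex_norm_square[symmetric] indicator_def)
  also have "\<dots> = of_real (h1sq T v)" unfolding h1sq_def set_lebesgue_integral_def
    by (rule integral_complex_of_real)
  finally show ?thesis .
qed

lemma l2sq_nonneg: "0 \<le> l2sq T v" 
  unfolding l2sq_def set_lebesgue_integral_def by (rule integral_nonneg_AE) auto

lemma gradsq_nonneg: "0 \<le> gradsq v x" by (simp add: gradsq_def sum_nonneg)

lemma h1sq_nonneg: "0 \<le> h1sq T v" 
  unfolding h1sq_def set_lebesgue_integral_def by (rule integral_nonneg_AE) (auto simp: gradsq_nonneg)

lemma integrable_squares:
  assumes T: "2 simplex T" and v: "poly_on p T v"
  shows "set_integrable lebesgue T (\<lambda>x. (cmod (v x))\<^sup>2)" "set_integrable lebesgue T (gradsq v)"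
proof -
  have "set_integrable lebesgue T (\<lambda>x. Re (v x * cnj (v x)))"
    using integrable_Re[OF integrable_forms(2)[OF T v v, unfolded set_integrable_def]]
    unfolding set_integrable_def by simp
  then show "set_integrable lebesgue T (\<lambda>x. (cmod (v x))\<^sup>2)"
    by (simp add: complex_norm_square[symmetric] flip: of_real_power)
  have "set_integrable lebesgue T (\<lambda>x. Re (\<Sum>i\<in>UNIV. pderivative i v x * cnj (pderivative i v x)))"
    using integrable_Re[OF integrable_forms(1)[OF T v v, unfolded set_integrable_def]]
    unfolding set_integrable_def by simp
  moreover have "Re (\<Sum>i\<in>UNIV. pderivative i v x * cnj (pderivative i v x)) = gradsq v x" for x
    unfolding gradsq_def by (simp add: complex_norm_square[symmetric] flip: of_real_power)
  ultimately show "set_integrable lebesgue T (gradsq v)" by simp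
qed

text \<open>Test positivity with \<open>u - t b(u, v) v\<close> for real \<open>t\<close>. If \<open>b(v, v) = 0\<close>, large \<open>t\<close> show that
  \<open>b(u, v) = 0\<close>.\<close>

lemma hermitian_Cauchy_Schwarz:
  assumes "sesq V b" "csubspace V" "u \<in> V" "v \<in> V"
    and herm: "\<And>u v. u \<in> V \<Longrightarrow> v \<in> V \<Longrightarrow> b v u = cnj (b u v)"
    and pos: "\<And>u. u \<in> V \<Longrightarrow> 0 \<le> Re (b u u)"
  shows "cmod (b u v) \<le> sqrt (Re (b u u)) * sqrt (Re (b v v))"
proof -
  have q: "0 \<le> Re (b u u) - 2 * t * (cmod (b u v))\<^sup>2 + t\<^sup>2 * (cmod (b u v))\<^sup>2 * Re (b v v)" for t :: real
  proof -
    define a where "a = - of_real t * b u v"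
    have w: "(\<lambda>x. u x + a * v x) \<in> V" using csubspace_comb assms by blast
    have "b (\<lambda>x. u x + a * v x) (\<lambda>x. u x + a * v x)
        = b u u + cnj a * b u v + a * (b v u + cnj a * b v v)"
      using sesqD(1)[OF assms(1,3,4) w] sesqD(2)[OF assms(1,3,4), of u] sesqD(2)[OF assms(1,3,4), of v] assms(3,4)
      by simp
    also have "b v u = cnj (b u v)" using herm assms by blast
    also have "b u u + cnj a * b u v + a * (cnj (b u v) + cnj a * b v v)
        = b u u - 2 * of_real t * (b u v * cnj (b u v)) + of_real t ^ 2 * (b u v * cnj (b u v)) * b v v"
      by (simp add: a_def algebra_simps power2_eq_square)
    also have "b u v * cnj (b u v) = of_real ((cmod (b u v))\<^sup>2)" by (rule complex_norm_square[symmetric])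
    also have "b u u - 2 * of_real t * of_real ((cmod (b u v))\<^sup>2) + of_real t ^ 2 * of_real ((cmod (b u v))\<^sup>2) * b v v
        = b u u - of_real (2 * t * (cmod (b u v))\<^sup>2) + of_real (t\<^sup>2 * (cmod (b u v))\<^sup>2) * b v v" by simp
    finally have "Re (b (\<lambda>x. u x + a * v x) (\<lambda>x. u x + a * v x)) =
        Re (b u u - of_real (2 * t * (cmod (b u v))\<^sup>2) + of_real (t\<^sup>2 * (cmod (b u v))\<^sup>2) * b v v)"
      by (rule arg_cong)
    also have "\<dots> = Re (b u u) - 2 * t * (cmod (b u v))\<^sup>2 + t\<^sup>2 * (cmod (b u v))\<^sup>2 * Re (b v v)"
      unfolding plus_complex.sel minus_complex.sel times_complex.sel Re_complex_of_real Im_complex_of_real by simp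
    finally have "Re (b (\<lambda>x. u x + a * v x) (\<lambda>x. u x + a * v x)) =
        Re (b u u) - 2 * t * (cmod (b u v))\<^sup>2 + t\<^sup>2 * (cmod (b u v))\<^sup>2 * Re (b v v)" .
    with pos[OF w] show ?thesis by simp
  qed
  let ?n = "(cmod (b u v))\<^sup>2" and ?U = "Re (b u u)" and ?V = "Re (b v v)"
  have "?n \<le> ?U * ?V"
  proof (cases "?V = 0")
    case True
    have "?n = 0"
    proof (rule ccontr)
      assume "?n \<noteq> 0"
      then have n: "?n > 0" by simp
      have "0 \<le> ?U - 2 * ((?U + 1) / ?n) * ?n" using q[of "(?U + 1) / ?n"] True by simp
      also have "\<dots> = - ?U - 2" using n by (simp add: field_simps)
      finally show False using pos[OF assms(3)] by simp
    qed
    then show ?thesis using True by simp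
  next
    case False
    then have V: "?V > 0" using pos[OF assms(4)] by simp
    have "0 \<le> ?U - 2 * (1 / ?V) * ?n + (1 / ?V)\<^sup>2 * ?n * ?V" using q[of "1 / ?V"] .
    also have "\<dots> = ?U - ?n / ?V" using V by (simp add: field_simps power2_eq_square)
    finally show ?thesis using V by (simp add: field_simps)
  qed
  then have "sqrt ?n \<le> sqrt (?U * ?V)" by (rule real_sqrt_le_mono)
  then show ?thesis by (simp add: real_sqrt_mult)
qed

lemma csubspace_poly_on: "csubspace {v. poly_on p T v}"
  unfolding csubspace_def using polyfun_const[of p 0]
  by (auto simp: poly_on_add_cmult) (auto simp: poly_on_iff)

lemma l2_inner_CS:
  assumes "2 simplex T" "poly_on p T v" "poly_on p T w"
  shows "cmod (l2_inner T v w) \<le> sqrt (l2sq T v) * sqrt (l2sq T w)"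
proof -
  have "cmod (l2_inner T v w) \<le> sqrt (Re (l2_inner T v v)) * sqrt (Re (l2_inner T w w))"
  proof (rule hermitian_Cauchy_Schwarz[OF sesq_l2_inner_simplex[OF assms(1)] csubspace_poly_on])
    show "l2_inner T v u = cnj (l2_inner T u v)" for u v by (rule l2_inner_hermitian)
    show "0 \<le> Re (l2_inner T u u)" for u by (simp add: l2_inner_self l2sq_nonneg)
  qed (use assms(2,3) in simp_all)
  then show ?thesis by (simp only: l2_inner_self Re_complex_of_real)
qed

lemma grad_inner_CS:
  assumes "2 simplex T" "poly_on p T v" "poly_on p T w"
  shows "cmod (grad_inner T v w) \<le> sqrt (h1sq T v) * sqrt (h1sq T w)"
proof -
  have "cmod (grad_inner T v w) \<le> sqrt (Re (grad_inner T v v)) * sqrt (Re (grad_inner T w w))"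
  proof (rule hermitian_Cauchy_Schwarz[OF sesq_grad_inner_simplex[OF assms(1)] csubspace_poly_on])
    show "grad_inner T v u = cnj (grad_inner T u v)" for u v by (rule grad_inner_hermitian)
    show "0 \<le> Re (grad_inner T u u)" for u by (simp add: grad_inner_self h1sq_nonneg)
  qed (use assms(2,3) in simp_all)
  then show ?thesis by (simp only: grad_inner_self Re_complex_of_real)
qed

section \<open>Inverse estimates\<close>

lemma measure_ball_plane: "0 \<le> r \<Longrightarrow> measure lebesgue (ball (c :: real^2) r) = r\<^sup>2 * pi"
  by (simp add: circle_area)

lemma measure_le_of_diameter:
  fixes T :: "(real^2) set"
  assumes "2 simplex T" "diameter T \<le> \<rho>" "0 < \<rho>"
  shows "measure lebesgue T \<le> 4 * \<rho>\<^sup>2 * pi"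
proof -
  obtain x where x: "x \<in> T" using interior_simplex_nonempty[OF assms(1)] interior_subset by blast
  have "T \<subseteq> ball x (2 * \<rho>)"
  proof
    fix y assume "y \<in> T"
    then have "dist x y \<le> diameter T"
      using x compact_imp_bounded[OF compact_simplex[OF assms(1)]] by (intro diameter_bounded_bound)
    then show "y \<in> ball x (2 * \<rho>)" using assms by simp
  qed
  then have "measure lebesgue T \<le> measure lebesgue (ball x (2 * \<rho>))"
    by (intro measure_mono_fmeasurable sets_simplex[OF assms(1)]) auto
  then show ?thesis using measure_ball_plane[of "2 * \<rho>" x] assms(3) by (simp add: power_mult_distrib)
qed

lemma set_integral_le_const:
  fixes F :: "real^2 \<Rightarrow> real"
  assumes T: "2 simplex T" and F: "set_integrable lebesgue T F" and B: "\<And>x. x \<in> interior T \<Longrightarrow> F x \<le> B"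
  shows "(LINT x:T|lebesgue. F x) \<le> B * measure lebesgue T"
proof -
  have m: "T \<in> lmeasurable" using lmeasurable_compact[OF compact_simplex[OF T]] .
  have i: "integrable lebesgue (\<lambda>x. indicator T x *\<^sub>R B)"
    using m by (intro integrable_scaleR_left) (auto simp: fmeasurable_def)
  have "(LINT x:T|lebesgue. F x) \<le> integral\<^sup>L lebesgue (\<lambda>x. indicator T x *\<^sub>R B)"
    unfolding set_lebesgue_integral_def
  proof (rule integral_mono_AE[OF F[unfolded set_integrable_def] i])
    show "AE x in lebesgue. indicator T x *\<^sub>R F x \<le> indicator T x *\<^sub>R B"
      using AE_not_in_negligible[OF negligible_simplex_boundary[OF T]]
      by eventually_elim (auto simp: indicator_def B)
  qed
  also have "\<dots> = B * measure lebesgue T" by simp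
  finally show ?thesis .
qed

lemma l2sq_ge_ball:
  assumes T: "2 simplex T" and v: "poly_on p T v" and b: "ball y s \<subseteq> T" "0 \<le> s"
    and q: "\<And>x. x \<in> ball y s \<Longrightarrow> q \<le> (cmod (v x))\<^sup>2"
  shows "q * (s\<^sup>2 * pi) \<le> l2sq T v"
proof -
  have i: "integrable lebesgue (\<lambda>x. indicator (ball y s) x *\<^sub>R q)"
    using lmeasurable_ball[of y s] by (intro integrable_scaleR_left) (auto simp: fmeasurable_def)
  have "q * (s\<^sup>2 * pi) = integral\<^sup>L lebesgue (\<lambda>x. indicator (ball y s) x *\<^sub>R q)"
    using measure_ball_plane[OF b(2), of y] by simp
  also have "\<dots> \<le> l2sq T v"
    unfolding l2sq_def set_lebesgue_integral_def
  proof (rule integral_mono_AE[OF i integrable_squares(1)[OF T v, unfolded set_integrable_def]])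
    have "indicator (ball y s) x *\<^sub>R q \<le> indicator T x *\<^sub>R (cmod (v x))\<^sup>2" for x
      using q[of x] b(1) by (auto simp: indicator_def)
    then show "AE x in lebesgue. indicator (ball y s) x *\<^sub>R q \<le> indicator T x *\<^sub>R (cmod (v x))\<^sup>2" by simp
  qed
  finally show ?thesis .
qed

lemma derivative_bound_of_lipschitz:
  assumes d: "(v has_derivative D) (at x)" and U: "open U" "x \<in> U"
    and lip: "\<And>y. y \<in> U \<Longrightarrow> norm (v y - v x) \<le> B * norm (y - x)" and h: "norm h = 1"
  shows "norm (D h) \<le> B"
proof (rule field_le_epsilon)
  fix e :: real assume "0 < e"
  then obtain d where d0: "d > 0" "\<And>y. norm (y - x) < d \<Longrightarrow> norm (v y - v x - D (y - x)) \<le> e * norm (y - x)"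
    using d unfolding has_derivative_at_alt by blast
  obtain d' where d': "d' > 0" "ball x d' \<subseteq> U" using U open_contains_ball by blast
  define t where "t = min d d' / 2"
  have t: "0 < t" "t < d" "t < d'" using d0 d' by (auto simp: t_def)
  have lin: "D (t *\<^sub>R h) = t *\<^sub>R D h" using d has_derivative_linear linear_scale by blast
  have n: "norm (t *\<^sub>R h) = t" using t h by simp
  have "norm (v (x + t *\<^sub>R h) - v x - D (t *\<^sub>R h)) \<le> e * t" using d0(2)[of "x + t *\<^sub>R h"] n t by simp
  moreover have "x + t *\<^sub>R h \<in> U" using d'(2) n t by (auto simp: dist_norm)
  then have "norm (v (x + t *\<^sub>R h) - v x) \<le> B * t" using lip[of "x + t *\<^sub>R h"] n by simp
  ultimately have "norm (D (t *\<^sub>R h)) \<le> B * t + e * t"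
    using norm_triangle_ineq4[of "v (x + t *\<^sub>R h) - v x" "v (x + t *\<^sub>R h) - v x - D (t *\<^sub>R h)"] by simp
  then have "t * norm (D h) \<le> t * (B + e)" using t by (simp add: lin algebra_simps)
  then show "norm (D h) \<le> B + e" using t by simp
qed

lemma inj_on_node:
  assumes "\<not> affine_dependent W" "0 < p"
  shows "inj_on (node W p) (idx W p)"
proof (intro inj_onI ext)
  fix k k' v assume k: "k \<in> idx W p" "k' \<in> idx W p" and eq: "node W p k = node W p k'"
  show "k v = k' v"
  proof (cases "v \<in> W")
    case True
    then have "real (k v) / real p = real (k' v) / real p"
      using bary_node[OF assms k(1)] bary_node[OF assms k(2)] eq by metis
    then show ?thesis using assms(2) by simp
  qed (use k in \<open>auto simp: idx_def\<close>)
qed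

lemma sum_nodes:
  assumes "2 simplex T" "0 < p"
  shows "(\<Sum>k\<in>idx (vertices T) p. f (node (vertices T) p k)) = (\<Sum>x\<in>element_nodes p T. f x)"
  unfolding element_nodes_eq[OF assms(1)]
  by (subst sum.reindex[OF inj_on_node[OF simplex_vertices(2)[OF assms(1)] assms(2)]]) simp

text \<open>Writing a polynomial in the Lagrange basis bounds it and its differences by its nodal values,
  because the basis functions are bounded and vary on the scale of the inradius.\<close>

lemma nodal_bounds:
  assumes p: "0 < p"
  obtains M where "1 \<le> M"
    "\<And>T v x. 2 simplex T \<Longrightarrow> poly_on p T v \<Longrightarrow> x \<in> T \<Longrightarrow>
       cmod (v x) \<le> M * (\<Sum>z\<in>element_nodes p T. cmod (v z))"
    "\<And>T v c r x y. 2 simplex T \<Longrightarrow> poly_on p T v \<Longrightarrow> x \<in> T \<Longrightarrow> y \<in> T \<Longrightarrow> 0 < r \<Longrightarrow> ball c r \<subseteq> T \<Longrightarrow>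
       cmod (v x - v y) \<le> M / r * (\<Sum>z\<in>element_nodes p T. cmod (v z)) * norm (x - y)"
proof -
  obtain M where M: "1 \<le> M"
    "\<And>T k x. 2 simplex T \<Longrightarrow> k \<in> idx (vertices T) p \<Longrightarrow> x \<in> T \<Longrightarrow> \<bar>shape (vertices T) p k x\<bar> \<le> M"
    "\<And>T k c r x y. 2 simplex T \<Longrightarrow> k \<in> idx (vertices T) p \<Longrightarrow> x \<in> T \<Longrightarrow> y \<in> T \<Longrightarrow> 0 < r \<Longrightarrow>
      ball c r \<subseteq> T \<Longrightarrow> \<bar>shape (vertices T) p k x - shape (vertices T) p k y\<bar> \<le> M / r * norm (x - y)"
    by (rule shape_bounds) blast
  show thesis
  proof (rule that[OF M(1)])
    fix T v x assume T: "2 simplex T" and v: "poly_on p T v" and x: "x \<in> T"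
    have "cmod (v x) = cmod (\<Sum>k\<in>idx (vertices T) p. v (node (vertices T) p k) * of_real (shape (vertices T) p k x))"
      using poly_on_eq_interp[OF T p v x] by (simp add: interp_def)
    also have "\<dots> \<le> (\<Sum>k\<in>idx (vertices T) p. M * cmod (v (node (vertices T) p k)))"
      using M(2)[OF T _ x] by (intro sum_norm_le) (simp add: norm_mult mult.commute mult_right_mono)
    also have "\<dots> = M * (\<Sum>z\<in>element_nodes p T. cmod (v z))"
      using sum_nodes[OF T p, of "\<lambda>z. cmod (v z)"] by (simp add: sum_distrib_left[symmetric])
    finally show "cmod (v x) \<le> M * (\<Sum>z\<in>element_nodes p T. cmod (v z))" .
  next
    fix T v c r x y
    assume T: "2 simplex T" and v: "poly_on p T v" and xy: "x \<in> T" "y \<in> T" and r: "0 < r" "ball c r \<subseteq> T"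
    have "cmod (v x - v y) = cmod (\<Sum>k\<in>idx (vertices T) p. v (node (vertices T) p k) *
        of_real (shape (vertices T) p k x - shape (vertices T) p k y))"
      using poly_on_eq_interp[OF T p v xy(1)] poly_on_eq_interp[OF T p v xy(2)]
      by (simp add: interp_def sum_subtractf[symmetric] right_diff_distrib)
    also have "\<dots> \<le> (\<Sum>k\<in>idx (vertices T) p. (M / r * norm (x - y)) * cmod (v (node (vertices T) p k)))"
    proof (intro sum_norm_le)
      fix k assume k: "k \<in> idx (vertices T) p"
      have "cmod (v (node (vertices T) p k)) * \<bar>shape (vertices T) p k x - shape (vertices T) p k y\<bar>
        \<le> cmod (v (node (vertices T) p k)) * (M / r * norm (x - y))"
        by (intro mult_left_mono M(3)[OF T k xy r]) simp
      then show "cmod (v (node (vertices T) p k) * of_real (shape (vertices T) p k x - shape (vertices T) p k y))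
        \<le> (M / r * norm (x - y)) * cmod (v (node (vertices T) p k))"
        unfolding norm_mult norm_of_real by (simp only: mult.commute)
    qed
    also have "\<dots> = (M / r * norm (x - y)) * (\<Sum>z\<in>element_nodes p T. cmod (v z))"
      unfolding sum_nodes[OF T p, of "\<lambda>z. cmod (v z)", symmetric] by (rule sum_distrib_left[symmetric])
    finally show "cmod (v x - v y) \<le> M / r * (\<Sum>z\<in>element_nodes p T. cmod (v z)) * norm (x - y)"
      by (simp only: mult_ac)
  qed
qed

lemma nodal_sum_squared_le:
  assumes "2 simplex T"
  shows "(\<Sum>z\<in>element_nodes p T. cmod (v z))\<^sup>2 \<le> real ((p + 1) ^ 3) * (\<Sum>z\<in>element_nodes p T. (cmod (v z))\<^sup>2)"
proof -
  have "(\<Sum>z\<in>element_nodes p T. cmod (v z))\<^sup>2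
      \<le> (\<Sum>z\<in>element_nodes p T. (cmod (v z))\<^sup>2) * card (element_nodes p T)"
    by (rule sum_squared_le_sum_of_squares)
  also have "\<dots> \<le> (\<Sum>z\<in>element_nodes p T. (cmod (v z))\<^sup>2) * real ((p + 1) ^ 3)"
    using card_element_nodes_le[OF assms, of p] by (intro mult_left_mono sum_nonneg) (simp_all only: of_nat_le_iff zero_le_power2)
  finally show ?thesis by (simp only: mult.commute)
qed

text \<open>On a shape-regular triangle the area is of order \<open>r\<^sup>2\<close> and the gradient of a polynomial is of
  order \<open>1 / r\<close> times its nodal values, so the two powers of \<open>r\<close> cancel in the gradient term.\<close>

lemma energy_le_nodal:
  assumes p: "0 < p"
  obtains C where "0 < C"
    "\<And>T v c r. 2 simplex T \<Longrightarrow> poly_on p T v \<Longrightarrow> 0 < r \<Longrightarrow> ball c r \<subseteq> T \<Longrightarrow> diameter T \<le> L * r \<Longrightarrow> 0 < L \<Longrightarrow>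
       h1sq T v \<le> C * (\<Sum>z\<in>element_nodes p T. (cmod (v z))\<^sup>2)"
    "\<And>T v c r. 2 simplex T \<Longrightarrow> poly_on p T v \<Longrightarrow> 0 < r \<Longrightarrow> ball c r \<subseteq> T \<Longrightarrow> diameter T \<le> L * r \<Longrightarrow> 0 < L \<Longrightarrow>
       l2sq T v \<le> C * r\<^sup>2 * (\<Sum>z\<in>element_nodes p T. (cmod (v z))\<^sup>2)"
proof -
  obtain M where M: "1 \<le> M"
    "\<And>T v x. 2 simplex T \<Longrightarrow> poly_on p T v \<Longrightarrow> x \<in> T \<Longrightarrow>
       cmod (v x) \<le> M * (\<Sum>z\<in>element_nodes p T. cmod (v z))"
    "\<And>T v c r x y. 2 simplex T \<Longrightarrow> poly_on p T v \<Longrightarrow> x \<in> T \<Longrightarrow> y \<in> T \<Longrightarrow> 0 < r \<Longrightarrow> ball c r \<subseteq> T \<Longrightarrow>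
       cmod (v x - v y) \<le> M / r * (\<Sum>z\<in>element_nodes p T. cmod (v z)) * norm (x - y)"
    by (rule nodal_bounds[OF p]) blast
  define n where "n = real ((p + 1) ^ 3)"
  have n: "0 < n" by (simp add: n_def)
  define C where "C = 2 * (M\<^sup>2 * n) * (4 * L\<^sup>2 * pi) + 1"
  have C0: "0 < C" using n by (auto simp: C_def intro!: add_nonneg_pos)
  show thesis
  proof (rule that[OF C0])
    fix T v c r assume T: "2 simplex T" and v: "poly_on p T v" and r: "0 < r" "ball c r \<subseteq> T"
      and d: "diameter T \<le> L * r" and L: "0 < L"
    define N where "N = (\<Sum>z\<in>element_nodes p T. cmod (v z))"
    define N2 where "N2 = (\<Sum>z\<in>element_nodes p T. (cmod (v z))\<^sup>2)"
    have N0: "0 \<le> N" "0 \<le> N2" by (auto simp: N_def N2_def intro!: sum_nonneg)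
    have NN: "N\<^sup>2 \<le> n * N2" unfolding N_def N2_def n_def by (rule nodal_sum_squared_le[OF T])
    have mT: "measure lebesgue T \<le> 4 * (L * r)\<^sup>2 * pi"
      using measure_le_of_diameter[OF T d] L r by simp
    have "gradsq v x \<le> 2 * (M / r * N)\<^sup>2" if x: "x \<in> interior T" for x
    proof -
      have dv: "(v has_derivative frechet_derivative v (at x)) (at x)" using poly_on_interior[OF v] x by metis
      have "cmod (pderivative i v x) \<le> M / r * N" for i
        unfolding pderivative_def
      proof (rule derivative_bound_of_lipschitz[OF dv open_interior x])
        show "cmod (v y - v x) \<le> M / r * N * norm (y - x)" if "y \<in> interior T" for y
          unfolding N_def using that x interior_subset by (intro M(3)[OF T v _ _ r]) auto
      qed simp
      then have "(cmod (pderivative i v x))\<^sup>2 \<le> (M / r * N)\<^sup>2" for i by (rule power_mono) simp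
      then show ?thesis unfolding gradsq_def sum_2 by (smt (verit, best))
    qed
    then have "h1sq T v \<le> 2 * (M / r * N)\<^sup>2 * measure lebesgue T"
      unfolding h1sq_def by (intro set_integral_le_const[OF T integrable_squares(2)[OF T v]])
    also have "\<dots> \<le> 2 * (M / r * N)\<^sup>2 * (4 * (L * r)\<^sup>2 * pi)" using mT by (intro mult_left_mono) auto
    also have "\<dots> = 2 * M\<^sup>2 * (4 * L\<^sup>2 * pi) * N\<^sup>2" using r by (simp add: power_mult_distrib power_divide)
    also have "\<dots> \<le> 2 * M\<^sup>2 * (4 * L\<^sup>2 * pi) * (n * N2)" using NN by (intro mult_left_mono) auto
    also have "\<dots> = (C - 1) * N2" by (simp add: C_def)
    also have "\<dots> \<le> C * N2" using N0 by (simp add: mult_right_mono)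
    finally show "h1sq T v \<le> C * (\<Sum>z\<in>element_nodes p T. (cmod (v z))\<^sup>2)" by (simp add: N2_def)
    have "(cmod (v x))\<^sup>2 \<le> (M * N)\<^sup>2" if "x \<in> interior T" for x
      using M(2)[OF T v] that interior_subset unfolding N_def by (intro power_mono) auto
    then have "l2sq T v \<le> (M * N)\<^sup>2 * measure lebesgue T"
      unfolding l2sq_def by (intro set_integral_le_const[OF T integrable_squares(1)[OF T v]])
    also have "\<dots> \<le> (M * N)\<^sup>2 * (4 * (L * r)\<^sup>2 * pi)" using mT by (intro mult_left_mono) auto
    also have "\<dots> = M\<^sup>2 * (4 * L\<^sup>2 * pi) * r\<^sup>2 * N\<^sup>2" by (simp add: power_mult_distrib)
    also have "\<dots> \<le> M\<^sup>2 * (4 * L\<^sup>2 * pi) * r\<^sup>2 * (n * N2)" using NN by (intro mult_left_mono) auto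
    also have "\<dots> \<le> 2 * M\<^sup>2 * (4 * L\<^sup>2 * pi) * r\<^sup>2 * (n * N2)" using n N0 by (intro mult_right_mono) auto
    also have "\<dots> = (C - 1) * (r\<^sup>2 * N2)" by (simp add: C_def)
    also have "\<dots> \<le> C * (r\<^sup>2 * N2)" using N0 by (intro mult_right_mono) auto
    finally show "l2sq T v \<le> C * r\<^sup>2 * (\<Sum>z\<in>element_nodes p T. (cmod (v z))\<^sup>2)" by (simp add: N2_def)
  qed
qed

text \<open>Near a point where the modulus is maximal a polynomial still has at least half of this
  modulus, on a distance comparable to the inradius; and there the triangle contains a comparable disc,
  the image of the inscribed one under a homothety about that point.\<close>

lemma sup_le_l2:
  assumes p: "0 < p" and L: "1 \<le> L"
  obtains C where "0 < C"
    "\<And>T v c r x. 2 simplex T \<Longrightarrow> poly_on p T v \<Longrightarrow> 0 < r \<Longrightarrow> ball c r \<subseteq> T \<Longrightarrow> diameter T \<le> L * r \<Longrightarrow> x \<in> T \<Longrightarrow>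
       r\<^sup>2 * (cmod (v x))\<^sup>2 \<le> C * l2sq T v"
proof -
  obtain M where M: "1 \<le> M"
    "\<And>T v x. 2 simplex T \<Longrightarrow> poly_on p T v \<Longrightarrow> x \<in> T \<Longrightarrow>
       cmod (v x) \<le> M * (\<Sum>z\<in>element_nodes p T. cmod (v z))"
    "\<And>T v c r x y. 2 simplex T \<Longrightarrow> poly_on p T v \<Longrightarrow> x \<in> T \<Longrightarrow> y \<in> T \<Longrightarrow> 0 < r \<Longrightarrow> ball c r \<subseteq> T \<Longrightarrow>
       cmod (v x - v y) \<le> M / r * (\<Sum>z\<in>element_nodes p T. cmod (v z)) * norm (x - y)"
    by (rule nodal_bounds[OF p]) blast
  define n where "n = real ((p + 1) ^ 3)"
  have n: "1 \<le> n" by (simp add: n_def)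
  define \<theta> where "\<theta> = 1 / (2 * M * n * L)"
  have "1 * 1 * 1 \<le> M * n * L" using M(1) n L by (intro mult_mono) auto
  then have \<theta>: "0 < \<theta>" "\<theta> \<le> 1" using M(1) n L by (auto simp: \<theta>_def divide_simps)
  define C where "C = 4 / (\<theta>\<^sup>2 * pi)"
  have C0: "0 < C" using \<theta> by (simp add: C_def)
  show thesis
  proof (rule that[OF C0])
    fix T v c r x assume T: "2 simplex T" and v: "poly_on p T v" and r: "0 < r" "ball c r \<subseteq> T"
      and d: "diameter T \<le> L * r" and x: "x \<in> T"
    obtain f where f: "polyfun p f" "\<And>x. x \<in> T \<Longrightarrow> v x = f x" using v by (auto simp: poly_on_iff)
    have "continuous_on T (\<lambda>x. cmod (f x))" by (intro continuous_intros continuous_on_polyfun[OF f(1)])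
    then obtain x0 where x0: "x0 \<in> T" "\<And>y. y \<in> T \<Longrightarrow> cmod (f y) \<le> cmod (f x0)"
      using continuous_attains_sup[OF compact_simplex[OF T], of "\<lambda>x. cmod (f x)"] x by blast
    define m where "m = cmod (v x0)"
    have m: "cmod (v y) \<le> m" if "y \<in> T" for y using x0 that f(2) by (simp add: m_def)
    have m0: "0 \<le> m" by (simp add: m_def)
    have "(\<Sum>z\<in>element_nodes p T. cmod (v z)) \<le> real (card (element_nodes p T)) * m"
      using m element_nodes_subset[OF T p] by (intro sum_bounded_above) auto
    also have "\<dots> \<le> n * m"
      unfolding n_def using card_element_nodes_le[OF T, of p] m0 by (intro mult_right_mono) (simp_all only: of_nat_le_iff)
    finally have N: "(\<Sum>z\<in>element_nodes p T. cmod (v z)) \<le> n * m" .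
    define y0 where "y0 = x0 + \<theta> *\<^sub>R (c - x0)"
    have ball: "y \<in> T \<and> norm (y - x0) \<le> r / (2 * M * n)" if y: "y \<in> ball y0 (\<theta> * r)" for y
    proof -
      define z where "z = c + (1 / \<theta>) *\<^sub>R (y - y0)"
      have "norm (y - y0) < \<theta> * r" using y by (simp add: dist_norm norm_minus_commute)
      then have "norm (y - y0) / \<theta> < r" using \<theta> by (simp add: field_simps)
      then have "norm ((1 / \<theta>) *\<^sub>R (y - y0)) < r" using \<theta> unfolding norm_scaleR by simp
      then have "dist c z < r" by (simp add: z_def dist_norm)
      then have zT: "z \<in> T" using r(2) by auto
      have "\<theta> *\<^sub>R z = \<theta> *\<^sub>R c + (y - y0)" using \<theta> by (simp add: z_def algebra_simps)
      then have yz: "y = (1 - \<theta>) *\<^sub>R x0 + \<theta> *\<^sub>R z" by (simp add: y0_def algebra_simps)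
      have "y \<in> T" unfolding yz using convexD_alt[OF convex_simplex[OF T] x0(1) zT] \<theta> by simp
      moreover have "norm (y - x0) = \<theta> * norm (z - x0)"
      proof -
        have "y - x0 = \<theta> *\<^sub>R (z - x0)" by (simp add: yz algebra_simps)
        then show ?thesis using \<theta> by simp
      qed
      moreover have "norm (z - x0) \<le> L * r"
        using diameter_bounded_bound[OF compact_imp_bounded[OF compact_simplex[OF T]] zT x0(1)] d
        by (simp add: dist_norm)
      then have "\<theta> * norm (z - x0) \<le> \<theta> * (L * r)" using \<theta> by (intro mult_left_mono) auto
      moreover have "\<theta> * (L * r) = r / (2 * M * n)" using L by (simp add: \<theta>_def)
      ultimately show ?thesis by simp
    qed
    have low: "m\<^sup>2 / 4 \<le> (cmod (v y))\<^sup>2" if y: "y \<in> ball y0 (\<theta> * r)" for y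
    proof -
      have "cmod (v x0 - v y) \<le> M / r * (\<Sum>z\<in>element_nodes p T. cmod (v z)) * norm (x0 - y)"
        using M(3)[OF T v x0(1) _ r] ball[OF y] by blast
      also have "\<dots> \<le> M / r * (n * m) * (r / (2 * M * n))"
        using N ball[OF y] M(1) n r m0
        by (intro mult_mono mult_left_mono) (auto simp: norm_minus_commute sum_nonneg)
      also have "\<dots> = m / 2" using M(1) n r by simp
      finally have "m / 2 \<le> cmod (v y)" using norm_triangle_ineq2[of "v x0" "v y"] by (simp add: m_def)
      then have "(m / 2)\<^sup>2 \<le> (cmod (v y))\<^sup>2" using m0 by (intro power_mono) auto
      then show ?thesis by (simp add: power_divide)
    qed
    have "m\<^sup>2 / 4 * ((\<theta> * r)\<^sup>2 * pi) \<le> l2sq T v"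
      using ball r \<theta> by (intro l2sq_ge_ball[OF T v _ _ low]) auto
    then have "r\<^sup>2 * m\<^sup>2 \<le> C * l2sq T v" using \<theta> by (simp add: C_def power_mult_distrib field_simps)
    moreover have "r\<^sup>2 * (cmod (v x))\<^sup>2 \<le> r\<^sup>2 * m\<^sup>2" using m[OF x] by (intro mult_left_mono power_mono) auto
    ultimately show "r\<^sup>2 * (cmod (v x))\<^sup>2 \<le> C * l2sq T v" by simp
  qed
qed

text \<open>All these triangles lie in a disc of radius \<open>4 h\<close> and contain disjoint discs of radius \<open>r\<close>.\<close>

lemma card_touching_le:
  assumes S: "simplicial S" and r: "0 < r" and h: "0 < h" "\<And>T. T \<in> S \<Longrightarrow> diameter T \<le> h"
    "\<And>T. T \<in> S \<Longrightarrow> \<exists>c. ball c r \<subseteq> T" and T0: "T0 \<in> S"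
  shows "real (card {T\<in>S. T \<inter> T0 \<noteq> {}}) \<le> 16 * (h / r)\<^sup>2"
proof -
  let ?A = "{T\<in>S. T \<inter> T0 \<noteq> {}}"
  note sT = simplicialD(2)[OF S]
  have fin: "finite ?A" using simplicialD(1)[OF S] by simp
  obtain x0 where x0: "x0 \<in> T0" using interior_simplex_nonempty[OF sT[OF T0]] interior_subset by blast
  have sub: "T \<subseteq> ball x0 (4 * h)" if TA: "T \<in> ?A" for T
  proof
    fix z assume z: "z \<in> T"
    obtain y where y: "y \<in> T" "y \<in> T0" and TS: "T \<in> S" using TA by blast
    have "dist x0 y \<le> h"
      using diameter_bounded_bound[OF compact_imp_bounded[OF compact_simplex[OF sT[OF T0]]] x0 y(2)] h(2)[OF T0] by simp
    moreover have "dist y z \<le> h"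
      using diameter_bounded_bound[OF compact_imp_bounded[OF compact_simplex[OF sT[OF TS]]] y(1) z] h(2)[OF TS] by simp
    ultimately show "z \<in> ball x0 (4 * h)" using dist_triangle[of x0 z y] h(1) by simp
  qed
  have lm: "T \<in> lmeasurable" if "T \<in> ?A" for T using lmeasurable_compact[OF compact_simplex[OF sT]] that by blast
  have "measure lebesgue (\<Union>?A) = (\<Sum>T\<in>?A. measure lebesgue T)"
  proof (rule measure_negligible_finite_Union[OF fin lm])
    show "pairwise (\<lambda>T T'. negligible (T \<inter> T')) ?A"
    proof (rule pairwiseI)
      fix T T' assume T: "T \<in> ?A" "T' \<in> ?A" "T \<noteq> T'"
      have "T \<inter> T' \<subseteq> T - interior T" using simplicial_interior_disjoint[OF S, of T T'] T by blast
      then show "negligible (T \<inter> T')" using negligible_simplex_boundary[OF sT, of T] T negligible_subset by blast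
    qed
  qed
  moreover have "measure lebesgue (\<Union>?A) \<le> measure lebesgue (ball x0 (4 * h))"
    using fin lm by (intro measure_mono_fmeasurable fmeasurableD fmeasurable.finite_Union Union_least sub) auto
  moreover have "real (card ?A) * (r\<^sup>2 * pi) \<le> (\<Sum>T\<in>?A. measure lebesgue T)"
  proof (rule sum_bounded_below)
    fix T assume T: "T \<in> ?A"
    then obtain c where "ball c r \<subseteq> T" using h(3) by blast
    then have "measure lebesgue (ball c r) \<le> measure lebesgue T"
      using lm[OF T] by (intro measure_mono_fmeasurable) auto
    then show "r\<^sup>2 * pi \<le> measure lebesgue T" using measure_ball_plane[of r c] r by simp
  qed
  ultimately have "real (card ?A) * (r\<^sup>2 * pi) \<le> measure lebesgue (ball x0 (4 * h))" by linarith
  then have "(real (card ?A) * r\<^sup>2) * pi \<le> (16 * h\<^sup>2) * pi"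
    using measure_ball_plane[of "4 * h" x0] h(1) by (simp add: power_mult_distrib mult.assoc)
  then have "real (card ?A) * r\<^sup>2 \<le> 16 * h\<^sup>2" unfolding mult_le_cancel_right_pos[OF pi_gt_zero] .
  then show ?thesis using r by (simp add: power_divide field_simps)
qed

section \<open>The strip estimate on star-shaped domains\<close>

lemma nn_integral_homothety:
  fixes F :: "real^2 \<Rightarrow> ennreal"
  assumes [measurable]: "F \<in> borel_measurable borel" and t: "0 < t"
  shows "(\<integral>\<^sup>+y. F y \<partial>lborel) = ennreal (t\<^sup>2) * (\<integral>\<^sup>+x. F (c + t *\<^sub>R (x - c)) \<partial>lborel)"
proof -
  have "(\<integral>\<^sup>+y. F y \<partial>lborel) = (\<integral>\<^sup>+y. F y \<partial>density (distr lborel borel (\<lambda>x. (c - t *\<^sub>R c) + t *\<^sub>R x)) (\<lambda>_. ennreal (\<bar>t\<bar> ^ DIM(real^2))))"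
    using lborel_affine[of t "c - t *\<^sub>R c"] t by simp
  also have "\<dots> = (\<integral>\<^sup>+x. ennreal (t\<^sup>2) * F ((c - t *\<^sub>R c) + t *\<^sub>R x) \<partial>lborel)"
    using t by (simp add: nn_integral_density nn_integral_distr)
  also have "\<dots> = ennreal (t\<^sup>2) * (\<integral>\<^sup>+x. F ((c - t *\<^sub>R c) + t *\<^sub>R x) \<partial>lborel)"
    by (rule nn_integral_cmult) measurable
  finally show ?thesis by (simp add: algebra_simps)
qed

text \<open>The fundamental theorem of calculus, with an exceptional finite set of parameters for the points
  where a ray crosses an edge, and in a form in which the right-hand side may be infinite.\<close>

lemma increment_le_nn_integral:
  fixes \<phi> \<phi>' g :: "real \<Rightarrow> real"
  assumes E: "finite E" and ab: "a \<le> b" and cont: "continuous_on {a..b} \<phi>" and pos: "0 \<le> \<phi> a"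
    and der: "\<And>t. t \<in> {a<..<b} - E \<Longrightarrow> (\<phi> has_real_derivative \<phi>' t) (at t)"
    and le: "\<And>t. t \<in> {a<..<b} - E \<Longrightarrow> \<phi>' t \<le> g t"
    and g[measurable]: "g \<in> borel_measurable borel" and g0: "\<And>t. 0 \<le> g t"
  shows "ennreal (\<phi> b) \<le> ennreal (\<phi> a) + (\<integral>\<^sup>+t. ennreal (indicator {a..b} t * g t) \<partial>lborel)"
proof (cases "(\<integral>\<^sup>+t. ennreal (indicator {a..b} t * g t) \<partial>lborel)")
  case (real r)
  define \<psi> where "\<psi> t = (if t \<in> {a<..<b} - E then \<phi>' t else 0)" for t
  have "(\<psi> has_integral (\<phi> b - \<phi> a)) {a..b}"
    by (rule fundamental_theorem_of_calculus_interior_strong[OF E ab _ cont])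
      (use der in \<open>auto simp: \<psi>_def has_real_derivative_iff_has_vector_derivative\<close>)
  moreover have "((\<lambda>t. indicator {a..b} t * g t) has_integral r) UNIV"
    by (rule nn_integral_has_integral) (use real g0 in auto)
  then have "((\<lambda>t. if t \<in> {a..b} then g t else 0) has_integral r) UNIV"
    by (rule has_integral_eq[rotated]) (auto simp: indicator_def)
  then have "(g has_integral r) {a..b}" unfolding has_integral_restrict_UNIV .
  ultimately have "\<phi> b - \<phi> a \<le> r"
    by (rule has_integral_le) (use le g0 in \<open>auto simp: \<psi>_def\<close>)
  then have "ennreal (\<phi> b) \<le> ennreal (\<phi> a + r)" by (intro ennreal_leI) simp
  also have "\<dots> = ennreal (\<phi> a) + ennreal r" using pos real by simp
  finally show ?thesis using real by simp
qed simp

lemma gradsq_bounds_derivative: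
  assumes "linear D"
  shows "cmod (D (h :: real^2)) \<le> norm h * sqrt (\<Sum>i\<in>UNIV. (cmod (D (axis i 1)))\<^sup>2)"
proof -
  have "D h = D (\<Sum>i\<in>UNIV. h $ i *\<^sub>R axis i 1)" by (simp add: basis_expansion[of h, unfolded scalar_mult_eq_scaleR])
  also have "\<dots> = (\<Sum>i\<in>UNIV. h $ i *\<^sub>R D (axis i 1))" using assms by (simp add: linear_sum linear_scale)
  finally have "cmod (D h) \<le> (\<Sum>i\<in>UNIV. \<bar>h $ i\<bar> * \<bar>cmod (D (axis i 1))\<bar>)"
    by (simp add: sum_norm_le)
  also have "\<dots> \<le> L2_set (\<lambda>i. h $ i) UNIV * L2_set (\<lambda>i. cmod (D (axis i 1))) UNIV"
    by (rule L2_set_mult_ineq)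
  finally show ?thesis by (simp add: L2_set_def norm_vec_def)
qed

text \<open>The lines that carry the edges. They form a null set which a generic ray meets in finitely many
  points, and off which every point of the mesh is interior to an element.\<close>

definition all_bary_zero :: "(real^2) set set \<Rightarrow> (real^2) set" where
  "all_bary_zero S = (\<Union>T\<in>S. \<Union>w\<in>vertices T. {x. bary (vertices T) x w = 0})"

lemma negligible_all_bary_zero:
  assumes S: "simplicial S"
  shows "negligible (all_bary_zero S)"
  unfolding all_bary_zero_def
proof (intro negligible_Union finite_imageI)
  show "finite S" by (rule simplicialD(1)[OF S])
  fix Z assume "Z \<in> (\<lambda>T. \<Union>w\<in>vertices T. {x. bary (vertices T) x w = 0}) ` S"
  then obtain T where T: "2 simplex T" "Z = (\<Union>w\<in>vertices T. {x. bary (vertices T) x w = 0})"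
    using simplicialD(2)[OF S] by blast
  show "negligible Z" unfolding T(2)
    by (intro negligible_Union finite_imageI simplex_vertices(1)[OF T(1)]) (auto intro: negligible_bary_zero[OF T(1)])
qed

lemma not_bary_zero_imp_interior:
  assumes "simplicial S" "T \<in> S" "x \<in> T" "x \<notin> all_bary_zero S"
  shows "x \<in> interior T"
proof (rule bary_pos_imp_interior[OF simplicialD(2)[OF assms(1,2)]])
  fix w assume w: "w \<in> vertices T"
  have "0 \<le> bary (vertices T) x w" using mem_simplex_iff[OF simplicialD(2)[OF assms(1,2)], of x] assms(3) w by blast
  moreover have "bary (vertices T) x w \<noteq> 0" using assms(2,4) w by (auto simp: all_bary_zero_def)
  ultimately show "0 < bary (vertices T) x w" by simp
qed

lemma nn_integral_square_simplex:
  assumes "2 simplex T" "poly_on p T v" "0 \<le> a" "0 \<le> b"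
  shows "(\<integral>\<^sup>+x. ennreal (indicator T x * (a * (cmod (v x))\<^sup>2 + b * gradsq v x)) \<partial>lborel) = ennreal (a * l2sq T v + b * h1sq T v)"
proof -
  note I = integrable_squares[OF assms(1,2)]
  have i: "set_integrable lebesgue T (\<lambda>x. a * (cmod (v x))\<^sup>2 + b * gradsq v x)"
    by (intro set_integral_add(1) set_integrable_mult_right I)
  have "(\<integral>\<^sup>+x. ennreal (indicator T x * (a * (cmod (v x))\<^sup>2 + b * gradsq v x)) \<partial>lebesgue)
      = ennreal (LINT x:T|lebesgue. a * (cmod (v x))\<^sup>2 + b * gradsq v x)"
    unfolding set_lebesgue_integral_def
    using nn_integral_eq_integral[OF i[unfolded set_integrable_def]] assms(3,4) gradsq_nonneg by simp
  also have "(LINT x:T|lebesgue. a * (cmod (v x))\<^sup>2 + b * gradsq v x) = a * l2sq T v + b * h1sq T v"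
    unfolding l2sq_def h1sq_def
    by (subst set_integral_add(2)) (auto intro!: I set_integrable_mult_right)
  finally show ?thesis by (simp add: nn_integral_completion)
qed

text \<open>Let \<open>G\<close> be star-shaped about \<open>z\<close> and let \<open>G\<^sub>q\<close> be its image under the homothety with
  ratio \<open>q = 1 - s\<close> about \<open>z\<close>. The integral of \<open>\<bar>v\<bar>\<^sup>2\<close> over \<open>G - G\<^sub>q\<close> is the integral over \<open>G\<close> of
  \<open>\<bar>v(x)\<bar>\<^sup>2 - q\<^sup>2 \<bar>v(z + q(x - z))\<bar>\<^sup>2\<close>, an increment of \<open>t\<^sup>2 \<bar>v(z + t(x - z))\<bar>\<^sup>2\<close> over an
  interval of length \<open>s\<close>. Integrating the derivative along the rays gives a bound which is
  proportional to \<open>s\<close>. Almost every ray meets the edges of the mesh in finitely many points only.\<close>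

lemma strip_estimate:
  assumes S: "simplicial S" and cv: "continuous_on (\<Union>S) v" and pv: "\<And>T. T \<in> S \<Longrightarrow> poly_on p T v"
    and star: "\<And>x. x \<in> interior (\<Union>S) \<Longrightarrow> closed_segment z x \<subseteq> interior (\<Union>S)"
    and D: "\<And>x. x \<in> interior (\<Union>S) \<Longrightarrow> norm (x - z) \<le> D" "0 \<le> D"
    and s: "0 < s" "s \<le> 1 / 2" and \<kappa>: "0 < \<kappa>" and N: "N \<subseteq> S"
    and strip: "\<And>T x. T \<in> N \<Longrightarrow> x \<in> interior (\<Union>S) \<Longrightarrow> z + (1 - s) *\<^sub>R (x - z) \<notin> interior T"
  shows "(\<Sum>T\<in>N. l2sq T v) \<le> 8 * s * (1 / \<kappa>\<^sup>2 + D / (2 * \<kappa>)) * (\<Sum>T\<in>S. h1sq T v + \<kappa>\<^sup>2 * l2sq T v)"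
proof -
  let ?G = "interior (\<Union>S)" and ?Z = "all_bary_zero S"
  define q where "q = 1 - s"
  have q: "1 / 2 \<le> q" "q < 1" "0 < q" using s by (auto simp: q_def)
  note fin = simplicialD(1)[OF S] and sT = simplicialD(2)[OF S]
  have clS: "closed (\<Union>S)" by (rule closed_Union_simplicial[OF S])
  have GS: "?G \<subseteq> \<Union>S" by (rule interior_subset)
  define f where "f x = (cmod (indicator (\<Union>S) x *\<^sub>R v x))\<^sup>2" for x
  have f[measurable]: "f \<in> borel_measurable borel"
    unfolding f_def using borel_measurable_continuous_on_indicator[OF _ cv] clS by measurable
  have f0: "0 \<le> f x" for x by (simp add: f_def)
  have f_eq: "f x = (cmod (v x))\<^sup>2" if "x \<in> \<Union>S" for x using that by (simp add: f_def)
  \<comment> \<open>a Borel version of the integrand which majorises half of the derivative along a ray\<close>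
  have "\<forall>T\<in>S. \<exists>P. polyfun p P \<and> (\<forall>x\<in>T. v x = P x) \<and> (\<forall>x\<in>interior T. \<forall>i. pderivative i v x = pderivative i P x)"
    using poly_on_interior[OF pv] by (metis (no_types))
  then obtain P where P: "\<And>T. T \<in> S \<Longrightarrow> polyfun p (P T)" "\<And>T x. T \<in> S \<Longrightarrow> x \<in> T \<Longrightarrow> v x = P T x"
      "\<And>T x i. T \<in> S \<Longrightarrow> x \<in> interior T \<Longrightarrow> pderivative i v x = pderivative i (P T) x"
    by metis
  define a b where "a = 1 + D * \<kappa> / 2" and "b = D / (2 * \<kappa>)"
  have ab: "0 \<le> a" "0 \<le> b" using D(2) \<kappa> by (auto simp: a_def b_def)
  define g where "g x = (\<Sum>T\<in>S. indicator (interior T) x * (a * (cmod (P T x))\<^sup>2 + b * gradsq (P T) x))" for x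
  have "gradsq (P T) \<in> borel_measurable borel" if "T \<in> S" for T
    unfolding gradsq_def
    by (intro borel_measurable_continuous_onI continuous_intros C1fun_pderivative polyfun_C1fun[OF P(1)[OF that]])
  moreover have "P T \<in> borel_measurable borel" if "T \<in> S" for T
    by (intro borel_measurable_continuous_onI continuous_on_polyfun[OF P(1)[OF that]])
  ultimately have g[measurable]: "g \<in> borel_measurable borel"
    unfolding g_def by (intro borel_measurable_sum borel_measurable_times borel_measurable_add
      borel_measurable_power borel_measurable_norm borel_measurable_const borel_measurable_indicator) auto
  have g0: "0 \<le> g x" for x using ab gradsq_nonneg by (auto simp: g_def intro!: sum_nonneg mult_nonneg_nonneg add_nonneg_nonneg)
  have g_eq: "g x = a * (cmod (v x))\<^sup>2 + b * gradsq v x" if T: "T \<in> S" "x \<in> interior T" for T x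
  proof -
    have "indicator (interior T') x * (a * (cmod (P T' x))\<^sup>2 + b * gradsq (P T') x) = 0" if "T' \<in> S - {T}" for T'
    proof -
      have "x \<notin> interior T'" using simplicial_interior_disjoint[OF S, of T' T] that T interior_subset by blast
      then show ?thesis by simp
    qed
    then have "(\<Sum>T'\<in>S - {T}. indicator (interior T') x * (a * (cmod (P T' x))\<^sup>2 + b * gradsq (P T') x)) = 0"
      by (intro sum.neutral) blast
    then have "g x = indicator (interior T) x * (a * (cmod (P T x))\<^sup>2 + b * gradsq (P T) x)"
      unfolding g_def sum.remove[OF fin T(1)] by simp
    moreover have "gradsq (P T) x = gradsq v x" unfolding gradsq_def using P(3)[OF T] by simp
    moreover have "P T x = v x" using P(2)[OF T(1)] T(2) interior_subset by (metis subsetD)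
    ultimately show ?thesis using T(2) by simp
  qed
  have g_int: "(\<integral>\<^sup>+x. ennreal (g x) \<partial>lborel) \<le> ennreal (\<Sum>T\<in>S. a * l2sq T v + b * h1sq T v)"
  proof -
    have "(\<integral>\<^sup>+x. ennreal (g x) \<partial>lborel) = (\<integral>\<^sup>+x. ennreal (g x) \<partial>lebesgue)" by (simp add: nn_integral_completion)
    also have "\<dots> \<le> (\<integral>\<^sup>+x. (\<Sum>T\<in>S. ennreal (indicator T x * (a * (cmod (v x))\<^sup>2 + b * gradsq v x))) \<partial>lebesgue)"
    proof (rule nn_integral_mono)
      fix x
      have "g x \<le> (\<Sum>T\<in>S. indicator T x * (a * (cmod (v x))\<^sup>2 + b * gradsq v x))"
      proof (cases "\<exists>T\<in>S. x \<in> interior T")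
        case True
        then obtain T where T: "T \<in> S" "x \<in> interior T" by blast
        then have "g x = indicator T x * (a * (cmod (v x))\<^sup>2 + b * gradsq v x)"
          using g_eq[OF T] interior_subset[of T] by (auto simp: indicator_def)
        also have "\<dots> \<le> (\<Sum>T\<in>S. indicator T x * (a * (cmod (v x))\<^sup>2 + b * gradsq v x))"
          using ab gradsq_nonneg T(1) fin by (intro member_le_sum) auto
        finally show ?thesis .
      next
        case False
        then have "g x = 0" unfolding g_def by (intro sum.neutral) (auto simp: indicator_def)
        then show ?thesis using ab gradsq_nonneg by (auto intro!: sum_nonneg mult_nonneg_nonneg add_nonneg_nonneg)
      qed
      then show "ennreal (g x) \<le> (\<Sum>T\<in>S. ennreal (indicator T x * (a * (cmod (v x))\<^sup>2 + b * gradsq v x)))"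
        using ab gradsq_nonneg by (subst sum_ennreal) (auto intro: ennreal_leI)
    qed
    also have "\<dots> = (\<Sum>T\<in>S. \<integral>\<^sup>+x. ennreal (indicator T x * (a * (cmod (v x))\<^sup>2 + b * gradsq v x)) \<partial>lebesgue)"
    proof (rule nn_integral_sum)
      fix T assume T: "T \<in> S"
      have "set_integrable lebesgue T (\<lambda>x. a * (cmod (v x))\<^sup>2 + b * gradsq v x)"
        by (intro set_integral_add(1) set_integrable_mult_right integrable_squares[OF sT[OF T] pv[OF T]])
      then have "(\<lambda>x. indicator T x * (a * (cmod (v x))\<^sup>2 + b * gradsq v x)) \<in> borel_measurable lebesgue"
        unfolding set_integrable_def by simp
      then show "(\<lambda>x. ennreal (indicator T x * (a * (cmod (v x))\<^sup>2 + b * gradsq v x))) \<in> borel_measurable lebesgue"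
        by (rule measurable_compose_rev[OF measurable_ennreal])
    qed
    also have "\<dots> = (\<Sum>T\<in>S. ennreal (a * l2sq T v + b * h1sq T v))"
      using nn_integral_square_simplex[OF sT pv ab] by (intro sum.cong refl) (simp add: nn_integral_completion)
    also have "\<dots> = ennreal (\<Sum>T\<in>S. a * l2sq T v + b * h1sq T v)"
      using ab l2sq_nonneg h1sq_nonneg by (intro sum_ennreal) auto
    finally show ?thesis .
  qed
  have l2: "(\<integral>\<^sup>+x. ennreal (indicator T x * f x) \<partial>lborel) = ennreal (l2sq T v)" if "T \<in> S" for T
  proof -
    have "(\<integral>\<^sup>+x. ennreal (indicator T x * f x) \<partial>lborel)
        = (\<integral>\<^sup>+x. ennreal (indicator T x * (1 * (cmod (v x))\<^sup>2 + 0 * gradsq v x)) \<partial>lborel)"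
      using f_eq[OF UnionI[OF that]] by (intro nn_integral_cong) (auto simp: indicator_def)
    also have "\<dots> = ennreal (1 * l2sq T v + 0 * h1sq T v)"
      by (rule nn_integral_square_simplex[OF sT[OF that] pv[OF that]]) auto
    finally show ?thesis by simp
  qed
  have measT[measurable]: "T \<in> sets borel" if "T \<in> S" for T using closed_simplex[OF sT[OF that]] by simp
  define \<Phi> where "\<Phi> t x = z + t *\<^sub>R (x - z)" for t and x :: "real^2"
  have \<Phi>G: "\<Phi> t x \<in> ?G" if "x \<in> ?G" "0 \<le> t" "t \<le> 1" for t x
  proof -
    have "\<Phi> t x = (1 - t) *\<^sub>R z + t *\<^sub>R x" by (simp add: \<Phi>_def algebra_simps)
    then have "\<Phi> t x \<in> closed_segment z x" using that unfolding closed_segment_def by blast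
    then show ?thesis using star[OF that(1)] by blast
  qed
  \<comment> \<open>the increment along a ray\<close>
  have ray: "ennreal (f x) \<le> ennreal (q\<^sup>2 * f (\<Phi> q x)) + (\<integral>\<^sup>+t. ennreal (indicator {q..1} t * (2 * g (\<Phi> t x))) \<partial>lborel)"
    if x: "x \<in> ?G" "x \<notin> ?Z" for x
  proof -
    define E where "E = (\<Union>T\<in>S. \<Union>w\<in>vertices T. {t. bary (vertices T) (\<Phi> t x) w = 0})"
    have finE: "finite E" unfolding E_def
    proof (intro finite_UN_I fin simplex_vertices(1)[OF sT])
      fix T w assume T: "T \<in> S" and w: "w \<in> vertices T"
      let ?g = "bary_grad T w"
      have aff: "bary (vertices T) (\<Phi> t x) w = bary (vertices T) x w + (t - 1) * (?g \<bullet> (x - z))" for t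
        using bary_affine[OF sT[OF T] w, of "\<Phi> t x"] bary_affine[OF sT[OF T] w, of x]
        by (simp add: \<Phi>_def inner_add_right inner_diff_right algebra_simps)
      have "bary (vertices T) x w \<noteq> 0" using x(2) T w by (auto simp: all_bary_zero_def)
      then have "t = 1 - bary (vertices T) x w / (?g \<bullet> (x - z))" if "bary (vertices T) (\<Phi> t x) w = 0" for t
      proof -
        have k: "bary (vertices T) x w = (1 - t) * (?g \<bullet> (x - z))" using that by (simp add: aff algebra_simps)
        then have "?g \<bullet> (x - z) \<noteq> 0" using \<open>bary (vertices T) x w \<noteq> 0\<close> by auto
        then show ?thesis unfolding k by simp
      qed
      then have "{t. bary (vertices T) (\<Phi> t x) w = 0} \<subseteq> {1 - bary (vertices T) x w / (?g \<bullet> (x - z))}" by blast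
      then show "finite {t. bary (vertices T) (\<Phi> t x) w = 0}" by (rule finite_subset) simp
    qed
    have inT: "\<exists>T\<in>S. \<Phi> t x \<in> interior T" if "t \<in> {q..1} - E" for t
    proof -
      have "\<Phi> t x \<in> ?G" by (rule \<Phi>G[OF x(1)]) (use that q in auto)
      then have "\<Phi> t x \<in> \<Union>S" using GS by blast
      then obtain T where T: "T \<in> S" "\<Phi> t x \<in> T" by blast
      moreover have "\<Phi> t x \<notin> ?Z" using that by (auto simp: E_def all_bary_zero_def)
      ultimately show ?thesis using not_bary_zero_imp_interior[OF S] by blast
    qed
    define \<phi> where "\<phi> t = t\<^sup>2 * (cmod (v (\<Phi> t x)))\<^sup>2" for t
    define \<phi>' where "\<phi>' t = 2 * t * (cmod (v (\<Phi> t x)))\<^sup>2 +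
        t\<^sup>2 * (2 * (v (\<Phi> t x) \<bullet> frechet_derivative v (at (\<Phi> t x)) (x - z)))" for t
    have d\<Phi>: "((\<lambda>t. \<Phi> t x) has_derivative (\<lambda>h. h *\<^sub>R (x - z))) (at t)" for t
      unfolding \<Phi>_def by (auto intro!: derivative_eq_intros)
    have "ennreal (\<phi> 1) \<le> ennreal (\<phi> q) + (\<integral>\<^sup>+t. ennreal (indicator {q..1} t * (2 * g (\<Phi> t x))) \<partial>lborel)"
    proof (rule increment_le_nn_integral[OF finE, of q 1 \<phi> \<phi>'])
      show "continuous_on {q..1} \<phi>"
      proof -
        have "continuous_on {q..1} (\<lambda>t. v (\<Phi> t x))"
        proof (rule continuous_on_compose2[OF cv])
          show "continuous_on {q..1} (\<lambda>t. \<Phi> t x)" unfolding \<Phi>_def by (intro continuous_intros)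
          show "(\<lambda>t. \<Phi> t x) ` {q..1} \<subseteq> \<Union>S"
          proof (rule image_subsetI)
            fix t assume "t \<in> {q..1}"
            then have "\<Phi> t x \<in> ?G" using q by (intro \<Phi>G[OF x(1)]) auto
            then show "\<Phi> t x \<in> \<Union>S" using GS by blast
          qed
        qed
        then show ?thesis unfolding \<phi>_def by (intro continuous_intros)
      qed
      fix t assume t: "t \<in> {q<..<1} - E"
      then obtain T where T: "T \<in> S" "\<Phi> t x \<in> interior T" using inT[of t] by auto
      have dv: "(v has_derivative frechet_derivative v (at (\<Phi> t x))) (at (\<Phi> t x))"
        using poly_on_interior[OF pv[OF T(1)]] T(2) by metis
      have lin: "linear (frechet_derivative v (at (\<Phi> t x)))" using has_derivative_linear[OF dv] .
      have "((\<lambda>t. v (\<Phi> t x)) has_derivative (\<lambda>h. frechet_derivative v (at (\<Phi> t x)) (h *\<^sub>R (x - z)))) (at t)"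
        by (rule has_derivative_compose[OF d\<Phi> dv])
      then have dc: "((\<lambda>t. v (\<Phi> t x)) has_derivative (\<lambda>h. h *\<^sub>R frechet_derivative v (at (\<Phi> t x)) (x - z))) (at t)"
        using lin by (simp add: linear_scale)
      have "((\<lambda>t. t\<^sup>2 * (v (\<Phi> t x) \<bullet> v (\<Phi> t x))) has_derivative (\<lambda>h. h * \<phi>' t)) (at t)"
        unfolding \<phi>'_def
        by (rule derivative_eq_intros dc refl)+
          (auto simp: algebra_simps power2_norm_eq_inner inner_commute)
      then show "(\<phi> has_real_derivative \<phi>' t) (at t)"
        unfolding has_field_derivative_def \<phi>_def power2_norm_eq_inner by (simp add: mult.commute[of _ "\<phi>' t"])
      let ?u = "cmod (v (\<Phi> t x))" and ?w = "sqrt (gradsq v (\<Phi> t x))"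
      have t01: "0 \<le> t" "t \<le> 1" "0 < t" using t q by auto
      have nD: "cmod (frechet_derivative v (at (\<Phi> t x)) (x - z)) \<le> D * ?w"
      proof -
        have "cmod (frechet_derivative v (at (\<Phi> t x)) (x - z)) \<le> norm (x - z) * ?w"
          using gradsq_bounds_derivative[OF lin, of "x - z"] by (simp add: gradsq_def pderivative_def)
        also have "\<dots> \<le> D * ?w" using D(1)[OF x(1)] gradsq_nonneg by (intro mult_right_mono) auto
        finally show ?thesis .
      qed
      have "v (\<Phi> t x) \<bullet> frechet_derivative v (at (\<Phi> t x)) (x - z) \<le> ?u * (D * ?w)"
        using norm_cauchy_schwarz[of "v (\<Phi> t x)" "frechet_derivative v (at (\<Phi> t x)) (x - z)"] nD
        by (meson mult_left_mono norm_ge_zero order_trans)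
      moreover have uw: "?u * ?w \<le> (\<kappa> * ?u\<^sup>2 + gradsq v (\<Phi> t x) / \<kappa>) / 2"
      proof -
        have "0 \<le> (\<kappa> * ?u - ?w)\<^sup>2" by simp
        also have "\<dots> = \<kappa>\<^sup>2 * ?u\<^sup>2 - 2 * \<kappa> * (?u * ?w) + gradsq v (\<Phi> t x)"
          using gradsq_nonneg by (simp add: power2_diff power_mult_distrib)
        finally show ?thesis using \<kappa> by (simp add: field_simps power2_eq_square)
      qed
      ultimately have "v (\<Phi> t x) \<bullet> frechet_derivative v (at (\<Phi> t x)) (x - z)
          \<le> D * ((\<kappa> * ?u\<^sup>2 + gradsq v (\<Phi> t x) / \<kappa>) / 2)"
        using mult_left_mono[OF uw D(2)] by (simp add: mult_ac)
      also have "D * ((\<kappa> * ?u\<^sup>2 + gradsq v (\<Phi> t x) / \<kappa>) / 2) = D * \<kappa> / 2 * ?u\<^sup>2 + b * gradsq v (\<Phi> t x)"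
        using \<kappa> by (simp add: b_def field_simps)
      finally have B: "v (\<Phi> t x) \<bullet> frechet_derivative v (at (\<Phi> t x)) (x - z) \<le> D * \<kappa> / 2 * ?u\<^sup>2 + b * gradsq v (\<Phi> t x)" .
      have "t\<^sup>2 \<le> 1" using t01 by (simp add: power_le_one)
      have B0: "0 \<le> D * \<kappa> / 2 * ?u\<^sup>2 + b * gradsq v (\<Phi> t x)" using D(2) \<kappa> ab gradsq_nonneg by auto
      have "\<phi>' t \<le> 2 * 1 * ?u\<^sup>2 + t\<^sup>2 * (2 * (D * \<kappa> / 2 * ?u\<^sup>2 + b * gradsq v (\<Phi> t x)))"
        unfolding \<phi>'_def using t01 B by (intro add_mono mult_mono mult_left_mono) auto
      also have "\<dots> \<le> 2 * 1 * ?u\<^sup>2 + 1 * (2 * (D * \<kappa> / 2 * ?u\<^sup>2 + b * gradsq v (\<Phi> t x)))"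
        using \<open>t\<^sup>2 \<le> 1\<close> B0 by (intro add_left_mono mult_right_mono) auto
      also have "\<dots> = 2 * g (\<Phi> t x)" using g_eq[OF T] by (simp add: a_def algebra_simps)
      finally show "\<phi>' t \<le> 2 * g (\<Phi> t x)" .
    next
      show "(\<lambda>t. 2 * g (\<Phi> t x)) \<in> borel_measurable borel" unfolding \<Phi>_def by measurable
    qed (use q g0 in \<open>auto simp: \<phi>_def\<close>)
    moreover have "x \<in> \<Union>S" using x(1) GS by blast
    then have "\<phi> 1 = f x" using f_eq[of x] by (simp add: \<phi>_def \<Phi>_def)
    moreover have "\<Phi> q x \<in> ?G" by (rule \<Phi>G[OF x(1)]) (use q in auto)
    then have "\<Phi> q x \<in> \<Union>S" using GS by blast
    then have "\<phi> q = q\<^sup>2 * f (\<Phi> q x)" using f_eq[of "\<Phi> q x"] by (simp add: \<phi>_def)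
    ultimately show ?thesis by simp
  qed
  have aeZ: "AE x in lborel. x \<notin> ?Z"
    using AE_not_in_negligible[OF negligible_all_bary_zero[OF S]] by (simp add: AE_completion_iff)
  have opG: "?G \<in> sets borel" by simp
  \<comment> \<open>the homothetic image of the domain, as a preimage\<close>
  define Gq where "Gq = {y. \<Phi> (1 / q) y \<in> ?G}"
  have inv: "\<Phi> q (\<Phi> (1 / q) y) = y" "\<Phi> (1 / q) (\<Phi> q y) = y" for y using q by (simp_all add: \<Phi>_def)
  have Gq: "Gq \<in> sets borel"
  proof -
    have "open (\<Phi> (1 / q) -` ?G)" unfolding \<Phi>_def by (intro open_vimage open_interior continuous_intros)
    then show ?thesis by (simp add: Gq_def vimage_def)
  qed
  have Gq_sub: "Gq \<subseteq> ?G"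
  proof
    fix y assume "y \<in> Gq"
    then have "\<Phi> (1 / q) y \<in> ?G" by (simp add: Gq_def)
    then have "\<Phi> q (\<Phi> (1 / q) y) \<in> ?G" by (rule \<Phi>G) (use q in auto)
    then show "y \<in> ?G" by (simp only: inv)
  qed
  have st: "\<Phi> q y \<notin> interior T" if "T \<in> N" "y \<in> ?G" for T y
    using strip[OF that] by (simp add: \<Phi>_def q_def)
  let ?I = "\<integral>\<^sup>+y. ennreal (indicator Gq y * f y) \<partial>lborel"
  have I2: "?I = (\<integral>\<^sup>+x. ennreal (indicator ?G x * (q\<^sup>2 * f (\<Phi> q x))) \<partial>lborel)"
  proof -
    have "?I = ennreal (q\<^sup>2) * (\<integral>\<^sup>+x. ennreal (indicator Gq (\<Phi> q x) * f (\<Phi> q x)) \<partial>lborel)"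
      unfolding \<Phi>_def by (rule nn_integral_homothety) (use Gq q in \<open>simp_all\<close>)
    also have "\<dots> = (\<integral>\<^sup>+x. ennreal (q\<^sup>2) * ennreal (indicator Gq (\<Phi> q x) * f (\<Phi> q x)) \<partial>lborel)"
      by (rule nn_integral_cmult[symmetric]) (use Gq in \<open>simp add: \<Phi>_def\<close>)
    also have "\<dots> = (\<integral>\<^sup>+x. ennreal (indicator ?G x * (q\<^sup>2 * f (\<Phi> q x))) \<partial>lborel)"
      using f0 by (intro nn_integral_cong) (auto simp: ennreal_mult'[symmetric] Gq_def inv indicator_def)
    finally show ?thesis .
  qed
  let ?J = "\<integral>\<^sup>+x. \<integral>\<^sup>+t. ennreal (indicator {q..1} t * (2 * g (\<Phi> t x))) \<partial>lborel \<partial>lborel"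
  have J: "?J \<le> ennreal (8 * s) * (\<integral>\<^sup>+x. ennreal (g x) \<partial>lborel)"
  proof -
    have "?J = (\<integral>\<^sup>+t. \<integral>\<^sup>+x. ennreal (indicator {q..1} t * (2 * g (\<Phi> t x))) \<partial>lborel \<partial>lborel)"
      unfolding \<Phi>_def by (rule lborel_pair.Fubini'[symmetric]) (simp add: split_beta')
    also have "\<dots> \<le> (\<integral>\<^sup>+t. ennreal (8 * indicator {q..1} t) * (\<integral>\<^sup>+x. ennreal (g x) \<partial>lborel) \<partial>lborel)"
    proof (rule nn_integral_mono)
      fix t
      show "(\<integral>\<^sup>+x. ennreal (indicator {q..1} t * (2 * g (\<Phi> t x))) \<partial>lborel)
          \<le> ennreal (8 * indicator {q..1} t) * (\<integral>\<^sup>+x. ennreal (g x) \<partial>lborel)"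
      proof (cases "t \<in> {q..1}")
        case True
        then have t: "1 / 2 \<le> t" "t \<le> 1" using q by auto
        have "(1 / 2)\<^sup>2 \<le> t\<^sup>2" using t by (intro power_mono) auto
        then have t4: "2 \<le> 8 * t\<^sup>2" by (simp add: power2_eq_square)
        have m: "(\<lambda>x. ennreal (g (\<Phi> t x))) \<in> borel_measurable borel" unfolding \<Phi>_def by measurable
        have "(\<integral>\<^sup>+x. ennreal (indicator {q..1} t * (2 * g (\<Phi> t x))) \<partial>lborel)
            = (\<integral>\<^sup>+x. ennreal 2 * ennreal (g (\<Phi> t x)) \<partial>lborel)"
          using True by (intro nn_integral_cong) (simp add: ennreal_mult')
        also have "\<dots> = ennreal 2 * (\<integral>\<^sup>+x. ennreal (g (\<Phi> t x)) \<partial>lborel)"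
          using m by (intro nn_integral_cmult) simp
        also have "\<dots> \<le> ennreal (8 * t\<^sup>2) * (\<integral>\<^sup>+x. ennreal (g (\<Phi> t x)) \<partial>lborel)"
          using t4 by (intro mult_right_mono ennreal_leI) auto
        also have "\<dots> = ennreal 8 * (ennreal (t\<^sup>2) * (\<integral>\<^sup>+x. ennreal (g (\<Phi> t x)) \<partial>lborel))"
          by (subst ennreal_mult') (auto simp: mult.assoc)
        also have "ennreal (t\<^sup>2) * (\<integral>\<^sup>+x. ennreal (g (\<Phi> t x)) \<partial>lborel) = (\<integral>\<^sup>+x. ennreal (g x) \<partial>lborel)"
          unfolding \<Phi>_def using t by (intro nn_integral_homothety[symmetric]) auto
        finally show ?thesis using True by simp
      qed simp
    qed
    also have "\<dots> = (\<integral>\<^sup>+t. ennreal (8 * indicator {q..1} t) \<partial>lborel) * (\<integral>\<^sup>+x. ennreal (g x) \<partial>lborel)"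
      by (rule nn_integral_multc) simp
    also have "(\<integral>\<^sup>+t. ennreal (8 * indicator {q..1} t) \<partial>lborel) = (\<integral>\<^sup>+t. ennreal 8 * indicator {q..1} t \<partial>lborel)"
      by (intro nn_integral_cong) (auto simp: indicator_def)
    also have "\<dots> = ennreal 8 * ennreal (1 - q)" using q by (simp add: nn_integral_cmult_indicator)
    also have "\<dots> = ennreal (8 * s)" using s by (subst ennreal_mult') (simp_all add: q_def)
    finally show ?thesis .
  qed
  \<comment> \<open>off a null set every point of the mesh lies in exactly one element\<close>
  have uniq: "(\<Sum>T\<in>M. indicator T x) = (if \<exists>T\<in>M. x \<in> T then 1 else 0 :: real)" if "M \<subseteq> S" "x \<notin> ?Z" for M x
  proof (cases "\<exists>T\<in>M. x \<in> T")
    case True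
    then obtain T where T: "T \<in> M" "x \<in> T" by blast
    then have xi: "x \<in> interior T" using not_bary_zero_imp_interior[OF S] that by blast
    have "x \<notin> T'" if "T' \<in> M - {T}" for T'
      using simplicial_interior_disjoint[OF S, of T T'] that \<open>M \<subseteq> S\<close> T xi by blast
    then have "(\<Sum>T'\<in>M. indicator T' x) = (indicator T x :: real)"
      using finite_subset[OF that(1) fin] T(1) by (subst sum.remove[of M T]) (auto simp: indicator_def intro!: sum.neutral)
    then show ?thesis using True T by (auto simp: indicator_def)
  qed (auto intro!: sum.neutral simp: indicator_def)
  have "ennreal (\<Sum>T\<in>N. l2sq T v) + ?I = (\<integral>\<^sup>+x. (\<Sum>T\<in>N. ennreal (indicator T x * f x)) + ennreal (indicator Gq x * f x) \<partial>lborel)"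
  proof -
    have "(\<integral>\<^sup>+x. (\<Sum>T\<in>N. ennreal (indicator T x * f x)) + ennreal (indicator Gq x * f x) \<partial>lborel)
        = (\<Sum>T\<in>N. \<integral>\<^sup>+x. ennreal (indicator T x * f x) \<partial>lborel) + ?I"
      using N measT Gq by (subst nn_integral_add, (auto intro!: borel_measurable_sum)[2], subst nn_integral_sum) auto
    also have "(\<Sum>T\<in>N. \<integral>\<^sup>+x. ennreal (indicator T x * f x) \<partial>lborel) = ennreal (\<Sum>T\<in>N. l2sq T v)"
    proof -
      have "(\<Sum>T\<in>N. \<integral>\<^sup>+x. ennreal (indicator T x * f x) \<partial>lborel) = (\<Sum>T\<in>N. ennreal (l2sq T v))"
        by (intro sum.cong refl l2) (use N in blast)
      also have "\<dots> = ennreal (\<Sum>T\<in>N. l2sq T v)" by (rule sum_ennreal) (rule l2sq_nonneg)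
      finally show ?thesis .
    qed
    finally show ?thesis ..
  qed
  also have "\<dots> \<le> (\<integral>\<^sup>+x. ennreal (indicator ?G x * (q\<^sup>2 * f (\<Phi> q x))) +
        (\<integral>\<^sup>+t. ennreal (indicator {q..1} t * (2 * g (\<Phi> t x))) \<partial>lborel) \<partial>lborel)"
  proof (rule nn_integral_mono_AE)
    show "AE x in lborel. (\<Sum>T\<in>N. ennreal (indicator T x * f x)) + ennreal (indicator Gq x * f x)
      \<le> ennreal (indicator ?G x * (q\<^sup>2 * f (\<Phi> q x))) + (\<integral>\<^sup>+t. ennreal (indicator {q..1} t * (2 * g (\<Phi> t x))) \<partial>lborel)"
      using aeZ
    proof eventually_elim
      fix x assume x: "x \<notin> ?Z"
      have "(\<Sum>T\<in>N. ennreal (indicator T x * f x)) = ennreal ((\<Sum>T\<in>N. indicator T x) * f x)"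
        using f0 by (subst sum_ennreal) (auto simp: sum_distrib_right)
      then have eq: "(\<Sum>T\<in>N. ennreal (indicator T x * f x)) + ennreal (indicator Gq x * f x)
          = ennreal (((if \<exists>T\<in>N. x \<in> T then 1 else 0) + indicator Gq x) * f x)"
        using f0 uniq[OF N x] by (simp add: ring_distribs ennreal_plus[symmetric] del: ennreal_plus)
      show "(\<Sum>T\<in>N. ennreal (indicator T x * f x)) + ennreal (indicator Gq x * f x)
        \<le> ennreal (indicator ?G x * (q\<^sup>2 * f (\<Phi> q x))) + (\<integral>\<^sup>+t. ennreal (indicator {q..1} t * (2 * g (\<Phi> t x))) \<partial>lborel)"
      proof (cases "x \<in> ?G")
        case True
        have "x \<notin> Gq" if "T \<in> N" "x \<in> T" for T
        proof
          assume "x \<in> Gq"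
          then have "\<Phi> q (\<Phi> (1 / q) x) \<notin> interior T" by (intro st[OF that(1)]) (simp add: Gq_def)
          moreover have "x \<in> interior T" using not_bary_zero_imp_interior[OF S _ that(2) x] N that(1) by blast
          ultimately show False by (simp add: inv)
        qed
        then have "(if \<exists>T\<in>N. x \<in> T then 1 else 0) + indicator Gq x \<le> (1::real)" by (auto simp: indicator_def)
        from mult_right_mono[OF this f0[of x]]
        have "((if \<exists>T\<in>N. x \<in> T then 1 else 0) + indicator Gq x) * f x \<le> f x" by simp
        then have "ennreal (((if \<exists>T\<in>N. x \<in> T then 1 else 0) + indicator Gq x) * f x) \<le> ennreal (f x)"
          by (rule ennreal_leI)
        also note ray[OF True x]
        finally show ?thesis unfolding eq using True by simp
      next
        case False
        then have "x \<notin> Gq" using Gq_sub by blast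
        moreover have "\<not> (\<exists>T\<in>N. x \<in> T)"
          using False not_bary_zero_imp_interior[OF S _ _ x] N interior_mono[OF Union_upper] by blast
        ultimately show ?thesis unfolding eq by simp
      qed
    qed
  qed
  also have "\<dots> = ?I + ?J"
    unfolding I2
  proof (rule nn_integral_add)
    show "(\<lambda>x. ennreal (indicator ?G x * (q\<^sup>2 * f (\<Phi> q x)))) \<in> borel_measurable lborel"
      unfolding \<Phi>_def using opG by simp
    show "(\<lambda>x. \<integral>\<^sup>+t. ennreal (indicator {q..1} t * (2 * g (\<Phi> t x))) \<partial>lborel) \<in> borel_measurable lborel"
      unfolding \<Phi>_def by (intro lborel.borel_measurable_nn_integral) (simp add: split_beta')
  qed
  finally have main: "?I + ennreal (\<Sum>T\<in>N. l2sq T v) \<le> ?I + ?J" by (simp only: add.commute)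
  have "?I \<le> (\<integral>\<^sup>+y. (\<Sum>T\<in>S. ennreal (indicator T y * f y)) \<partial>lborel)"
  proof (rule nn_integral_mono)
    fix y
    show "ennreal (indicator Gq y * f y) \<le> (\<Sum>T\<in>S. ennreal (indicator T y * f y))"
    proof (cases "y \<in> Gq")
      case True
      then obtain T where T: "T \<in> S" "y \<in> T" using Gq_sub interior_subset by blast
      then have "ennreal (indicator T y * f y) \<le> (\<Sum>T\<in>S. ennreal (indicator T y * f y))"
        using fin by (intro member_le_sum) auto
      then show ?thesis using True T by simp
    qed simp
  qed
  also have "\<dots> = (\<Sum>T\<in>S. ennreal (l2sq T v))"
    using measT l2 by (subst nn_integral_sum) auto
  also have "\<dots> < \<infinity>" by (simp add: sum_ennreal l2sq_nonneg)
  finally have fI: "?I \<noteq> \<infinity>" by simp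
  have "ennreal (\<Sum>T\<in>N. l2sq T v) \<le> ?J"
    using main[unfolded ennreal_add_left_cancel_le] fI by blast
  also have "\<dots> \<le> ennreal (8 * s) * ennreal (\<Sum>T\<in>S. a * l2sq T v + b * h1sq T v)"
    using J g_int by (meson mult_left_mono order_trans zero_le)
  also have "\<dots> = ennreal (8 * s * (\<Sum>T\<in>S. a * l2sq T v + b * h1sq T v))"
    using s ab l2sq_nonneg h1sq_nonneg by (intro ennreal_mult[symmetric] sum_nonneg add_nonneg_nonneg mult_nonneg_nonneg) auto
  finally have "(\<Sum>T\<in>N. l2sq T v) \<le> 8 * s * (\<Sum>T\<in>S. a * l2sq T v + b * h1sq T v)"
    using s ab l2sq_nonneg h1sq_nonneg
    by (subst (asm) ennreal_le_iff) (auto intro!: sum_nonneg mult_nonneg_nonneg add_nonneg_nonneg)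
  also have "\<dots> \<le> 8 * s * (\<Sum>T\<in>S. (1 / \<kappa>\<^sup>2 + D / (2 * \<kappa>)) * (h1sq T v + \<kappa>\<^sup>2 * l2sq T v))"
  proof (intro mult_left_mono sum_mono)
    fix T
    have "(1 / \<kappa>\<^sup>2 + D / (2 * \<kappa>)) * (h1sq T v + \<kappa>\<^sup>2 * l2sq T v)
        = a * l2sq T v + b * h1sq T v + h1sq T v / \<kappa>\<^sup>2"
      using \<kappa> by (simp add: a_def b_def field_simps power2_eq_square)
    then show "a * l2sq T v + b * h1sq T v \<le> (1 / \<kappa>\<^sup>2 + D / (2 * \<kappa>)) * (h1sq T v + \<kappa>\<^sup>2 * l2sq T v)"
      using h1sq_nonneg[of T v] by simp
  qed (use s in auto)
  finally show ?thesis by (simp add: sum_distrib_left[symmetric] mult.assoc)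
qed

section \<open>The boundary of a union of triangles\<close>

lemma closure_interior_Union:
  assumes S: "simplicial S"
  shows "closure (interior (\<Union>S)) = \<Union>S"
proof
  show "closure (interior (\<Union>S)) \<subseteq> \<Union>S"
    using closure_minimal[OF interior_subset closed_Union_simplicial[OF S]] .
  show "\<Union>S \<subseteq> closure (interior (\<Union>S))"
  proof (rule Union_least)
    fix T assume T: "T \<in> S"
    have "T = closure (interior T)" using closure_interior_simplex[OF simplicialD(2)[OF S T]] by simp
    also have "\<dots> \<subseteq> closure (interior (\<Union>S))" using T by (intro closure_mono interior_mono) blast
    finally show "T \<subseteq> closure (interior (\<Union>S))" .
  qed
qed

lemma frontier_interior_Union:
  assumes S: "simplicial S"
  shows "frontier (interior (\<Union>S)) = \<Union>S - interior (\<Union>S)"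
  using closure_interior_Union[OF S] by (simp add: frontier_def)

lemma edge_of_simplex:
  assumes T: "2 simplex T"
  shows "e edge_of T \<longleftrightarrow> (\<exists>a b. a \<in> vertices T \<and> b \<in> vertices T \<and> a \<noteq> b \<and> e = closed_segment a b)"
proof -
  note V = simplex_vertices[OF T]
  have f: "e face_of T \<longleftrightarrow> (\<exists>W. W \<subseteq> vertices T \<and> e = convex hull W)"
    using face_of_convex_hull_affine_independent[OF V(2), of e] V(4) by simp
  have d: "aff_dim (convex hull W) = 1 \<longleftrightarrow> card W = 2" if "W \<subseteq> vertices T" for W
    using aff_dim_affine_independent[OF affine_independent_subset[OF V(2) that]] by (auto simp: aff_dim_convex_hull)
  show ?thesis
  proof
    assume "e edge_of T"
    then obtain W where W: "W \<subseteq> vertices T" "e = convex hull W" "card W = 2"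
      using f d by (auto simp: edge_of_def)
    then obtain a b where "W = {a, b}" "a \<noteq> b" by (auto simp: card_2_iff)
    then show "\<exists>a b. a \<in> vertices T \<and> b \<in> vertices T \<and> a \<noteq> b \<and> e = closed_segment a b"
    proof (intro exI conjI)
      show "a \<in> vertices T" "b \<in> vertices T" using W(1) \<open>W = {a, b}\<close> by blast+
      show "a \<noteq> b" by fact
      show "e = closed_segment a b" unfolding W(2) \<open>W = {a, b}\<close> by (rule segment_convex_hull[symmetric])
    qed
  next
    assume "\<exists>a b. a \<in> vertices T \<and> b \<in> vertices T \<and> a \<noteq> b \<and> e = closed_segment a b"
    then obtain a b where ab: "{a, b} \<subseteq> vertices T" "a \<noteq> b" "e = convex hull {a, b}"
      by (auto simp: segment_convex_hull)
    then have "e face_of T" unfolding f by blast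
    moreover have "aff_dim e = 1" unfolding ab(3) d[OF ab(1)] using ab(2) by simp
    ultimately show "e edge_of T" unfolding edge_of_def ..
  qed
qed

text \<open>If an edge meets the interior of the union in one of its relatively interior points, then
  there are triangles on both sides of the edge, and these two triangles together are a neighbourhood
  of all its relatively interior points.\<close>

lemma edge_interior_propagates:
  assumes S: "simplicial S" and T: "T \<in> S" and V: "vertices T = {a, b, w}" and ne: "a \<noteq> b" "w \<noteq> a" "w \<noteq> b"
    and z: "z \<in> closed_segment a b" "z \<noteq> a" "z \<noteq> b" "z \<in> interior (\<Union>S)"
    and y: "y \<in> closed_segment a b" "y \<noteq> a" "y \<noteq> b"
  shows "y \<in> interior (\<Union>S)"
proof -
  note sT = simplicialD(2)[OF S T]
  note VT = simplex_vertices[OF sT]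
  let ?\<beta> = "bary (vertices T)"
  have seg: "?\<beta> x w = 0 \<and> 0 < ?\<beta> x a \<and> 0 < ?\<beta> x b" if x: "x \<in> closed_segment a b" "x \<noteq> a" "x \<noteq> b" for x
  proof -
    obtain u where u: "0 \<le> u" "u \<le> 1" "x = (1 - u) *\<^sub>R a + u *\<^sub>R b" using x(1) by (auto simp: in_segment)
    have u': "0 < u" "u < 1" using u x(2,3) by (auto simp: less_le)
    define c where "c v = (if v = a then 1 - u else if v = b then u else 0)" for v
    have "?\<beta> x v = c v" if "v \<in> vertices T" for v
    proof (rule bary_unique[OF VT(2) _ _ that])
      show "sum c (vertices T) = 1" using V ne by (simp add: c_def)
      show "(\<Sum>v\<in>vertices T. c v *\<^sub>R v) = x" using V ne u(3) by (simp add: c_def)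
    qed
    then show ?thesis using V ne u' by (simp add: c_def)
  qed
  note z0 = seg[OF z(1-3)]
  \<comment> \<open>a point slightly beyond the edge, and a triangle which contains both this point and \<open>z\<close>\<close>
  have "closed (\<Union>{T'\<in>S. z \<notin> T'})" 
    by (rule closed_Union_simplicial[OF simplicial_subset[OF S]]) blast
  then have "open (interior (\<Union>S) - \<Union>{T'\<in>S. z \<notin> T'})" by (intro open_Diff) auto
  then obtain \<delta> where \<delta>: "\<delta> > 0" "ball z \<delta> \<subseteq> interior (\<Union>S) - \<Union>{T'\<in>S. z \<notin> T'}"
    using z(4) open_contains_ball by (metis (no_types, lifting) DiffI UnionE mem_Collect_eq)
  define n where "n = norm (w - z) + 1"
  have n: "0 < n" "norm (w - z) < n" by (simp_all add: n_def add_nonneg_pos)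
  define t where "t = \<delta> / (2 * n)"
  have t: "0 < t" using \<delta>(1) n(1) by (simp add: t_def)
  have "t * norm (w - z) < t * n" using t n(2) by simp
  also have "\<dots> = \<delta> / 2" using n(1) by (simp add: t_def)
  finally have "t * norm (w - z) < \<delta>" using \<delta>(1) by simp
  define x where "x = z - t *\<^sub>R (w - z)"
  have "x \<in> ball z \<delta>" using \<open>t * norm (w - z) < \<delta>\<close> t by (simp add: x_def dist_norm)
  then obtain T' where T': "T' \<in> S" "x \<in> T'" "z \<in> T'" using \<delta>(2) interior_subset by blast
  have affT: "?\<beta> (u + s *\<^sub>R (k - u)) v = ?\<beta> u v + s * (?\<beta> k v - ?\<beta> u v)" if "v \<in> vertices T" for u k s v
    using bary_affine[OF sT that, of "u + s *\<^sub>R (k - u)"] bary_affine[OF sT that, of u] bary_affine[OF sT that, of k]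
    by (simp add: inner_add_right inner_diff_right algebra_simps)
  have bw: "?\<beta> w w = 1" using bary_vertex[OF VT(2), of w w] V by simp
  have xw: "?\<beta> x w = - t" using affT[of w z "- t" w] V z0 bw by (simp add: x_def)
  then have "x \<notin> T" using mem_simplex_iff[OF sT, of x] V t by auto
  then have TT': "T' \<noteq> T" using T' by blast
  note sT' = simplicialD(2)[OF S T'(1)]
  note VT' = simplex_vertices[OF sT']
  obtain W where W: "W \<subseteq> vertices T" "W \<subseteq> vertices T'" "T \<inter> T' = convex hull W"
    using common_face[OF S T T'(1)] .
  have "z \<in> T" using mem_simplex_iff[OF sT, of z] V z0 by auto
  then have zW: "z \<in> affine hull W" using T' W(3) convex_hull_subset_affine_hull by blast
  have aW: "a \<in> W" using bary_subset[OF VT(2) W(1) zW, of a] V z0 by (auto split: if_splits)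
  have bW: "b \<in> W" using bary_subset[OF VT(2) W(1) zW, of b] V z0 by (auto split: if_splits)
  have "w \<notin> W"
  proof
    assume "w \<in> W"
    then have "vertices T \<subseteq> W" unfolding V using aW bW by simp
    then have "W = vertices T" using W(1) by (rule subset_antisym[rotated])
    then have "T \<inter> T' = T" using W(3) VT(4) by simp
    then show False using simplicial_interior_disjoint[OF S T T'(1)] TT' interior_simplex_nonempty[OF sT] interior_subset by blast
  qed
  have "card (vertices T') = 3" by (rule card_vertices[OF sT'])
  then have "card (vertices T' - {a, b}) = 1" using aW bW W(2) ne by (subst card_Diff_subset) auto
  then obtain w' where w': "vertices T' - {a, b} = {w'}" by (auto simp: card_1_singleton_iff)
  then have V': "vertices T' = {a, b, w'}" "w' \<noteq> a" "w' \<noteq> b" using aW bW W(2) by auto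
  let ?\<gamma> = "bary (vertices T')"
  have seg': "?\<gamma> x w' = 0 \<and> 0 < ?\<gamma> x a \<and> 0 < ?\<gamma> x b" if x: "x \<in> closed_segment a b" "x \<noteq> a" "x \<noteq> b" for x
  proof -
    obtain u where u: "0 \<le> u" "u \<le> 1" "x = (1 - u) *\<^sub>R a + u *\<^sub>R b" using x(1) by (auto simp: in_segment)
    have u': "0 < u" "u < 1" using u x(2,3) by (auto simp: less_le)
    define c where "c v = (if v = a then 1 - u else if v = b then u else 0)" for v
    have "?\<gamma> x v = c v" if "v \<in> vertices T'" for v
    proof (rule bary_unique[OF VT'(2) _ _ that])
      show "sum c (vertices T') = 1" using V' ne by (simp add: c_def)
      show "(\<Sum>v\<in>vertices T'. c v *\<^sub>R v) = x" using V' ne u(3) by (simp add: c_def)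
    qed
    then show ?thesis using V' ne u' by (simp add: c_def)
  qed
  \<comment> \<open>the coordinates belonging to \<open>w\<close> and \<open>w'\<close> both vanish on the edge, hence are proportional\<close>
  have proportional: "?\<gamma> k w' = ?\<beta> k w * ?\<gamma> w w'" for k
  proof -
    have w'T': "w' \<in> vertices T'" using V' by simp
    obtain c g where cg: "\<And>k. ?\<gamma> k w' = c + g \<bullet> k" using bary_affine[OF sT' w'T'] by blast
    have "?\<gamma> a w' = 0" "?\<gamma> b w' = 0" using bary_vertex[OF VT'(2), of a w'] bary_vertex[OF VT'(2), of b w'] V' by auto
    then have ab: "c + g \<bullet> a = 0" "c + g \<bullet> b = 0" using cg[of a] cg[of b] by simp_all
    have s1: "?\<beta> k a + ?\<beta> k b + ?\<beta> k w = 1" using sum_bary[OF sT, of k] V ne by (simp add: add.assoc)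
    have "k = ?\<beta> k a *\<^sub>R a + ?\<beta> k b *\<^sub>R b + ?\<beta> k w *\<^sub>R w" using sum_bary_scaleR[OF sT, of k] V ne by (simp add: add.assoc)
    then have "g \<bullet> k = g \<bullet> (?\<beta> k a *\<^sub>R a + ?\<beta> k b *\<^sub>R b + ?\<beta> k w *\<^sub>R w)" by (rule arg_cong)
    also have "\<dots> = ?\<beta> k a * (g \<bullet> a) + ?\<beta> k b * (g \<bullet> b) + ?\<beta> k w * (g \<bullet> w)"
      by (simp only: inner_add_right inner_scaleR_right)
    also have "g \<bullet> a = - c" using ab by simp
    also have "g \<bullet> b = - c" using ab by simp
    finally have "c + g \<bullet> k = c * (1 - ?\<beta> k a - ?\<beta> k b) + ?\<beta> k w * (g \<bullet> w)" by (simp add: algebra_simps)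
    also have "1 - ?\<beta> k a - ?\<beta> k b = ?\<beta> k w" using s1 by simp
    finally show ?thesis by (simp add: cg algebra_simps)
  qed
  have "0 \<le> ?\<gamma> x w'" using mem_simplex_iff[OF sT', of x] T'(2) V' by auto
  then have "0 \<le> - t * ?\<gamma> w w'" using proportional[of x] xw by simp
  then have neg: "?\<gamma> w w' \<le> 0" using t by (simp add: mult_le_0_iff zero_le_mult_iff)
  define U where "U = {x. 0 < ?\<beta> x a} \<inter> {x. 0 < ?\<beta> x b} \<inter> {x. 0 < ?\<gamma> x a} \<inter> {x. 0 < ?\<gamma> x b}"
  have "open U" unfolding U_def
    by (intro open_Int open_Collect_less continuous_on_const continuous_on_bary sT sT') (auto simp: V V')
  moreover have "y \<in> U" using seg[OF y] seg'[OF y] by (simp add: U_def)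
  moreover have "U \<subseteq> \<Union>S"
  proof
    fix k assume k: "k \<in> U"
    show "k \<in> \<Union>S"
    proof (cases "0 \<le> ?\<beta> k w")
      case True
      then have "k \<in> T" using k mem_simplex_iff[OF sT, of k] V by (auto simp: U_def)
      then show ?thesis using T by blast
    next
      case False
      then have "0 \<le> ?\<gamma> k w'" using proportional[of k] neg by (simp add: mult_nonpos_nonpos)
      then have "k \<in> T'" using k mem_simplex_iff[OF sT', of k] V' by (auto simp: U_def)
      then show ?thesis using T' by blast
    qed
  qed
  ultimately show ?thesis by (rule interiorI)
qed

lemma finite_edges:
  fixes T :: "(real^2) set"
  assumes "2 simplex T"
  shows "finite {e. e edge_of T}" "card {e. e edge_of T} \<le> 9"
proof -
  have *: "{e. e edge_of T} \<subseteq> (\<lambda>(a, b). closed_segment a b) ` (vertices T \<times> vertices T)"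
    using edge_of_simplex[OF assms] by auto
  have fin: "finite (vertices T \<times> vertices T)" using simplex_vertices(1)[OF assms] by simp
  show "finite {e. e edge_of T}" using * fin by (meson finite_imageI finite_subset)
  have "card {e. e edge_of T} \<le> card (vertices T \<times> vertices T)"
    using card_mono[OF finite_imageI[OF fin] *] card_image_le[OF fin] le_trans by blast
  then show "card {e. e edge_of T} \<le> 9" using card_vertices[OF assms] by (simp add: card_cartesian_product)
qed

lemma finite_boundary_edges: "simplicial S \<Longrightarrow> finite (boundary_edges S)"
proof -
  assume S: "simplicial S"
  have "boundary_edges S \<subseteq> (\<Union>T\<in>S. {e. e edge_of T})" by (auto simp: boundary_edges_def)
  moreover have "finite (\<Union>T\<in>S. {e. e edge_of T})"
    by (intro finite_UN_I simplicialD(1)[OF S] finite_edges simplicialD(2)[OF S])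
  ultimately show ?thesis by (rule finite_subset)
qed

text \<open>By \<open>edge_interior_propagates\<close> an edge which meets the interior is not on the boundary except
  possibly for its end points, so a boundary point missed by the boundary edges is a vertex and
  isolated in the boundary. A small punctured disc about it is connected, so it lies in the interior;
  since the union is closed, the vertex itself is then an interior point.\<close>

lemma frontier_covered:
  assumes S: "simplicial S"
  shows "frontier (interior (\<Union>S)) = \<Union>(boundary_edges S)"
proof
  show "\<Union>(boundary_edges S) \<subseteq> frontier (interior (\<Union>S))" by (auto simp: boundary_edges_def)
  let ?G = "interior (\<Union>S)"
  define F where "F = \<Union>(boundary_edges S)"
  define V where "V = (\<Union>T\<in>S. vertices T)"
  have "finite (vertices T)" if "T \<in> S" for T by (rule simplex_vertices(1)[OF simplicialD(2)[OF S that]])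
  then have finV: "finite V" unfolding V_def using simplicialD(1)[OF S] by blast
  have "closed F" unfolding F_def
    using finite_boundary_edges[OF S] edge_of_simplex simplicialD(2)[OF S]
    by (intro closed_Union) (auto simp: boundary_edges_def)
  have cov: "x \<in> F \<union> V" if x: "x \<in> frontier ?G" for x
  proof (rule ccontr)
    assume nx: "x \<notin> F \<union> V"
    have "x \<in> \<Union>S" "x \<notin> ?G" using x frontier_interior_Union[OF S] by auto
    then obtain T where T: "T \<in> S" "x \<in> T" by blast
    note sT = simplicialD(2)[OF S T(1)]
    have "x \<notin> interior T" using \<open>x \<notin> ?G\<close> T(1) interior_mono[OF Union_upper] by blast
    then obtain w where w: "w \<in> vertices T" "bary (vertices T) x w \<le> 0"
      using bary_pos_imp_interior[OF sT, of x] by (meson not_le)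
    then have w0: "bary (vertices T) x w = 0" using mem_simplex_iff[OF sT, of x] T(2) by fastforce
    have "card (vertices T - {w}) = 2" using card_vertices[OF sT] w(1) simplex_vertices(1)[OF sT] by (simp add: card_Diff_subset)
    then obtain a b where ab: "vertices T - {w} = {a, b}" "a \<noteq> b" by (auto simp: card_2_iff)
    then have V3: "vertices T = {a, b, w}" "w \<noteq> a" "w \<noteq> b" using w(1) by auto
    have "x = bary (vertices T) x a *\<^sub>R a + bary (vertices T) x b *\<^sub>R b"
      using sum_bary_scaleR[OF sT, of x] V3 ab(2) w0 by simp
    moreover have "bary (vertices T) x a + bary (vertices T) x b = 1" using sum_bary[OF sT, of x] V3 ab(2) w0 by simp
    moreover have "0 \<le> bary (vertices T) x a" "0 \<le> bary (vertices T) x b"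
      using mem_simplex_iff[OF sT, of x] T(2) V3 by auto
    ultimately have xe: "x \<in> closed_segment a b" unfolding segment_convex_hull convex_hull_2 by blast
    have e: "closed_segment a b edge_of T" using edge_of_simplex[OF sT] V3 ab(2) by blast
    have "\<not> closed_segment a b \<subseteq> frontier ?G"
      using nx xe e T(1) by (auto simp: F_def boundary_edges_def)
    then obtain z where z: "z \<in> closed_segment a b" "z \<notin> frontier ?G" by blast
    have "z \<in> \<Union>S" using z(1) edge_of_imp_subset[OF e] T(1) by blast
    then have "z \<in> ?G" using z(2) frontier_interior_Union[OF S] by blast
    have "open_segment a b \<inter> ?G \<noteq> {}"
    proof -
      have "z \<in> closure (open_segment a b)" using z(1) ab(2) by simp
      then show ?thesis using \<open>z \<in> ?G\<close> open_Int_closure_eq_empty[OF open_interior, of "\<Union>S" "open_segment a b"] by blast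
    qed
    then obtain z' where z': "z' \<in> closed_segment a b" "z' \<noteq> a" "z' \<noteq> b" "z' \<in> ?G" by (auto simp: open_segment_def)
    have "x \<noteq> a" "x \<noteq> b" using nx T(1) V3 by (auto simp: V_def)
    then have "x \<in> ?G" using edge_interior_propagates[OF S T(1) V3(1) ab(2) V3(2,3) z' xe] by blast
    with \<open>x \<notin> ?G\<close> show False ..
  qed
  show "frontier ?G \<subseteq> \<Union>(boundary_edges S)"
  proof
    fix x assume x: "x \<in> frontier ?G"
    show "x \<in> \<Union>(boundary_edges S)"
    proof (rule ccontr)
      assume "x \<notin> \<Union>(boundary_edges S)"
      then have xF: "x \<notin> F" by (simp add: F_def)
      have "closed (V - {x})" by (rule finite_imp_closed) (use finV in simp)
      then have "open (- (F \<union> (V - {x})))" using \<open>closed F\<close> by (intro open_Compl closed_Un)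
      then obtain r where r: "r > 0" "ball x r \<subseteq> - (F \<union> (V - {x}))"
        using xF open_contains_ball by (metis (no_types, lifting) Compl_iff DiffE Un_iff insertI1)
      have no: "(ball x r - {x}) \<inter> frontier ?G = {}" using cov r(2) by blast
      have conn: "connected (ball x r - {x})" by (rule connected_punctured_ball) simp
      have "x \<in> closure ?G" "x \<notin> ?G" using x by (auto simp: frontier_def)
      then have "x \<in> ball x r \<inter> closure ?G" using r(1) by simp
      then have "ball x r \<inter> ?G \<noteq> {}" using open_Int_closure_eq_empty[OF open_ball, of x r ?G] by blast
      then have "(ball x r - {x}) \<inter> ?G \<noteq> {}" using \<open>x \<notin> ?G\<close> by blast
      then have "ball x r - {x} \<subseteq> ?G" using connected_Int_frontier[OF conn] no by blast
      then have "ball x r \<subseteq> \<Union>S" using x frontier_interior_Union[OF S] interior_subset by blast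
      then have "x \<in> ?G" using r(1) by (intro interiorI[OF open_ball]) auto
      with \<open>x \<notin> ?G\<close> show False ..
    qed
  qed
qed

section \<open>Boundary integrals\<close>

lemma edge_continuous:
  assumes "2 simplex T" "e edge_of T" "poly_on p T v"
  shows "continuous_on e v"
proof -
  obtain f where f: "polyfun p f" "\<And>x. x \<in> T \<Longrightarrow> v x = f x" using assms(3) by (auto simp: poly_on_iff)
  have "e \<subseteq> T" using assms(2) by (rule edge_of_imp_subset)
  then show ?thesis using f(2) by (intro continuous_on_eq[OF continuous_on_polyfun[OF f(1)]]) auto
qed

lemma edge_integrable:
  fixes f :: "real^2 \<Rightarrow> complex"
  assumes "continuous_on (closed_segment a b) f"
  shows "(\<lambda>t. f (linepath a b t)) integrable_on {0..1}"
proof (rule integrable_continuous_real)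
  show "continuous_on {0..1} (\<lambda>t. f (linepath a b t))"
    by (rule continuous_on_compose2[OF assms continuous_on_linepath]) (auto simp: linepath_image_01[symmetric])
qed

lemma edge_integral_add_cmult:
  assumes "continuous_on (closed_segment a b) f" "continuous_on (closed_segment a b) g"
  shows "edge_integral (closed_segment a b) (\<lambda>x. f x + c * g x)
      = edge_integral (closed_segment a b) f + c * edge_integral (closed_segment a b) g"
proof -
  note i = edge_integrable[OF assms(1)] edge_integrable[OF assms(2)]
  have "integral {0..1} (\<lambda>t. f (linepath a b t) + c * g (linepath a b t))
      = integral {0..1} (\<lambda>t. f (linepath a b t)) + integral {0..1} (\<lambda>t. c * g (linepath a b t))"
    by (rule Henstock_Kurzweil_Integration.integral_add[OF i(1) integrable_on_mult_right[OF i(2)]])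
  also have "integral {0..1} (\<lambda>t. c * g (linepath a b t)) = c * integral {0..1} (\<lambda>t. g (linepath a b t))"
    by (rule Henstock_Kurzweil_Integration.integral_mult_right)
  finally have "integral {0..1} (\<lambda>t. f (linepath a b t) + c * g (linepath a b t))
      = integral {0..1} (\<lambda>t. f (linepath a b t)) + c * integral {0..1} (\<lambda>t. g (linepath a b t))" .
  then show ?thesis unfolding edge_integral_closed_segment by (simp add: ring_distribs)
qed

lemma edge_integral_bound:
  assumes "continuous_on (closed_segment a b) f" "\<And>x. x \<in> closed_segment a b \<Longrightarrow> cmod (f x) \<le> B"
  shows "cmod (edge_integral (closed_segment a b) f) \<le> dist a b * B"
proof -
  have "cmod (integral {0..1} (\<lambda>t. f (linepath a b t))) \<le> B * (1 - 0)"
  proof (rule integral_bound)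
    show "continuous_on {0..1} (\<lambda>t. f (linepath a b t))"
      by (rule continuous_on_compose2[OF assms(1) continuous_on_linepath]) (auto simp: linepath_image_01[symmetric])
    show "cmod (f (linepath a b t)) \<le> B" if "t \<in> {0..1}" for t
      using assms(2)[of "linepath a b t"] that by (auto simp: linepath_image_01[symmetric])
  qed simp
  then show ?thesis unfolding edge_integral_closed_segment norm_mult by (simp add: mult_left_mono)
qed

lemma edge_integral_square:
  assumes "continuous_on (closed_segment a b) v"
  shows "edge_integral (closed_segment a b) (\<lambda>x. v x * cnj (v x))
      = of_real (dist a b * integral {0..1} (\<lambda>t. (cmod (v (linepath a b t)))\<^sup>2))"
    and "0 \<le> integral {0..1} (\<lambda>t. (cmod (v (linepath a b t)))\<^sup>2)"
    and "integral {0..1} (\<lambda>t. (cmod (v (linepath a b t)))\<^sup>2) = 0 \<Longrightarrow> x \<in> closed_segment a b \<Longrightarrow> v x = 0"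
proof -
  have c: "continuous_on {0..1} (\<lambda>t. v (linepath a b t))"
    by (rule continuous_on_compose2[OF assms(1) continuous_on_linepath]) (auto simp: linepath_image_01[symmetric])
  have c2: "continuous_on {0..1} (\<lambda>t. (cmod (v (linepath a b t)))\<^sup>2)" by (intro continuous_intros c)
  have "((\<lambda>t. (cmod (v (linepath a b t)))\<^sup>2) has_integral integral {0..1} (\<lambda>t. (cmod (v (linepath a b t)))\<^sup>2)) {0..1}"
    using integrable_continuous_real[OF c2] by (rule integrable_integral)
  then have "((\<lambda>t. complex_of_real ((cmod (v (linepath a b t)))\<^sup>2)) has_integral of_real (integral {0..1} (\<lambda>t. (cmod (v (linepath a b t)))\<^sup>2))) {0..1}"
    by (rule has_integral_of_real)
  then have "integral {0..1} (\<lambda>t. v (linepath a b t) * cnj (v (linepath a b t))) = of_real (integral {0..1} (\<lambda>t. (cmod (v (linepath a b t)))\<^sup>2))"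
    unfolding complex_norm_square by (rule integral_unique)
  then show "edge_integral (closed_segment a b) (\<lambda>x. v x * cnj (v x))
      = of_real (dist a b * integral {0..1} (\<lambda>t. (cmod (v (linepath a b t)))\<^sup>2))"
    unfolding edge_integral_closed_segment by simp
  show "0 \<le> integral {0..1} (\<lambda>t. (cmod (v (linepath a b t)))\<^sup>2)"
    by (rule Henstock_Kurzweil_Integration.integral_nonneg[OF integrable_continuous_real[OF c2]]) simp
  assume "integral {0..1} (\<lambda>t. (cmod (v (linepath a b t)))\<^sup>2) = 0" "x \<in> closed_segment a b"
  then obtain t where t: "t \<in> {0..1}" "x = linepath a b t" by (auto simp: linepath_image_01[symmetric])
  have "\<forall>t\<in>{0..1}. (cmod (v (linepath a b t)))\<^sup>2 = 0"
    using \<open>integral _ _ = 0\<close> integral_eq_0_iff[OF c2] by simp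
  then show "v x = 0" using t by simp
qed

lemma boundary_edge_cases:
  assumes S: "simplicial S" and e: "e \<in> boundary_edges S"
  obtains T a b where "T \<in> S" "e edge_of T" "a \<noteq> b" "e = closed_segment a b" "\<not> T \<subseteq> interior (\<Union>S)" "{a, b} \<subseteq> T"
proof -
  obtain T where T: "T \<in> S" "e edge_of T" "e \<subseteq> frontier (interior (\<Union>S))" using e by (auto simp: boundary_edges_def)
  obtain a b where ab: "a \<noteq> b" "e = closed_segment a b" using edge_of_simplex[OF simplicialD(2)[OF S T(1)]] T(2) by blast
  have "a \<in> e" "b \<in> e" using ab by auto
  moreover have "e \<subseteq> T" using T(2) by (rule edge_of_imp_subset)
  moreover have "a \<notin> interior (\<Union>S)" using \<open>a \<in> e\<close> T(3) frontier_interior_Union[OF S] by blast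
  ultimately show thesis using that[OF T(1,2) ab] by blast
qed

lemma sesq_boundary_inner:
  assumes S: "simplicial S"
  shows "sesq {v. \<forall>T\<in>S. poly_on p T v} (boundary_inner S)"
  unfolding sesq_def
proof (intro ballI allI conjI; simp only: mem_Collect_eq)
  fix u v w a assume p: "\<forall>T\<in>S. poly_on p T u" "\<forall>T\<in>S. poly_on p T v" "\<forall>T\<in>S. poly_on p T w"
  have c: "continuous_on e u \<and> continuous_on e v \<and> continuous_on e w" if "e \<in> boundary_edges S" for e
    using boundary_edge_cases[OF S that] edge_continuous[OF simplicialD(2)[OF S]] p by metis
  have "edge_integral e (\<lambda>x. (u x + a * v x) * cnj (w x)) =
      edge_integral e (\<lambda>x. u x * cnj (w x)) + a * edge_integral e (\<lambda>x. v x * cnj (w x))"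
    if e: "e \<in> boundary_edges S" for e
  proof -
    obtain T b d where "e = closed_segment b d" using boundary_edge_cases[OF S e] by metis
    then have "edge_integral e (\<lambda>x. u x * cnj (w x) + a * (v x * cnj (w x))) =
      edge_integral e (\<lambda>x. u x * cnj (w x)) + a * edge_integral e (\<lambda>x. v x * cnj (w x))"
      using c[OF e] by (auto intro!: edge_integral_add_cmult continuous_intros)
    then show ?thesis by (simp add: ring_distribs mult.assoc)
  qed
  then show "boundary_inner S (\<lambda>x. u x + a * v x) w = boundary_inner S u w + a * boundary_inner S v w"
    by (simp add: boundary_inner_def sum.distrib sum_distrib_left)
  have "edge_integral e (\<lambda>x. w x * cnj (u x + a * v x)) =
      edge_integral e (\<lambda>x. w x * cnj (u x)) + cnj a * edge_integral e (\<lambda>x. w x * cnj (v x))"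
    if e: "e \<in> boundary_edges S" for e
  proof -
    obtain T b d where "e = closed_segment b d" using boundary_edge_cases[OF S e] by metis
    then have "edge_integral e (\<lambda>x. w x * cnj (u x) + cnj a * (w x * cnj (v x))) =
      edge_integral e (\<lambda>x. w x * cnj (u x)) + cnj a * edge_integral e (\<lambda>x. w x * cnj (v x))"
      using c[OF e] by (auto intro!: edge_integral_add_cmult continuous_intros)
    then show ?thesis by (simp add: ring_distribs mult_ac)
  qed
  then show "boundary_inner S w (\<lambda>x. u x + a * v x) = boundary_inner S w u + cnj a * boundary_inner S w v"
    by (simp add: boundary_inner_def sum.distrib sum_distrib_left)
qed

text \<open>The boundary integral of \<open>\<bar>v\<bar>\<^sup>2\<close> is nonnegative, and it vanishes only if \<open>v\<close> is zero on
  every boundary edge, hence on the boundary by \<open>frontier_covered\<close>.\<close>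

lemma boundary_inner_self:
  assumes S: "simplicial S" and p: "\<And>T. T \<in> S \<Longrightarrow> poly_on p T v"
  obtains r where "0 \<le> r" "boundary_inner S v v = of_real r"
    "r = 0 \<Longrightarrow> (\<And>x. x \<in> frontier (interior (\<Union>S)) \<Longrightarrow> v x = 0)"
proof -
  have "\<forall>e\<in>boundary_edges S. \<exists>r. 0 \<le> r \<and> edge_integral e (\<lambda>x. v x * cnj (v x)) = of_real r \<and>
      (r = 0 \<longrightarrow> (\<forall>x\<in>e. v x = 0))"
  proof
    fix e assume e: "e \<in> boundary_edges S"
    obtain T a b where T: "T \<in> S" "e edge_of T" and ab: "a \<noteq> b" "e = closed_segment a b"
      using boundary_edge_cases[OF S e] by metis
    have c: "continuous_on (closed_segment a b) v"
      using edge_continuous[OF simplicialD(2)[OF S T(1)] T(2) p[OF T(1)]] ab by simp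
    show "\<exists>r. 0 \<le> r \<and> edge_integral e (\<lambda>x. v x * cnj (v x)) = of_real r \<and> (r = 0 \<longrightarrow> (\<forall>x\<in>e. v x = 0))"
    proof (intro exI conjI impI ballI)
      let ?i = "integral {0..1} (\<lambda>t. (cmod (v (linepath a b t)))\<^sup>2)"
      show "0 \<le> dist a b * ?i" using edge_integral_square(2)[OF c] by simp
      show "edge_integral e (\<lambda>x. v x * cnj (v x)) = of_real (dist a b * ?i)"
        unfolding ab(2) by (rule edge_integral_square(1)[OF c])
      fix x assume "dist a b * ?i = 0" and x: "x \<in> e"
      then have "?i = 0" using ab(1) by simp
      then show "v x = 0" using x unfolding ab(2) by (rule edge_integral_square(3)[OF c])
    qed
  qed
  from bchoice[OF this] obtain r where "\<forall>e\<in>boundary_edges S. 0 \<le> r e \<and>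
      edge_integral e (\<lambda>x. v x * cnj (v x)) = of_real (r e) \<and> (r e = 0 \<longrightarrow> (\<forall>x\<in>e. v x = 0))" by (rule exE)
  then have r: "\<And>e. e \<in> boundary_edges S \<Longrightarrow> 0 \<le> r e"
    "\<And>e. e \<in> boundary_edges S \<Longrightarrow> edge_integral e (\<lambda>x. v x * cnj (v x)) = of_real (r e)"
    "\<And>e x. e \<in> boundary_edges S \<Longrightarrow> r e = 0 \<Longrightarrow> x \<in> e \<Longrightarrow> v x = 0"
    by blast+
  show thesis
  proof (rule that[of "sum r (boundary_edges S)"])
    show "0 \<le> sum r (boundary_edges S)" using r(1) by (rule sum_nonneg)
    show "boundary_inner S v v = of_real (sum r (boundary_edges S))"
      using r(2) by (simp add: boundary_inner_def)
    fix x assume "sum r (boundary_edges S) = 0" and x: "x \<in> frontier (interior (\<Union>S))"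
    then have "\<forall>e\<in>boundary_edges S. r e = 0"
      using sum_nonneg_eq_0_iff[OF finite_boundary_edges[OF S], of r] r(1) by blast
    then show "v x = 0" using r(3) x frontier_covered[OF S] by blast
  qed
qed

lemma boundary_inner_zero:
  assumes S: "simplicial S" and "(\<forall>x\<in>frontier (interior (\<Union>S)). u x = 0) \<or> (\<forall>x\<in>frontier (interior (\<Union>S)). w x = 0)"
  shows "boundary_inner S u w = 0"
  unfolding boundary_inner_def
proof (rule sum.neutral, rule ballI)
  fix e assume e: "e \<in> boundary_edges S"
  obtain T a b where T: "T \<in> S" "e edge_of T" and ab: "a \<noteq> b" "e = closed_segment a b"
    using boundary_edge_cases[OF S e] by metis
  have z: "u x * cnj (w x) = 0" if "x \<in> e" for x
  proof -
    have "x \<in> frontier (interior (\<Union>S))" using e that by (auto simp: boundary_edges_def)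
    then show ?thesis using assms(2) by auto
  qed
  have "integral {0..1} (\<lambda>t. u (linepath a b t) * cnj (w (linepath a b t))) = integral {0..1::real} (\<lambda>t. 0)"
    by (rule Henstock_Kurzweil_Integration.integral_cong) (use z ab in \<open>auto simp: linepath_image_01[symmetric]\<close>)
  then show "edge_integral e (\<lambda>x. u x * cnj (w x)) = 0" unfolding ab(2) edge_integral_closed_segment by simp
qed

definition rim :: "(real^2) set set \<Rightarrow> (real^2) set set" where
  "rim S = {T\<in>S. \<not> T \<subseteq> interior (\<Union>S)}"

text \<open>Each boundary edge has length at most \<open>h\<close> and belongs to an element of the rim, which has at most
  nine edges; this crude count is that of the ordered pairs of vertices.\<close>

lemma boundary_inner_bound:
  assumes S: "simplicial S" and h: "\<And>T. T \<in> S \<Longrightarrow> diameter T \<le> h" "0 \<le> h"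
    and vw: "\<And>T. T \<in> S \<Longrightarrow> poly_on p T v" "\<And>T. T \<in> S \<Longrightarrow> poly_on p T w"
    and A: "\<And>T x. T \<in> rim S \<Longrightarrow> x \<in> T \<Longrightarrow> cmod (v x) \<le> A * sqrt (l2sq T v)"
      "\<And>T x. T \<in> rim S \<Longrightarrow> x \<in> T \<Longrightarrow> cmod (w x) \<le> A * sqrt (l2sq T w)" "0 \<le> A"
  shows "cmod (boundary_inner S v w) \<le> 9 * h * A\<^sup>2 * (\<Sum>T\<in>rim S. sqrt (l2sq T v) * sqrt (l2sq T w))"
proof -
  let ?q = "\<lambda>T. h * A\<^sup>2 * (sqrt (l2sq T v) * sqrt (l2sq T w))"
  have q0: "0 \<le> ?q T" for T using h(2) l2sq_nonneg by auto
  have finR: "finite (rim S)" using simplicialD(1)[OF S] by (simp add: rim_def)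
  have edge: "\<exists>T\<in>rim S. e edge_of T \<and> cmod (edge_integral e (\<lambda>x. v x * cnj (w x))) \<le> ?q T" if e: "e \<in> boundary_edges S" for e
  proof -
    obtain T a b where T: "T \<in> S" "e edge_of T" and ab: "a \<noteq> b" "e = closed_segment a b"
      and nT: "\<not> T \<subseteq> interior (\<Union>S)" "{a, b} \<subseteq> T"
      using boundary_edge_cases[OF S e] by metis
    have TR: "T \<in> rim S" using T nT by (simp add: rim_def)
    note sT = simplicialD(2)[OF S T(1)]
    have sub: "e \<subseteq> T" using T(2) by (rule edge_of_imp_subset)
    have "cmod (edge_integral (closed_segment a b) (\<lambda>x. v x * cnj (w x))) \<le> dist a b * (A\<^sup>2 * (sqrt (l2sq T v) * sqrt (l2sq T w)))"
    proof (rule edge_integral_bound)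
      show "continuous_on (closed_segment a b) (\<lambda>x. v x * cnj (w x))"
        using edge_continuous[OF sT T(2) vw(1)[OF T(1)]] edge_continuous[OF sT T(2) vw(2)[OF T(1)]] ab
        by (auto intro!: continuous_intros)
      fix x assume "x \<in> closed_segment a b"
      then have x: "x \<in> T" using sub ab by blast
      have "cmod (v x * cnj (w x)) \<le> (A * sqrt (l2sq T v)) * (A * sqrt (l2sq T w))"
        unfolding norm_mult complex_mod_cnj using A(1)[OF TR x] A(2)[OF TR x] A(3) l2sq_nonneg by (intro mult_mono) auto
      then show "cmod (v x * cnj (w x)) \<le> A\<^sup>2 * (sqrt (l2sq T v) * sqrt (l2sq T w))" by (simp add: power2_eq_square mult_ac)
    qed
    also have "\<dots> \<le> h * (A\<^sup>2 * (sqrt (l2sq T v) * sqrt (l2sq T w)))"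
    proof (rule mult_right_mono)
      show "dist a b \<le> h"
        using diameter_bounded_bound[OF compact_imp_bounded[OF compact_simplex[OF sT]], of a b] nT(2) h(1)[OF T(1)] by simp
    qed (use l2sq_nonneg in auto)
    finally show ?thesis using TR T(2) ab(2) by (auto simp: mult.assoc)
  qed
  have "cmod (boundary_inner S v w) \<le> (\<Sum>e\<in>boundary_edges S. cmod (edge_integral e (\<lambda>x. v x * cnj (w x))))"
    unfolding boundary_inner_def by (rule norm_sum)
  also have "\<dots> \<le> (\<Sum>e\<in>boundary_edges S. \<Sum>T\<in>{T\<in>rim S. e edge_of T}. ?q T)"
  proof (rule sum_mono)
    fix e assume "e \<in> boundary_edges S"
    then obtain T where T: "T \<in> {T\<in>rim S. e edge_of T}" "cmod (edge_integral e (\<lambda>x. v x * cnj (w x))) \<le> ?q T"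
      using edge by blast
    have "?q T \<le> (\<Sum>T\<in>{T\<in>rim S. e edge_of T}. ?q T)" using q0 T(1) finR by (intro member_le_sum) auto
    then show "cmod (edge_integral e (\<lambda>x. v x * cnj (w x))) \<le> (\<Sum>T\<in>{T\<in>rim S. e edge_of T}. ?q T)" using T(2) by linarith
  qed
  also have "\<dots> = (\<Sum>T\<in>rim S. \<Sum>e\<in>{e\<in>boundary_edges S. e edge_of T}. ?q T)"
    by (rule sum.swap_restrict[OF finite_boundary_edges[OF S] finR])
  also have "\<dots> \<le> (\<Sum>T\<in>rim S. 9 * ?q T)"
  proof (rule sum_mono)
    fix T assume "T \<in> rim S"
    then have sT: "2 simplex T" using simplicialD(2)[OF S] by (simp add: rim_def)
    have "card {e\<in>boundary_edges S. e edge_of T} \<le> 9"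
      using card_mono[OF finite_edges(1)[OF sT], of "{e\<in>boundary_edges S. e edge_of T}"] finite_edges(2)[OF sT] by fastforce
    then show "(\<Sum>e\<in>{e\<in>boundary_edges S. e edge_of T}. ?q T) \<le> 9 * ?q T"
      using q0[of T] by (simp only: sum_constant) (intro mult_right_mono, simp_all)
  qed
  also have "\<dots> = 9 * h * A\<^sup>2 * (\<Sum>T\<in>rim S. sqrt (l2sq T v) * sqrt (l2sq T w))"
    by (simp add: sum_distrib_left mult_ac)
  finally show ?thesis .
qed

section \<open>The forms on piecewise polynomial functions\<close>

definition pwpoly :: "nat \<Rightarrow> (real^2) set set \<Rightarrow> (real^2 \<Rightarrow> complex) set" where
  "pwpoly p S = {v. \<forall>T\<in>S. poly_on p T v}"

lemma pwpolyD: "v \<in> pwpoly p S \<Longrightarrow> T \<in> S \<Longrightarrow> poly_on p T v"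
  by (simp add: pwpoly_def)

lemma pwpoly_mono: "S' \<subseteq> S \<Longrightarrow> pwpoly p S \<subseteq> pwpoly p S'"
  by (auto simp: pwpoly_def)

lemma csubspace_pwpoly: "csubspace (pwpoly p S)"
  unfolding csubspace_def pwpoly_def using polyfun_const[of p 0]
  by (auto simp: poly_on_add_cmult) (auto simp: poly_on_iff)

lemma fe_space_pwpoly: "fe_space p S \<subseteq> pwpoly p S"
  by (auto simp: fe_space_def pwpoly_def)

lemma frechet_derivative_cong_open:
  assumes "open U" "x \<in> U" "\<And>y. y \<in> U \<Longrightarrow> v y = w y"
  shows "frechet_derivative v (at x) = frechet_derivative w (at x)"
proof -
  have "(v has_derivative D) (at x) = (w has_derivative D) (at x)" for D
    using has_derivative_transform_within_open[OF _ assms(1,2), of v D UNIV w]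
      has_derivative_transform_within_open[OF _ assms(1,2), of w D UNIV v] assms(3) by metis
  then show ?thesis by (simp add: frechet_derivative_def)
qed

lemma pderivative_cong_interior:
  assumes "x \<in> interior T" "\<And>y. y \<in> T \<Longrightarrow> v y = w y"
  shows "pderivative i v x = pderivative i w x"
proof -
  have "interior T \<subseteq> T" by (rule interior_subset)
  then have "frechet_derivative v (at x) = frechet_derivative w (at x)"
    by (intro frechet_derivative_cong_open[OF open_interior assms(1)]) (use assms(2) in blast)
  then show ?thesis by (simp add: pderivative_def)
qed

lemma grad_inner_cong:
  assumes T: "2 simplex T" and p: "poly_on p T v'" "poly_on p T w'"
    and eq: "\<And>y. y \<in> T \<Longrightarrow> v y = v' y" "\<And>y. y \<in> T \<Longrightarrow> w y = w' y"
  shows "grad_inner T v w = grad_inner T v' w'"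
  unfolding grad_inner_def
proof (rule set_integral_spike(2)[OF integrable_forms(1)[OF T p] negligible_simplex_boundary[OF T]])
  fix x assume "x \<in> T" "x \<notin> T - interior T"
  then have x: "x \<in> interior T" by blast
  show "(\<Sum>i\<in>UNIV. pderivative i v x * cnj (pderivative i w x)) = (\<Sum>i\<in>UNIV. pderivative i v' x * cnj (pderivative i w' x))"
    using pderivative_cong_interior[OF x eq(1)] pderivative_cong_interior[OF x eq(2)] by simp
qed

lemma l2_inner_cong:
  assumes "\<And>y. y \<in> T \<Longrightarrow> v y = v' y" "\<And>y. y \<in> T \<Longrightarrow> w y = w' y"
  shows "l2_inner T v w = l2_inner T v' w'"
  unfolding l2_inner_def set_lebesgue_integral_def
  by (rule Bochner_Integration.integral_cong) (auto simp: indicator_def assms)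

lemma h1sq_cong:
  assumes T: "2 simplex T" and p: "poly_on p T v'" and eq: "\<And>y. y \<in> T \<Longrightarrow> v y = v' y"
  shows "h1sq T v = h1sq T v'"
proof -
  have "complex_of_real (h1sq T v) = of_real (h1sq T v')"
    unfolding grad_inner_self[symmetric] by (rule grad_inner_cong[OF T p p eq eq])
  then show ?thesis by simp
qed

lemma l2sq_cong: "(\<And>y. y \<in> T \<Longrightarrow> v y = v' y) \<Longrightarrow> l2sq T v = l2sq T v'"
proof -
  assume "\<And>y. y \<in> T \<Longrightarrow> v y = v' y"
  then have "complex_of_real (l2sq T v) = of_real (l2sq T v')"
    unfolding l2_inner_self[symmetric] by (intro l2_inner_cong)
  then show ?thesis by simp
qed

lemma grad_inner_Union:
  assumes "simplicial S" "v \<in> pwpoly p S" "w \<in> pwpoly p S"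
  shows "grad_inner (interior (\<Union>S)) v w = (\<Sum>T\<in>S. grad_inner T v w)"
  unfolding grad_inner_def
  by (rule set_integral_simplicial[OF assms(1)])
    (rule integrable_forms(1)[OF simplicialD(2)[OF assms(1)] pwpolyD[OF assms(2)] pwpolyD[OF assms(3)]])

lemma l2_inner_Union:
  assumes "simplicial S" "v \<in> pwpoly p S" "w \<in> pwpoly p S"
  shows "l2_inner (interior (\<Union>S)) v w = (\<Sum>T\<in>S. l2_inner T v w)"
  unfolding l2_inner_def
  by (rule set_integral_simplicial[OF assms(1)])
    (rule integrable_forms(2)[OF simplicialD(2)[OF assms(1)] pwpolyD[OF assms(2)] pwpolyD[OF assms(3)]])

lemma sesq_sum_forms:
  assumes "\<And>T. T \<in> S \<Longrightarrow> sesq V (b T)" shows "sesq V (\<lambda>v w. \<Sum>T\<in>S. b T v w)"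
  using assms unfolding sesq_def by (simp add: sum.distrib sum_distrib_left)

lemma sesq_cong:
  assumes "csubspace V" "\<And>u v. u \<in> V \<Longrightarrow> v \<in> V \<Longrightarrow> b u v = b' u v" "sesq V b'"
  shows "sesq V b"
  using assms csubspace_comb[OF assms(1)] unfolding sesq_def by simp

lemma sesq_add_cmult: "sesq V b \<Longrightarrow> sesq V b' \<Longrightarrow> sesq V (\<lambda>u v. b u v + k * b' u v)"
  unfolding sesq_def by (simp add: algebra_simps)

lemma sesq_grad_inner:
  assumes S: "simplicial S" shows "sesq (pwpoly p S) (grad_inner (interior (\<Union>S)))"
proof (rule sesq_cong[OF csubspace_pwpoly grad_inner_Union[OF S]])
  show "sesq (pwpoly p S) (\<lambda>v w. \<Sum>T\<in>S. grad_inner T v w)"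
    by (rule sesq_sum_forms, rule sesq_mono[OF sesq_grad_inner_simplex[OF simplicialD(2)[OF S]]])
      (auto simp: pwpoly_def)
qed

lemma sesq_l2_inner:
  assumes S: "simplicial S" shows "sesq (pwpoly p S) (l2_inner (interior (\<Union>S)))"
proof (rule sesq_cong[OF csubspace_pwpoly l2_inner_Union[OF S]])
  show "sesq (pwpoly p S) (\<lambda>v w. \<Sum>T\<in>S. l2_inner T v w)"
    by (rule sesq_sum_forms, rule sesq_mono[OF sesq_l2_inner_simplex[OF simplicialD(2)[OF S]]])
      (auto simp: pwpoly_def)
qed

lemma sesq_helmholtz:
  assumes S: "simplicial S" shows "sesq (pwpoly p S) (helmholtz_form \<kappa> \<epsilon> S)"
proof -
  have b: "sesq (pwpoly p S) (boundary_inner S)" unfolding pwpoly_def by (rule sesq_boundary_inner[OF S])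
  have "sesq (pwpoly p S) (\<lambda>v w. (grad_inner (interior (\<Union>S)) v w
      + (- (of_real (\<kappa>\<^sup>2) + \<i> * of_real \<epsilon>)) * l2_inner (interior (\<Union>S)) v w) + (- \<i> * of_real \<kappa>) * boundary_inner S v w)"
    by (intro sesq_add_cmult sesq_grad_inner[OF S] sesq_l2_inner[OF S] b)
  moreover have "helmholtz_form \<kappa> \<epsilon> S v w = (grad_inner (interior (\<Union>S)) v w
      + (- (of_real (\<kappa>\<^sup>2) + \<i> * of_real \<epsilon>)) * l2_inner (interior (\<Union>S)) v w) + (- \<i> * of_real \<kappa>) * boundary_inner S v w" for v w
    by (simp add: helmholtz_form_def ring_distribs)
  ultimately show ?thesis unfolding sesq_def by simp
qed

lemma sesq_energy:
  assumes S: "simplicial S" shows "sesq (pwpoly p S) (energy_inner \<kappa> (interior (\<Union>S)))"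
proof -
  have "sesq (pwpoly p S) (\<lambda>v w. grad_inner (interior (\<Union>S)) v w + of_real (\<kappa>\<^sup>2) * l2_inner (interior (\<Union>S)) v w)"
    by (intro sesq_add_cmult sesq_grad_inner[OF S] sesq_l2_inner[OF S])
  then show ?thesis unfolding sesq_def energy_inner_def by simp
qed

definition esq :: "real \<Rightarrow> (real^2) set \<Rightarrow> (real^2 \<Rightarrow> complex) \<Rightarrow> real" where
  "esq \<kappa> T v = h1sq T v + \<kappa>\<^sup>2 * l2sq T v"

lemma esq_nonneg: "0 \<le> esq \<kappa> T v"
  using h1sq_nonneg l2sq_nonneg by (simp add: esq_def)

lemma h1sq_le_esq: "h1sq T v \<le> esq \<kappa> T v" and l2sq_le_esq: "\<kappa>\<^sup>2 * l2sq T v \<le> esq \<kappa> T v"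
  using h1sq_nonneg l2sq_nonneg by (simp_all add: esq_def)

lemma esq_cong:
  assumes "2 simplex T" "poly_on p T v'" "\<And>y. y \<in> T \<Longrightarrow> v y = v' y"
  shows "esq \<kappa> T v = esq \<kappa> T v'"
  unfolding esq_def using h1sq_cong[OF assms(1,2), of v] l2sq_cong[of T v v'] assms(3) by simp

lemma energy_inner_self:
  assumes S: "simplicial S" and v: "v \<in> pwpoly p S"
  shows "energy_inner \<kappa> (interior (\<Union>S)) v v = of_real (\<Sum>T\<in>S. esq \<kappa> T v)"
  unfolding energy_inner_def grad_inner_Union[OF S v v] l2_inner_Union[OF S v v]
  by (simp add: grad_inner_self l2_inner_self esq_def sum.distrib sum_distrib_left)

lemma energy_norm_eq:
  assumes S: "simplicial S" and v: "v \<in> pwpoly p S"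
  shows "energy_norm \<kappa> (interior (\<Union>S)) v = sqrt (\<Sum>T\<in>S. esq \<kappa> T v)"
  unfolding energy_norm_def energy_inner_self[OF assms] by simp

lemma energy_hermitian: "energy_inner \<kappa> G w v = cnj (energy_inner \<kappa> G v w)"
  unfolding energy_inner_def using grad_inner_hermitian[of G w v] l2_inner_hermitian[of G w v] by simp

lemma energy_CS:
  assumes S: "simplicial S" and v: "v \<in> pwpoly p S" and w: "w \<in> pwpoly p S"
  shows "cmod (energy_inner \<kappa> (interior (\<Union>S)) v w)
    \<le> energy_norm \<kappa> (interior (\<Union>S)) v * energy_norm \<kappa> (interior (\<Union>S)) w"
  unfolding energy_norm_def
proof (rule hermitian_Cauchy_Schwarz[OF sesq_energy[OF S] csubspace_pwpoly v w])
  show "energy_inner \<kappa> (interior (\<Union>S)) v u = cnj (energy_inner \<kappa> (interior (\<Union>S)) u v)" for u v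
    by (rule energy_hermitian)
  fix u assume u: "u \<in> pwpoly p S"
  show "0 \<le> Re (energy_inner \<kappa> (interior (\<Union>S)) u u)"
    unfolding energy_inner_self[OF S u] using esq_nonneg by (simp add: sum_nonneg)
qed

lemma energy_norm_triangle:
  assumes S: "simplicial S" and v: "v \<in> pwpoly p S" and w: "w \<in> pwpoly p S"
  shows "energy_norm \<kappa> (interior (\<Union>S)) (\<lambda>x. v x + a * w x)
    \<le> energy_norm \<kappa> (interior (\<Union>S)) v + cmod a * energy_norm \<kappa> (interior (\<Union>S)) w"
proof -
  let ?b = "energy_inner \<kappa> (interior (\<Union>S))" and ?n = "energy_norm \<kappa> (interior (\<Union>S))"
  have n2: "?b u u = of_real ((?n u)\<^sup>2) \<and> 0 \<le> ?n u" if "u \<in> pwpoly p S" for u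
    unfolding energy_norm_eq[OF S that] energy_inner_self[OF S that]
    using esq_nonneg by (simp add: sum_nonneg)
  have u: "(\<lambda>x. v x + a * w x) \<in> pwpoly p S" by (rule csubspace_comb[OF csubspace_pwpoly v w])
  note sq = sesqD[OF sesq_energy[OF S]]
  have "?b (\<lambda>x. v x + a * w x) (\<lambda>x. v x + a * w x) = (?b v v + cnj a * ?b v w) + a * (?b w v + cnj a * ?b w w)"
    using sq(1)[OF v w u] sq(2)[OF v w v] sq(2)[OF v w w] by simp
  moreover have "Re (?b v v + cnj a * ?b v w + a * (?b w v + cnj a * ?b w w))
      \<le> cmod (?b v v) + cmod a * cmod (?b v w) + cmod a * (cmod (?b w v) + cmod a * cmod (?b w w))"
  proof -
    have 1: "cmod (?b v v + cnj a * ?b v w) \<le> cmod (?b v v) + cmod a * cmod (?b v w)"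
      using norm_triangle_ineq[of "?b v v" "cnj a * ?b v w"] by (simp add: norm_mult)
    have "cmod (?b w v + cnj a * ?b w w) \<le> cmod (?b w v) + cmod a * cmod (?b w w)"
      using norm_triangle_ineq[of "?b w v" "cnj a * ?b w w"] by (simp add: norm_mult)
    then have 2: "cmod (a * (?b w v + cnj a * ?b w w)) \<le> cmod a * (cmod (?b w v) + cmod a * cmod (?b w w))"
      unfolding norm_mult by (rule mult_left_mono) simp
    show ?thesis
      using 1 2 norm_triangle_ineq[of "?b v v + cnj a * ?b v w" "a * (?b w v + cnj a * ?b w w)"]
        complex_Re_le_cmod[of "?b v v + cnj a * ?b v w + a * (?b w v + cnj a * ?b w w)"] by linarith
  qed
  ultimately have "Re (?b (\<lambda>x. v x + a * w x) (\<lambda>x. v x + a * w x))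
      \<le> cmod (?b v v) + cmod a * cmod (?b v w) + cmod a * (cmod (?b w v) + cmod a * cmod (?b w w))" by simp
  also have "\<dots> \<le> (?n v)\<^sup>2 + cmod a * (?n v * ?n w) + cmod a * (?n v * ?n w + cmod a * (?n w)\<^sup>2)"
  proof -
    have "cmod (?b v v) = \<bar>(?n v)\<^sup>2\<bar>" "cmod (?b w w) = \<bar>(?n w)\<^sup>2\<bar>"
      unfolding conjunct1[OF n2[OF v]] conjunct1[OF n2[OF w]] by (rule norm_of_real)+
    then have "cmod (?b v v) = (?n v)\<^sup>2" "cmod (?b w w) = (?n w)\<^sup>2" by simp_all
    moreover have "cmod (?b v w) \<le> ?n v * ?n w" by (rule energy_CS[OF S v w])
    moreover have "cmod (?b w v) \<le> ?n v * ?n w" using energy_CS[OF S w v] by (simp add: mult.commute)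
    ultimately show ?thesis by (intro add_mono mult_left_mono) auto
  qed
  also have "\<dots> = (?n v + cmod a * ?n w)\<^sup>2" by (simp add: power2_eq_square algebra_simps)
  finally have "(?n (\<lambda>x. v x + a * w x))\<^sup>2 \<le> (?n v + cmod a * ?n w)\<^sup>2" using n2[OF u] by simp
  moreover have "0 \<le> ?n v + cmod a * ?n w" using conjunct2[OF n2[OF v]] conjunct2[OF n2[OF w]] by simp
  ultimately show ?thesis by (rule power2_le_imp_le)
qed

lemma l2sq_zero_imp:
  assumes T: "2 simplex T" and p: "0 < p" "poly_on p T v" and 0: "l2sq T v = 0" and x: "x \<in> T"
  shows "v x = 0"
proof -
  obtain z where "z \<in> interior T" using interior_simplex_nonempty[OF T] by blast
  then obtain r where r: "0 < r" "ball z r \<subseteq> interior T" using open_contains_ball[of "interior T"] by auto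
  have "interior T \<subseteq> T" by (rule interior_subset)
  with r have r2: "ball z r \<subseteq> T" by blast
  define L where "L = max 1 (diameter T / r)"
  have L: "1 \<le> L" "diameter T \<le> L * r"
  proof -
    show "1 \<le> L" by (simp add: L_def)
    have "diameter T / r \<le> L" by (simp add: L_def)
    then show "diameter T \<le> L * r" using r(1) by (simp add: field_simps)
  qed
  obtain C where "0 < C" "\<And>T v c r x. 2 simplex T \<Longrightarrow> poly_on p T v \<Longrightarrow> 0 < r \<Longrightarrow> ball c r \<subseteq> T \<Longrightarrow>
      diameter T \<le> L * r \<Longrightarrow> x \<in> T \<Longrightarrow> r\<^sup>2 * (cmod (v x))\<^sup>2 \<le> C * l2sq T v"
    by (rule sup_le_l2[OF p(1) L(1)]) blast
  from this(2)[OF T p(2) r(1) r2 L(2) x] have "r\<^sup>2 * (cmod (v x))\<^sup>2 \<le> 0" using 0 by simp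
  then show ?thesis using r(1) by (simp add: mult_le_0_iff)
qed

lemma l2_zero_imp:
  assumes S: "simplicial S" and p: "0 < p" and v: "v \<in> fe_space p S" and 0: "(\<Sum>T\<in>S. l2sq T v) = 0"
  shows "v = (\<lambda>x. 0)"
proof
  fix x
  show "v x = 0"
  proof (cases "x \<in> \<Union>S")
    case True
    then obtain T where T: "T \<in> S" "x \<in> T" by blast
    have "l2sq T v = 0"
      using 0 sum_nonneg_eq_0_iff[OF simplicialD(1)[OF S], of "\<lambda>T. l2sq T v"] l2sq_nonneg T(1) by blast
    then show ?thesis using l2sq_zero_imp[OF simplicialD(2)[OF S T(1)] p _ _ T(2)] v T(1) by (simp add: fe_space_def)
  qed (use v in \<open>simp add: fe_space_def\<close>)
qed

lemma definite_l2:
  assumes S: "simplicial S" and p: "0 < p"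
  shows "definite (fe_space p S) (l2_inner (interior (\<Union>S)))"
  unfolding definite_def
proof (intro ballI impI)
  fix v assume v: "v \<in> fe_space p S" and 0: "l2_inner (interior (\<Union>S)) v v = 0"
  have v': "v \<in> pwpoly p S" using v fe_space_pwpoly by blast
  have "complex_of_real (\<Sum>T\<in>S. l2sq T v) = 0" using 0 l2_inner_Union[OF S v' v'] by (simp add: l2_inner_self)
  then have "(\<Sum>T\<in>S. l2sq T v) = 0" by (simp only: of_real_eq_0_iff)
  then show "v = (\<lambda>x. 0)" by (rule l2_zero_imp[OF S p v])
qed

text \<open>The imaginary part of the form controls the mass term, thanks to the absorption; the real
  part then controls the energy.\<close>

lemma helmholtz_lower:
  assumes S: "simplicial S" and v: "v \<in> pwpoly p S" and \<epsilon>: "0 < \<epsilon>" and \<kappa>: "0 < \<kappa>"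
  shows "\<epsilon> * (\<Sum>T\<in>S. l2sq T v) \<le> cmod (helmholtz_form \<kappa> \<epsilon> S v v)"
    and "(\<Sum>T\<in>S. esq \<kappa> T v) \<le> (1 + 2 * \<kappa>\<^sup>2 / \<epsilon>) * cmod (helmholtz_form \<kappa> \<epsilon> S v v)"
proof -
  obtain r where r: "0 \<le> r" "boundary_inner S v v = of_real r"
    using boundary_inner_self[OF S, of p v] pwpolyD[OF v] by metis
  define H where "H = (\<Sum>T\<in>S. h1sq T v)"
  define M where "M = (\<Sum>T\<in>S. l2sq T v)"
  have M0: "0 \<le> M" unfolding M_def by (intro sum_nonneg l2sq_nonneg)
  have "helmholtz_form \<kappa> \<epsilon> S v v = of_real H - (of_real (\<kappa>\<^sup>2) + \<i> * of_real \<epsilon>) * of_real M - \<i> * of_real \<kappa> * of_real r"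
    unfolding helmholtz_form_def r(2) grad_inner_Union[OF S v v] l2_inner_Union[OF S v v] H_def M_def
    by (simp add: grad_inner_self l2_inner_self)
  also have "\<dots> = Complex (H - \<kappa>\<^sup>2 * M) (- (\<epsilon> * M + \<kappa> * r))"
    by (simp add: complex_eq_iff)
  finally have a: "helmholtz_form \<kappa> \<epsilon> S v v = Complex (H - \<kappa>\<^sup>2 * M) (- (\<epsilon> * M + \<kappa> * r))" .
  have "\<bar>Im (helmholtz_form \<kappa> \<epsilon> S v v)\<bar> \<le> cmod (helmholtz_form \<kappa> \<epsilon> S v v)" by (rule abs_Im_le_cmod)
  moreover have kr: "0 \<le> \<kappa> * r" using \<kappa> r(1) by simp
  moreover have "0 \<le> \<epsilon> * M + \<kappa> * r" using M0 \<epsilon> kr by simp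
  then have "\<bar>Im (helmholtz_form \<kappa> \<epsilon> S v v)\<bar> = \<epsilon> * M + \<kappa> * r"
    unfolding a complex.sel abs_minus_cancel by (rule abs_of_nonneg)
  ultimately have im: "\<epsilon> * M \<le> cmod (helmholtz_form \<kappa> \<epsilon> S v v)" by linarith
  then show "\<epsilon> * (\<Sum>T\<in>S. l2sq T v) \<le> cmod (helmholtz_form \<kappa> \<epsilon> S v v)" by (simp add: M_def)
  have re: "H - \<kappa>\<^sup>2 * M \<le> cmod (helmholtz_form \<kappa> \<epsilon> S v v)" using complex_Re_le_cmod[of "helmholtz_form \<kappa> \<epsilon> S v v"] a by simp
  have "2 * \<kappa>\<^sup>2 * M = 2 * \<kappa>\<^sup>2 / \<epsilon> * (\<epsilon> * M)" using \<epsilon> by simp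
  also have "\<dots> \<le> 2 * \<kappa>\<^sup>2 / \<epsilon> * cmod (helmholtz_form \<kappa> \<epsilon> S v v)" using im \<epsilon> by (intro mult_left_mono) auto
  finally have "H + \<kappa>\<^sup>2 * M \<le> (1 + 2 * \<kappa>\<^sup>2 / \<epsilon>) * cmod (helmholtz_form \<kappa> \<epsilon> S v v)"
    using re by (simp add: algebra_simps)
  then show "(\<Sum>T\<in>S. esq \<kappa> T v) \<le> (1 + 2 * \<kappa>\<^sup>2 / \<epsilon>) * cmod (helmholtz_form \<kappa> \<epsilon> S v v)"
    by (simp add: esq_def H_def M_def sum.distrib sum_distrib_left)
qed

text \<open>Absorption makes every Galerkin problem uniquely solvable, on every mesh.\<close>

lemma definite_helmholtz:
  assumes S: "simplicial S" and p: "0 < p" and \<epsilon>: "0 < \<epsilon>" and \<kappa>: "0 < \<kappa>"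
  shows "definite (fe_space p S) (helmholtz_form \<kappa> \<epsilon> S)"
  unfolding definite_def
proof (intro ballI impI)
  fix v assume v: "v \<in> fe_space p S" and 0: "helmholtz_form \<kappa> \<epsilon> S v v = 0"
  have v': "v \<in> pwpoly p S" using v fe_space_pwpoly by blast
  have "\<epsilon> * (\<Sum>T\<in>S. l2sq T v) \<le> 0" using helmholtz_lower(1)[OF S v' \<epsilon> \<kappa>] 0 by simp
  then have "(\<Sum>T\<in>S. l2sq T v) \<le> 0" using \<epsilon> by (simp add: mult_le_0_iff)
  moreover have "0 \<le> (\<Sum>T\<in>S. l2sq T v)" by (intro sum_nonneg l2sq_nonneg)
  ultimately have "(\<Sum>T\<in>S. l2sq T v) = 0" by (rule antisym)
  then show "v = (\<lambda>x. 0)" by (rule l2_zero_imp[OF S p v])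
qed

lemma fe_space_finite_span:
  assumes "simplicial S" "0 < p"
  obtains f and I :: "(real^2) set" where "finite I" "fe_space p S = fspan f I"
  using fe_space_fspan[OF assms] finite_mesh_nodes[OF assms(1)] by blast

section \<open>The operators of the method\<close>

text \<open>An element outside \<open>\<Omega>\<^sub>l\<close> meets it at most in its boundary.\<close>

lemma outside_disjoint:
  assumes S: "simplicial S" and "E \<subseteq> S" "T \<in> S" "T \<notin> E"
  shows "interior T \<inter> \<Union>E = {}" "T \<inter> interior (\<Union>E) = {}"
proof -
  show 1: "interior T \<inter> \<Union>E = {}"
    using simplicial_interior_disjoint[OF S assms(3)] assms(2,4) by blast
  have "interior (\<Union>E) \<subseteq> \<Union>E" by (rule interior_subset)
  then have "interior (\<Union>E) \<inter> interior T = {}" using 1 by blast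
  then have "interior (\<Union>E) \<inter> closure (interior T) = {}"
    using open_Int_closure_eq_empty[OF open_interior, of "\<Union>E" "interior T"] by blast
  then show "T \<inter> interior (\<Union>E) = {}" using closure_interior_simplex[OF simplicialD(2)[OF S assms(3)]] by blast
qed

lemma nodal_interp_on_element:
  assumes S: "simplicial S" and p: "0 < p" and T: "T \<in> S" "x \<in> T"
  shows "nodal_interp p S f x = interp (vertices T) p f x"
proof -
  have "nodal_interp p S f x = interp (vertices T) p (nodal_interp p S f) x"
    by (rule fe_eq_interp[OF S p nodal_interp(1)[OF S p] T])
  also have "\<dots> = interp (vertices T) p f x"
    by (rule interp_cong_nodes[OF simplicialD(2)[OF S T(1)]])
      (use T in \<open>auto intro!: nodal_interp(2)[OF S p] simp: mesh_nodes_def\<close>)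
  finally show ?thesis .
qed

lemma nodal_interp_linear:
  assumes S: "simplicial S" and p: "0 < p"
  shows "nodal_interp p S (\<lambda>x. f x + a * g x) = (\<lambda>x. nodal_interp p S f x + a * nodal_interp p S g x)"
  by (rule nodal_interp_eqI[OF S p csubspace_comb[OF csubspace_fe_space nodal_interp(1)[OF S p] nodal_interp(1)[OF S p]]])
    (simp add: nodal_interp(2)[OF S p])

lemma nodal_interp_cong:
  assumes S: "simplicial S" and p: "0 < p" and "\<And>x. x \<in> mesh_nodes p S \<Longrightarrow> f x = g x"
  shows "nodal_interp p S f = nodal_interp p S g"
  by (rule nodal_interp_eqI[OF S p nodal_interp(1)[OF S p]]) (simp add: nodal_interp(2)[OF S p] assms(3))

lemma boundary_inner_definite:
  assumes S: "simplicial S" and p: "\<And>T. T \<in> S \<Longrightarrow> poly_on p T v"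
    and 0: "boundary_inner S v v = 0" and x: "x \<in> frontier (interior (\<Union>S))"
  shows "v x = 0"
proof (rule boundary_inner_self[OF S p])
  fix r assume r: "boundary_inner S v v = of_real r"
    and z: "\<And>x. r = 0 \<Longrightarrow> x \<in> frontier (interior (\<Union>S)) \<Longrightarrow> v x = 0"
  have "r = 0" using 0 unfolding r by simp
  then show ?thesis using x by (rule z)
qed

lemma poly_on_cong: "poly_on p T v \<Longrightarrow> (\<And>x. x \<in> T \<Longrightarrow> w x = v x) \<Longrightarrow> poly_on p T w"
  unfolding poly_on_iff by auto

text \<open>What the algebra of the method needs. The last assumption is the support condition on the partition
  of unity in the form in which it is used at the nodes of an element outside \<open>\<Omega>\<^sub>l\<close>.\<close>

locale discretisation =
  fixes c :: ddm
  assumes mesh: "simplicial (mesh c)" and order: "0 < fe_order c"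
    and wave: "0 < wavenumber c" and absorb: "0 < absorption c"
    and elems_sub: "\<And>l. l \<in> {1..nsub c} \<Longrightarrow> elems c l \<subseteq> mesh c"
    and pou_sum: "\<And>x. x \<in> \<Union>(mesh c) \<Longrightarrow> (\<Sum>l\<in>{1..nsub c}. pou c l x) = 1"
    and pou_zero: "\<And>l T x. l \<in> {1..nsub c} \<Longrightarrow> T \<in> mesh c \<Longrightarrow> T \<notin> elems c l \<Longrightarrow> x \<in> T \<Longrightarrow> pou c l x = 0"
begin

abbreviation "p \<equiv> fe_order c"
abbreviation "M \<equiv> mesh c"
abbreviation "I \<equiv> {1..nsub c}"

lemma elems_simplicial: "l \<in> I \<Longrightarrow> simplicial (elems c l)"
  using simplicial_subset[OF mesh elems_sub] .

lemma closure_subdom: "l \<in> I \<Longrightarrow> closure (subdom c l) = \<Union>(elems c l)"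
  unfolding subdom_def by (rule closure_interior_Union[OF elems_simplicial])

lemma frontier_subdom: "l \<in> I \<Longrightarrow> frontier (subdom c l) = \<Union>(elems c l) - subdom c l"
  unfolding subdom_def by (rule frontier_interior_Union[OF elems_simplicial])

lemma Vh_pwpoly: "v \<in> Vh c \<Longrightarrow> v \<in> pwpoly p M"
  unfolding Vh_def using fe_space_pwpoly by blast

lemma restr_fe_space:
  assumes l: "l \<in> I" and v: "v \<in> Vh c"
  shows "restr (\<Union>(elems c l)) v \<in> fe_space p (elems c l)"
proof -
  have sub: "elems c l \<subseteq> M" using elems_sub[OF l] .
  have "continuous_on (\<Union>M) v" using v by (simp add: Vh_def fe_space_def)
  then have "continuous_on (\<Union>(elems c l)) v" by (rule continuous_on_subset) (use sub in blast)
  then have "continuous_on (\<Union>(elems c l)) (restr (\<Union>(elems c l)) v)"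
    by (rule continuous_on_eq) (simp add: restr_def)
  moreover have "poly_on p T (restr (\<Union>(elems c l)) v)" if T: "T \<in> elems c l" for T
  proof -
    have "poly_on p T v" using v sub T by (auto simp: Vh_def fe_space_def)
    then show ?thesis by (rule poly_on_cong) (use T in \<open>auto simp: restr_def\<close>)
  qed
  ultimately show ?thesis by (simp add: fe_space_def restr_def)
qed

lemma extend_eq:
  assumes l: "l \<in> I" and w: "w \<in> fe_space p (elems c l)"
  shows "extend c l w = nodal_interp p M w"
proof -
  have "restr (\<Union>(elems c l)) w = w" using w by (auto simp: restr_def fe_space_def fun_eq_iff)
  then show ?thesis by (simp add: extend_def closure_subdom[OF l])
qed

lemma extend_Vh: "l \<in> I \<Longrightarrow> extend c l w \<in> Vh c"
  unfolding extend_def Vh_def by (rule nodal_interp(1)[OF mesh order])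

lemma extend_on_elems:
  assumes l: "l \<in> I" and w: "w \<in> fe_space p (elems c l)" and T: "T \<in> elems c l" "x \<in> T"
  shows "extend c l w x = w x"
proof -
  have "extend c l w x = interp (vertices T) p w x"
    unfolding extend_eq[OF l w] using elems_sub[OF l] T by (intro nodal_interp_on_element[OF mesh order]) auto
  also have "\<dots> = w x" by (rule fe_eq_interp[OF elems_simplicial[OF l] order w T, symmetric])
  finally show ?thesis .
qed

text \<open>Restrictions of finite element functions exhaust the finite element functions on the subdomain,
  since these extend by their nodal values.\<close>

lemma Vh_loc_eq: "l \<in> I \<Longrightarrow> Vh_loc c l = fe_space p (elems c l)"
proof
  assume l: "l \<in> I"
  show "Vh_loc c l \<subseteq> fe_space p (elems c l)"
    unfolding Vh_loc_def closure_subdom[OF l] using restr_fe_space[OF l] by blast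
  show "fe_space p (elems c l) \<subseteq> Vh_loc c l"
  proof
    fix w assume w: "w \<in> fe_space p (elems c l)"
    have "w = restr (\<Union>(elems c l)) (extend c l w)"
    proof
      fix x show "w x = restr (\<Union>(elems c l)) (extend c l w) x"
      proof (cases "x \<in> \<Union>(elems c l)")
        case True
        then obtain T where "T \<in> elems c l" "x \<in> T" by blast
        then show ?thesis using extend_on_elems[OF l w] True by (simp add: restr_def)
      next
        case False
        then show ?thesis using w by (simp add: restr_def fe_space_def)
      qed
    qed
    then show "w \<in> Vh_loc c l" unfolding Vh_loc_def closure_subdom[OF l] using extend_Vh[OF l] by blast
  qed
qed

lemma extend_linear:
  assumes l: "l \<in> I" and "u \<in> fe_space p (elems c l)" "w \<in> fe_space p (elems c l)"
  shows "extend c l (\<lambda>x. u x + a * w x) = (\<lambda>x. extend c l u x + a * extend c l w x)"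
  using extend_eq[OF l] csubspace_comb[OF csubspace_fe_space assms(2,3)] assms(2,3)
  by (simp add: nodal_interp_linear[OF mesh order])

lemma DE_eq:
  assumes l: "l \<in> I" and w: "w \<in> fe_space p (elems c l)"
  shows "DE c l w = nodal_interp p M (\<lambda>x. of_real (pou c l x) * w x)"
  unfolding DE_def weight_def extend_eq[OF l w]
  by (rule nodal_interp_cong[OF mesh order]) (simp add: nodal_interp(2)[OF mesh order])

lemma DE_Vh: "DE c l w \<in> Vh c"
  unfolding DE_def weight_def Vh_def by (rule nodal_interp(1)[OF mesh order])

lemma DE_linear:
  assumes l: "l \<in> I" and "u \<in> fe_space p (elems c l)" "w \<in> fe_space p (elems c l)"
  shows "DE c l (\<lambda>x. u x + a * w x) = (\<lambda>x. DE c l u x + a * DE c l w x)"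
proof -
  have "(\<lambda>x. of_real (pou c l x) * (u x + a * w x))
      = (\<lambda>x. of_real (pou c l x) * u x + a * (of_real (pou c l x) * w x))" by (simp add: algebra_simps)
  then show ?thesis
    using DE_eq[OF l] csubspace_comb[OF csubspace_fe_space assms(2,3)] assms(2,3)
    by (simp add: nodal_interp_linear[OF mesh order])
qed

lemma DE_zero: "l \<in> I \<Longrightarrow> DE c l (\<lambda>x. 0) = (\<lambda>x. 0)"
proof -
  assume l: "l \<in> I"
  have z: "(\<lambda>x. 0) \<in> fe_space p (elems c l)" by (rule csubspace_zero[OF csubspace_fe_space])
  show ?thesis using DE_linear[OF l z z, of "-1"] by simp
qed

lemma DE_sum:
  assumes l: "l \<in> I" and J: "finite J" "\<And>i. i \<in> J \<Longrightarrow> u i \<in> fe_space p (elems c l)"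
  shows "DE c l (\<lambda>x. \<Sum>i\<in>J. a i * u i x) = (\<lambda>x. \<Sum>i\<in>J. a i * DE c l (u i) x)"
  using J
proof (induction J)
  case (insert i J)
  have s: "(\<lambda>x. \<Sum>i\<in>J. a i * u i x) \<in> fe_space p (elems c l)"
    using insert.prems by (intro csubspace_sum csubspace_scale csubspace_fe_space) auto
  have "DE c l (\<lambda>x. (\<Sum>i\<in>J. a i * u i x) + a i * u i x) = (\<lambda>x. DE c l (\<lambda>x. \<Sum>i\<in>J. a i * u i x) x + a i * DE c l (u i) x)"
    by (rule DE_linear[OF l s]) (use insert.prems in simp)
  moreover have "(\<lambda>x. \<Sum>i\<in>insert i J. a i * u i x) = (\<lambda>x. (\<Sum>i\<in>J. a i * u i x) + a i * u i x)"
    using insert.hyps by (simp add: add.commute)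
  ultimately show ?case using insert.IH insert.prems insert.hyps by (simp add: add.commute)
qed (simp add: DE_zero[OF l])

text \<open>All nodes of such an element have weight zero.\<close>

lemma DE_outside:
  assumes l: "l \<in> I" and T: "T \<in> M" "T \<notin> elems c l" "x \<in> T" and w: "w \<in> fe_space p (elems c l)"
  shows "DE c l w x = 0"
proof -
  note sT = simplicialD(2)[OF mesh T(1)]
  have "DE c l w x = interp (vertices T) p (\<lambda>x. of_real (pou c l x) * w x) x"
    unfolding DE_eq[OF l w] by (rule nodal_interp_on_element[OF mesh order T(1,3)])
  also have "\<dots> = interp (vertices T) p (\<lambda>x. 0) x"
  proof (rule interp_cong_nodes[OF sT])
    fix x assume "x \<in> element_nodes p T"
    then have "x \<in> T" using element_nodes_subset[OF sT order] by blast
    then show "of_real (pou c l x) * w x = 0" using pou_zero[OF l T(1,2)] by simp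
  qed
  also have "\<dots> = 0" by (simp add: interp_def)
  finally show ?thesis .
qed

text \<open>At a node \<open>D\<^sub>l E\<^sub>l\<close> multiplies by \<open>\<chi>\<^sub>l\<close>, also where the node lies outside \<open>\<Omega>\<^sub>l\<close> since \<open>\<chi>\<^sub>l\<close>
  vanishes there.\<close>

lemma sum_DE_restr:
  assumes v: "v \<in> Vh c"
  shows "(\<lambda>x. \<Sum>l\<in>I. DE c l (restr (\<Union>(elems c l)) v) x) = v"
proof (rule fe_space_eqI[OF mesh order])
  show "v \<in> fe_space p M" using v by (simp add: Vh_def)
  show "(\<lambda>x. \<Sum>l\<in>I. DE c l (restr (\<Union>(elems c l)) v) x) \<in> fe_space p M"
    using DE_Vh unfolding Vh_def by (intro csubspace_sum csubspace_fe_space)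
  fix x assume x: "x \<in> mesh_nodes p M"
  then have xM: "x \<in> \<Union>M" using mesh_nodes_subset[OF mesh order] by blast
  have "DE c l (restr (\<Union>(elems c l)) v) x = of_real (pou c l x) * v x" if l: "l \<in> I" for l
  proof -
    have "DE c l (restr (\<Union>(elems c l)) v) x = of_real (pou c l x) * restr (\<Union>(elems c l)) v x"
      unfolding DE_eq[OF l restr_fe_space[OF l v]] by (rule nodal_interp(2)[OF mesh order x])
    moreover have "pou c l x = 0" if "x \<notin> \<Union>(elems c l)"
    proof -
      obtain T where "T \<in> M" "x \<in> T" using xM by blast
      then show ?thesis using pou_zero[OF l, of T x] that by blast
    qed
    ultimately show ?thesis by (auto simp: restr_def)
  qed
  then have "(\<Sum>l\<in>I. DE c l (restr (\<Union>(elems c l)) v) x) = of_real (\<Sum>l\<in>I. pou c l x) * v x"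
    by (simp add: sum_distrib_right)
  then show "(\<Sum>l\<in>I. DE c l (restr (\<Union>(elems c l)) v) x) = v x" unfolding pou_sum[OF xM] by simp
qed

subsection \<open>Solvability and the form of the preconditioned operator\<close>

lemma form_sesq: "sesq (fe_space p M) (form c)" and form_definite: "definite (fe_space p M) (form c)"
  unfolding form_def
  using sesq_mono[OF sesq_helmholtz[OF mesh] fe_space_pwpoly] definite_helmholtz[OF mesh order absorb wave] by auto

lemma form_loc_sesq: "l \<in> I \<Longrightarrow> sesq (fe_space p (elems c l)) (form_loc c l)"
  unfolding form_loc_def by (rule sesq_mono[OF sesq_helmholtz[OF elems_simplicial] fe_space_pwpoly])

lemma form_loc_definite: "l \<in> I \<Longrightarrow> definite (fe_space p (elems c l)) (form_loc c l)"
  unfolding form_loc_def by (rule definite_helmholtz[OF elems_simplicial order absorb wave])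

lemma l2_sesq: "sesq (fe_space p M) (l2_inner (whole c))" and l2_definite: "definite (fe_space p M) (l2_inner (whole c))"
  unfolding whole_def using sesq_mono[OF sesq_l2_inner[OF mesh] fe_space_pwpoly] definite_l2[OF mesh order] by auto

lemma l2_loc_sesq: "l \<in> I \<Longrightarrow> sesq (fe_space p (elems c l)) (l2_inner (subdom c l))"
  unfolding subdom_def by (rule sesq_mono[OF sesq_l2_inner[OF elems_simplicial] fe_space_pwpoly])

lemma l2_loc_definite: "l \<in> I \<Longrightarrow> definite (fe_space p (elems c l)) (l2_inner (subdom c l))"
  unfolding subdom_def by (rule definite_l2[OF elems_simplicial order])

lemma A_op:
  assumes v: "v \<in> Vh c"
  shows "A_op c v \<in> Vh c" "\<And>w. w \<in> Vh c \<Longrightarrow> l2_inner (whole c) (A_op c v) w = form c v w"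
proof -
  obtain f and J :: "(real^2) set" where J: "finite J" "fe_space p M = fspan f J"
    by (rule fe_space_finite_span[OF mesh order])
  note r = representer[OF J(2,1) l2_sesq l2_definite sesq_antilin[OF form_sesq v[unfolded Vh_def]]]
  show "A_op c v \<in> Vh c" unfolding A_op_def Vh_def by (rule r)
  show "l2_inner (whole c) (A_op c v) w = form c v w" if "w \<in> Vh c" for w
    using r(2)[OF that[unfolded Vh_def]] by (simp add: A_op_def Vh_def)
qed

text \<open>The operator \<open>P\<^sub>\<epsilon>\<^sub>,\<^sub>l\<close>. Passing through the \<open>L\<^sup>2\<close> representers and back, as the preconditioner
  does, amounts to it by \<open>A_loc_solve\<close>.\<close>

definition P_loc :: "nat \<Rightarrow> (real^2 \<Rightarrow> complex) \<Rightarrow> real^2 \<Rightarrow> complex" where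
  "P_loc l v = representer (fe_space p (elems c l)) (form_loc c l) (\<lambda>w. form c v (extend c l w))"

lemma antilin_extend:
  assumes l: "l \<in> I" and b: "sesq (fe_space p M) b" and v: "v \<in> Vh c"
  shows "antilin (fe_space p (elems c l)) (\<lambda>w. b v (extend c l w))"
  unfolding antilin_def
  using extend_linear[OF l] sesqD(2)[OF b _ _ v[unfolded Vh_def]] extend_Vh[OF l, unfolded Vh_def] by simp

lemma P_loc:
  assumes l: "l \<in> I" and v: "v \<in> Vh c"
  shows "P_loc l v \<in> fe_space p (elems c l)"
    "\<And>w. w \<in> fe_space p (elems c l) \<Longrightarrow> form_loc c l (P_loc l v) w = form c v (extend c l w)"
proof -
  obtain f and J :: "(real^2) set" where J: "finite J" "fe_space p (elems c l) = fspan f J"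
    by (rule fe_space_finite_span[OF elems_simplicial[OF l] order])
  note r = representer[OF J(2,1) form_loc_sesq[OF l] form_loc_definite[OF l] antilin_extend[OF l form_sesq v]]
  show "P_loc l v \<in> fe_space p (elems c l)" unfolding P_loc_def by (rule r)
  show "form_loc c l (P_loc l v) w = form c v (extend c l w)" if "w \<in> fe_space p (elems c l)" for w
    unfolding P_loc_def by (rule r(2)[OF that])
qed

text \<open>The \<open>L\<^sup>2\<close> representers cancel: \<open>A\<^sub>\<epsilon>\<^sub>,\<^sub>l P\<^sub>\<epsilon>\<^sub>,\<^sub>l v = E\<^sub>l\<^sup>* A\<^sub>\<epsilon> v\<close>, and \<open>A\<^sub>\<epsilon>\<^sub>,\<^sub>l\<close> is injective.\<close>

lemma A_loc_solve:
  assumes l: "l \<in> I" and v: "v \<in> Vh c"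
  shows "inv_into (Vh_loc c l) (A_loc c l) (extend_adj c l (A_op c v)) = P_loc l v"
proof -
  let ?V = "fe_space p (elems c l)"
  have V: "csubspace ?V" by (rule csubspace_fe_space)
  obtain f and J :: "(real^2) set" where J: "finite J" "?V = fspan f J"
    by (rule fe_space_finite_span[OF elems_simplicial[OF l] order])
  have A: "A_loc c l u \<in> ?V \<and> (\<forall>w\<in>?V. l2_inner (subdom c l) (A_loc c l u) w = form_loc c l u w)" if "u \<in> ?V" for u
    unfolding A_loc_def Vh_loc_eq[OF l]
    using representer[OF J(2,1) l2_loc_sesq[OF l] l2_loc_definite[OF l] sesq_antilin[OF form_loc_sesq[OF l] that]] by blast
  have inj: "inj_on (A_loc c l) ?V"
  proof (rule inj_onI)
    fix u u' assume u: "u \<in> ?V" "u' \<in> ?V" and eq: "A_loc c l u = A_loc c l u'"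
    have "form_loc c l u w = form_loc c l u' w" if "w \<in> ?V" for w
      using A[OF u(1)] A[OF u(2)] eq that by metis
    then show "u = u'" by (rule definite_unique[OF form_loc_sesq[OF l] V form_loc_definite[OF l] u])
  qed
  have "extend_adj c l (A_op c v) = A_loc c l (P_loc l v)"
    unfolding extend_adj_def Vh_loc_eq[OF l]
  proof (rule representer_eqI[OF l2_loc_sesq[OF l] V l2_loc_definite[OF l]])
    note P = P_loc[OF l v]
    show "A_loc c l (P_loc l v) \<in> ?V" using A[OF P(1)] by blast
    show "l2_inner (subdom c l) (A_loc c l (P_loc l v)) w = l2_inner (whole c) (A_op c v) (extend c l w)"
      if w: "w \<in> ?V" for w
      using A[OF P(1)] P(2)[OF w] A_op(2)[OF v extend_Vh[OF l]] w by simp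
  qed
  then show ?thesis unfolding Vh_loc_eq[OF l] by (rule inv_into_f_eq[OF inj P_loc(1)[OF l v] sym])
qed

text \<open>The operator \<open>P\<^sub>0\<^sup>\<rho>\<close>, for an arbitrary coarse space.\<close>

definition P_coarse :: "(real^2 \<Rightarrow> complex) set \<Rightarrow> (real^2 \<Rightarrow> complex) \<Rightarrow> real^2 \<Rightarrow> complex" where
  "P_coarse V0 v = representer V0 (form c) (form c v)"

lemma P_coarse:
  assumes V0: "V0 \<subseteq> Vh c" "V0 = fspan f J" "finite J" and v: "v \<in> Vh c"
  shows "P_coarse V0 v \<in> V0" "\<And>w. w \<in> V0 \<Longrightarrow> form c (P_coarse V0 v) w = form c v w"
proof -
  have sub: "V0 \<subseteq> fe_space p M" using V0(1) by (simp add: Vh_def)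
  note r = representer[OF V0(2,3) sesq_mono[OF form_sesq sub] definite_mono[OF form_definite sub]
      antilin_mono[OF sesq_antilin[OF form_sesq v[unfolded Vh_def]] sub]]
  show "P_coarse V0 v \<in> V0" unfolding P_coarse_def by (rule r)
  show "form c (P_coarse V0 v) w = form c v w" if "w \<in> V0" for w
    unfolding P_coarse_def by (rule r(2)[OF that])
qed

lemma P_coarse_eqI:
  assumes V0: "V0 \<subseteq> Vh c" "V0 = fspan f J" and u: "u \<in> V0" "\<And>w. w \<in> V0 \<Longrightarrow> form c u w = form c v w"
  shows "P_coarse V0 v = u"
proof -
  have sub: "V0 \<subseteq> fe_space p M" using V0(1) by (simp add: Vh_def)
  have "csubspace V0" unfolding V0(2) by (rule csubspace_fspan)
  then show ?thesis unfolding P_coarse_def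
    using representer_eqI[OF sesq_mono[OF form_sesq sub] _ definite_mono[OF form_definite sub] u] by blast
qed

lemma coarse_solve:
  assumes V0: "V0 \<subseteq> Vh c" "V0 = fspan f J" "finite J" and v: "v \<in> Vh c"
  shows "coarse_solve c V0 (A_op c v) = P_coarse V0 v"
proof -
  have sub: "V0 \<subseteq> fe_space p M" using V0(1) by (simp add: Vh_def)
  have V: "csubspace V0" unfolding V0(2) by (rule csubspace_fspan)
  note l2 = sesq_mono[OF l2_sesq sub] definite_mono[OF l2_definite sub]
  note fo = sesq_mono[OF form_sesq sub] definite_mono[OF form_definite sub]
  have A: "A_coarse c V0 u \<in> V0 \<and> (\<forall>w\<in>V0. l2_inner (whole c) (A_coarse c V0 u) w = form c u w)" if "u \<in> V0" for u
    unfolding A_coarse_def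
    using representer[OF V0(2,3) l2 sesq_antilin[OF fo(1) that]] by blast
  have inj: "inj_on (A_coarse c V0) V0"
  proof (rule inj_onI)
    fix u u' assume u: "u \<in> V0" "u' \<in> V0" and eq: "A_coarse c V0 u = A_coarse c V0 u'"
    have "form c u w = form c u' w" if "w \<in> V0" for w using A[OF u(1)] A[OF u(2)] eq that by metis
    then show "u = u'" by (rule definite_unique[OF fo(1) V fo(2) u])
  qed
  note P = P_coarse[OF V0 v]
  have "incl_adj c V0 (A_op c v) = A_coarse c V0 (P_coarse V0 v)"
    unfolding incl_adj_def
  proof (rule representer_eqI[OF l2(1) V l2(2)])
    show "A_coarse c V0 (P_coarse V0 v) \<in> V0" using A[OF P(1)] by blast
    show "l2_inner (whole c) (A_coarse c V0 (P_coarse V0 v)) w = l2_inner (whole c) (A_op c v) w" if w: "w \<in> V0" for w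
      using A[OF P(1)] P(2)[OF w] A_op(2)[OF v] w V0(1) by auto
  qed
  then show ?thesis unfolding coarse_solve_def by (rule inv_into_f_eq[OF inj P(1) sym])
qed

lemma P_op_eq:
  assumes V0: "V0 \<subseteq> Vh c" "V0 = fspan f J" "finite J" and v: "v \<in> Vh c"
  defines "y \<equiv> \<lambda>x. \<Sum>l\<in>I. DE c l (P_loc l v) x"
  shows "P_op c V0 v = (\<lambda>x. y x - P_coarse V0 y x + P_coarse V0 v x)"
proof -
  have y: "local_solves c (A_op c v) = y"
    unfolding local_solves_def y_def using A_loc_solve[OF _ v] by (intro ext sum.cong) auto
  have "y \<in> Vh c" unfolding y_def Vh_def
    using DE_Vh unfolding Vh_def by (intro csubspace_sum csubspace_fe_space)
  then show ?thesis
    unfolding P_op_def B_inv_def y using coarse_solve[OF V0] v by simp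
qed

subsection \<open>The local errors are discrete Helmholtz extensions\<close>

text \<open>The extension differs from the extension by zero only through nodal values on the boundary of
  \<open>\<Omega>\<^sub>l\<close>.\<close>

lemma extend_of_zero_trace:
  assumes l: "l \<in> I" and w: "w \<in> fe_space p (elems c l)" and z: "\<And>x. x \<in> frontier (subdom c l) \<Longrightarrow> w x = 0"
  shows "extend c l w = w"
proof
  fix x
  show "extend c l w x = w x"
  proof (cases "x \<in> \<Union>M")
    case True
    then obtain T where T: "T \<in> M" "x \<in> T" by blast
    show ?thesis
    proof (cases "T \<in> elems c l")
      case True
      then show ?thesis using extend_on_elems[OF l w _ T(2)] by simp
    next
      case False
      have w0: "w y = 0" if "y \<in> T" for y
      proof (cases "y \<in> \<Union>(elems c l)")
        case True
        have "y \<notin> subdom c l"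
          using outside_disjoint(2)[OF mesh elems_sub[OF l] T(1) False] that by (auto simp: subdom_def)
        then show ?thesis using z frontier_subdom[OF l] True by blast
      next
        case False then show ?thesis using w by (simp add: fe_space_def)
      qed
      have "extend c l w x = interp (vertices T) p w x"
        unfolding extend_eq[OF l w] by (rule nodal_interp_on_element[OF mesh order T])
      also have "\<dots> = interp (vertices T) p (\<lambda>x. 0) x"
        using w0 element_nodes_subset[OF simplicialD(2)[OF mesh T(1)] order]
        by (intro interp_cong_nodes[OF simplicialD(2)[OF mesh T(1)]]) blast
      also have "\<dots> = w x" using w0[OF T(2)] by (simp add: interp_def)
      finally show ?thesis .
    qed
  next
    case False
    then have "x \<notin> \<Union>(elems c l)" using elems_sub[OF l] by blast
    then show ?thesis using False w extend_Vh[OF l, of w] by (simp add: Vh_def fe_space_def)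
  qed
qed

text \<open>For test functions with zero trace the global and the local form see the same integrals. Therefore
  the local error solves a local problem whose right-hand side depends on traces only.\<close>

lemma form_eq_of_zero_trace:
  assumes l: "l \<in> I" and v: "v \<in> Vh c" and w: "w \<in> fe_space p (elems c l)"
    and z: "\<And>x. x \<in> frontier (subdom c l) \<Longrightarrow> w x = 0"
  shows "form c v (extend c l w) = form_loc c l (restr (\<Union>(elems c l)) v) w"
proof -
  let ?E = "elems c l"
  have ext: "extend c l w = w" by (rule extend_of_zero_trace[OF assms(1,3,4)])
  have wV: "w \<in> Vh c" using extend_Vh[OF l, of w] ext by simp
  note sub = elems_sub[OF l] and S = elems_simplicial[OF l]
  note vM = Vh_pwpoly[OF v] and wM = Vh_pwpoly[OF wV]
  have vE: "restr (\<Union>?E) v \<in> pwpoly p ?E" using restr_fe_space[OF l v] fe_space_pwpoly by blast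
  have wE: "w \<in> pwpoly p ?E" using w fe_space_pwpoly by blast
  have w0: "w x = 0" if "T \<in> M - ?E" "x \<in> T" for T x
  proof (cases "x \<in> \<Union>?E")
    case True
    have "x \<notin> subdom c l" using outside_disjoint(2)[OF mesh sub, of T] that by (auto simp: subdom_def)
    then show ?thesis using z frontier_subdom[OF l] True by blast
  next
    case False then show ?thesis using w by (simp add: fe_space_def)
  qed
  have zp: "poly_on p T (\<lambda>x. 0)" for T using csubspace_zero[OF csubspace_pwpoly, of p "{T}"] by (simp add: pwpoly_def)
  have out: "grad_inner T v w = 0 \<and> l2_inner T v w = 0" if T: "T \<in> M - ?E" for T
  proof -
    have sT: "2 simplex T" using simplicialD(2)[OF mesh] T by blast
    have pv: "poly_on p T v" using pwpolyD[OF vM] T by blast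
    have z0: "poly_on p T (\<lambda>x. 0)" by (rule zp)
    have "grad_inner T v w = grad_inner T v (\<lambda>x. 0)" using w0[OF T] by (intro grad_inner_cong[OF sT pv z0]) auto
    also have "\<dots> = 0" using sesq_zero(2)[OF sesq_grad_inner_simplex[OF sT] csubspace_poly_on] pv by simp
    finally have 1: "grad_inner T v w = 0" .
    have "l2_inner T v w = l2_inner T v (\<lambda>x. 0)" using w0[OF T] by (intro l2_inner_cong) auto
    also have "\<dots> = 0" using sesq_zero(2)[OF sesq_l2_inner_simplex[OF sT] csubspace_poly_on] pv by simp
    finally show ?thesis using 1 by simp
  qed
  have rest: "grad_inner T (restr (\<Union>?E) v) w = grad_inner T v w \<and> l2_inner T (restr (\<Union>?E) v) w = l2_inner T v w"
    if T: "T \<in> ?E" for T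
  proof -
    have sT: "2 simplex T" using simplicialD(2)[OF S T] .
    have eq: "restr (\<Union>?E) v y = v y" if "y \<in> T" for y using that T by (auto simp: restr_def)
    have "poly_on p T v" "poly_on p T w" using pwpolyD[OF vM] pwpolyD[OF wM] T sub by blast+
    then show ?thesis using grad_inner_cong[OF sT] l2_inner_cong eq by blast
  qed
  have g: "(\<Sum>T\<in>M. grad_inner T v w) = (\<Sum>T\<in>?E. grad_inner T (restr (\<Union>?E) v) w)"
    using out rest by (intro sum.mono_neutral_cong_right simplicialD(1)[OF mesh] sub) auto
  have m: "(\<Sum>T\<in>M. l2_inner T v w) = (\<Sum>T\<in>?E. l2_inner T (restr (\<Union>?E) v) w)"
    using out rest by (intro sum.mono_neutral_cong_right simplicialD(1)[OF mesh] sub) auto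
  have "interior (\<Union>?E) \<subseteq> interior (\<Union>M)" using sub by (intro interior_mono) blast
  then have "w x = 0" if "x \<in> frontier (interior (\<Union>M))" for x
  proof (cases "x \<in> \<Union>?E")
    case True
    have "x \<notin> interior (\<Union>?E)" using that \<open>interior (\<Union>?E) \<subseteq> interior (\<Union>M)\<close> frontier_interior_Union[OF mesh] by blast
    then show ?thesis using z frontier_subdom[OF l] True unfolding subdom_def by blast
  next
    case False then show ?thesis using w by (simp add: fe_space_def)
  qed
  then have b: "boundary_inner M v w = 0" by (intro boundary_inner_zero[OF mesh]) blast
  have be: "boundary_inner ?E (restr (\<Union>?E) v) w = 0"
    using z[unfolded subdom_def] by (intro boundary_inner_zero[OF S]) blast
  show ?thesis
    unfolding ext form_def form_loc_def helmholtz_form_def b be grad_inner_Union[OF mesh vM wM]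
      l2_inner_Union[OF mesh vM wM] grad_inner_Union[OF S vE wE] l2_inner_Union[OF S vE wE] g m ..
qed

text \<open>A functional that only depends on the trace is represented on the traces by the boundary
  inner product, because this is definite there. So every solution of the local problem with a
  right-hand side that does not see interior degrees of freedom lies in \<open>Vh_bd\<close>.\<close>

lemma mem_Vh_bd:
  assumes l: "l \<in> I" and z: "z \<in> fe_space p (elems c l)"
    and 0: "\<And>w. w \<in> fe_space p (elems c l) \<Longrightarrow> (\<And>x. x \<in> frontier (subdom c l) \<Longrightarrow> w x = 0) \<Longrightarrow> form_loc c l z w = 0"
  shows "z \<in> Vh_bd c l"
proof -
  let ?E = "elems c l" and ?V = "fe_space p (elems c l)" and ?F = "frontier (subdom c l)"
  note S = elems_simplicial[OF l]
  have Vs: "csubspace ?V" by (rule csubspace_fe_space)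
  define W where "W = restr ?F ` ?V"
  obtain f and J :: "(real^2) set" where J: "finite J" "?V = fspan f J"
    by (rule fe_space_finite_span[OF S order])
  have W: "W = fspan (\<lambda>i. restr ?F (f i)) J"
  proof -
    have "restr ?F (\<lambda>x. \<Sum>i\<in>J. a i * f i x) = (\<lambda>x. \<Sum>i\<in>J. a i * restr ?F (f i) x)" for a
      by (auto simp: restr_def fun_eq_iff)
    then show ?thesis unfolding W_def J(2) fspan_def by (auto simp: image_iff) metis+
  qed
  have Ws: "csubspace W" unfolding W by (rule csubspace_fspan)
  have edge: "boundary_inner ?E u w = boundary_inner ?E (restr ?F u) (restr ?F w)" for u w
    unfolding boundary_inner_def
  proof (rule sum.cong[OF refl])
    fix e assume e: "e \<in> boundary_edges ?E"
    obtain T a b where ab: "e = closed_segment a b" using boundary_edge_cases[OF S e] by metis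
    have "x \<in> ?F" if "x \<in> e" for x using e that by (auto simp: boundary_edges_def subdom_def)
    then have "u (linepath a b t) * cnj (w (linepath a b t)) = restr ?F u (linepath a b t) * cnj (restr ?F w (linepath a b t))"
      if "t \<in> {0..1}" for t using that ab by (auto simp: linepath_image_01[symmetric] restr_def)
    then have "integral {0..1} (\<lambda>t. u (linepath a b t) * cnj (w (linepath a b t)))
        = integral {0..1} (\<lambda>t. restr ?F u (linepath a b t) * cnj (restr ?F w (linepath a b t)))"
      by (rule Henstock_Kurzweil_Integration.integral_cong)
    then show "edge_integral e (\<lambda>x. u x * cnj (w x)) = edge_integral e (\<lambda>x. restr ?F u x * cnj (restr ?F w x))"
      unfolding ab edge_integral_closed_segment by simp
  qed
  have bV: "sesq ?V (boundary_inner ?E)"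
    by (rule sesq_mono[OF sesq_boundary_inner[OF S]]) (use fe_space_pwpoly in \<open>auto simp: pwpoly_def\<close>)
  have rl: "restr ?F (\<lambda>x. u x + a * v x) = (\<lambda>x. restr ?F u x + a * restr ?F v x)" for u v a
    by (auto simp: restr_def fun_eq_iff)
  have bW: "sesq W (boundary_inner ?E)"
    unfolding sesq_def
  proof (intro ballI allI)
    fix u v w a assume "u \<in> W" "v \<in> W" "w \<in> W"
    then obtain u' v' w' where uvw: "u = restr ?F u'" "v = restr ?F v'" "w = restr ?F w'" "u' \<in> ?V" "v' \<in> ?V" "w' \<in> ?V"
      by (auto simp: W_def)
    show "boundary_inner ?E (\<lambda>x. u x + a * v x) w = boundary_inner ?E u w + a * boundary_inner ?E v w \<and>
      boundary_inner ?E w (\<lambda>x. u x + a * v x) = boundary_inner ?E w u + cnj a * boundary_inner ?E w v"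
      unfolding uvw rl[symmetric] edge[symmetric] using sesqD[OF bV uvw(4-6)] by blast
  qed
  have dW: "definite W (boundary_inner ?E)"
    unfolding definite_def
  proof (intro ballI impI)
    fix u assume "u \<in> W" and u0: "boundary_inner ?E u u = 0"
    then obtain u' where u: "u = restr ?F u'" "u' \<in> ?V" by (auto simp: W_def)
    have "boundary_inner ?E u' u' = 0" using u0 unfolding u(1) edge[symmetric] .
    then have "u' x = 0" if "x \<in> ?F" for x
      using that u(2) unfolding subdom_def by (intro boundary_inner_definite[OF S, of p u' x]) (auto simp: fe_space_def)
    then show "u = (\<lambda>x. 0)" unfolding u(1) by (auto simp: restr_def)
  qed
  define lift where "lift u = (SOME w. w \<in> ?V \<and> restr ?F w = u)" for u
  have lift: "lift u \<in> ?V \<and> restr ?F (lift u) = u" if "u \<in> W" for u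
  proof -
    from that obtain w where "w \<in> ?V \<and> restr ?F w = u" unfolding W_def by blast
    then show ?thesis unfolding lift_def by (rule someI[of "\<lambda>w. w \<in> ?V \<and> restr ?F w = u" w])
  qed
  have dep: "form_loc c l z w = form_loc c l z w'" if "w \<in> ?V" "w' \<in> ?V" "restr ?F w = restr ?F w'" for w w'
  proof -
    have "w x - w' x = 0" if "x \<in> ?F" for x using fun_cong[OF \<open>restr ?F w = restr ?F w'\<close>, of x] that by (simp add: restr_def)
    then have "form_loc c l z (\<lambda>x. w x - w' x) = 0" using csubspace_diff[OF Vs that(1,2)] by (intro 0) auto
    then show ?thesis using sesq_diff(2)[OF form_loc_sesq[OF l] that(1,2) z] by simp
  qed
  have "antilin W (\<lambda>u. form_loc c l z (lift u))"
    unfolding antilin_def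
  proof (intro ballI allI)
    fix u v a assume u: "u \<in> W" and v: "v \<in> W"
    have uv: "(\<lambda>x. u x + a * v x) \<in> W" by (rule csubspace_comb[OF Ws u v])
    have "form_loc c l z (lift (\<lambda>x. u x + a * v x)) = form_loc c l z (\<lambda>x. lift u x + a * lift v x)"
      using lift[OF u] lift[OF v] lift[OF uv] rl by (intro dep csubspace_comb[OF Vs]) auto
    also have "\<dots> = form_loc c l z (lift u) + cnj a * form_loc c l z (lift v)"
      using sesqD(2)[OF form_loc_sesq[OF l] _ _ z] lift[OF u] lift[OF v] by blast
    finally show "form_loc c l z (lift (\<lambda>x. u x + a * v x)) = form_loc c l z (lift u) + cnj a * form_loc c l z (lift v)" .
  qed
  from definite_solvable[OF J(1) bW[unfolded W] dW[unfolded W] this[unfolded W]]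
  obtain g where g: "g \<in> W" "\<And>u. u \<in> W \<Longrightarrow> boundary_inner ?E g u = form_loc c l z (lift u)"
    unfolding W by blast
  have "helmholtz_ext c l g = z"
    unfolding helmholtz_ext_def Vh_loc_eq[OF l]
  proof (rule representer_eqI[OF form_loc_sesq[OF l] Vs form_loc_definite[OF l] z])
    fix w assume w: "w \<in> ?V"
    have wW: "restr ?F w \<in> W" using w by (auto simp: W_def)
    have rr: "restr ?F (restr ?F w) = restr ?F w" by (auto simp: restr_def)
    have "boundary_inner ?E g w = boundary_inner ?E g (restr ?F w)"
      unfolding edge[of g w] edge[of g "restr ?F w"] rr ..
    also have "\<dots> = form_loc c l z (lift (restr ?F w))" by (rule g(2)[OF wW])
    also have "\<dots> = form_loc c l z w" using lift[OF wW] w by (intro dep) auto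
    finally show "form_loc c l z w = boundary_inner ?E g w" by simp
  qed
  moreover have "g \<in> Vh_trace c l" using g(1) by (simp add: Vh_trace_def Vh_loc_eq[OF l] W_def)
  ultimately show ?thesis unfolding Vh_bd_def by blast
qed

definition local_error :: "nat \<Rightarrow> (real^2 \<Rightarrow> complex) \<Rightarrow> real^2 \<Rightarrow> complex" where
  "local_error l v = (\<lambda>x. restr (\<Union>(elems c l)) v x - P_loc l v x)"

lemma local_error:
  assumes l: "l \<in> I" and v: "v \<in> Vh c"
  shows "local_error l v \<in> fe_space p (elems c l)" "local_error l v \<in> Vh_bd c l"
    "\<And>w. w \<in> fe_space p (elems c l) \<Longrightarrow>
       form_loc c l (local_error l v) w = form_loc c l (restr (\<Union>(elems c l)) v) w - form c v (extend c l w)"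
proof -
  note r = restr_fe_space[OF l v] and P = P_loc[OF l v]
  show 1: "local_error l v \<in> fe_space p (elems c l)"
    unfolding local_error_def by (rule csubspace_diff[OF csubspace_fe_space r P(1)])
  show 2: "form_loc c l (local_error l v) w = form_loc c l (restr (\<Union>(elems c l)) v) w - form c v (extend c l w)"
    if w: "w \<in> fe_space p (elems c l)" for w
    unfolding local_error_def using sesq_diff(1)[OF form_loc_sesq[OF l] r P(1) w] P(2)[OF w] by simp
  show "local_error l v \<in> Vh_bd c l"
    by (rule mem_Vh_bd[OF l 1]) (simp add: 2 form_eq_of_zero_trace[OF l v])
qed

lemma Vh_bd_subset: "l \<in> I \<Longrightarrow> Vh_bd c l \<subseteq> fe_space p (elems c l)"
proof
  fix z assume l: "l \<in> I" and "z \<in> Vh_bd c l"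
  then obtain g where g: "g \<in> Vh_trace c l" "z = helmholtz_ext c l g" by (auto simp: Vh_bd_def)
  note S = elems_simplicial[OF l]
  obtain f and J :: "(real^2) set" where J: "finite J" "fe_space p (elems c l) = fspan f J"
    by (rule fe_space_finite_span[OF S order])
  obtain g' where g': "g' \<in> fe_space p (elems c l)" "g = restr (frontier (subdom c l)) g'"
    using g(1) by (auto simp: Vh_trace_def Vh_loc_eq[OF l])
  have "boundary_inner (elems c l) g w = boundary_inner (elems c l) g' w" for w
    unfolding boundary_inner_def
  proof (rule sum.cong[OF refl])
    fix e assume e: "e \<in> boundary_edges (elems c l)"
    obtain T a b where ab: "e = closed_segment a b" using boundary_edge_cases[OF S e] by metis
    have "x \<in> frontier (subdom c l)" if "x \<in> e" for x using e that by (auto simp: boundary_edges_def subdom_def)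
    then have "g (linepath a b t) * cnj (w (linepath a b t)) = g' (linepath a b t) * cnj (w (linepath a b t))"
      if "t \<in> {0..1}" for t using that ab g'(2) by (auto simp: linepath_image_01[symmetric] restr_def)
    then have "integral {0..1} (\<lambda>t. g (linepath a b t) * cnj (w (linepath a b t)))
        = integral {0..1} (\<lambda>t. g' (linepath a b t) * cnj (w (linepath a b t)))"
      by (rule Henstock_Kurzweil_Integration.integral_cong)
    then show "edge_integral e (\<lambda>x. g x * cnj (w x)) = edge_integral e (\<lambda>x. g' x * cnj (w x))"
      unfolding ab edge_integral_closed_segment by simp
  qed
  then have gg: "boundary_inner (elems c l) g = boundary_inner (elems c l) g'" by (rule ext)
  have bV: "sesq (fe_space p (elems c l)) (boundary_inner (elems c l))"
    by (rule sesq_mono[OF sesq_boundary_inner[OF S]]) (use fe_space_pwpoly in \<open>auto simp: pwpoly_def\<close>)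
  show "z \<in> fe_space p (elems c l)"
    unfolding g(2) helmholtz_ext_def Vh_loc_eq[OF l] gg
    by (rule representer(1)[OF J(2,1) form_loc_sesq[OF l] form_loc_definite[OF l] sesq_antilin[OF bV g'(1)]])
qed

end

section \<open>Stability estimates\<close>

lemma sum_mult_le_sqrt:
  fixes a b :: "'i \<Rightarrow> real"
  assumes "\<And>i. i \<in> J \<Longrightarrow> 0 \<le> a i" "\<And>i. i \<in> J \<Longrightarrow> 0 \<le> b i"
  shows "(\<Sum>i\<in>J. sqrt (a i) * sqrt (b i)) \<le> sqrt (sum a J) * sqrt (sum b J)"
proof -
  have "(\<Sum>i\<in>J. sqrt (a i) * sqrt (b i)) = (\<Sum>i\<in>J. \<bar>sqrt (a i)\<bar> * \<bar>sqrt (b i)\<bar>)"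
    using assms by (intro sum.cong) auto
  also have "\<dots> \<le> L2_set (\<lambda>i. sqrt (a i)) J * L2_set (\<lambda>i. sqrt (b i)) J" by (rule L2_set_mult_ineq)
  also have "\<dots> = sqrt (sum a J) * sqrt (sum b J)"
    unfolding L2_set_def using assms by (simp add: real_sqrt_pow2 cong: sum.cong)
  finally show ?thesis .
qed

lemma sqrt_mult_common:
  fixes X a b :: real
  assumes "0 \<le> X" shows "sqrt (X * a) * sqrt (X * b) = X * (sqrt a * sqrt b)"
proof -
  have "sqrt (X * a) * sqrt (X * b) = (sqrt X * sqrt X) * (sqrt a * sqrt b)"
    by (simp only: real_sqrt_mult mult_ac)
  then show ?thesis using assms by simp
qed

lemma esq_zero: "esq \<kappa> T (\<lambda>x. 0) = 0"
  by (simp add: esq_def h1sq_def l2sq_def gradsq_def pderivative_def set_lebesgue_integral_def)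

lemma esq_sum_le:
  assumes T: "2 simplex T" and J: "finite J" and u: "\<And>i. i \<in> J \<Longrightarrow> poly_on p T (u i)"
  shows "esq \<kappa> T (\<lambda>x. \<Sum>i\<in>J. u i x) \<le> real (card J) * (\<Sum>i\<in>J. esq \<kappa> T (u i))"
proof -
  have S: "simplicial {T}"
    using T face_of_refl[OF convex_simplex[OF T]] by (auto simp: simplicial_def triangulation_def)
  have n: "energy_norm \<kappa> (interior (\<Union>{T})) v = sqrt (esq \<kappa> T v)" if "poly_on p T v" for v
    using energy_norm_eq[OF S, of v p] that by (simp add: pwpoly_def)
  have "sqrt (esq \<kappa> T (\<lambda>x. \<Sum>i\<in>J. u i x)) \<le> (\<Sum>i\<in>J. sqrt (esq \<kappa> T (u i))) \<and> poly_on p T (\<lambda>x. \<Sum>i\<in>J. u i x)"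
    using J u
  proof (induction J)
    case empty
    have "poly_on p T (\<lambda>x. 0)" using csubspace_zero[OF csubspace_poly_on, of p T] by simp
    then show ?case by (simp add: esq_zero)
  next
    case (insert i J)
    let ?v = "\<lambda>x. \<Sum>i\<in>J. u i x"
    have IH: "sqrt (esq \<kappa> T ?v) \<le> (\<Sum>i\<in>J. sqrt (esq \<kappa> T (u i)))" "poly_on p T ?v"
      using insert.IH insert.prems by (simp_all add: insertI2)
    have ui: "poly_on p T (u i)" using insert.prems by simp
    have eq: "(\<lambda>x. \<Sum>i\<in>insert i J. u i x) = (\<lambda>x. ?v x + 1 * u i x)" using insert.hyps by (simp add: add.commute)
    have pv: "poly_on p T (\<lambda>x. ?v x + 1 * u i x)" by (rule poly_on_add_cmult[OF IH(2) ui])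
    have "energy_norm \<kappa> (interior (\<Union>{T})) (\<lambda>x. ?v x + 1 * u i x)
        \<le> energy_norm \<kappa> (interior (\<Union>{T})) ?v + cmod 1 * energy_norm \<kappa> (interior (\<Union>{T})) (u i)"
      by (rule energy_norm_triangle[OF S, where p = p]) (use IH(2) ui in \<open>simp_all add: pwpoly_def\<close>)
    then have "sqrt (esq \<kappa> T (\<lambda>x. ?v x + 1 * u i x)) \<le> sqrt (esq \<kappa> T ?v) + sqrt (esq \<kappa> T (u i))"
      unfolding n[OF pv] n[OF IH(2)] n[OF ui] by simp
    moreover have "(\<Sum>i\<in>insert i J. sqrt (esq \<kappa> T (u i))) = (\<Sum>i\<in>J. sqrt (esq \<kappa> T (u i))) + sqrt (esq \<kappa> T (u i))"
      using insert.hyps by simp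
    ultimately show ?case unfolding eq using IH(1) pv by linarith
  qed
  then have "sqrt (esq \<kappa> T (\<lambda>x. \<Sum>i\<in>J. u i x)) \<le> (\<Sum>i\<in>J. sqrt (esq \<kappa> T (u i)))" by blast
  then have "(sqrt (esq \<kappa> T (\<lambda>x. \<Sum>i\<in>J. u i x)))\<^sup>2 \<le> (\<Sum>i\<in>J. sqrt (esq \<kappa> T (u i)))\<^sup>2"
    using esq_nonneg by (intro power_mono) auto
  also have "\<dots> \<le> (\<Sum>i\<in>J. (sqrt (esq \<kappa> T (u i)))\<^sup>2) * card J" by (rule sum_squared_le_sum_of_squares)
  finally show ?thesis using esq_nonneg by (simp add: mult.commute)
qed

lemma sum_Union_le:
  fixes F :: "'t \<Rightarrow> real"
  assumes "finite I" "\<And>l. l \<in> I \<Longrightarrow> finite (E l)" "\<And>T. 0 \<le> F T"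
  shows "(\<Sum>T\<in>(\<Union>l\<in>I. E l). F T) \<le> (\<Sum>l\<in>I. \<Sum>T\<in>E l. F T)"
  using assms(1,2)
proof (induction I)
  case (insert i I)
  have f: "finite (E i)" "finite (\<Union>l\<in>I. E l)" using insert by simp_all
  have "(\<Sum>T\<in>E i \<union> (\<Union>l\<in>I. E l). F T) + (\<Sum>T\<in>E i \<inter> (\<Union>l\<in>I. E l). F T) = sum F (E i) + (\<Sum>T\<in>(\<Union>l\<in>I. E l). F T)"
    by (rule sum.union_inter[OF f])
  moreover have "0 \<le> (\<Sum>T\<in>E i \<inter> (\<Union>l\<in>I. E l). F T)" by (intro sum_nonneg assms(3))
  moreover have "(\<Sum>T\<in>(\<Union>l\<in>I. E l). F T) \<le> (\<Sum>l\<in>I. \<Sum>T\<in>E l. F T)" using insert by simp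
  ultimately show ?case using insert.hyps by simp
qed simp

text \<open>Interchange the sums; each \<open>F T\<close> then occurs at most \<open>K\<close> times.\<close>

lemma sum_overlap:
  fixes F :: "'t \<Rightarrow> real"
  assumes "finite I" "finite M" "\<And>l. l \<in> I \<Longrightarrow> E l \<subseteq> M" "\<And>T. T \<in> M \<Longrightarrow> real (card {l\<in>I. T \<in> E l}) \<le> K"
    "\<And>T. T \<in> M \<Longrightarrow> 0 \<le> F T"
  shows "(\<Sum>l\<in>I. \<Sum>T\<in>E l. F T) \<le> K * (\<Sum>T\<in>M. F T)"
proof -
  have "(\<Sum>l\<in>I. \<Sum>T\<in>E l. F T) = (\<Sum>l\<in>I. \<Sum>T\<in>{T\<in>M. T \<in> E l}. F T)"
    using assms(3) by (intro sum.cong refl arg_cong2[where f = sum]) auto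
  also have "\<dots> = (\<Sum>T\<in>M. \<Sum>l\<in>{l\<in>I. T \<in> E l}. F T)" by (rule sum.swap_restrict[OF assms(1,2)])
  also have "\<dots> \<le> (\<Sum>T\<in>M. K * F T)"
    using assms(4,5) by (intro sum_mono) (simp add: mult_right_mono)
  finally show ?thesis by (simp add: sum_distrib_left)
qed

text \<open>The constants that have to be uniform: \<open>K\<close> bounds the overlap, \<open>Cs\<close> and \<open>Cn\<close> are the constants
  of the inverse estimates, \<open>Ct\<close> that of the strip estimate and \<open>Kt\<close> bounds the number of elements
  touching an element. The strip estimate is assumed for the subdomains only; for the whole domain,
  which may fail to be star-shaped, it is inherited by \<open>rim_M_le\<close>.\<close>

locale quantitative = discretisation +
  fixes h K Cs Cn Ct Kt :: real
  assumes h: "0 < h" "\<And>T. T \<in> M \<Longrightarrow> diameter T \<le> h"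
    and cpos: "0 \<le> K" "0 \<le> Cs" "0 \<le> Cn" "0 \<le> Ct" "0 \<le> Kt"
    and sup: "\<And>T v x. T \<in> M \<Longrightarrow> poly_on p T v \<Longrightarrow> x \<in> T \<Longrightarrow> (cmod (v x))\<^sup>2 \<le> Cs / h\<^sup>2 * l2sq T v"
    and nod: "\<And>T v. T \<in> M \<Longrightarrow> poly_on p T v \<Longrightarrow>
      esq (wavenumber c) T v \<le> Cn * (\<Sum>x\<in>element_nodes p T. (cmod (v x))\<^sup>2)"
    and strip: "\<And>l v. l \<in> I \<Longrightarrow> continuous_on (\<Union>(elems c l)) v \<Longrightarrow> v \<in> pwpoly p (elems c l) \<Longrightarrow>
      (\<Sum>T\<in>rim (elems c l). l2sq T v) \<le> Ct * (h / wavenumber c) * (\<Sum>T\<in>elems c l. esq (wavenumber c) T v)"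
    and overlap: "\<And>T. T \<in> M \<Longrightarrow> real (card {l\<in>I. T \<in> elems c l}) \<le> K"
    and cover: "\<And>T. T \<in> M \<Longrightarrow> \<exists>l\<in>I. T \<in> elems c l"
    and diameter_ge_0_core: "\<And>l. l \<in> I \<Longrightarrow> 0 \<le> diameter (core c l)"
    and touch: "\<And>T0. T0 \<in> M \<Longrightarrow> real (card {T\<in>M. T \<inter> T0 \<noteq> {}}) \<le> Kt"
begin

abbreviation "\<kappa> \<equiv> wavenumber c"
abbreviation "\<epsilon> \<equiv> absorption c"
abbreviation "Nsq S v \<equiv> (\<Sum>T\<in>S. esq \<kappa> T v)"

lemma finite_M: "finite M" using simplicialD(1)[OF mesh] .
lemma finite_E: "l \<in> I \<Longrightarrow> finite (elems c l)" using simplicialD(1)[OF elems_simplicial] .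

lemma Nsq_nonneg: "0 \<le> Nsq S v" by (intro sum_nonneg esq_nonneg)

lemma sup_sqrt:
  assumes "T \<in> M" "poly_on p T v" "x \<in> T"
  shows "cmod (v x) \<le> sqrt (Cs / h\<^sup>2) * sqrt (l2sq T v)"
proof -
  have "cmod (v x) = sqrt ((cmod (v x))\<^sup>2)" by simp
  also have "\<dots> \<le> sqrt (Cs / h\<^sup>2 * l2sq T v)" by (rule real_sqrt_le_mono[OF sup[OF assms]])
  also have "\<dots> = sqrt (Cs / h\<^sup>2) * sqrt (l2sq T v)" by (rule real_sqrt_mult)
  finally show ?thesis .
qed

text \<open>An element of the rim of the whole mesh belongs to the rim of every subdomain that contains it.\<close>

lemma rim_M_le:
  assumes v: "v \<in> Vh c"
  shows "(\<Sum>T\<in>rim M. l2sq T v) \<le> Ct * (h / \<kappa>) * (K * Nsq M v)"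
proof -
  have sub: "rim M \<subseteq> (\<Union>l\<in>I. rim (elems c l))"
  proof
    fix T assume T: "T \<in> rim M"
    then have "T \<in> M" by (simp add: rim_def)
    then obtain l where l: "l \<in> I" "T \<in> elems c l" using cover by blast
    have "interior (\<Union>(elems c l)) \<subseteq> interior (\<Union>M)" using elems_sub[OF l(1)] by (intro interior_mono) blast
    then have "T \<in> rim (elems c l)" using T l by (auto simp: rim_def)
    then show "T \<in> (\<Union>l\<in>I. rim (elems c l))" using l by blast
  qed
  have fin: "finite (rim (elems c l))" if "l \<in> I" for l using finite_E[OF that] by (simp add: rim_def)
  have "(\<Sum>T\<in>rim M. l2sq T v) \<le> (\<Sum>T\<in>(\<Union>l\<in>I. rim (elems c l)). l2sq T v)"
    using fin by (intro sum_mono2[OF _ sub]) (auto intro: l2sq_nonneg)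
  also have "\<dots> \<le> (\<Sum>l\<in>I. \<Sum>T\<in>rim (elems c l). l2sq T v)"
    by (rule sum_Union_le[OF finite_atLeastAtMost fin l2sq_nonneg])
  also have "\<dots> \<le> (\<Sum>l\<in>I. Ct * (h / \<kappa>) * Nsq (elems c l) v)"
  proof (rule sum_mono)
    fix l assume l: "l \<in> I"
    have "continuous_on (\<Union>M) v" using v by (simp add: Vh_def fe_space_def)
    then have "continuous_on (\<Union>(elems c l)) v" by (rule continuous_on_subset) (use elems_sub[OF l] in blast)
    then show "(\<Sum>T\<in>rim (elems c l). l2sq T v) \<le> Ct * (h / \<kappa>) * Nsq (elems c l) v"
      by (rule strip[OF l]) (use pwpoly_mono[OF elems_sub[OF l]] Vh_pwpoly[OF v] in blast)
  qed
  also have "\<dots> = Ct * (h / \<kappa>) * (\<Sum>l\<in>I. Nsq (elems c l) v)" by (simp add: sum_distrib_left)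
  also have "\<dots> \<le> Ct * (h / \<kappa>) * (K * Nsq M v)"
    using cpos h(1) wave by (intro mult_left_mono sum_overlap finite_M elems_sub overlap esq_nonneg) auto
  finally show ?thesis .
qed

text \<open>The localisation to \<open>N\<close> keeps the norm of \<open>v\<close> local when \<open>w\<close> is extended from a subdomain.\<close>

lemma volume_bound:
  assumes S: "simplicial S" and N: "N \<subseteq> S" and v: "v \<in> pwpoly p S" and w: "w \<in> pwpoly p S"
    and w0: "\<And>T x. T \<in> S - N \<Longrightarrow> x \<in> T \<Longrightarrow> w x = 0"
  shows "cmod (grad_inner (interior (\<Union>S)) v w - (of_real (\<kappa>\<^sup>2) + \<i> * of_real \<epsilon>) * l2_inner (interior (\<Union>S)) v w)
    \<le> (2 + \<epsilon> / \<kappa>\<^sup>2) * (sqrt (Nsq N v) * sqrt (Nsq N w))"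
proof -
  let ?k = "of_real (\<kappa>\<^sup>2) + \<i> * of_real \<epsilon>"
  have finN: "finite N" using N simplicialD(1)[OF S] finite_subset by blast
  have k: "cmod ?k \<le> \<kappa>\<^sup>2 + \<epsilon>"
  proof -
    have "cmod ?k \<le> cmod (of_real (\<kappa>\<^sup>2)) + cmod (\<i> * of_real \<epsilon>)" by (rule norm_triangle_ineq)
    also have "\<dots> = \<kappa>\<^sup>2 + \<epsilon>" using absorb by (simp add: norm_mult norm_power)
    finally show ?thesis .
  qed
  have zp: "poly_on p T (\<lambda>x. 0)" for T using csubspace_zero[OF csubspace_poly_on, of p T] by simp
  have out: "grad_inner T v w - ?k * l2_inner T v w = 0" if T: "T \<in> S - N" for T
  proof -
    have sT: "2 simplex T" using simplicialD(2)[OF S] T by blast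
    have pv: "poly_on p T v" using pwpolyD[OF v] T by blast
    have "grad_inner T v w = grad_inner T v (\<lambda>x. 0)" using w0[OF T] by (intro grad_inner_cong[OF sT pv zp]) auto
    also have "\<dots> = 0" using sesq_zero(2)[OF sesq_grad_inner_simplex[OF sT] csubspace_poly_on] pv by simp
    finally have 1: "grad_inner T v w = 0" .
    have "l2_inner T v w = l2_inner T v (\<lambda>x. 0)" using w0[OF T] by (intro l2_inner_cong) auto
    also have "\<dots> = 0" using sesq_zero(2)[OF sesq_l2_inner_simplex[OF sT] csubspace_poly_on] pv by simp
    finally show ?thesis using 1 by simp
  qed
  have el: "cmod (grad_inner T v w - ?k * l2_inner T v w) \<le> (2 + \<epsilon> / \<kappa>\<^sup>2) * (sqrt (esq \<kappa> T v) * sqrt (esq \<kappa> T w))"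
    if T: "T \<in> N" for T
  proof -
    have sT: "2 simplex T" using simplicialD(2)[OF S] T N by blast
    have p: "poly_on p T v" "poly_on p T w" using pwpolyD[OF v] pwpolyD[OF w] T N by blast+
    let ?e = "sqrt (esq \<kappa> T v) * sqrt (esq \<kappa> T w)"
    have e0: "0 \<le> ?e" using esq_nonneg by simp
    have "cmod (grad_inner T v w) \<le> sqrt (h1sq T v) * sqrt (h1sq T w)" by (rule grad_inner_CS[OF sT p])
    also have "\<dots> \<le> ?e" using h1sq_le_esq h1sq_nonneg esq_nonneg by (intro mult_mono real_sqrt_le_mono) auto
    finally have 1: "cmod (grad_inner T v w) \<le> ?e" .
    have "\<kappa>\<^sup>2 * cmod (l2_inner T v w) \<le> \<kappa>\<^sup>2 * (sqrt (l2sq T v) * sqrt (l2sq T w))"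
      by (intro mult_left_mono l2_inner_CS[OF sT p]) simp
    also have "\<dots> = sqrt (\<kappa>\<^sup>2 * l2sq T v) * sqrt (\<kappa>\<^sup>2 * l2sq T w)"
      using wave by (simp add: real_sqrt_mult power2_eq_square)
    also have "\<dots> \<le> ?e" using l2sq_le_esq l2sq_nonneg esq_nonneg by (intro mult_mono real_sqrt_le_mono) auto
    finally have 2: "\<kappa>\<^sup>2 * cmod (l2_inner T v w) \<le> ?e" .
    have "cmod (?k * l2_inner T v w) \<le> (\<kappa>\<^sup>2 + \<epsilon>) * cmod (l2_inner T v w)"
      unfolding norm_mult by (rule mult_right_mono[OF k]) simp
    also have "\<dots> = (1 + \<epsilon> / \<kappa>\<^sup>2) * (\<kappa>\<^sup>2 * cmod (l2_inner T v w))" using wave by (simp add: field_simps)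
    also have "\<dots> \<le> (1 + \<epsilon> / \<kappa>\<^sup>2) * ?e" using 2 absorb by (intro mult_left_mono) auto
    finally have "cmod (?k * l2_inner T v w) \<le> (1 + \<epsilon> / \<kappa>\<^sup>2) * ?e" .
    then have "cmod (grad_inner T v w - ?k * l2_inner T v w) \<le> ?e + (1 + \<epsilon> / \<kappa>\<^sup>2) * ?e"
      using 1 norm_triangle_ineq4[of "grad_inner T v w" "?k * l2_inner T v w"] by linarith
    then show ?thesis by (simp add: algebra_simps)
  qed
  have "grad_inner (interior (\<Union>S)) v w - ?k * l2_inner (interior (\<Union>S)) v w
      = (\<Sum>T\<in>S. grad_inner T v w - ?k * l2_inner T v w)"
    unfolding grad_inner_Union[OF S v w] l2_inner_Union[OF S v w] by (simp add: sum_subtractf sum_distrib_left)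
  also have "\<dots> = (\<Sum>T\<in>N. grad_inner T v w - ?k * l2_inner T v w)"
    using out by (intro sum.mono_neutral_right simplicialD(1)[OF S] N) auto
  also have "cmod \<dots> \<le> (\<Sum>T\<in>N. (2 + \<epsilon> / \<kappa>\<^sup>2) * (sqrt (esq \<kappa> T v) * sqrt (esq \<kappa> T w)))"
    by (rule sum_norm_le) (rule el)
  also have "\<dots> = (2 + \<epsilon> / \<kappa>\<^sup>2) * (\<Sum>T\<in>N. sqrt (esq \<kappa> T v) * sqrt (esq \<kappa> T w))" by (simp add: sum_distrib_left)
  also have "\<dots> \<le> (2 + \<epsilon> / \<kappa>\<^sup>2) * (sqrt (Nsq N v) * sqrt (Nsq N w))"
    using absorb by (intro mult_left_mono sum_mult_le_sqrt esq_nonneg) auto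
  finally show ?thesis .
qed

lemma helmholtz_split:
  assumes "cmod (grad_inner (interior (\<Union>S)) v w - (of_real (\<kappa>\<^sup>2) + \<i> * of_real \<epsilon>) * l2_inner (interior (\<Union>S)) v w) \<le> A"
    and "cmod (boundary_inner S v w) \<le> B"
  shows "cmod (helmholtz_form \<kappa> \<epsilon> S v w) \<le> A + \<kappa> * B"
proof -
  have "cmod (\<i> * of_real \<kappa> * boundary_inner S v w) \<le> \<kappa> * B"
    unfolding norm_mult using assms(2) wave by (simp add: mult_left_mono)
  then show ?thesis unfolding helmholtz_form_def using assms(1) norm_triangle_ineq4 by (smt (verit, best))
qed

text \<open>Replaces a trace inequality: together with the strip estimate it shows that \<open>\<kappa>\<close> times the boundary
  term is bounded by the energy norms, uniformly in \<open>\<kappa>\<close> and \<open>h\<close>.\<close>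

lemma boundary_bound:
  assumes S: "simplicial S" "S \<subseteq> M" and v: "v \<in> pwpoly p S" and w: "w \<in> pwpoly p S"
  shows "cmod (boundary_inner S v w) \<le> 9 * (Cs / h) * (\<Sum>T\<in>rim S. sqrt (l2sq T v) * sqrt (l2sq T w))"
proof -
  have "cmod (boundary_inner S v w) \<le> 9 * h * (sqrt (Cs / h\<^sup>2))\<^sup>2 * (\<Sum>T\<in>rim S. sqrt (l2sq T v) * sqrt (l2sq T w))"
  proof (rule boundary_inner_bound[OF S(1)])
    show "cmod (v x) \<le> sqrt (Cs / h\<^sup>2) * sqrt (l2sq T v)" if "T \<in> rim S" "x \<in> T" for T x
      using that S(2) pwpolyD[OF v] by (intro sup_sqrt) (auto simp: rim_def)
    show "cmod (w x) \<le> sqrt (Cs / h\<^sup>2) * sqrt (l2sq T w)" if "T \<in> rim S" "x \<in> T" for T x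
      using that S(2) pwpolyD[OF w] by (intro sup_sqrt) (auto simp: rim_def)
  qed (use h S(2) cpos pwpolyD[OF v] pwpolyD[OF w] in auto)
  moreover have "9 * h * (sqrt (Cs / h\<^sup>2))\<^sup>2 = 9 * (Cs / h)"
    using cpos h(1) by (simp add: power2_eq_square)
  ultimately show ?thesis by simp
qed

definition "Ca = 2 + \<epsilon> / \<kappa>\<^sup>2"

lemma Ca_pos: "2 \<le> Ca" using absorb by (simp add: Ca_def)

lemma form_loc_bound:
  assumes l: "l \<in> I" and v: "v \<in> fe_space p (elems c l)" and w: "w \<in> fe_space p (elems c l)"
  shows "cmod (form_loc c l v w) \<le> (Ca + 9 * Cs * Ct) * (sqrt (Nsq (elems c l) v) * sqrt (Nsq (elems c l) w))"
proof -
  let ?E = "elems c l"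
  note S = elems_simplicial[OF l]
  have pw: "v \<in> pwpoly p ?E" "w \<in> pwpoly p ?E" using v w fe_space_pwpoly by blast+
  have st: "(\<Sum>T\<in>rim ?E. l2sq T u) \<le> Ct * (h / \<kappa>) * Nsq ?E u" if "u \<in> fe_space p ?E" for u
    using that fe_space_pwpoly by (intro strip[OF l]) (auto simp: fe_space_def pwpoly_def)
  have "cmod (boundary_inner ?E v w) \<le> 9 * (Cs / h) * (\<Sum>T\<in>rim ?E. sqrt (l2sq T v) * sqrt (l2sq T w))"
    by (rule boundary_bound[OF S elems_sub[OF l] pw])
  also have "\<dots> \<le> 9 * (Cs / h) * (sqrt (\<Sum>T\<in>rim ?E. l2sq T v) * sqrt (\<Sum>T\<in>rim ?E. l2sq T w))"
    using cpos h(1) by (intro mult_left_mono sum_mult_le_sqrt l2sq_nonneg) auto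
  also have "\<dots> \<le> 9 * (Cs / h) * (sqrt (Ct * (h / \<kappa>) * Nsq ?E v) * sqrt (Ct * (h / \<kappa>) * Nsq ?E w))"
    using cpos h(1) wave Nsq_nonneg
    by (intro mult_left_mono mult_mono real_sqrt_le_mono st v w) (auto intro!: sum_nonneg l2sq_nonneg)
  also have "\<dots> = 9 * (Cs / h) * (Ct * (h / \<kappa>)) * (sqrt (Nsq ?E v) * sqrt (Nsq ?E w))"
    using cpos h(1) wave by (subst sqrt_mult_common) simp_all
  also have "\<dots> = 9 * Cs * Ct / \<kappa> * (sqrt (Nsq ?E v) * sqrt (Nsq ?E w))" using h(1) by simp
  finally have b: "cmod (boundary_inner ?E v w) \<le> 9 * Cs * Ct / \<kappa> * (sqrt (Nsq ?E v) * sqrt (Nsq ?E w))" .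
  have "cmod (form_loc c l v w) \<le> (2 + \<epsilon> / \<kappa>\<^sup>2) * (sqrt (Nsq ?E v) * sqrt (Nsq ?E w))
      + \<kappa> * (9 * Cs * Ct / \<kappa> * (sqrt (Nsq ?E v) * sqrt (Nsq ?E w)))"
    unfolding form_loc_def by (rule helmholtz_split[OF volume_bound[OF S subset_refl pw] b]) auto
  also have "\<dots> = (Ca + 9 * Cs * Ct) * (sqrt (Nsq ?E v) * sqrt (Nsq ?E w))"
    using wave by (simp add: Ca_def algebra_simps)
  finally show ?thesis .
qed

text \<open>The elements which touch \<open>\<Omega>\<^sub>l\<close>: outside them an extended function vanishes.\<close>

abbreviation "near l \<equiv> add_layer M (elems c l)"

lemma near_sub: "near l \<subseteq> M" by (auto simp: add_layer_def)

lemma elems_sub_near: "l \<in> I \<Longrightarrow> elems c l \<subseteq> near l"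
proof
  fix T assume l: "l \<in> I" and T: "T \<in> elems c l"
  have "T \<in> M" using elems_sub[OF l] T by blast
  moreover have "T \<noteq> {}" using interior_simplex_nonempty[OF simplicialD(2)[OF mesh \<open>T \<in> M\<close>]] by auto
  ultimately show "T \<in> near l" using T by (auto simp: add_layer_def)
qed

lemma extend_zero_far:
  assumes l: "l \<in> I" and w: "w \<in> fe_space p (elems c l)" and T: "T \<in> M - near l" "x \<in> T"
  shows "extend c l w x = 0"
proof -
  have TM: "T \<in> M" using T by blast
  note sT = simplicialD(2)[OF mesh TM]
  have "w y = 0" if "y \<in> T" for y
  proof -
    have "y \<notin> \<Union>(elems c l)" using T(1) that by (auto simp: add_layer_def)
    then show ?thesis using w by (simp add: fe_space_def)
  qed
  then have "interp (vertices T) p w x = interp (vertices T) p (\<lambda>x. 0) x"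
    using element_nodes_subset[OF sT order] by (intro interp_cong_nodes[OF sT]) blast
  then show ?thesis
    unfolding extend_eq[OF l w] using nodal_interp_on_element[OF mesh order TM T(2), of w] by (simp add: interp_def)
qed

lemma overlap_near:
  assumes T: "T \<in> M"
  shows "real (card {l\<in>I. T \<in> near l}) \<le> Kt * K"
proof -
  let ?A = "{T'\<in>M. T' \<inter> T \<noteq> {}}"
  have fin: "finite ?A" using finite_M by simp
  have "{l\<in>I. T \<in> near l} \<subseteq> (\<Union>T'\<in>?A. {l\<in>I. T' \<in> elems c l})"
    using elems_sub by (fastforce simp: add_layer_def)
  then have "card {l\<in>I. T \<in> near l} \<le> card (\<Union>T'\<in>?A. {l\<in>I. T' \<in> elems c l})"
    using fin by (intro card_mono) auto
  also have "\<dots> \<le> (\<Sum>T'\<in>?A. card {l\<in>I. T' \<in> elems c l})" by (rule card_UN_le[OF fin])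
  finally have "real (card {l\<in>I. T \<in> near l}) \<le> real (\<Sum>T'\<in>?A. card {l\<in>I. T' \<in> elems c l})"
    by (simp only: of_nat_le_iff)
  also have "\<dots> = (\<Sum>T'\<in>?A. real (card {l\<in>I. T' \<in> elems c l}))" by (rule of_nat_sum)
  also have "\<dots> \<le> real (card ?A) * K" using overlap by (intro sum_bounded_above) auto
  also have "\<dots> \<le> Kt * K" using touch[OF T] cpos by (intro mult_right_mono) auto
  finally show ?thesis .
qed

definition "Ce = Cn * (real ((fe_order c + 1) ^ 3)) * Cs * Kt * Ct"

text \<open>Outside \<open>\<Omega>\<^sub>l\<close> an extended function is determined by nodal values on the boundary of \<open>\<Omega>\<^sub>l\<close>.
  These are controlled by the mass on the elements of the rim alone. Inverse estimates applied to the
  mass on all elements would give the factor \<open>1 / (h \<kappa>)\<^sup>2\<close>; the strip estimate for the rim improves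
  it to \<open>1 / (h \<kappa>)\<close>, which is the source of the summand \<open>\<gamma> / 2\<close> in the exponent of the theorem.\<close>

lemma extend_bound:
  assumes l: "l \<in> I" and w: "w \<in> fe_space p (elems c l)"
  shows "Nsq M (extend c l w) \<le> (1 + Ce / (h * \<kappa>)) * Nsq (elems c l) w"
proof -
  let ?E = "elems c l" and ?e = "extend c l w" and ?n = "real ((fe_order c + 1) ^ 3)"
  note S = elems_simplicial[OF l] and sub = elems_sub[OF l]
  have eM: "?e \<in> pwpoly p M" using Vh_pwpoly[OF extend_Vh[OF l]] .
  have wE: "w \<in> pwpoly p ?E" using w fe_space_pwpoly by blast
  have "Nsq M ?e = Nsq ?E ?e + Nsq (M - ?E) ?e"
    using sum.subset_diff[OF sub finite_M] by (simp add: add.commute)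
  also have "Nsq ?E ?e = Nsq ?E w"
    by (intro sum.cong refl esq_cong[where p = p] extend_on_elems[OF l w])
      (use simplicialD(2)[OF S] pwpolyD[OF wE] in auto)
  also have "Nsq (M - ?E) ?e \<le> (\<Sum>T\<in>M - ?E. \<Sum>T'\<in>{T'\<in>rim ?E. T' \<inter> T \<noteq> {}}. Cn * ?n * (Cs / h\<^sup>2) * l2sq T' w)"
  proof (rule sum_mono)
    fix T assume T: "T \<in> M - ?E"
    then have TM: "T \<in> M" by blast
    note sT = simplicialD(2)[OF mesh TM]
    let ?Q = "\<Sum>T'\<in>{T'\<in>rim ?E. T' \<inter> T \<noteq> {}}. l2sq T' w"
    have finR: "finite {T'\<in>rim ?E. T' \<inter> T \<noteq> {}}" using finite_E[OF l] by (simp add: rim_def)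
    have Q0: "0 \<le> ?Q" by (intro sum_nonneg l2sq_nonneg)
    have nv: "(cmod (?e x))\<^sup>2 \<le> Cs / h\<^sup>2 * ?Q" if x: "x \<in> element_nodes p T" for x
    proof -
      have xT: "x \<in> T" using element_nodes_subset[OF sT order] x by blast
      have "x \<in> mesh_nodes p M" using x TM by (auto simp: mesh_nodes_def)
      then have ex: "?e x = w x" unfolding extend_eq[OF l w] by (rule nodal_interp(2)[OF mesh order])
      show ?thesis
      proof (cases "x \<in> \<Union>?E")
        case True
        then obtain T' where T': "T' \<in> ?E" "x \<in> T'" by blast
        have "x \<notin> interior (\<Union>?E)" using outside_disjoint(2)[OF mesh sub TM] T xT by blast
        then have R: "T' \<in> {T'\<in>rim ?E. T' \<inter> T \<noteq> {}}" using T' xT by (auto simp: rim_def)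
        have "(cmod (w x))\<^sup>2 \<le> Cs / h\<^sup>2 * l2sq T' w"
          using T' sub pwpolyD[OF wE T'(1)] by (intro sup) auto
        also have "\<dots> \<le> Cs / h\<^sup>2 * ?Q"
          using R finR cpos by (intro mult_left_mono member_le_sum) (auto intro: l2sq_nonneg)
        finally show ?thesis by (simp add: ex)
      next
        case False
        then have "w x = 0" using w by (simp add: fe_space_def)
        then show ?thesis using ex Q0 cpos by simp
      qed
    qed
    have "esq \<kappa> T ?e \<le> Cn * (\<Sum>x\<in>element_nodes p T. (cmod (?e x))\<^sup>2)" by (rule nod[OF TM pwpolyD[OF eM TM]])
    also have "\<dots> \<le> Cn * (?n * (Cs / h\<^sup>2 * ?Q))"
    proof (rule mult_left_mono)
      have "(\<Sum>x\<in>element_nodes p T. (cmod (?e x))\<^sup>2) \<le> real (card (element_nodes p T)) * (Cs / h\<^sup>2 * ?Q)"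
        using nv by (rule sum_bounded_above)
      also have "\<dots> \<le> ?n * (Cs / h\<^sup>2 * ?Q)"
        using card_element_nodes_le[OF sT, of p] cpos Q0 by (intro mult_right_mono) (simp_all only: of_nat_le_iff, simp)
      finally show "(\<Sum>x\<in>element_nodes p T. (cmod (?e x))\<^sup>2) \<le> ?n * (Cs / h\<^sup>2 * ?Q)" .
    qed (use cpos in simp)
    finally show "esq \<kappa> T ?e \<le> (\<Sum>T'\<in>{T'\<in>rim ?E. T' \<inter> T \<noteq> {}}. Cn * ?n * (Cs / h\<^sup>2) * l2sq T' w)"
      by (simp add: sum_distrib_left mult.assoc)
  qed
  also have "(\<Sum>T\<in>M - ?E. \<Sum>T'\<in>{T'\<in>rim ?E. T' \<inter> T \<noteq> {}}. Cn * ?n * (Cs / h\<^sup>2) * l2sq T' w)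
      = (\<Sum>T'\<in>rim ?E. \<Sum>T\<in>{T\<in>M - ?E. T' \<inter> T \<noteq> {}}. Cn * ?n * (Cs / h\<^sup>2) * l2sq T' w)"
    by (rule sum.swap_restrict) (use finite_M finite_E[OF l] in \<open>simp_all add: rim_def\<close>)
  also have "\<dots> \<le> (\<Sum>T'\<in>rim ?E. Kt * (Cn * ?n * (Cs / h\<^sup>2) * l2sq T' w))"
  proof (rule sum_mono)
    fix T' assume "T' \<in> rim ?E"
    then have T': "T' \<in> M" using sub by (auto simp: rim_def)
    have "card {T\<in>M - ?E. T' \<inter> T \<noteq> {}} \<le> card {T\<in>M. T \<inter> T' \<noteq> {}}"
      using finite_M by (intro card_mono) auto
    then have "real (card {T\<in>M - ?E. T' \<inter> T \<noteq> {}}) \<le> Kt" using touch[OF T'] by linarith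
    then show "(\<Sum>T\<in>{T\<in>M - ?E. T' \<inter> T \<noteq> {}}. Cn * ?n * (Cs / h\<^sup>2) * l2sq T' w) \<le> Kt * (Cn * ?n * (Cs / h\<^sup>2) * l2sq T' w)"
      unfolding sum_constant using cpos l2sq_nonneg[of T' w] by (intro mult_right_mono) auto
  qed
  also have "\<dots> = Kt * Cn * ?n * (Cs / h\<^sup>2) * (\<Sum>T'\<in>rim ?E. l2sq T' w)"
    unfolding sum_distrib_left by (rule sum.cong[OF refl]) (simp only: mult_ac)
  also have "\<dots> \<le> Kt * Cn * ?n * (Cs / h\<^sup>2) * (Ct * (h / \<kappa>) * Nsq ?E w)"
    using cpos w wE by (intro mult_left_mono strip[OF l]) (auto simp: fe_space_def)
  also have "\<dots> = Ce / (h * \<kappa>) * Nsq ?E w"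
    using h(1) by (simp add: Ce_def power2_eq_square field_simps)
  finally show ?thesis by (simp add: algebra_simps)
qed

text \<open>The boundary mass of \<open>v\<close> that is visible to functions extended from \<open>\<Omega>\<^sub>l\<close>. It is kept as a separate
  quantity because the strip estimate bounds only its sum over all subdomains.\<close>

definition bsq :: "nat \<Rightarrow> (real^2 \<Rightarrow> complex) \<Rightarrow> real" where
  "bsq l v = (\<Sum>T\<in>rim M \<inter> near l. l2sq T v)"

lemma bsq_nonneg: "0 \<le> bsq l v" unfolding bsq_def by (intro sum_nonneg l2sq_nonneg)

lemma form_extend_bound:
  assumes l: "l \<in> I" and v: "v \<in> Vh c" and w: "w \<in> fe_space p (elems c l)"
  shows "cmod (form c v (extend c l w)) \<le>
    (Ca * sqrt (Nsq (near l) v) + 9 * Cs * sqrt (Ct * K) * sqrt (\<kappa> / h * bsq l v))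
      * (sqrt (1 + Ce / (h * \<kappa>)) * sqrt (Nsq (elems c l) w))"
proof -
  let ?e = "extend c l w" and ?W = "sqrt (1 + Ce / (h * \<kappa>)) * sqrt (Nsq (elems c l) w)"
  have eV: "?e \<in> Vh c" by (rule extend_Vh[OF l])
  note pv = Vh_pwpoly[OF v] and pe = Vh_pwpoly[OF eV]
  have eW: "sqrt (Nsq M ?e) \<le> ?W"
    using real_sqrt_le_mono[OF extend_bound[OF l w]] by (simp add: real_sqrt_mult)
  have z: "?e x = 0" if "T \<in> M - near l" "x \<in> T" for T x by (rule extend_zero_far[OF l w that])
  have near_le: "sqrt (Nsq (near l) ?e) \<le> ?W"
  proof -
    have "Nsq (near l) ?e \<le> Nsq M ?e" using near_sub by (intro sum_mono2 finite_M esq_nonneg) auto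
    then show ?thesis using eW real_sqrt_le_mono order_trans by blast
  qed
  have W0: "0 \<le> ?W" using eW Nsq_nonneg by (meson order_trans real_sqrt_ge_zero)
  have vol: "cmod (grad_inner (interior (\<Union>M)) v ?e - (of_real (\<kappa>\<^sup>2) + \<i> * of_real \<epsilon>) * l2_inner (interior (\<Union>M)) v ?e)
      \<le> Ca * (sqrt (Nsq (near l) v) * ?W)"
  proof -
    have "cmod (grad_inner (interior (\<Union>M)) v ?e - (of_real (\<kappa>\<^sup>2) + \<i> * of_real \<epsilon>) * l2_inner (interior (\<Union>M)) v ?e)
      \<le> Ca * (sqrt (Nsq (near l) v) * sqrt (Nsq (near l) ?e))"
      unfolding Ca_def by (rule volume_bound[OF mesh near_sub pv pe z])
    also have "\<dots> \<le> Ca * (sqrt (Nsq (near l) v) * ?W)"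
      using near_le Ca_pos Nsq_nonneg by (intro mult_left_mono) auto
    finally show ?thesis .
  qed
  have bd: "cmod (boundary_inner M v ?e) \<le> 9 * (Cs / h) * (sqrt (bsq l v) * sqrt (Ct * (h / \<kappa>) * K) * ?W)"
  proof -
    have fR: "finite (rim M)" using finite_M by (simp add: rim_def)
    have "cmod (boundary_inner M v ?e) \<le> 9 * (Cs / h) * (\<Sum>T\<in>rim M. sqrt (l2sq T v) * sqrt (l2sq T ?e))"
      by (rule boundary_bound[OF mesh subset_refl pv pe])
    also have "(\<Sum>T\<in>rim M. sqrt (l2sq T v) * sqrt (l2sq T ?e)) = (\<Sum>T\<in>rim M \<inter> near l. sqrt (l2sq T v) * sqrt (l2sq T ?e))"
    proof (rule sum.mono_neutral_right[OF fR])
      show "\<forall>T\<in>rim M - rim M \<inter> near l. sqrt (l2sq T v) * sqrt (l2sq T ?e) = 0"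
      proof
        fix T assume "T \<in> rim M - rim M \<inter> near l"
        then have "T \<in> M - near l" by (auto simp: rim_def)
        then have "l2sq T ?e = l2sq T (\<lambda>x. 0)" using z by (intro l2sq_cong) auto
        also have "\<dots> = 0" by (simp add: l2sq_def set_lebesgue_integral_def)
        finally show "sqrt (l2sq T v) * sqrt (l2sq T ?e) = 0" by simp
      qed
    qed auto
    also have "9 * (Cs / h) * \<dots> \<le> 9 * (Cs / h) * (sqrt (bsq l v) * sqrt (\<Sum>T\<in>rim M \<inter> near l. l2sq T ?e))"
      unfolding bsq_def using cpos h(1) by (intro mult_left_mono sum_mult_le_sqrt l2sq_nonneg) auto
    also have "\<dots> \<le> 9 * (Cs / h) * (sqrt (bsq l v) * (sqrt (Ct * (h / \<kappa>) * K) * ?W))"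
    proof (intro mult_left_mono)
      have "(\<Sum>T\<in>rim M \<inter> near l. l2sq T ?e) \<le> (\<Sum>T\<in>rim M. l2sq T ?e)"
        by (intro sum_mono2 fR l2sq_nonneg) auto
      also have "\<dots> \<le> Ct * (h / \<kappa>) * (K * Nsq M ?e)" by (rule rim_M_le[OF eV])
      finally have "sqrt (\<Sum>T\<in>rim M \<inter> near l. l2sq T ?e) \<le> sqrt (Ct * (h / \<kappa>) * K * Nsq M ?e)"
        by (intro real_sqrt_le_mono) (simp add: mult.assoc)
      also have "\<dots> = sqrt (Ct * (h / \<kappa>) * K) * sqrt (Nsq M ?e)" by (rule real_sqrt_mult)
      also have "\<dots> \<le> sqrt (Ct * (h / \<kappa>) * K) * ?W" using eW cpos h(1) wave by (intro mult_left_mono) auto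
      finally show "sqrt (\<Sum>T\<in>rim M \<inter> near l. l2sq T ?e) \<le> sqrt (Ct * (h / \<kappa>) * K) * ?W" .
    qed (use cpos h(1) bsq_nonneg in auto)
    finally show ?thesis by (simp add: mult.assoc)
  qed
  have k: "\<kappa> * (9 * (Cs / h) * (sqrt (bsq l v) * sqrt (Ct * (h / \<kappa>) * K) * ?W))
      = 9 * Cs * sqrt (Ct * K) * sqrt (\<kappa> / h * bsq l v) * ?W"
  proof -
    have a: "sqrt (\<kappa> / h) * sqrt (h / \<kappa>) = 1"
      using wave h(1) unfolding real_sqrt_mult[symmetric] by simp
    have b: "sqrt (\<kappa> / h) * sqrt (\<kappa> / h) = \<kappa> / h" using wave h(1) by simp
    have "(sqrt (\<kappa> / h) * sqrt (\<kappa> / h)) * sqrt (h / \<kappa>) = sqrt (\<kappa> / h) * (sqrt (\<kappa> / h) * sqrt (h / \<kappa>))"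
      by (rule mult.assoc)
    then have e: "\<kappa> / h * sqrt (h / \<kappa>) = sqrt (\<kappa> / h)" by (simp only: a b mult_1_right)
    have "Ct * (h / \<kappa>) * K = (Ct * K) * (h / \<kappa>)" by (simp only: mult_ac)
    then have d: "sqrt (Ct * (h / \<kappa>) * K) = sqrt (Ct * K) * sqrt (h / \<kappa>)" by (simp only: real_sqrt_mult)
    have "\<kappa> * (9 * (Cs / h) * (sqrt (bsq l v) * sqrt (Ct * (h / \<kappa>) * K) * ?W))
      = (\<kappa> / h * sqrt (h / \<kappa>)) * (9 * Cs * sqrt (Ct * K) * sqrt (bsq l v) * ?W)"
      unfolding d by simp
    also have "\<kappa> / h * sqrt (h / \<kappa>) = sqrt (\<kappa> / h)" by (rule e)
    also have "sqrt (\<kappa> / h) * (9 * Cs * sqrt (Ct * K) * sqrt (bsq l v) * ?W)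
        = 9 * Cs * sqrt (Ct * K) * sqrt (\<kappa> / h * bsq l v) * ?W"
      unfolding real_sqrt_mult[of "\<kappa> / h" "bsq l v"] by (simp only: mult_ac)
    finally show ?thesis .
  qed
  have "cmod (form c v ?e) \<le> Ca * (sqrt (Nsq (near l) v) * ?W)
      + \<kappa> * (9 * (Cs / h) * (sqrt (bsq l v) * sqrt (Ct * (h / \<kappa>) * K) * ?W))"
    unfolding form_def by (rule helmholtz_split[OF vol bd])
  also have "\<dots> = (Ca * sqrt (Nsq (near l) v) + 9 * Cs * sqrt (Ct * K) * sqrt (\<kappa> / h * bsq l v)) * ?W"
    unfolding k by (simp add: algebra_simps)
  finally show ?thesis .
qed

lemma form_bound:
  assumes v: "v \<in> Vh c" and w: "w \<in> Vh c"
  shows "cmod (form c v w) \<le> (Ca + 9 * Cs * Ct * K) * (sqrt (Nsq M v) * sqrt (Nsq M w))"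
proof -
  note pw = Vh_pwpoly[OF v] Vh_pwpoly[OF w]
  have "cmod (boundary_inner M v w) \<le> 9 * (Cs / h) * (\<Sum>T\<in>rim M. sqrt (l2sq T v) * sqrt (l2sq T w))"
    by (rule boundary_bound[OF mesh subset_refl pw])
  also have "\<dots> \<le> 9 * (Cs / h) * (sqrt (\<Sum>T\<in>rim M. l2sq T v) * sqrt (\<Sum>T\<in>rim M. l2sq T w))"
    using cpos h(1) by (intro mult_left_mono sum_mult_le_sqrt l2sq_nonneg) auto
  also have "\<dots> \<le> 9 * (Cs / h) * (sqrt (Ct * (h / \<kappa>) * (K * Nsq M v)) * sqrt (Ct * (h / \<kappa>) * (K * Nsq M w)))"
    using cpos h(1) wave Nsq_nonneg
    by (intro mult_left_mono mult_mono real_sqrt_le_mono rim_M_le v w) (auto intro!: sum_nonneg l2sq_nonneg)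
  also have "\<dots> = 9 * (Cs / h) * (Ct * (h / \<kappa>) * K) * (sqrt (Nsq M v) * sqrt (Nsq M w))"
    unfolding mult.assoc[of "Ct * (h / \<kappa>)" K, symmetric]
    using cpos h(1) wave by (subst sqrt_mult_common) simp_all
  also have "\<dots> = 9 * Cs * Ct * K / \<kappa> * (sqrt (Nsq M v) * sqrt (Nsq M w))" using h(1) by simp
  finally have b: "cmod (boundary_inner M v w) \<le> 9 * Cs * Ct * K / \<kappa> * (sqrt (Nsq M v) * sqrt (Nsq M w))" .
  have "cmod (form c v w) \<le> (2 + \<epsilon> / \<kappa>\<^sup>2) * (sqrt (Nsq M v) * sqrt (Nsq M w))
      + \<kappa> * (9 * Cs * Ct * K / \<kappa> * (sqrt (Nsq M v) * sqrt (Nsq M w)))"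
    unfolding form_def by (rule helmholtz_split[OF volume_bound[OF mesh subset_refl pw] b]) auto
  also have "\<dots> = (Ca + 9 * Cs * Ct * K) * (sqrt (Nsq M v) * sqrt (Nsq M w))"
    using wave by (simp add: Ca_def algebra_simps)
  finally show ?thesis .
qed

text \<open>Galerkin orthogonality and the coercivity of \<open>helmholtz_lower\<close>, whose constant \<open>\<kappa>\<^sup>2 / \<epsilon>\<close> is
  \<open>\<kappa>\<close> to the power \<open>1 - \<alpha>\<close>. Coercivity is inherited by every coarse space.\<close>

lemma P_coarse_bound:
  assumes V0: "V0 \<subseteq> Vh c" "V0 = fspan f J" "finite J" and v: "v \<in> Vh c"
  shows "sqrt (Nsq M (P_coarse V0 v)) \<le> (1 + 2 * \<kappa>\<^sup>2 / \<epsilon>) * (Ca + 9 * Cs * Ct * K) * sqrt (Nsq M v)"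
proof -
  let ?u = "P_coarse V0 v" and ?k = "1 + 2 * \<kappa>\<^sup>2 / \<epsilon>" and ?b = "Ca + 9 * Cs * Ct * K"
  note P = P_coarse[OF V0 v]
  have uV: "?u \<in> Vh c" using P(1) V0(1) by blast
  have k0: "0 \<le> ?k" using absorb by simp
  have "Nsq M ?u \<le> ?k * cmod (form c ?u ?u)"
    unfolding form_def by (rule helmholtz_lower(2)[OF mesh Vh_pwpoly[OF uV] absorb wave])
  also have "form c ?u ?u = form c v ?u" by (rule P(2)[OF P(1)])
  also have "?k * cmod (form c v ?u) \<le> ?k * (?b * (sqrt (Nsq M v) * sqrt (Nsq M ?u)))"
    by (intro mult_left_mono form_bound v uV k0)
  finally have "sqrt (Nsq M ?u) * sqrt (Nsq M ?u) \<le> (?k * ?b * sqrt (Nsq M v)) * sqrt (Nsq M ?u)"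
    using Nsq_nonneg[where S = M and v = ?u] by (simp add: mult_ac)
  moreover have "0 \<le> sqrt (Nsq M ?u)" using Nsq_nonneg by simp
  moreover have "0 \<le> ?k * ?b * sqrt (Nsq M v)" using k0 Ca_pos cpos Nsq_nonneg by simp
  ultimately show ?thesis by (metis mult_le_cancel_right order_le_less)
qed

text \<open>The local inf-sup estimate applied to the local error. The functional on the right-hand side is
  \<open>w \<mapsto> a\<^sub>l(v, w) - a(v, E\<^sub>l w)\<close>, and both of its parts have been bounded above.\<close>

lemma local_error_bound:
  assumes l: "l \<in> I" and v: "v \<in> Vh c" and infsup: "local_inf_sup C c" and C: "0 \<le> C"
  defines "Q \<equiv> sqrt (1 + Ce / (h * \<kappa>)) * ((2 * Ca + 9 * Cs * Ct) * sqrt (Nsq (near l) v)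
      + 9 * Cs * sqrt (Ct * K) * sqrt (\<kappa> / h * bsq l v))"
  shows "sqrt (Nsq (elems c l) (local_error l v)) \<le> C * (1 + \<kappa> * diameter (core c l)) * Q"
proof -
  let ?E = "elems c l" and ?z = "local_error l v"
  let ?s = "sqrt (1 + Ce / (h * \<kappa>))"
  note S = elems_simplicial[OF l] and z = local_error[OF l v] and r = restr_fe_space[OF l v]
  have nl: "norm_\<kappa>_loc c l w = sqrt (Nsq ?E w)" if "w \<in> fe_space p ?E" for w
    unfolding norm_\<kappa>_loc_def subdom_def using that fe_space_pwpoly by (intro energy_norm_eq[OF S]) blast
  have Ce0: "0 \<le> Ce / (h * \<kappa>)" using cpos h(1) wave by (simp add: Ce_def)
  then have s1: "1 \<le> ?s" by simp
  have Q0: "0 \<le> Q" unfolding Q_def using s1 Ca_pos cpos Nsq_nonneg bsq_nonneg h(1) wave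
    by (intro mult_nonneg_nonneg add_nonneg_nonneg) auto
  have bd: "cmod (form_loc c l ?z w) \<le> Q * sqrt (Nsq ?E w)" if w: "w \<in> fe_space p ?E" for w
  proof -
    let ?w = "sqrt (Nsq ?E w)"
    have w0: "0 \<le> ?w" using Nsq_nonneg by simp
    have "Nsq ?E (restr (\<Union>?E) v) = Nsq ?E v"
      by (intro sum.cong refl esq_cong[where p = p])
        (use simplicialD(2)[OF S] pwpolyD[OF Vh_pwpoly[OF v]] elems_sub[OF l] in \<open>auto simp: restr_def\<close>)
    also have "\<dots> \<le> Nsq (near l) v"
      using elems_sub_near[OF l] by (intro sum_mono2 finite_subset[OF near_sub finite_M] esq_nonneg)
    finally have rn: "sqrt (Nsq ?E (restr (\<Union>?E) v)) \<le> sqrt (Nsq (near l) v)" by (rule real_sqrt_le_mono)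
    have "cmod (form_loc c l (restr (\<Union>?E) v) w) \<le> (Ca + 9 * Cs * Ct) * (sqrt (Nsq ?E (restr (\<Union>?E) v)) * ?w)"
      by (rule form_loc_bound[OF l r w])
    also have "\<dots> \<le> (Ca + 9 * Cs * Ct) * (sqrt (Nsq (near l) v) * ?w)"
      using rn w0 Ca_pos cpos by (intro mult_left_mono mult_right_mono) auto
    also have "\<dots> = 1 * ((Ca + 9 * Cs * Ct) * sqrt (Nsq (near l) v) * ?w)" by simp
    also have "\<dots> \<le> ?s * ((Ca + 9 * Cs * Ct) * sqrt (Nsq (near l) v) * ?w)"
      using s1 w0 Ca_pos cpos Nsq_nonneg by (intro mult_right_mono) auto
    finally have a: "cmod (form_loc c l (restr (\<Union>?E) v) w) \<le> ?s * ((Ca + 9 * Cs * Ct) * sqrt (Nsq (near l) v) * ?w)" .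
    have "cmod (form_loc c l ?z w) \<le> cmod (form_loc c l (restr (\<Union>?E) v) w) + cmod (form c v (extend c l w))"
      unfolding z(3)[OF w] by (rule norm_triangle_ineq4)
    also have "\<dots> \<le> ?s * ((Ca + 9 * Cs * Ct) * sqrt (Nsq (near l) v) * ?w)
        + (Ca * sqrt (Nsq (near l) v) + 9 * Cs * sqrt (Ct * K) * sqrt (\<kappa> / h * bsq l v)) * (?s * ?w)"
      by (rule add_mono[OF a form_extend_bound[OF l v w]])
    also have "\<dots> = Q * ?w" unfolding Q_def by (simp only: algebra_simps mult_2)
    finally show ?thesis .
  qed
  show ?thesis
  proof (cases "?z = (\<lambda>x. 0)")
    case True
    have "Nsq ?E (\<lambda>x. 0) = 0" by (simp add: esq_zero)
    moreover have "0 \<le> diameter (core c l)" by (rule diameter_ge_0_core[OF l])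
    ultimately show ?thesis using True C Q0 wave by simp
  next
    case False
    let ?S = "SUP w\<in>Vh_loc c l - {\<lambda>x. 0}. cmod (form_loc c l ?z w) / norm_\<kappa>_loc c l w"
    have ne: "Vh_loc c l - {\<lambda>x. 0} \<noteq> {}" using z(1) False Vh_loc_eq[OF l] by blast
    have SQ: "?S \<le> Q"
    proof (rule cSUP_least[OF ne])
      fix w assume "w \<in> Vh_loc c l - {\<lambda>x. 0}"
      then have w: "w \<in> fe_space p ?E" using Vh_loc_eq[OF l] by blast
      show "cmod (form_loc c l ?z w) / norm_\<kappa>_loc c l w \<le> Q"
        using bd[OF w] nl[OF w] Q0 Nsq_nonneg[where S = "?E" and v = w] by (cases "Nsq ?E w = 0") (simp_all add: field_simps)
    qed
    have S0: "0 \<le> ?S"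
    proof -
      have bdd: "bdd_above ((\<lambda>w. cmod (form_loc c l ?z w) / norm_\<kappa>_loc c l w) ` (Vh_loc c l - {\<lambda>x. 0}))"
      proof (rule bdd_aboveI2)
        fix w assume "w \<in> Vh_loc c l - {\<lambda>x. 0}"
        then have w: "w \<in> fe_space p ?E" using Vh_loc_eq[OF l] by blast
        show "cmod (form_loc c l ?z w) / norm_\<kappa>_loc c l w \<le> Q"
          using bd[OF w] nl[OF w] Q0 Nsq_nonneg[where S = "?E" and v = w] by (cases "Nsq ?E w = 0") (simp_all add: field_simps)
      qed
      have zin: "?z \<in> Vh_loc c l - {\<lambda>x. 0}" using z(1) False Vh_loc_eq[OF l] by blast
      have "0 \<le> cmod (form_loc c l ?z ?z) / norm_\<kappa>_loc c l ?z" using nl[OF z(1)] Nsq_nonneg by simp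
      also have "\<dots> \<le> ?S" by (rule cSUP_upper[OF zin bdd])
      finally show ?thesis .
    qed
    have "sqrt (Nsq ?E ?z) = norm_\<kappa>_loc c l ?z" using nl[OF z(1)] by simp
    also have "\<dots> \<le> C * min (1 + \<kappa> * diameter (core c l)) (\<kappa>\<^sup>2 / \<epsilon>) * ?S"
      using infsup l z(1) Vh_loc_eq[OF l] unfolding local_inf_sup_def by blast
    also have "\<dots> \<le> C * (1 + \<kappa> * diameter (core c l)) * ?S"
      using S0 C by (intro mult_right_mono mult_left_mono) auto
    also have "\<dots> \<le> C * (1 + \<kappa> * diameter (core c l)) * Q"
      using SQ C wave diameter_ge_0_core[OF l] by (intro mult_left_mono) auto
    finally show ?thesis .
  qed
qed

end

section \<open>The coarse space removes the large local errors\<close>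

lemma cspanI: "(\<lambda>x. \<Sum>i\<in>A. a i * \<xi> i x) \<in> cspan \<xi> A"
  unfolding cspan_def by blast

context quantitative
begin

lemma coarse_fspan:
  fixes \<rho> :: real
  assumes eig: "\<And>l. l \<in> I \<Longrightarrow> eigensystem c l (m l) (\<mu> l) (\<xi> l)"
  defines "J \<equiv> SIGMA l:I. {cut_index (m l) (\<mu> l) \<rho>..m l}"
  shows "coarse c m \<mu> \<xi> \<rho> \<subseteq> Vh c"
    and "coarse c m \<mu> \<xi> \<rho> = fspan (\<lambda>(l, i). DE c l (\<xi> l i)) J" and "finite J"
proof -
  show fin: "finite J" by (simp add: J_def)
  have cut: "1 \<le> cut_index m' \<mu>' \<rho>" for m' \<mu>'
    unfolding cut_index_def by (rule LeastI2[where a = "Suc m'"]) auto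
  have \<xi>: "\<xi> l i \<in> fe_space p (elems c l)" if "l \<in> I" "i \<in> {cut_index (m l) (\<mu> l) \<rho>..m l}" for l i
  proof -
    have "i \<in> {1..m l}" using cut[of "m l" "\<mu> l"] that(2) by auto
    then show ?thesis using eig[OF that(1)] Vh_bd_subset[OF that(1)] unfolding eigensystem_def by blast
  qed
  have D: "DE c l (\<lambda>x. \<Sum>i\<in>{cut_index (m l) (\<mu> l) \<rho>..m l}. a i * \<xi> l i x)
      = (\<lambda>x. \<Sum>i\<in>{cut_index (m l) (\<mu> l) \<rho>..m l}. a i * DE c l (\<xi> l i) x)" if "l \<in> I" for l a
    by (rule DE_sum[OF that]) (use \<xi>[OF that] in auto)
  show eq: "coarse c m \<mu> \<xi> \<rho> = fspan (\<lambda>(l, i). DE c l (\<xi> l i)) J"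
  proof (intro subset_antisym subsetI)
    fix u assume "u \<in> coarse c m \<mu> \<xi> \<rho>"
    then obtain v where u: "u = (\<lambda>x. \<Sum>l\<in>I. DE c l (v l) x)"
      and v: "\<forall>l\<in>I. v l \<in> coarse_loc (m l) (\<mu> l) (\<xi> l) \<rho>" unfolding coarse_def by blast
    have "\<forall>l\<in>I. \<exists>a. v l = (\<lambda>x. \<Sum>i\<in>{cut_index (m l) (\<mu> l) \<rho>..m l}. a i * \<xi> l i x)"
      using v unfolding coarse_loc_def cspan_def by blast
    from bchoice[OF this] obtain a
      where a: "\<And>l. l \<in> I \<Longrightarrow> v l = (\<lambda>x. \<Sum>i\<in>{cut_index (m l) (\<mu> l) \<rho>..m l}. a l i * \<xi> l i x)" by blast
    have "u = (\<lambda>x. \<Sum>(l, i)\<in>J. a l i * DE c l (\<xi> l i) x)"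
      unfolding u J_def by (subst sum.Sigma[symmetric]) (auto simp: a D intro!: ext sum.cong)
    also have "\<dots> = (\<lambda>x. \<Sum>j\<in>J. (case j of (l, i) \<Rightarrow> a l i) * (case j of (l, i) \<Rightarrow> DE c l (\<xi> l i)) x)"
      by (auto intro!: ext sum.cong)
    finally show "u \<in> fspan (\<lambda>(l, i). DE c l (\<xi> l i)) J" unfolding fspan_def by blast
  next
    fix u assume "u \<in> fspan (\<lambda>(l, i). DE c l (\<xi> l i)) J"
    then obtain a where u: "u = (\<lambda>x. \<Sum>j\<in>J. a j * (case j of (l, i) \<Rightarrow> DE c l (\<xi> l i)) x)"
      unfolding fspan_def by blast
    define v where "v l = (\<lambda>x. \<Sum>i\<in>{cut_index (m l) (\<mu> l) \<rho>..m l}. a (l, i) * \<xi> l i x)" for l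
    have "u = (\<lambda>x. \<Sum>(l, i)\<in>J. a (l, i) * DE c l (\<xi> l i) x)"
      unfolding u by (auto intro!: ext sum.cong)
    also have "\<dots> = (\<lambda>x. \<Sum>l\<in>I. DE c l (v l) x)"
      unfolding J_def by (subst sum.Sigma[symmetric]) (auto simp: v_def D intro!: ext sum.cong)
    finally have "u = (\<lambda>x. \<Sum>l\<in>I. DE c l (v l) x)" .
    moreover have "\<forall>l\<in>I. v l \<in> coarse_loc (m l) (\<mu> l) (\<xi> l) \<rho>"
      unfolding coarse_loc_def v_def by (intro ballI cspanI)
    ultimately show "u \<in> coarse c m \<mu> \<xi> \<rho>" unfolding coarse_def by (intro CollectI exI conjI)
  qed
  show "coarse c m \<mu> \<xi> \<rho> \<subseteq> Vh c" unfolding eq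
    using DE_Vh by (intro fspan_minimal) (auto simp: Vh_def csubspace_fe_space)
qed

text \<open>In the eigenbasis the energy of the weighted extension is diagonal, so the part of a function
  that belongs to eigenvalues below \<open>\<rho>\<^sup>2\<close> is damped by \<open>\<rho>\<close>.\<close>

lemma eigen_split:
  assumes l: "l \<in> I" and eig: "eigensystem c l m \<mu> \<xi>" and z: "z \<in> Vh_bd c l"
  obtains z0 z1 where "z0 \<in> coarse_loc m \<mu> \<xi> \<rho>" "z0 \<in> fe_space p (elems c l)" "z1 \<in> fe_space p (elems c l)"
    "z = (\<lambda>x. z0 x + z1 x)" "Nsq (elems c l) (DE c l z1) \<le> \<rho>\<^sup>2 * Nsq (elems c l) z"
proof -
  let ?E = "elems c l" and ?c = "cut_index m \<mu> \<rho>"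
  let ?b = "inner_\<kappa>_loc c l"
  note S = elems_simplicial[OF l]
  have b: "?b = energy_inner \<kappa> (interior (\<Union>?E))" by (simp add: inner_\<kappa>_loc_def subdom_def fun_eq_iff)
  have bs: "sesq (pwpoly p ?E) ?b" unfolding b by (rule sesq_energy[OF S])
  have Ps: "csubspace (pwpoly p ?E)" by (rule csubspace_pwpoly)
  have \<xi>: "\<xi> i \<in> Vh_bd c l" "0 \<le> \<mu> i"
    "\<And>\<theta>. \<theta> \<in> Vh_bd c l \<Longrightarrow> ?b (DE c l (\<xi> i)) (DE c l \<theta>) = of_real (\<mu> i) * ?b (\<xi> i) \<theta>" if "i \<in> {1..m}" for i
    using eig that unfolding eigensystem_def by blast+
  have orth: "?b (\<xi> i) (\<xi> j) = (if i = j then 1 else 0)" if "i \<in> {1..m}" "j \<in> {1..m}" for i j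
    using eig that unfolding eigensystem_def by blast
  have span: "cspan \<xi> {1..m} = Vh_bd c l" using eig unfolding eigensystem_def by blast
  have fe: "\<xi> i \<in> fe_space p ?E" if "i \<in> {1..m}" for i using \<xi>(1)[OF that] Vh_bd_subset[OF l] by blast
  have pw: "\<xi> i \<in> pwpoly p ?E" if "i \<in> {1..m}" for i using fe[OF that] fe_space_pwpoly by blast
  have DEpw: "DE c l w \<in> pwpoly p ?E" for w
    using Vh_pwpoly[OF DE_Vh] pwpoly_mono[OF elems_sub[OF l]] by blast
  obtain a where a: "z = (\<lambda>x. \<Sum>i\<in>{1..m}. a i * \<xi> i x)" using z span unfolding cspan_def by blast
  have c1: "1 \<le> ?c" unfolding cut_index_def by (rule LeastI2[where a = "Suc m"]) auto
  define J1 where "J1 = {i\<in>{1..m}. i < ?c}"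
  have J1: "J1 \<subseteq> {1..m}" "finite J1" by (auto simp: J1_def)
  have small: "\<mu> i \<le> \<rho>\<^sup>2" if "i \<in> J1" for i
  proof -
    have "\<not> (1 \<le> i \<and> (i \<le> m \<longrightarrow> \<rho>\<^sup>2 \<le> \<mu> i))" using that unfolding J1_def cut_index_def by (auto dest: not_less_Least)
    then show ?thesis using that by (auto simp: J1_def)
  qed
  define z0 where "z0 = (\<lambda>x. \<Sum>i\<in>{?c..m}. a i * \<xi> i x)"
  define z1 where "z1 = (\<lambda>x. \<Sum>i\<in>J1. a i * \<xi> i x)"
  have sub0: "{?c..m} \<subseteq> {1..m}" using c1 by auto
  have "{1..m} = {?c..m} \<union> J1" "{?c..m} \<inter> J1 = {}" using c1 by (auto simp: J1_def)
  then have zz: "z = (\<lambda>x. z0 x + z1 x)" unfolding a z0_def z1_def using J1 by (simp add: sum.union_disjoint)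
  have z0fe: "z0 \<in> fe_space p ?E" unfolding z0_def using fe sub0 by (intro csubspace_sum csubspace_scale csubspace_fe_space) blast
  have z1fe: "z1 \<in> fe_space p ?E" unfolding z1_def using fe J1 by (intro csubspace_sum csubspace_scale csubspace_fe_space) blast
  have "z1 = (\<lambda>x. \<Sum>i\<in>{1..m}. (if i \<in> J1 then a i else 0) * \<xi> i x)"
    unfolding z1_def by (intro ext sum.mono_neutral_cong_left) (use J1 in auto)
  then have z1bd: "z1 \<in> Vh_bd c l" unfolding span[symmetric] by (simp only: cspanI)
  \<comment> \<open>expansion of the inner products in the eigenbasis\<close>
  have coef: "?b (\<xi> i) (\<lambda>x. \<Sum>j\<in>A. a j * \<xi> j x) = (if i \<in> A then cnj (a i) else 0)" if i: "i \<in> {1..m}" and A: "A \<subseteq> {1..m}" for i A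
  proof -
    have "?b (\<xi> i) (\<lambda>x. \<Sum>j\<in>A. a j * \<xi> j x) = (\<Sum>j\<in>A. ?b (\<xi> i) (\<lambda>x. a j * \<xi> j x))"
      by (rule sesq_sum(2)[OF bs Ps]) (use A pw i in \<open>auto intro!: csubspace_scale[OF Ps]\<close>)
    also have "\<dots> = (\<Sum>j\<in>A. if j = i then cnj (a i) else 0)"
    proof (rule sum.cong[OF refl])
      fix j assume "j \<in> A"
      then have j: "j \<in> {1..m}" using A by blast
      have "?b (\<xi> i) (\<lambda>x. a j * \<xi> j x) = cnj (a j) * ?b (\<xi> i) (\<xi> j)"
        by (rule sesq_scale(2)[OF bs Ps pw[OF j] pw[OF i]])
      then show "?b (\<xi> i) (\<lambda>x. a j * \<xi> j x) = (if j = i then cnj (a i) else 0)" using orth[OF i j] by auto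
    qed
    also have "\<dots> = (if i \<in> A then cnj (a i) else 0)" using finite_subset[OF A] by (simp add: sum.delta)
    finally show ?thesis .
  qed
  have zpw: "z \<in> pwpoly p ?E" using z Vh_bd_subset[OF l] fe_space_pwpoly by blast
  have "?b z z = (\<Sum>i\<in>{1..m}. ?b (\<lambda>x. a i * \<xi> i x) z)"
    by (subst (1) a, rule sesq_sum(1)[OF bs Ps _ zpw]) (use pw in \<open>auto intro!: csubspace_scale[OF Ps]\<close>)
  also have "\<dots> = (\<Sum>i\<in>{1..m}. of_real ((cmod (a i))\<^sup>2))"
  proof (rule sum.cong[OF refl])
    fix i assume i: "i \<in> {1..m}"
    have "?b (\<lambda>x. a i * \<xi> i x) z = a i * ?b (\<xi> i) z" by (rule sesq_scale(1)[OF bs Ps pw[OF i] zpw])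
    also have "?b (\<xi> i) z = cnj (a i)" unfolding a using coef[OF i subset_refl] i by simp
    finally show "?b (\<lambda>x. a i * \<xi> i x) z = of_real ((cmod (a i))\<^sup>2)" by (simp only: complex_norm_square)
  qed
  finally have "complex_of_real (Nsq ?E z) = of_real (\<Sum>i\<in>{1..m}. (cmod (a i))\<^sup>2)"
    unfolding b energy_inner_self[OF S zpw] by simp
  then have nz: "Nsq ?E z = (\<Sum>i\<in>{1..m}. (cmod (a i))\<^sup>2)" by (simp only: of_real_eq_iff)
  have Dz1: "DE c l z1 = (\<lambda>x. \<Sum>i\<in>J1. a i * DE c l (\<xi> i) x)"
    unfolding z1_def by (rule DE_sum[OF l J1(2)]) (use fe J1 in blast)
  have "?b (DE c l z1) (DE c l z1) = (\<Sum>i\<in>J1. ?b (\<lambda>x. a i * DE c l (\<xi> i) x) (DE c l z1))"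
    by (subst (1) Dz1, rule sesq_sum(1)[OF bs Ps _ DEpw]) (rule csubspace_scale[OF Ps DEpw])
  also have "\<dots> = (\<Sum>i\<in>J1. of_real (\<mu> i * (cmod (a i))\<^sup>2))"
  proof (rule sum.cong[OF refl])
    fix i assume i1: "i \<in> J1"
    then have i: "i \<in> {1..m}" using J1 by blast
    have "?b (\<lambda>x. a i * DE c l (\<xi> i) x) (DE c l z1) = a i * ?b (DE c l (\<xi> i)) (DE c l z1)"
      by (rule sesq_scale(1)[OF bs Ps DEpw DEpw])
    also have "?b (DE c l (\<xi> i)) (DE c l z1) = of_real (\<mu> i) * ?b (\<xi> i) z1" by (rule \<xi>(3)[OF i z1bd])
    also have "?b (\<xi> i) z1 = cnj (a i)" unfolding z1_def using coef[OF i J1(1)] i1 by simp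
    finally show "?b (\<lambda>x. a i * DE c l (\<xi> i) x) (DE c l z1) = of_real (\<mu> i * (cmod (a i))\<^sup>2)"
      by (simp only: of_real_mult complex_norm_square mult_ac)
  qed
  finally have "complex_of_real (Nsq ?E (DE c l z1)) = of_real (\<Sum>i\<in>J1. \<mu> i * (cmod (a i))\<^sup>2)"
    unfolding b energy_inner_self[OF S DEpw] by simp
  then have "Nsq ?E (DE c l z1) = (\<Sum>i\<in>J1. \<mu> i * (cmod (a i))\<^sup>2)" by (simp only: of_real_eq_iff)
  also have "\<dots> \<le> (\<Sum>i\<in>J1. \<rho>\<^sup>2 * (cmod (a i))\<^sup>2)" using small by (intro sum_mono mult_right_mono) auto
  also have "\<dots> \<le> (\<Sum>i\<in>{1..m}. \<rho>\<^sup>2 * (cmod (a i))\<^sup>2)" using J1 by (intro sum_mono2) auto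
  also have "\<dots> = \<rho>\<^sup>2 * Nsq ?E z" unfolding nz by (simp add: sum_distrib_left)
  finally have "Nsq ?E (DE c l z1) \<le> \<rho>\<^sup>2 * Nsq ?E z" .
  moreover have "z0 \<in> coarse_loc m \<mu> \<xi> \<rho>" unfolding coarse_loc_def z0_def by (rule cspanI)
  ultimately show thesis using that z0fe z1fe zz by blast
qed

text \<open>On each element at most \<open>K\<close> of the summands are nonzero.\<close>

lemma sum_DE_bound:
  assumes w: "\<And>l. l \<in> I \<Longrightarrow> w l \<in> fe_space p (elems c l)"
  shows "Nsq M (\<lambda>x. \<Sum>l\<in>I. DE c l (w l) x) \<le> K * (\<Sum>l\<in>I. Nsq (elems c l) (DE c l (w l)))"
proof -
  have "Nsq M (\<lambda>x. \<Sum>l\<in>I. DE c l (w l) x) \<le> (\<Sum>T\<in>M. K * (\<Sum>l\<in>{l\<in>I. T \<in> elems c l}. esq \<kappa> T (DE c l (w l))))"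
  proof (rule sum_mono)
    fix T assume T: "T \<in> M"
    let ?A = "{l\<in>I. T \<in> elems c l}"
    note sT = simplicialD(2)[OF mesh T]
    have pT: "poly_on p T (DE c l (w l))" for l using pwpolyD[OF Vh_pwpoly[OF DE_Vh] T] .
    have ps: "poly_on p T (\<lambda>x. \<Sum>l\<in>?A. DE c l (w l) x)"
      using csubspace_sum[OF csubspace_poly_on, of ?A "\<lambda>l. DE c l (w l)" p T] pT by simp
    have "(\<Sum>l\<in>I. DE c l (w l) x) = (\<Sum>l\<in>?A. DE c l (w l) x)" if "x \<in> T" for x
      using DE_outside[OF _ T _ that] w by (intro sum.mono_neutral_right) auto
    then have "esq \<kappa> T (\<lambda>x. \<Sum>l\<in>I. DE c l (w l) x) = esq \<kappa> T (\<lambda>x. \<Sum>l\<in>?A. DE c l (w l) x)"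
      by (intro esq_cong[OF sT ps])
    also have "\<dots> \<le> real (card ?A) * (\<Sum>l\<in>?A. esq \<kappa> T (DE c l (w l)))"
      by (rule esq_sum_le[OF sT _ pT]) simp
    also have "\<dots> \<le> K * (\<Sum>l\<in>?A. esq \<kappa> T (DE c l (w l)))"
      using overlap[OF T] by (intro mult_right_mono sum_nonneg esq_nonneg) auto
    finally show "esq \<kappa> T (\<lambda>x. \<Sum>l\<in>I. DE c l (w l) x) \<le> K * (\<Sum>l\<in>?A. esq \<kappa> T (DE c l (w l)))" .
  qed
  also have "\<dots> = K * (\<Sum>T\<in>M. \<Sum>l\<in>{l\<in>I. T \<in> elems c l}. esq \<kappa> T (DE c l (w l)))" by (simp add: sum_distrib_left)
  also have "(\<Sum>T\<in>M. \<Sum>l\<in>{l\<in>I. T \<in> elems c l}. esq \<kappa> T (DE c l (w l)))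
      = (\<Sum>l\<in>I. \<Sum>T\<in>{T\<in>M. T \<in> elems c l}. esq \<kappa> T (DE c l (w l)))"
    by (rule sum.swap_restrict[OF finite_M]) simp
  also have "\<dots> = (\<Sum>l\<in>I. Nsq (elems c l) (DE c l (w l)))"
    using elems_sub by (intro sum.cong refl arg_cong2[where f = sum]) auto
  finally show ?thesis .
qed

text \<open>The large parts of the local errors lie in the coarse space, where the coarse correction acts
  as the identity. Only the damped parts remain in \<open>P_op v - v\<close>.\<close>

lemma P_op_deviation:
  assumes eig: "\<And>l. l \<in> I \<Longrightarrow> eigensystem c l (m l) (\<mu> l) (\<xi> l)" and v: "v \<in> Vh c"
  obtains g where "g \<in> Vh c" "P_op c (coarse c m \<mu> \<xi> \<rho>) v = (\<lambda>x. v x - g x + P_coarse (coarse c m \<mu> \<xi> \<rho>) g x)"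
    "Nsq M g \<le> K * \<rho>\<^sup>2 * (\<Sum>l\<in>I. Nsq (elems c l) (local_error l v))"
proof -
  let ?V0 = "coarse c m \<mu> \<xi> \<rho>"
  let ?f = "\<lambda>(l, i). DE c l (\<xi> l i)" and ?J = "SIGMA l:I. {cut_index (m l) (\<mu> l) \<rho>..m l}"
  have V0: "?V0 \<subseteq> Vh c" "?V0 = fspan ?f ?J" "finite ?J"
    by (rule coarse_fspan(1), erule eig) (rule coarse_fspan(2), erule eig, simp)
  have V0s: "csubspace ?V0" unfolding V0(2) by (rule csubspace_fspan)
  have Vs: "csubspace (Vh c)" unfolding Vh_def by (rule csubspace_fe_space)
  let ?S = "\<lambda>l z0 z1. z0 \<in> coarse_loc (m l) (\<mu> l) (\<xi> l) \<rho> \<and> z0 \<in> fe_space p (elems c l) \<and>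
      z1 \<in> fe_space p (elems c l) \<and> local_error l v = (\<lambda>x. z0 x + z1 x) \<and>
      Nsq (elems c l) (DE c l z1) \<le> \<rho>\<^sup>2 * Nsq (elems c l) (local_error l v)"
  have "\<exists>q. ?S l (fst q) (snd q)" if l: "l \<in> I" for l
  proof (rule eigen_split[OF l eig[OF l] local_error(2)[OF l v], where \<rho> = \<rho>])
    fix z0 z1 assume "z0 \<in> coarse_loc (m l) (\<mu> l) (\<xi> l) \<rho>" "z0 \<in> fe_space p (elems c l)"
      "z1 \<in> fe_space p (elems c l)" "local_error l v = (\<lambda>x. z0 x + z1 x)"
      "Nsq (elems c l) (DE c l z1) \<le> \<rho>\<^sup>2 * Nsq (elems c l) (local_error l v)"
    then show ?thesis by (intro exI[of _ "(z0, z1)"]) simp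
  qed
  then have "\<forall>l\<in>I. \<exists>q. ?S l (fst q) (snd q)" by blast
  from bchoice[OF this] obtain q where q: "\<forall>l\<in>I. ?S l (fst (q l)) (snd (q l))" by blast
  define z0 z1 where "z0 l = fst (q l)" and "z1 l = snd (q l)" for l
  have z: "z0 l \<in> coarse_loc (m l) (\<mu> l) (\<xi> l) \<rho>" "z0 l \<in> fe_space p (elems c l)"
      "z1 l \<in> fe_space p (elems c l)" "local_error l v = (\<lambda>x. z0 l x + z1 l x)"
      "Nsq (elems c l) (DE c l (z1 l)) \<le> \<rho>\<^sup>2 * Nsq (elems c l) (local_error l v)" if "l \<in> I" for l
    using q that unfolding z0_def z1_def by blast+
  define g0 where "g0 = (\<lambda>x. \<Sum>l\<in>I. DE c l (z0 l) x)"
  define g where "g = (\<lambda>x. \<Sum>l\<in>I. DE c l (z1 l) x)"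
  define y where "y = (\<lambda>x. \<Sum>l\<in>I. DE c l (P_loc l v) x)"
  have g0: "g0 \<in> ?V0" 
    unfolding g0_def coarse_def using z(1) by (intro CollectI exI[of _ z0] conjI refl ballI)
  have gV: "g \<in> Vh c" unfolding g_def by (intro csubspace_sum Vs DE_Vh)
  have g0V: "g0 \<in> Vh c" using g0 V0(1) by blast
  have yx: "y x = v x - g0 x - g x" for x
  proof -
    have "DE c l (P_loc l v) x = DE c l (restr (\<Union>(elems c l)) v) x - (DE c l (z0 l) x + DE c l (z1 l) x)" if l: "l \<in> I" for l
    proof -
      note r = restr_fe_space[OF l v]
      have s: "(\<lambda>x. z0 l x + z1 l x) \<in> fe_space p (elems c l)" by (rule csubspace_add[OF csubspace_fe_space z(2,3)[OF l]])
      have "P_loc l v x = restr (\<Union>(elems c l)) v x + (- 1) * (z0 l x + z1 l x)" for x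
      proof -
        have "restr (\<Union>(elems c l)) v x = P_loc l v x + (z0 l x + z1 l x)"
          using fun_cong[OF z(4)[OF l], of x] by (simp add: local_error_def diff_eq_eq add_ac)
        then show ?thesis by simp
      qed
      then have "P_loc l v = (\<lambda>x. restr (\<Union>(elems c l)) v x + (- 1) * (z0 l x + z1 l x))" by (rule ext)
      then have "DE c l (P_loc l v) = (\<lambda>x. DE c l (restr (\<Union>(elems c l)) v) x + (- 1) * DE c l (\<lambda>x. z0 l x + z1 l x) x)"
        using DE_linear[OF l r s, of "- 1"] by simp
      moreover have "DE c l (\<lambda>x. z0 l x + z1 l x) = (\<lambda>x. DE c l (z0 l) x + DE c l (z1 l) x)"
        using DE_linear[OF l z(2,3)[OF l], of 1] by simp
      ultimately show ?thesis by simp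
    qed
    then have "y x = (\<Sum>l\<in>I. DE c l (restr (\<Union>(elems c l)) v) x) - (g0 x + g x)"
      by (simp add: y_def g0_def g_def sum_subtractf sum.distrib)
    then show ?thesis using fun_cong[OF sum_DE_restr[OF v], of x] by simp
  qed
  have yV: "y \<in> Vh c" unfolding y_def by (intro csubspace_sum Vs DE_Vh)
  note Pv = P_coarse[OF V0 v] and Pg = P_coarse[OF V0 gV]
  have Py: "P_coarse ?V0 y = (\<lambda>x. P_coarse ?V0 v x - g0 x - P_coarse ?V0 g x)"
  proof (rule P_coarse_eqI[OF V0(1,2)])
    show "(\<lambda>x. P_coarse ?V0 v x - g0 x - P_coarse ?V0 g x) \<in> ?V0"
      by (intro csubspace_diff V0s Pv(1) g0 Pg(1))
    fix w assume w: "w \<in> ?V0"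
    have wV: "w \<in> fe_space p M" using w V0(1) by (auto simp: Vh_def)
    note sd = sesq_diff(1)[OF form_sesq _ _ wV]
    have fV: "P_coarse ?V0 v \<in> fe_space p M" "g0 \<in> fe_space p M" "P_coarse ?V0 g \<in> fe_space p M" "v \<in> fe_space p M" "g \<in> fe_space p M"
      using Pv(1) Pg(1) g0V gV v V0(1) by (auto simp: Vh_def)
    have "form c (\<lambda>x. P_coarse ?V0 v x - g0 x - P_coarse ?V0 g x) w
        = form c (P_coarse ?V0 v) w - form c g0 w - form c (P_coarse ?V0 g) w"
      using sd[OF csubspace_diff[OF csubspace_fe_space fV(1,2)] fV(3)] sd[OF fV(1,2)] by simp
    also have "\<dots> = form c v w - form c g0 w - form c g w" using Pv(2)[OF w] Pg(2)[OF w] by simp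
    also have "\<dots> = form c (\<lambda>x. v x - g0 x - g x) w"
      using sd[OF csubspace_diff[OF csubspace_fe_space fV(4,2)] fV(5)] sd[OF fV(4,2)] by simp
    also have "(\<lambda>x. v x - g0 x - g x) = y" using yx by auto
    finally show "form c (\<lambda>x. P_coarse ?V0 v x - g0 x - P_coarse ?V0 g x) w = form c y w" .
  qed
  have "P_op c ?V0 v = (\<lambda>x. v x - g x + P_coarse ?V0 g x)"
  proof -
    have s: "(\<Sum>l\<in>I. DE c l (P_loc l v) x) = v x - g0 x - g x" for x using yx[of x] by (simp only: y_def)
    show ?thesis unfolding P_op_eq[OF V0 v] y_def[symmetric] Py unfolding s by (simp add: algebra_simps)
  qed
  moreover have "Nsq M g \<le> K * \<rho>\<^sup>2 * (\<Sum>l\<in>I. Nsq (elems c l) (local_error l v))"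
  proof -
    have "Nsq M g \<le> K * (\<Sum>l\<in>I. Nsq (elems c l) (DE c l (z1 l)))"
      unfolding g_def by (rule sum_DE_bound[OF z(3)])
    also have "\<dots> \<le> K * (\<Sum>l\<in>I. \<rho>\<^sup>2 * Nsq (elems c l) (local_error l v))"
      using z(5) cpos by (intro mult_left_mono sum_mono) auto
    finally show ?thesis by (simp add: sum_distrib_left mult.assoc)
  qed
  ultimately show thesis using that gV by blast
qed

text \<open>Finite overlap turns the sum of the local right-hand sides into a multiple of the global energy.\<close>

lemma sum_local_errors:
  assumes v: "v \<in> Vh c" and infsup: "local_inf_sup C c" and C: "0 \<le> C"
    and G: "\<And>l. l \<in> I \<Longrightarrow> C * (1 + \<kappa> * diameter (core c l)) * sqrt (1 + Ce / (h * \<kappa>)) \<le> G" and G0: "0 \<le> G"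
  shows "(\<Sum>l\<in>I. Nsq (elems c l) (local_error l v))
    \<le> G\<^sup>2 * (2 * (2 * Ca + 9 * Cs * Ct)\<^sup>2 * (Kt * K) + 2 * (9 * Cs)\<^sup>2 * (Ct * K) * (Kt * K) * (Ct * K)) * Nsq M v"
proof -
  let ?B = "2 * Ca + 9 * Cs * Ct"
  have B0: "0 \<le> ?B" using Ca_pos cpos by simp
  have "Nsq (elems c l) (local_error l v) \<le> G\<^sup>2 * (2 * ?B\<^sup>2 * Nsq (near l) v + 2 * (9 * Cs)\<^sup>2 * (Ct * K) * (\<kappa> / h * bsq l v))"
    if l: "l \<in> I" for l
  proof -
    let ?x = "?B * sqrt (Nsq (near l) v)" and ?y = "9 * Cs * sqrt (Ct * K) * sqrt (\<kappa> / h * bsq l v)"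
    have xy: "0 \<le> ?x" "0 \<le> ?y" using B0 cpos Nsq_nonneg bsq_nonneg h(1) wave by auto
    have "sqrt (Nsq (elems c l) (local_error l v)) \<le> C * (1 + \<kappa> * diameter (core c l)) * (sqrt (1 + Ce / (h * \<kappa>)) * (?x + ?y))"
      by (rule local_error_bound[OF l v infsup C])
    also have "\<dots> = (C * (1 + \<kappa> * diameter (core c l)) * sqrt (1 + Ce / (h * \<kappa>))) * (?x + ?y)" by (simp only: mult.assoc)
    also have "\<dots> \<le> G * (?x + ?y)" using xy by (intro mult_right_mono G[OF l]) auto
    finally have "(sqrt (Nsq (elems c l) (local_error l v)))\<^sup>2 \<le> (G * (?x + ?y))\<^sup>2"
      using Nsq_nonneg by (intro power_mono) auto
    then have "Nsq (elems c l) (local_error l v) \<le> G\<^sup>2 * (?x + ?y)\<^sup>2" using Nsq_nonneg by (simp add: power_mult_distrib)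
    also have "(?x + ?y)\<^sup>2 \<le> 2 * ?x\<^sup>2 + 2 * ?y\<^sup>2" using sum_squares_bound[of ?x ?y] by (simp add: power2_sum)
    then have "G\<^sup>2 * (?x + ?y)\<^sup>2 \<le> G\<^sup>2 * (2 * ?x\<^sup>2 + 2 * ?y\<^sup>2)" by (intro mult_left_mono) auto
    also have "?x\<^sup>2 = ?B\<^sup>2 * Nsq (near l) v" using Nsq_nonneg by (simp add: power_mult_distrib)
    also have "?y\<^sup>2 = (9 * Cs)\<^sup>2 * (Ct * K) * (\<kappa> / h * bsq l v)"
      using cpos bsq_nonneg[of l v] h(1) wave by (simp add: power_mult_distrib)
    finally show ?thesis by (simp add: mult.assoc)
  qed
  then have "(\<Sum>l\<in>I. Nsq (elems c l) (local_error l v))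
      \<le> (\<Sum>l\<in>I. G\<^sup>2 * (2 * ?B\<^sup>2 * Nsq (near l) v + 2 * (9 * Cs)\<^sup>2 * (Ct * K) * (\<kappa> / h * bsq l v)))"
    by (rule sum_mono)
  also have "\<dots> = G\<^sup>2 * (2 * ?B\<^sup>2 * (\<Sum>l\<in>I. Nsq (near l) v) + 2 * (9 * Cs)\<^sup>2 * (Ct * K) * (\<kappa> / h * (\<Sum>l\<in>I. bsq l v)))"
    by (simp only: sum_distrib_left sum.distrib distrib_left)
  also have "\<dots> \<le> G\<^sup>2 * (2 * ?B\<^sup>2 * (Kt * K * Nsq M v) + 2 * (9 * Cs)\<^sup>2 * (Ct * K) * (Kt * K * (Ct * K * Nsq M v)))"
  proof (intro mult_left_mono add_mono)
    show "(\<Sum>l\<in>I. Nsq (near l) v) \<le> Kt * K * Nsq M v"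
      by (rule sum_overlap[OF _ finite_M near_sub overlap_near esq_nonneg]) simp
    have "(\<Sum>l\<in>I. bsq l v) \<le> Kt * K * (\<Sum>T\<in>rim M. l2sq T v)"
      unfolding bsq_def
    proof (rule sum_overlap)
      show "finite (rim M)" using finite_M by (simp add: rim_def)
      fix T assume T: "T \<in> rim M"
      then have "{l\<in>I. T \<in> rim M \<inter> near l} = {l\<in>I. T \<in> near l}" by blast
      then show "real (card {l\<in>I. T \<in> rim M \<inter> near l}) \<le> Kt * K" using overlap_near[of T] T by (simp add: rim_def)
    qed (auto intro: l2sq_nonneg)
    also have "\<dots> \<le> Kt * K * (Ct * (h / \<kappa>) * (K * Nsq M v))"
      using cpos by (intro mult_left_mono rim_M_le v) auto
    finally have "\<kappa> / h * (\<Sum>l\<in>I. bsq l v) \<le> \<kappa> / h * (Kt * K * (Ct * (h / \<kappa>) * (K * Nsq M v)))"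
      using h(1) wave by (intro mult_left_mono) auto
    also have "\<dots> = Kt * K * (Ct * K * Nsq M v)" using h(1) wave by simp
    finally show "\<kappa> / h * (\<Sum>l\<in>I. bsq l v) \<le> Kt * K * (Ct * K * Nsq M v)" .
  qed (use cpos in auto)
  also have "\<dots> = G\<^sup>2 * (2 * ?B\<^sup>2 * (Kt * K) + 2 * (9 * Cs)\<^sup>2 * (Ct * K) * (Kt * K) * (Ct * K)) * Nsq M v"
    by (simp add: algebra_simps)
  finally show ?thesis .
qed

text \<open>A perturbation of the identity by an operator of norm at most \<open>1/2\<close> has both properties.\<close>

lemma P_op_bounds:
  assumes eig: "\<And>l. l \<in> I \<Longrightarrow> eigensystem c l (m l) (\<mu> l) (\<xi> l)"
    and infsup: "local_inf_sup C c" and C: "0 \<le> C" and \<rho>: "0 \<le> \<rho>"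
    and G: "\<And>l. l \<in> I \<Longrightarrow> C * (1 + \<kappa> * diameter (core c l))
      * sqrt (1 + Cn * real ((fe_order c + 1) ^ 3) * Cs * Kt * Ct / (h * \<kappa>)) \<le> G" and G0: "0 \<le> G"
    and A: "2 + \<epsilon> / \<kappa>\<^sup>2 \<le> A"
    and Q: "Q = sqrt (K * (2 * (2 * A + 9 * Cs * Ct)\<^sup>2 * (Kt * K)
      + 2 * (9 * Cs)\<^sup>2 * (Ct * K) * (Kt * K) * (Ct * K)))"
    and small: "(1 + (1 + 2 * \<kappa>\<^sup>2 / \<epsilon>) * (A + 9 * Cs * Ct * K)) * (\<rho> * G * Q) \<le> 1 / 2"
    and v: "v \<in> Vh c"
  shows "norm_\<kappa> c (P_op c (coarse c m \<mu> \<xi> \<rho>) v) \<le> 3 / 2 * norm_\<kappa> c v"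
    and "1 / 2 * (norm_\<kappa> c v)\<^sup>2 \<le> cmod (inner_\<kappa> c v (P_op c (coarse c m \<mu> \<xi> \<rho>) v))"
proof -
  let ?V0 = "coarse c m \<mu> \<xi> \<rho>" and ?n = "norm_\<kappa> c"
  let ?k = "(1 + 2 * \<kappa>\<^sup>2 / \<epsilon>) * (A + 9 * Cs * Ct * K)"
  obtain g where g: "g \<in> Vh c" "P_op c ?V0 v = (\<lambda>x. v x - g x + P_coarse ?V0 g x)"
    "Nsq M g \<le> K * \<rho>\<^sup>2 * (\<Sum>l\<in>I. Nsq (elems c l) (local_error l v))"
    by (rule P_op_deviation[OF eig v, where \<rho> = \<rho>])
  have nV: "?n w = sqrt (Nsq M w)" if "w \<in> Vh c" for w
    unfolding norm_\<kappa>_def whole_def by (rule energy_norm_eq[OF mesh Vh_pwpoly[OF that]])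
  have n0: "0 \<le> ?n w" if "w \<in> Vh c" for w unfolding nV[OF that] using Nsq_nonneg by simp
  have Vs: "csubspace (Vh c)" unfolding Vh_def by (rule csubspace_fe_space)
  have CaA: "Ca \<le> A" and A0: "0 \<le> A" using A Ca_pos unfolding Ca_def by linarith+
  let ?f = "\<lambda>(l, i). DE c l (\<xi> l i)" and ?J = "SIGMA l:I. {cut_index (m l) (\<mu> l) \<rho>..m l}"
  have V0: "?V0 \<subseteq> Vh c" "?V0 = fspan ?f ?J" "finite ?J"
    by (rule coarse_fspan(1), erule eig) (rule coarse_fspan(2), erule eig, simp)
  let ?u = "P_coarse ?V0 g"
  have uV: "?u \<in> Vh c" using P_coarse(1)[OF V0 g(1)] V0(1) by blast
  \<comment> \<open>the damped part of the local errors\<close>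
  have "Nsq M g \<le> K * \<rho>\<^sup>2 * (G\<^sup>2 * (2 * (2 * Ca + 9 * Cs * Ct)\<^sup>2 * (Kt * K)
      + 2 * (9 * Cs)\<^sup>2 * (Ct * K) * (Kt * K) * (Ct * K)) * Nsq M v)"
  proof (rule order_trans[OF g(3)], rule mult_left_mono)
    show "(\<Sum>l\<in>I. Nsq (elems c l) (local_error l v)) \<le> G\<^sup>2 * (2 * (2 * Ca + 9 * Cs * Ct)\<^sup>2 * (Kt * K)
      + 2 * (9 * Cs)\<^sup>2 * (Ct * K) * (Kt * K) * (Ct * K)) * Nsq M v"
      by (rule sum_local_errors[OF v infsup C _ G0]) (unfold Ce_def, rule G)
  qed (use cpos in simp)
  also have "\<dots> \<le> K * \<rho>\<^sup>2 * (G\<^sup>2 * (2 * (2 * A + 9 * Cs * Ct)\<^sup>2 * (Kt * K)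
      + 2 * (9 * Cs)\<^sup>2 * (Ct * K) * (Kt * K) * (Ct * K)) * Nsq M v)"
  proof -
    have "(2 * Ca + 9 * Cs * Ct)\<^sup>2 \<le> (2 * A + 9 * Cs * Ct)\<^sup>2"
      using CaA Ca_pos cpos by (intro power_mono) auto
    then show ?thesis using cpos Nsq_nonneg by (intro mult_left_mono mult_right_mono add_right_mono) auto
  qed
  also have "\<dots> = (\<rho> * G)\<^sup>2 * (K * (2 * (2 * A + 9 * Cs * Ct)\<^sup>2 * (Kt * K)
      + 2 * (9 * Cs)\<^sup>2 * (Ct * K) * (Kt * K) * (Ct * K))) * Nsq M v"
    unfolding power_mult_distrib by (simp only: mult_ac)
  finally have "sqrt (Nsq M g) \<le> sqrt \<dots>" by (rule real_sqrt_le_mono)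
  also have "\<dots> = \<rho> * G * Q * sqrt (Nsq M v)"
    unfolding real_sqrt_mult[of _ "Nsq M v"] real_sqrt_mult[of "(\<rho> * G)\<^sup>2"] Q using \<rho> G0 by simp
  finally have ng: "?n g \<le> \<rho> * G * Q * ?n v" unfolding nV[OF g(1)] nV[OF v] .
  have "?n ?u \<le> (1 + 2 * \<kappa>\<^sup>2 / \<epsilon>) * (Ca + 9 * Cs * Ct * K) * ?n g"
    unfolding nV[OF uV] nV[OF g(1)] by (rule P_coarse_bound[OF V0 g(1)])
  also have "\<dots> \<le> ?k * ?n g"
    using CaA absorb n0[OF g(1)] by (intro mult_left_mono mult_right_mono add_right_mono) auto
  finally have nu: "?n ?u \<le> ?k * ?n g" .
  let ?e = "\<lambda>x. ?u x + (- 1) * g x"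
  have eV: "?e \<in> Vh c" by (rule csubspace_comb[OF Vs uV g(1)])
  have Pe: "P_op c ?V0 v = (\<lambda>x. v x + 1 * ?e x)" unfolding g(2) by (simp add: algebra_simps)
  have PV: "P_op c ?V0 v \<in> Vh c" unfolding Pe by (rule csubspace_comb[OF Vs v eV])
  have tri: "?n (\<lambda>x. w x + a * w' x) \<le> ?n w + cmod a * ?n w'" if "w \<in> Vh c" "w' \<in> Vh c" for w w' a
    unfolding norm_\<kappa>_def whole_def by (rule energy_norm_triangle[OF mesh Vh_pwpoly Vh_pwpoly]) fact+
  have "?n ?e \<le> ?n ?u + ?n g" using tri[OF uV g(1), of "- 1"] by simp
  also have "\<dots> \<le> (1 + ?k) * ?n g" using nu by (simp add: algebra_simps)
  also have "\<dots> \<le> (1 + ?k) * (\<rho> * G * Q * ?n v)"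
    using A0 absorb cpos by (intro mult_left_mono ng) auto
  also have "\<dots> = (1 + ?k) * (\<rho> * G * Q) * ?n v" by (simp only: mult.assoc)
  also have "\<dots> \<le> 1 / 2 * ?n v" by (rule mult_right_mono[OF small n0[OF v]])
  finally have ne: "?n ?e \<le> 1 / 2 * ?n v" .
  show "?n (P_op c ?V0 v) \<le> 3 / 2 * ?n v" using tri[OF v eV, of 1] ne unfolding Pe by simp
  have ses: "sesq (Vh c) (inner_\<kappa> c)"
  proof -
    have "inner_\<kappa> c = energy_inner \<kappa> (interior (\<Union>M))" by (intro ext) (simp add: inner_\<kappa>_def whole_def)
    then show ?thesis using sesq_mono[OF sesq_energy[OF mesh]] Vh_pwpoly by (metis subsetI)
  qed
  have vv: "cmod (inner_\<kappa> c v v) = (?n v)\<^sup>2"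
    unfolding nV[OF v] inner_\<kappa>_def whole_def energy_inner_self[OF mesh Vh_pwpoly[OF v]] norm_of_real
    by (simp add: Nsq_nonneg)
  have i: "inner_\<kappa> c v (P_op c ?V0 v) = inner_\<kappa> c v v + inner_\<kappa> c v ?e"
    unfolding Pe using sesqD(2)[OF ses v eV v, of 1] by simp
  have "cmod (inner_\<kappa> c v ?e) \<le> ?n v * ?n ?e"
    unfolding norm_\<kappa>_def inner_\<kappa>_def whole_def by (rule energy_CS[OF mesh Vh_pwpoly[OF v] Vh_pwpoly[OF eV]])
  moreover have "?n v * ?n ?e \<le> 1 / 2 * (?n v)\<^sup>2"
    using mult_left_mono[OF ne n0[OF v]] by (simp add: power2_eq_square)
  moreover have "cmod (inner_\<kappa> c v v) \<le> cmod (inner_\<kappa> c v v + inner_\<kappa> c v ?e) + cmod (inner_\<kappa> c v ?e)"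
    using norm_triangle_ineq4[of "inner_\<kappa> c v v + inner_\<kappa> c v ?e" "inner_\<kappa> c v ?e"] by simp
  ultimately show "1 / 2 * (?n v)\<^sup>2 \<le> cmod (inner_\<kappa> c v (P_op c ?V0 v))" unfolding i using vv by linarith
qed

end

section \<open>Geometry of admissible decompositions\<close>

text \<open>Shrink the domain towards the centre of the disc by the ratio \<open>1 - 2 h / r\<close>. A disc of radius
  \<open>2 h\<close> about each point of the shrunk domain still lies in the domain, so no element of the rim has an
  interior point in it and the strip estimate applies. If \<open>h\<close> is not small compared with \<open>r\<close>, the
  bound is trivial because then \<open>h \<kappa>\<close> is bounded below.\<close>

lemma rim_estimate:
  assumes S: "simplicial S" and h: "\<And>T. T \<in> S \<Longrightarrow> diameter T \<le> h" "0 < h"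
    and star: "star_shaped_disc (interior (\<Union>S)) r" and r: "0 < r"
    and A: "diameter (interior (\<Union>S)) \<le> A * r" and B: "1 \<le> B * (\<kappa> * r)" and \<kappa>: "0 < \<kappa>"
    and cv: "continuous_on (\<Union>S) v" and pv: "v \<in> pwpoly p S"
  shows "(\<Sum>T\<in>rim S. l2sq T v) \<le> (16 * B + 8 * A) * (h / \<kappa>) * (\<Sum>T\<in>S. esq \<kappa> T v)"
proof -
  let ?G = "interior (\<Union>S)" and ?X = "\<Sum>T\<in>S. esq \<kappa> T v"
  have X0: "0 \<le> ?X" by (intro sum_nonneg esq_nonneg)
  have "0 < B * (\<kappa> * r)" using B by linarith
  then have B0: "0 < B" using mult_pos_pos[OF \<kappa> r] by (simp add: zero_less_mult_iff)
  obtain z where z: "ball z r \<subseteq> ?G" "\<And>y x. y \<in> ball z r \<Longrightarrow> x \<in> ?G \<Longrightarrow> closed_segment y x \<subseteq> ?G"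
    using star unfolding star_shaped_disc_def by blast
  have cS: "compact (\<Union>S)"
    using simplicialD(1,2)[OF S] compact_simplex by (intro compact_Union) auto
  have bG: "bounded ?G" by (rule bounded_subset[OF compact_imp_bounded[OF cS] interior_subset])
  have zG: "z \<in> ?G" using z(1) r by auto
  have D: "norm (x - z) \<le> A * r" if "x \<in> ?G" for x
  proof -
    have "dist x z \<le> diameter ?G" by (rule diameter_bounded_bound[OF bG that zG])
    then show ?thesis using A by (simp add: dist_norm)
  qed
  have "norm (z - z) \<le> A * r" by (rule D[OF zG])
  then have Ar: "0 \<le> A * r" by simp
  then have A0: "0 \<le> A" using r by (simp add: zero_le_mult_iff)
  show ?thesis
  proof (cases "2 * h / r \<le> 1 / 2")
    case True
    let ?s = "2 * h / r"
    have s0: "0 < ?s" using h(2) r by simp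
    have "(\<Sum>T\<in>rim S. l2sq T v) \<le> 8 * ?s * (1 / \<kappa>\<^sup>2 + A * r / (2 * \<kappa>)) * (\<Sum>T\<in>S. h1sq T v + \<kappa>\<^sup>2 * l2sq T v)"
    proof (rule strip_estimate[OF S cv _ _ D Ar s0 True \<kappa>])
      show "poly_on p T v" if "T \<in> S" for T by (rule pwpolyD[OF pv that])
      show "closed_segment z x \<subseteq> ?G" if "x \<in> ?G" for x using z(2)[OF _ that, of z] r by simp
      show "rim S \<subseteq> S" by (auto simp: rim_def)
      fix T x assume T: "T \<in> rim S" and x: "x \<in> ?G"
      show "z + (1 - ?s) *\<^sub>R (x - z) \<notin> interior T"
      proof
        let ?y = "z + (1 - ?s) *\<^sub>R (x - z)"
        assume "?y \<in> interior T"
        then have yT: "?y \<in> T" using interior_subset by blast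
        have TS: "T \<in> S" using T by (simp add: rim_def)
        have bT: "bounded T" by (rule compact_imp_bounded[OF compact_simplex[OF simplicialD(2)[OF S TS]]])
        \<comment> \<open>the homothety with centre \<open>x\<close> maps the disc onto a disc about \<open>?y\<close> of radius \<open>2 * h\<close>\<close>
        have "w \<in> ?G" if w: "w \<in> T" for w
        proof -
          let ?z = "z + (1 / ?s) *\<^sub>R (w - ?y)"
          have "norm (w - ?y) \<le> h"
            using diameter_bounded_bound[OF bT w yT] h(1)[OF TS] by (simp add: dist_norm)
          then have "(1 / ?s) * norm (w - ?y) \<le> (1 / ?s) * h" 
            by (rule mult_left_mono) (use r h(2) in simp)
          also have "\<dots> < r" using h(2) r by simp
          finally have "norm (z - ?z) < r" using r h(2) by simp
          then have "?z \<in> ball z r" by (simp add: dist_norm)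
          then have sub: "closed_segment ?z x \<subseteq> ?G" by (rule z(2)[OF _ x])
          have "?s *\<^sub>R ?z = ?s *\<^sub>R z + (w - ?y)" using r h(2) by (simp add: scaleR_add_right)
          then have "w = (1 - (1 - ?s)) *\<^sub>R ?z + (1 - ?s) *\<^sub>R x"
            by (simp add: algebra_simps)
          then have "w \<in> closed_segment ?z x"
            unfolding in_segment using s0 True by (intro exI[of _ "1 - ?s"]) auto
          then show ?thesis using sub by blast
        qed
        then have "T \<subseteq> ?G" by blast
        then show False using T by (simp add: rim_def)
      qed
    qed
    also have "\<dots> = 8 * ?s * (1 / \<kappa>\<^sup>2 + A * r / (2 * \<kappa>)) * ?X" by (simp add: esq_def)
    also have "8 * ?s * (1 / \<kappa>\<^sup>2 + A * r / (2 * \<kappa>)) = (16 * (1 / (\<kappa> * r)) + 8 * A) * (h / \<kappa>)"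
      using r \<kappa> by (simp add: field_simps power2_eq_square)
    also have "\<dots> * ?X \<le> (16 * B + 8 * A) * (h / \<kappa>) * ?X"
    proof (intro mult_right_mono X0)
      have "1 / (\<kappa> * r) \<le> B" using B mult_pos_pos[OF \<kappa> r] by (simp add: pos_divide_le_eq)
      then show "16 * (1 / (\<kappa> * r)) + 8 * A \<le> 16 * B + 8 * A" by linarith
      show "0 \<le> h / \<kappa>" using h(2) \<kappa> by simp
    qed
    finally show ?thesis .
  next
    case False
    then have hr: "r \<le> 4 * h" using r by (simp add: field_simps)
    have "1 \<le> B * (\<kappa> * (4 * h))" using B mult_left_mono[OF mult_left_mono[OF hr, of \<kappa>], of B] \<kappa> B0 by linarith
    then have "1 \<le> (16 * B) * (\<kappa> * h)" using mult_pos_pos[OF B0 mult_pos_pos[OF \<kappa> h(2)]] by simp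
    moreover have "0 \<le> 8 * A * (\<kappa> * h)" using A0 \<kappa> h(2) by simp
    ultimately have c: "1 \<le> (16 * B + 8 * A) * (\<kappa> * h)" by (simp add: distrib_right)
    have "1 / \<kappa>\<^sup>2 = (1 / \<kappa>\<^sup>2) * 1" by simp
    also have "\<dots> \<le> (1 / \<kappa>\<^sup>2) * ((16 * B + 8 * A) * (\<kappa> * h))" by (rule mult_left_mono[OF c]) simp
    also have "\<dots> = (16 * B + 8 * A) * (h / \<kappa>)" using \<kappa> by (simp add: power2_eq_square)
    finally have k: "1 / \<kappa>\<^sup>2 \<le> (16 * B + 8 * A) * (h / \<kappa>)" .
    have "(\<Sum>T\<in>rim S. l2sq T v) \<le> (\<Sum>T\<in>S. l2sq T v)"
      using simplicialD(1)[OF S] by (intro sum_mono2 l2sq_nonneg) (auto simp: rim_def)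
    also have "\<dots> \<le> (\<Sum>T\<in>S. (1 / \<kappa>\<^sup>2) * esq \<kappa> T v)"
    proof (rule sum_mono)
      fix T
      have "(1 / \<kappa>\<^sup>2) * (\<kappa>\<^sup>2 * l2sq T v) \<le> (1 / \<kappa>\<^sup>2) * esq \<kappa> T v"
        by (rule mult_left_mono[OF l2sq_le_esq]) simp
      then show "l2sq T v \<le> (1 / \<kappa>\<^sup>2) * esq \<kappa> T v" using \<kappa> by simp
    qed
    also have "\<dots> = (1 / \<kappa>\<^sup>2) * ?X" by (simp add: sum_distrib_left)
    also have "\<dots> \<le> (16 * B + 8 * A) * (h / \<kappa>) * ?X" by (rule mult_right_mono[OF k X0])
    finally show ?thesis .
  qed
qed

lemma add_layers_superset:
  assumes "S \<subseteq> M" "\<And>T. T \<in> M \<Longrightarrow> T \<noteq> {}"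
  shows "S \<subseteq> (add_layer M ^^ n) S" "(add_layer M ^^ n) S \<subseteq> M"
proof -
  have "S \<subseteq> (add_layer M ^^ n) S \<and> (add_layer M ^^ n) S \<subseteq> M"
  proof (induction n)
    case (Suc n)
    obtain X where X: "(add_layer M ^^ n) S = X" by simp
    have "X \<subseteq> add_layer M X"
    proof
      fix T assume T: "T \<in> X"
      then have "T \<in> M" using Suc X by blast
      moreover have "T \<inter> T \<noteq> {}" using assms(2)[OF \<open>T \<in> M\<close>] by simp
      ultimately show "T \<in> add_layer M X" unfolding add_layer_def using T by blast
    qed
    moreover have "add_layer M X \<subseteq> M" by (auto simp: add_layer_def)
    moreover have "(add_layer M ^^ Suc n) S = add_layer M X" using X by simp
    ultimately show ?case using Suc X by auto
  qed (use assms in simp)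
  then show "S \<subseteq> (add_layer M ^^ n) S" "(add_layer M ^^ n) S \<subseteq> M" by blast+
qed

locale admissible_discretisation =
  fixes \<Omega> :: "(real^2) set" and p \<alpha> \<beta> \<gamma> K d \<delta> c
  assumes adm: "admissible \<Omega> p \<alpha> \<beta> \<gamma> K d \<delta> c"
    and dom: "lipschitz_domain \<Omega>" "\<Omega> \<noteq> {}" and p1: "1 \<le> p" and K0: "0 < K"
    and exps: "0 < \<gamma>" "0 \<le> \<alpha>" "\<alpha> \<le> \<beta>" "\<beta> \<le> 1"
begin

abbreviation "\<T> \<equiv> mesh c"
abbreviation "h \<equiv> mesh_diameter \<T>"
abbreviation "\<kappa> \<equiv> wavenumber c"

lemma wave: "0 < \<kappa>" and ord: "fe_order c = p" and conf: "conforming_mesh \<Omega> \<T>"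
  and dec: "decomposition K d \<delta> c" and pu: "partition_of_unity K \<delta> c"
  and hk: "h \<le> K * \<kappa> powr (- (1 + \<gamma>))" "\<kappa> powr (- (1 + \<gamma>)) \<le> K * h"
  and star: "\<And>l. l \<in> {1..nsub c} \<Longrightarrow> \<exists>r. comparable K r (diameter (core c l)) \<and> star_shaped_disc (subdom c l) r"
  and nb: "\<And>l. l \<in> {1..nsub c} \<Longrightarrow> real (card (neighbours c l)) \<le> K"
  and eps: "absorption c = \<kappa> powr (1 + \<alpha>)" and eps0: "0 < absorption c"
  and dk: "d \<le> K * \<kappa> powr (- \<beta>)" "\<kappa> powr (- \<beta>) \<le> K * d"
  using adm unfolding admissible_def comparable_def by blast+

lemma mesh: "simplicial \<T>" and mesh_Union: "\<Union>\<T> = closure \<Omega>"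
  using conf unfolding conforming_mesh_def simplicial_def by blast+

lemma simplex: "T \<in> \<T> \<Longrightarrow> 2 simplex T" by (rule simplicialD(2)[OF mesh])

lemma nonempty: "T \<in> \<T> \<Longrightarrow> T \<noteq> {}"
  using interior_simplex_nonempty[OF simplex] interior_subset by blast

lemma core_diameter:
  assumes "l \<in> {1..nsub c}"
  shows "diameter (core c l) \<le> K * d" "d \<le> K * diameter (core c l)"
    "diameter (subdom c l) \<le> K * diameter (core c l)"
    "part c l \<subseteq> elems c l" "elems c l \<subseteq> \<T>"
proof -
  have "part c l \<subseteq> \<T>" using dec assms unfolding decomposition_def by blast
  then show "part c l \<subseteq> elems c l" "elems c l \<subseteq> \<T>"
    unfolding elems_def using add_layers_superset[of "part c l" \<T>] nonempty by blast+
  show "diameter (core c l) \<le> K * d" "d \<le> K * diameter (core c l)"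
    "diameter (subdom c l) \<le> K * diameter (core c l)"
    using dec assms unfolding decomposition_def comparable_def by blast+
qed

text \<open>The support condition on \<open>\<chi>\<^sub>l\<close> speaks of closures. It yields zeros in the interior of an element
  outside \<open>\<Omega>\<^sub>l\<close>, and by continuity in the whole element.\<close>

lemma discretisation: "discretisation c"
proof
  show "simplicial \<T>" "0 < \<kappa>" "0 < absorption c" by (fact mesh wave eps0)+
  show "0 < fe_order c" using ord p1 by simp
  show "elems c l \<subseteq> \<T>" if "l \<in> {1..nsub c}" for l by (rule core_diameter(5)[OF that])
  have W: "closure (whole c) = \<Union>\<T>" unfolding whole_def by (rule closure_interior_Union[OF mesh])
  show "(\<Sum>l\<in>{1..nsub c}. pou c l x) = 1" if "x \<in> \<Union>\<T>" for x
    using pu that unfolding partition_of_unity_def W by blast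
  fix l T x assume l: "l \<in> {1..nsub c}" and T: "T \<in> \<T>" "T \<notin> elems c l" and x: "x \<in> T"
  obtain L where "L-lipschitz_on (\<Union>\<T>) (pou c l)" using pu l unfolding partition_of_unity_def W by blast
  then have "continuous_on (\<Union>\<T>) (pou c l)" by (rule lipschitz_on_continuous_on)
  then have cont: "continuous_on (closure (interior T)) (pou c l)"
    unfolding closure_interior_simplex[OF simplex[OF T(1)]] by (rule continuous_on_subset) (use T in blast)
  have supp: "closure {x\<in>\<Union>\<T>. pou c l x \<noteq> 0} \<subseteq> closure (subdom c l)"
    using pu l unfolding partition_of_unity_def W by blast
  have cl: "closure (subdom c l) = \<Union>(elems c l)"
    unfolding subdom_def by (rule closure_interior_Union[OF simplicial_subset[OF mesh core_diameter(5)[OF l]]])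
  have zero: "pou c l y = 0" if y: "y \<in> interior T" for y
  proof (rule ccontr)
    assume "pou c l y \<noteq> 0"
    moreover have "y \<in> \<Union>\<T>" using T(1) subsetD[OF interior_subset y] by blast
    ultimately have "y \<in> {x\<in>\<Union>\<T>. pou c l x \<noteq> 0}" by simp
    then have "y \<in> closure {x\<in>\<Union>\<T>. pou c l x \<noteq> 0}" by (rule subsetD[OF closure_subset])
    then have "y \<in> \<Union>(elems c l)" using supp cl by blast
    then show False using outside_disjoint(1)[OF mesh core_diameter(5)[OF l] T] y by blast
  qed
  show "pou c l x = 0"
    using continuous_constant_on_closure[OF cont zero, of x] x
    unfolding closure_interior_simplex[OF simplex[OF T(1)]] by blast
qed

lemma mesh_size:
  assumes T: "T \<in> \<T>"
  shows "diameter T \<le> h" "h \<le> K * diameter T" "0 < h"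
proof -
  show 1: "diameter T \<le> h" unfolding mesh_diameter_def
    using simplicialD(1)[OF mesh] T by (intro Max_ge) auto
  show "h \<le> K * diameter T" using adm T unfolding admissible_def quasi_uniform_def by blast
  have "0 < \<kappa> powr (- (1 + \<gamma>))" using wave by simp
  also have "\<dots> \<le> K * h" by (rule hk(2))
  finally have "0 < K * h" .
  then show "0 < h" using K0 by (simp add: zero_less_mult_iff)
qed

text \<open>Otherwise the two inequalities relating \<open>h\<close> and the power of \<open>\<kappa>\<close> exclude each other.\<close>

lemma K_ge_1: "1 \<le> K"
proof (rule ccontr)
  assume "\<not> 1 \<le> K"
  then have K: "K < 1" by simp
  let ?x = "\<kappa> powr (- (1 + \<gamma>))"
  have x: "0 < ?x" using wave by simp
  have "?x \<le> K * (K * ?x)" using hk(2) mult_left_mono[OF hk(1), of K] K0 by linarith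
  moreover have "K * (K * ?x) < K * ?x" using K K0 x by simp
  moreover have "K * ?x < ?x" using K x by simp
  ultimately show False by linarith
qed

lemma ex_element: "\<exists>T. T \<in> \<T>"
  using mesh_Union dom(2) closure_subset[of \<Omega>] by blast

lemma h0: "0 < h" using mesh_size(3) ex_element by blast

lemma mesh_ball:
  assumes T: "T \<in> \<T>" shows "\<exists>z. ball z (h / K\<^sup>2) \<subseteq> T"
proof -
  obtain z r where z: "ball z r \<subseteq> T" "diameter T \<le> K * r"
    using adm T unfolding admissible_def shape_regular_def by blast
  have "h \<le> K * (K * r)" using mesh_size(2)[OF T] mult_left_mono[OF z(2), of K] K0 by linarith
  then have "h / K\<^sup>2 \<le> r" using K0 by (simp add: power2_eq_square field_simps)
  then have "ball z (h / K\<^sup>2) \<subseteq> T" using z(1) subset_ball by blast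
  then show ?thesis by blast
qed

lemma mesh_diameter_le: "h \<le> diameter \<Omega>"
proof -
  have "finite \<T>" "\<T> \<noteq> {}" using simplicialD(1)[OF mesh] ex_element by blast+
  then have "h \<in> diameter ` \<T>" unfolding mesh_diameter_def by (intro Max_in) auto
  then obtain T where T: "T \<in> \<T>" "h = diameter T" by blast
  have b: "bounded \<Omega>" using dom(1) by (simp add: lipschitz_domain_def)
  have "T \<subseteq> closure \<Omega>" using T(1) mesh_Union by blast
  then have "diameter T \<le> diameter (closure \<Omega>)" by (rule diameter_subset) (rule bounded_closure[OF b])
  also have "\<dots> = diameter \<Omega>" by (rule diameter_closure[OF b])
  finally show ?thesis using T(2) by simp
qed

text \<open>The mesh size is at most the diameter of the domain, which bounds the wavenumber below.\<close>

lemma wavenumber_ge: "(K * (diameter \<Omega> + 1)) powr (- (1 / (1 + \<gamma>))) \<le> \<kappa>"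
proof -
  let ?x = "\<kappa> powr (- (1 + \<gamma>))"
  have D: "0 < diameter \<Omega>" using mesh_diameter_le h0 by linarith
  have "?x \<le> K * h" by (rule hk(2))
  also have "\<dots> \<le> K * (diameter \<Omega> + 1)" using mesh_diameter_le K0 by (intro mult_left_mono) auto
  finally have "(K * (diameter \<Omega> + 1)) powr (- (1 / (1 + \<gamma>))) \<le> ?x powr (- (1 / (1 + \<gamma>)))"
    using exps wave by (intro powr_mono2') auto
  also have "\<dots> = \<kappa> powr 1"
    unfolding powr_powr using exps by (intro arg_cong2[where f = "(powr)"] refl) (simp add: field_simps)
  also have "\<dots> = \<kappa>" using wave by simp
  finally show ?thesis .
qed

lemma overlap:
  assumes T: "T \<in> \<T>"
  shows "real (card {l\<in>{1..nsub c}. T \<in> elems c l}) \<le> K"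
proof (cases "{l\<in>{1..nsub c}. T \<in> elems c l} = {}")
  case True
  then show ?thesis using K0 by (simp only: card.empty of_nat_0)
next
  case False
  then obtain l where l: "l \<in> {1..nsub c}" "T \<in> elems c l" by blast
  obtain x where x: "x \<in> interior T" using interior_simplex_nonempty[OF simplex[OF T]] by blast
  have "x \<in> subdom c j" if "T \<in> elems c j" for j
    unfolding subdom_def using x interior_mono[of T "\<Union>(elems c j)"] that by blast
  then have "{j\<in>{1..nsub c}. T \<in> elems c j} \<subseteq> neighbours c l" unfolding neighbours_def using l(2) by blast
  then have "card {j\<in>{1..nsub c}. T \<in> elems c j} \<le> card (neighbours c l)"
    by (intro card_mono) (simp_all add: neighbours_def)
  then show ?thesis using nb[OF l(1)] by linarith
qed

text \<open>The disc has radius of order \<open>d\<close>, that is \<open>\<kappa>\<close> to the power \<open>- \<beta>\<close>, and \<open>\<beta> \<le> 1\<close>. So \<open>\<kappa> r\<close> is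
  bounded below.\<close>

lemma local_rim_estimate:
  assumes \<kappa>0: "0 < \<kappa>0" "\<kappa>0 \<le> \<kappa>" and l: "l \<in> {1..nsub c}"
    and v: "continuous_on (\<Union>(elems c l)) v" "v \<in> pwpoly q (elems c l)"
  shows "(\<Sum>T\<in>rim (elems c l). l2sq T v)
    \<le> (16 * (K ^ 3 * \<kappa>0 powr (\<beta> - 1)) + 8 * K\<^sup>2) * (h / \<kappa>) * (\<Sum>T\<in>elems c l. esq \<kappa> T v)"
proof -
  obtain r where r: "diameter (core c l) \<le> K * r" "star_shaped_disc (subdom c l) r"
    using star[OF l] unfolding comparable_def by blast
  note cd = core_diameter[OF l]
  have "\<kappa> powr (- \<beta>) \<le> K * d" by (rule dk(2))
  also have "\<dots> \<le> K * (K * (K * r))"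
    using cd(2) r(1) K0 by (intro mult_left_mono) (auto intro: order_trans mult_left_mono)
  finally have kr: "\<kappa> powr (- \<beta>) \<le> K ^ 3 * r" by (simp add: power3_eq_cube mult.assoc)
  have kpos: "0 < \<kappa> powr (- \<beta>)" using wave by simp
  have "0 < K ^ 3 * r" using kr kpos by linarith
  then have r0: "0 < r" using K0 by (simp add: zero_less_mult_iff)
  have A: "diameter (interior (\<Union>(elems c l))) \<le> K\<^sup>2 * r"
  proof -
    have "K * diameter (core c l) \<le> K\<^sup>2 * r"
      using mult_left_mono[OF r(1), of K] K0 by (simp add: power2_eq_square mult.assoc)
    then show ?thesis using cd(3) unfolding subdom_def by linarith
  qed
  have "1 = \<kappa> powr (\<beta> - 1) * \<kappa> * \<kappa> powr (- \<beta>)"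
    using wave by (simp add: powr_add powr_diff powr_minus field_simps)
  also have "\<dots> \<le> \<kappa>0 powr (\<beta> - 1) * \<kappa> * (K ^ 3 * r)"
    using \<kappa>0 exps wave kr kpos by (intro mult_mono powr_mono2') auto
  also have "\<dots> = K ^ 3 * \<kappa>0 powr (\<beta> - 1) * (\<kappa> * r)" by (simp only: mult_ac)
  finally have B: "1 \<le> K ^ 3 * \<kappa>0 powr (\<beta> - 1) * (\<kappa> * r)" .
  show ?thesis
    by (rule rim_estimate[OF simplicial_subset[OF mesh cd(5)] _ h0 _ r0 A B wave v])
      (use r(2) cd(5) mesh_size(1) in \<open>auto simp: subdom_def\<close>)
qed

end

section \<open>Uniform constants\<close>

text \<open>The constants of the inverse estimates depend on \<open>p\<close> and the shape regularity only, where \<open>h\<close> and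
  the inradii of all elements are comparable by quasi-uniformity. The product \<open>h \<kappa>\<close> is at most a
  multiple of \<open>\<kappa>\<close> to the power \<open>- \<gamma>\<close>, hence bounded.\<close>

lemma admissible_constants:
  fixes \<Omega> :: "(real^2) set"
  assumes dom: "lipschitz_domain \<Omega>" "\<Omega> \<noteq> {}" and p: "1 \<le> p" and K: "0 < K"
    and exps: "0 < \<gamma>" "0 \<le> \<alpha>" "\<alpha> \<le> \<beta>" "\<beta> \<le> 1"
  obtains \<kappa>0 Cs Cn Ct Kt where "0 < \<kappa>0" "0 \<le> Cs" "0 \<le> Cn" "0 \<le> Ct" "0 \<le> Kt"
    "\<And>d \<delta> c. admissible \<Omega> p \<alpha> \<beta> \<gamma> K d \<delta> c \<Longrightarrow>
      quantitative c (mesh_diameter (mesh c)) K Cs Cn Ct Kt \<and> \<kappa>0 \<le> wavenumber c"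
proof -
  define \<kappa>0 where "\<kappa>0 = (K * (diameter \<Omega> + 1)) powr (- (1 / (1 + \<gamma>)))"
  have "0 \<le> diameter \<Omega>" using dom(1) by (intro diameter_ge_0) (simp add: lipschitz_domain_def)
  then have "0 < K * (diameter \<Omega> + 1)" using K by simp
  then have \<kappa>0: "0 < \<kappa>0" unfolding \<kappa>0_def powr_gt_zero by (rule less_imp_neq[symmetric])
  \<comment> \<open>the constants are chosen before a mesh is given, when \<open>1 \<le> K\<close> is not yet known\<close>
  define L where "L = max 1 (K\<^sup>2)"
  have L1: "1 \<le> L" by (simp add: L_def)
  have p0: "0 < p" using p by simp
  obtain C1 where C1: "0 < C1"
    "\<And>T v c r. 2 simplex T \<Longrightarrow> poly_on p T v \<Longrightarrow> 0 < r \<Longrightarrow> ball c r \<subseteq> T \<Longrightarrow> diameter T \<le> L * r \<Longrightarrow> 0 < L \<Longrightarrow>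
       h1sq T v \<le> C1 * (\<Sum>z\<in>element_nodes p T. (cmod (v z))\<^sup>2)"
    "\<And>T v c r. 2 simplex T \<Longrightarrow> poly_on p T v \<Longrightarrow> 0 < r \<Longrightarrow> ball c r \<subseteq> T \<Longrightarrow> diameter T \<le> L * r \<Longrightarrow> 0 < L \<Longrightarrow>
       l2sq T v \<le> C1 * r\<^sup>2 * (\<Sum>z\<in>element_nodes p T. (cmod (v z))\<^sup>2)"
    by (rule energy_le_nodal[OF p0, of L]) (rule that)
  obtain C2 where C2: "0 < C2"
    "\<And>T v c r x. 2 simplex T \<Longrightarrow> poly_on p T v \<Longrightarrow> 0 < r \<Longrightarrow> ball c r \<subseteq> T \<Longrightarrow> diameter T \<le> L * r \<Longrightarrow> x \<in> T \<Longrightarrow>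
       r\<^sup>2 * (cmod (v x))\<^sup>2 \<le> C2 * l2sq T v"
    by (rule sup_le_l2[OF p0 L1]) (rule that)
  define Cs Cn Ct Kt where "Cs = C2 * (K\<^sup>2)\<^sup>2" and "Cn = C1 * (1 + (K * \<kappa>0 powr (- \<gamma>))\<^sup>2)"
    and "Ct = 16 * (K ^ 3 * \<kappa>0 powr (\<beta> - 1)) + 8 * K\<^sup>2" and "Kt = 16 * (K\<^sup>2)\<^sup>2"
  have nonneg: "0 \<le> Cs" "0 \<le> Cn" "0 \<le> Ct" "0 \<le> Kt"
    using C1(1) C2(1) K by (simp_all add: Cs_def Cn_def Ct_def Kt_def)
  show thesis
  proof (rule that[OF \<kappa>0 nonneg])
    fix d \<delta> and c :: ddm assume adm: "admissible \<Omega> p \<alpha> \<beta> \<gamma> K d \<delta> c"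
    interpret A: admissible_discretisation \<Omega> p \<alpha> \<beta> \<gamma> K d \<delta> c
      by unfold_locales (fact adm dom p K exps)+
    let ?h = "mesh_diameter (mesh c)" and ?k = "wavenumber c"
    let ?r = "?h / K\<^sup>2"
    have r: "0 < ?r" using A.h0 K by simp
    have \<kappa>ge: "\<kappa>0 \<le> ?k" unfolding \<kappa>0_def by (rule A.wavenumber_ge)
    have "1 \<le> K\<^sup>2" using A.K_ge_1 by (rule one_le_power)
    then have "L * ?r = ?h" using K by (simp add: L_def)
    then have dT: "diameter T \<le> L * ?r" if "T \<in> mesh c" for T using A.mesh_size(1)[OF that] by simp
    have "quantitative c ?h K Cs Cn Ct Kt"
    proof (intro quantitative.intro A.discretisation quantitative_axioms.intro)
      show "0 < ?h" by (rule A.h0)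
      show "diameter T \<le> ?h" if "T \<in> mesh c" for T by (rule A.mesh_size(1)[OF that])
      show "0 \<le> K" using K by simp
      show "0 \<le> Cs" "0 \<le> Cn" "0 \<le> Ct" "0 \<le> Kt" by (fact nonneg)+
      show "(cmod (v x))\<^sup>2 \<le> Cs / ?h\<^sup>2 * l2sq T v"
        if T: "T \<in> mesh c" and v: "poly_on (fe_order c) T v" and x: "x \<in> T" for T v x
      proof -
        obtain z where z: "ball z ?r \<subseteq> T" using A.mesh_ball[OF T] by blast
        have "?r\<^sup>2 * (cmod (v x))\<^sup>2 \<le> C2 * l2sq T v"
          using C2(2)[OF A.simplex[OF T] _ r z dT[OF T] x] v A.ord by simp
        then have "(1 / ?r\<^sup>2) * (?r\<^sup>2 * (cmod (v x))\<^sup>2) \<le> (1 / ?r\<^sup>2) * (C2 * l2sq T v)"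
          by (rule mult_left_mono) simp
        moreover have "(1 / ?r\<^sup>2) * (?r\<^sup>2 * (cmod (v x))\<^sup>2) = (cmod (v x))\<^sup>2" using A.h0 K by simp
        moreover have "(1 / ?r\<^sup>2) * (C2 * l2sq T v) = Cs / ?h\<^sup>2 * l2sq T v"
          by (simp add: Cs_def power_divide)
        ultimately show ?thesis by linarith
      qed
      show "esq ?k T v \<le> Cn * (\<Sum>x\<in>element_nodes (fe_order c) T. (cmod (v x))\<^sup>2)"
        if T: "T \<in> mesh c" and v: "poly_on (fe_order c) T v" for T v
      proof -
        let ?S = "\<Sum>x\<in>element_nodes p T. (cmod (v x))\<^sup>2"
        obtain z where z: "ball z ?r \<subseteq> T" using A.mesh_ball[OF T] by blast
        have v': "poly_on p T v" using v A.ord by simp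
        have L0: "0 < L" using L1 by linarith
        have S0: "0 \<le> ?S" by (intro sum_nonneg) simp
        have "?r \<le> ?h" using \<open>1 \<le> K\<^sup>2\<close> A.h0 K by (simp add: divide_le_eq mult_le_cancel_left1)
        then have "?k * ?r \<le> ?k * ?h" using A.wave by (intro mult_left_mono) auto
        also have "\<dots> \<le> ?k * (K * ?k powr (- (1 + \<gamma>)))" using A.wave by (intro mult_left_mono A.hk(1)) auto
        also have "\<dots> = K * ?k powr (- \<gamma>)"
          using A.wave by (simp add: powr_diff powr_minus field_simps)
        also have "\<dots> \<le> K * \<kappa>0 powr (- \<gamma>)"
          using K exps \<kappa>0 \<kappa>ge by (intro mult_left_mono powr_mono2') auto
        finally have kr: "(?k * ?r)\<^sup>2 \<le> (K * \<kappa>0 powr (- \<gamma>))\<^sup>2"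
          by (rule power_mono) (rule mult_nonneg_nonneg[OF less_imp_le[OF A.wave] less_imp_le[OF r]])
        have "esq ?k T v \<le> C1 * ?S + ?k\<^sup>2 * (C1 * ?r\<^sup>2 * ?S)"
          unfolding esq_def
          by (intro add_mono mult_left_mono C1(2)[OF A.simplex[OF T] v' r z dT[OF T] L0]
              C1(3)[OF A.simplex[OF T] v' r z dT[OF T] L0]) simp
        also have "\<dots> = C1 * (1 + (?k * ?r)\<^sup>2) * ?S"
          unfolding power_mult_distrib[of ?k ?r] by (simp only: distrib_left distrib_right mult_1_right mult_ac)
        also have "\<dots> \<le> Cn * ?S" unfolding Cn_def
          using C1(1) S0 kr by (intro mult_right_mono mult_left_mono add_left_mono) auto
        finally show ?thesis using A.ord by simp
      qed
      show "(\<Sum>T\<in>rim (elems c l). l2sq T v) \<le> Ct * (?h / ?k) * (\<Sum>T\<in>elems c l. esq ?k T v)"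
        if "l \<in> {1..nsub c}" "continuous_on (\<Union>(elems c l)) v" "v \<in> pwpoly (fe_order c) (elems c l)" for l v
        unfolding Ct_def by (rule A.local_rim_estimate[OF \<kappa>0 \<kappa>ge that])
      show "real (card {l\<in>{1..nsub c}. T \<in> elems c l}) \<le> K" if "T \<in> mesh c" for T
        by (rule A.overlap[OF that])
      show "\<exists>l\<in>{1..nsub c}. T \<in> elems c l" if T: "T \<in> mesh c" for T
      proof -
        have "T \<in> (\<Union>l\<in>{1..nsub c}. part c l)" using A.dec T unfolding decomposition_def by blast
        then show ?thesis using A.core_diameter(4) by blast
      qed
      show "0 \<le> diameter (core c l)" if l: "l \<in> {1..nsub c}" for l
      proof (rule diameter_ge_0)
        have b: "bounded (\<Union>(mesh c))" unfolding A.mesh_Union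
          using dom(1) by (intro bounded_closure) (simp add: lipschitz_domain_def)
        have 1: "core c l \<subseteq> \<Union>(part c l)" unfolding core_def by (rule interior_subset)
        have 2: "\<Union>(part c l) \<subseteq> \<Union>(mesh c)" using A.core_diameter(4,5)[OF l] by blast
        show "bounded (core c l)" by (rule bounded_subset[OF b subset_trans[OF 1 2]])
      qed
      show "real (card {T\<in>mesh c. T \<inter> T0 \<noteq> {}}) \<le> Kt" if T0: "T0 \<in> mesh c" for T0
      proof -
        have "real (card {T\<in>mesh c. T \<inter> T0 \<noteq> {}}) \<le> 16 * (?h / ?r)\<^sup>2"
          by (rule card_touching_le[OF A.mesh r A.h0 A.mesh_size(1) A.mesh_ball T0])
        also have "?h / ?r = K\<^sup>2" using A.h0 K by simp
        finally show ?thesis by (simp add: Kt_def)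
      qed
    qed
    then show "quantitative c ?h K Cs Cn Ct Kt \<and> \<kappa>0 \<le> ?k" using \<kappa>ge by blast
  qed
qed

section \<open>The preconditioned operator\<close>

theorem theorem5p2:
  fixes \<Omega> :: "(real^2) set" and p :: nat
    and \<alpha> \<beta> \<gamma> K C :: real and hbar :: "real \<Rightarrow> nat \<Rightarrow> real"
  assumes "lipschitz_domain \<Omega>" and "connected \<Omega>" and "\<Omega> \<noteq> {}"
    and "1 \<le> p"
    and "0 < \<gamma>" and "\<gamma> \<le> 1"
    and "0 \<le> \<alpha>" and "\<alpha> \<le> \<beta>" and "\<beta> \<le> 1"
    and "0 < K" and "0 < C"
    and "mesh_threshold \<Omega> p \<alpha> \<beta> \<gamma> K C hbar"
  defines "\<sigma> \<equiv> 2 - (\<alpha> + \<beta>) + \<gamma> / 2"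
  shows "\<exists>C0>0. \<exists>C1>0. \<exists>C2>0.
    \<forall>c d \<delta> m \<mu> \<xi> \<rho>.
      admissible \<Omega> p \<alpha> \<beta> \<gamma> K d \<delta> c \<and>
      mesh_diameter (mesh c) < hbar (wavenumber c) p \<and>
      (\<forall>l\<in>{1..nsub c}. eigensystem c l (m l) (\<mu> l) (\<xi> l)) \<and>
      0 < \<rho> \<and> \<rho> < 1 \<and> \<rho> * wavenumber c powr \<sigma> \<le> C0
      \<longrightarrow> (\<forall>v\<in>Vh c. norm_\<kappa> c (P_op c (coarse c m \<mu> \<xi> \<rho>) v) \<le> C1 * norm_\<kappa> c v) \<and>
          (\<forall>v\<in>Vh c. C2 * (norm_\<kappa> c v)\<^sup>2
             \<le> cmod (inner_\<kappa> c v (P_op c (coarse c m \<mu> \<xi> \<rho>) v)))"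
proof -
  note exps = \<open>0 < \<gamma>\<close> \<open>0 \<le> \<alpha>\<close> \<open>\<alpha> \<le> \<beta>\<close> \<open>\<beta> \<le> 1\<close>
  obtain \<kappa>0 Cs Cn Ct Kt where \<kappa>0: "0 < \<kappa>0" and nn: "0 \<le> Cs" "0 \<le> Cn" "0 \<le> Ct" "0 \<le> Kt"
    and quant: "\<And>d \<delta> c. admissible \<Omega> p \<alpha> \<beta> \<gamma> K d \<delta> c \<Longrightarrow>
      quantitative c (mesh_diameter (mesh c)) K Cs Cn Ct Kt \<and> \<kappa>0 \<le> wavenumber c"
    by (rule admissible_constants[OF \<open>lipschitz_domain \<Omega>\<close> \<open>\<Omega> \<noteq> {}\<close> \<open>1 \<le> p\<close> \<open>0 < K\<close> exps]) (rule that)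
  define a where "a = \<kappa>0 powr (\<alpha> - 1)"
  define A where "A = 2 + a"
  define Ce where "Ce = Cn * real ((p + 1) ^ 3) * Cs * Kt * Ct"
  define E where "E = \<kappa>0 powr (- \<gamma>) + Ce * K"
  define F where "F = \<kappa>0 powr (\<beta> - 1) + K\<^sup>2"
  define Q where "Q = sqrt (K * (2 * (2 * A + 9 * Cs * Ct)\<^sup>2 * (Kt * K)
      + 2 * (9 * Cs)\<^sup>2 * (Ct * K) * (Kt * K) * (Ct * K)))"
  define B where "B = A + 9 * Cs * Ct * K"
  define H where "H = (a + (a + 2) * B) * (C * F * sqrt E * Q)"
  have pos: "0 < a" "0 \<le> Ce" "0 \<le> E" "0 \<le> F" "0 \<le> Q" "0 \<le> B"
    using \<kappa>0 nn \<open>0 < K\<close> by (simp_all add: a_def A_def B_def Ce_def E_def F_def Q_def)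
  have H0: "0 \<le> H" unfolding H_def using pos \<open>0 < C\<close> by simp
  \<comment> \<open>\<open>H\<close> bounds the operator norm of the perturbation divided by \<open>\<rho> \<kappa>\<^sup>\<sigma>\<close>; the summand \<open>1\<close> avoids
    a division by zero\<close>
  define C0 where "C0 = 1 / (2 * (H + 1))"
  have C0: "0 < C0" "C0 * H \<le> 1 / 2" using H0 by (simp_all add: C0_def field_simps)
  have main: "norm_\<kappa> c (P_op c (coarse c m \<mu> \<xi> \<rho>) v) \<le> 3 / 2 * norm_\<kappa> c v \<and>
      1 / 2 * (norm_\<kappa> c v)\<^sup>2 \<le> cmod (inner_\<kappa> c v (P_op c (coarse c m \<mu> \<xi> \<rho>) v))"
    if adm: "admissible \<Omega> p \<alpha> \<beta> \<gamma> K d \<delta> c" and hh: "mesh_diameter (mesh c) < hbar (wavenumber c) p"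
      and eig: "\<And>l. l \<in> {1..nsub c} \<Longrightarrow> eigensystem c l (m l) (\<mu> l) (\<xi> l)"
      and \<rho>: "0 < \<rho>" "\<rho> * wavenumber c powr \<sigma> \<le> C0" and v: "v \<in> Vh c"
    for c d \<delta> m \<mu> \<xi> \<rho> v
  proof -
    interpret A: admissible_discretisation \<Omega> p \<alpha> \<beta> \<gamma> K d \<delta> c
      by unfold_locales (fact adm \<open>lipschitz_domain \<Omega>\<close> \<open>\<Omega> \<noteq> {}\<close> \<open>1 \<le> p\<close> \<open>0 < K\<close> exps)+
    let ?k = "wavenumber c" and ?h = "mesh_diameter (mesh c)"
    have q: "quantitative c ?h K Cs Cn Ct Kt" and kge: "\<kappa>0 \<le> ?k" using quant[OF adm] by blast+
    have k: "0 < ?k" by (rule A.wave)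
    have infsup: "local_inf_sup C c"
      using \<open>mesh_threshold \<Omega> p \<alpha> \<beta> \<gamma> K C hbar\<close> adm hh unfolding mesh_threshold_def by blast
    define X Y Z where "X = ?k powr (1 - \<alpha>)" and "Y = ?k powr (1 - \<beta>)" and "Z = ?k powr (\<gamma> / 2)"
    have XYZ0: "0 < X" "0 < Y" "0 < Z" using k by (simp_all add: X_def Y_def Z_def)
    have "X * (Y * Z) = ?k powr \<sigma>"
      unfolding X_def Y_def Z_def \<sigma>_def powr_add[symmetric] by (rule arg_cong[where f = "(powr) ?k"]) simp
    then have XYZ: "\<rho> * (X * (Y * Z)) \<le> C0" using \<rho>(2) by simp
    \<comment> \<open>powers of \<open>\<kappa>\<close> with nonnegative exponent dominate constants, because \<open>\<kappa> \<ge> \<kappa>0\<close>\<close>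
    have dom: "1 \<le> \<kappa>0 powr (- s) * ?k powr s" if "0 \<le> s" for s
    proof -
      have "1 = \<kappa>0 powr (- s) * \<kappa>0 powr s" using \<kappa>0 by (simp add: powr_minus)
      also have "\<dots> \<le> \<kappa>0 powr (- s) * ?k powr s"
        using \<kappa>0 kge that by (intro mult_left_mono powr_mono2) auto
      finally show ?thesis .
    qed
    have oneX: "1 \<le> a * X" using dom[of "1 - \<alpha>"] exps by (simp add: a_def X_def)
    have oneY: "1 \<le> \<kappa>0 powr (\<beta> - 1) * Y" using dom[of "1 - \<beta>"] exps by (simp add: Y_def)
    have ek: "absorption c / ?k\<^sup>2 = ?k powr (\<alpha> - 1)"
    proof -
      have "?k powr (\<alpha> - 1) = ?k powr ((1 + \<alpha>) - 2)" by simp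
      also have "\<dots> = absorption c / ?k\<^sup>2" unfolding powr_diff A.eps using k by (simp add: powr_numeral)
      finally show ?thesis by simp
    qed
    have "?k powr (\<alpha> - 1) \<le> a" unfolding a_def using \<kappa>0 kge exps by (intro powr_mono2') auto
    then have A: "2 + absorption c / ?k\<^sup>2 \<le> A" unfolding A_def ek by simp
    have "?k\<^sup>2 / absorption c = inverse (absorption c / ?k\<^sup>2)" by (simp add: field_simps)
    also have "\<dots> = X" unfolding ek X_def powr_minus[symmetric] by simp
    finally have ke: "?k\<^sup>2 / absorption c = X" .
    have "?k powr (- \<gamma>) = ?k * ?k powr (- (1 + \<gamma>))"
      using k by (simp add: powr_diff powr_minus field_simps)
    also have "\<dots> \<le> ?k * (K * ?h)" using k by (intro mult_left_mono A.hk(2)) simp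
    finally have "?k powr \<gamma> * ?k powr (- \<gamma>) \<le> ?k powr \<gamma> * (?k * (K * ?h))"
      by (rule mult_left_mono) simp
    then have "1 \<le> K * ?k powr \<gamma> * (?h * ?k)" using k by (simp add: powr_minus mult_ac)
    then have hk: "1 / (?h * ?k) \<le> K * ?k powr \<gamma>" using A.h0 k by (simp add: pos_divide_le_eq)
    have "1 + Ce / (?h * ?k) = 1 + Ce * (1 / (?h * ?k))" by simp
    also have "\<dots> \<le> \<kappa>0 powr (- \<gamma>) * ?k powr \<gamma> + Ce * (K * ?k powr \<gamma>)"
      using dom[of \<gamma>] exps hk pos(2) by (intro add_mono mult_left_mono) auto
    also have "\<dots> = E * Z\<^sup>2"
    proof -
      have "Z\<^sup>2 = ?k powr \<gamma>" by (simp add: Z_def power2_eq_square powr_add[symmetric])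
      then show ?thesis by (simp add: E_def algebra_simps)
    qed
    finally have "sqrt (1 + Ce / (?h * ?k)) \<le> sqrt (E * Z\<^sup>2)" by (rule real_sqrt_le_mono)
    also have "\<dots> = sqrt E * Z" using XYZ0 by (simp add: real_sqrt_mult)
    finally have Gs: "sqrt (1 + Ce / (?h * ?k)) \<le> sqrt E * Z" .
    define G where "G = C * (F * Y) * (sqrt E * Z)"
    have G0: "0 \<le> G" unfolding G_def using pos XYZ0 \<open>0 < C\<close> by simp
    have G: "C * (1 + ?k * diameter (core c l))
        * sqrt (1 + Cn * real ((fe_order c + 1) ^ 3) * Cs * Kt * Ct / (?h * ?k)) \<le> G"
      if l: "l \<in> {1..nsub c}" for l
    proof -
      have "diameter (core c l) \<le> K * (K * ?k powr (- \<beta>))"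
        using A.core_diameter(1)[OF l] mult_left_mono[OF A.dk(1), of K] \<open>0 < K\<close> by linarith
      then have "?k * diameter (core c l) \<le> ?k * (K * (K * ?k powr (- \<beta>)))" using k by (intro mult_left_mono) auto
      also have "\<dots> = K\<^sup>2 * Y"
        using k by (simp add: Y_def powr_diff powr_minus power2_eq_square field_simps)
      finally have "1 + ?k * diameter (core c l) \<le> F * Y" using oneY by (simp add: F_def distrib_right)
      then have 1: "C * (1 + ?k * diameter (core c l)) \<le> C * (F * Y)" using \<open>0 < C\<close> by (intro mult_left_mono) auto
      have 2: "sqrt (1 + Cn * real ((fe_order c + 1) ^ 3) * Cs * Kt * Ct / (?h * ?k)) \<le> sqrt E * Z"
        using Gs by (simp only: Ce_def A.ord)
      show ?thesis unfolding G_def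
        by (rule mult_mono[OF 1 2]) (use pos XYZ0 \<open>0 < C\<close> A.h0 k nn in auto)
    qed
    have "1 + (1 + 2 * ?k\<^sup>2 / absorption c) * B \<le> a * X + (a * X + 2 * X) * B"
    proof -
      have "2 * ?k\<^sup>2 / absorption c = 2 * X" using ke by simp
      then show ?thesis using oneX pos(6) by (intro add_mono mult_right_mono) auto
    qed
    also have "\<dots> = (a + (a + 2) * B) * X" by (simp add: algebra_simps)
    finally have "(1 + (1 + 2 * ?k\<^sup>2 / absorption c) * B) * (\<rho> * G * Q) \<le> ((a + (a + 2) * B) * X) * (\<rho> * G * Q)"
      using \<rho>(1) G0 pos by (intro mult_right_mono) auto
    also have "\<dots> = (\<rho> * (X * (Y * Z))) * H" unfolding G_def H_def by (simp only: mult_ac)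
    also have "\<dots> \<le> C0 * H" by (rule mult_right_mono[OF XYZ H0])
    also have "\<dots> \<le> 1 / 2" by (rule C0(2))
    finally have small: "(1 + (1 + 2 * ?k\<^sup>2 / absorption c) * (A + 9 * Cs * Ct * K)) * (\<rho> * G * Q) \<le> 1 / 2"
      unfolding B_def .
    note bounds = quantitative.P_op_bounds[OF q eig infsup _ _ G G0 A Q_def small v]
    show ?thesis using bounds \<open>0 < C\<close> \<rho>(1) by simp
  qed
  show ?thesis
  proof (rule exI[of _ C0], rule conjI[OF C0(1)], rule exI[of _ "3 / 2"], rule conjI, simp,
      rule exI[of _ "1 / 2"], rule conjI, simp, intro allI impI, elim conjE)
    fix c d \<delta> m \<mu> \<xi> \<rho>
    assume adm: "admissible \<Omega> p \<alpha> \<beta> \<gamma> K d \<delta> c" and hh: "mesh_diameter (mesh c) < hbar (wavenumber c) p"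
      and eig: "\<forall>l\<in>{1..nsub c}. eigensystem c l (m l) (\<mu> l) (\<xi> l)"
      and \<rho>: "0 < \<rho>" "\<rho> * wavenumber c powr \<sigma> \<le> C0"
    note m = main[OF adm hh bspec[OF eig] \<rho>]
    show "(\<forall>v\<in>Vh c. norm_\<kappa> c (P_op c (coarse c m \<mu> \<xi> \<rho>) v) \<le> 3 / 2 * norm_\<kappa> c v) \<and>
        (\<forall>v\<in>Vh c. 1 / 2 * (norm_\<kappa> c v)\<^sup>2 \<le> cmod (inner_\<kappa> c v (P_op c (coarse c m \<mu> \<xi> \<rho>) v)))"
    proof (intro conjI ballI)
      show "norm_\<kappa> c (P_op c (coarse c m \<mu> \<xi> \<rho>) v) \<le> 3 / 2 * norm_\<kappa> c v" if "v \<in> Vh c" for v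
        by (rule conjunct1[OF m]) (simp_all add: that)
      show "1 / 2 * (norm_\<kappa> c v)\<^sup>2 \<le> cmod (inner_\<kappa> c v (P_op c (coarse c m \<mu> \<xi> \<rho>) v))" if "v \<in> Vh c" for v
        by (rule conjunct2[OF m]) (simp_all add: that)
    qed
  qed
qed

end
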